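(* Let $\mathbb{X}$ be a semi-abelian category, $n\geq 1$, and consider a functor $E\colon(\mathsf{3}^n)^{\mathrm{op}}\to\mathbb{X}$. Then the following conditions are equivalent: (i) $E$ is a $3^n$-diagram: each composite $E\circ(\alpha_{e,i})^{\mathrm{op}}$ in the $n$-sequence $E$ is a short exact sequence in $\mathbb{X}$; (ii) $E=\mathrm{KerSeq}^n(\mathrm{epi}^n(E))$ and $\mathrm{epi}^n(E)$ is an $n$-cubic extension; (iii) $E=\mathrm{CokerSeq}^n(\mathrm{mono}^n(E))$ and $\mathrm{mono}^n(E)$ is induced by a distributive $n$-tuple of normal monomorphisms; (iv) $E=\mathrm{KerSeq}^n(\mathrm{epi}^n(E))$ and $E=\mathrm{CokerSeq}^n(\mathrm{mono}^n(E))$.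
   Context: A semi-abelian category is a pointed, Barr exact, protomodular category with binary coproducts. We write $n=\{0,\dots,n-1\}$. $\mathsf{3}$ is the category $0\to1\to2$. For an object $e$ of $\mathsf{3}^n$ whose $i$-th coordinate is $0$, $\alpha_{e,i}\colon\mathsf{3}\to\mathsf{3}^n$ is the embedding parallel to the $i$-th coordinate axis: $k\mapsto(e_1,\dots,e_{i-1},k,e_{i+1},\dots,e_n)$. An $n$-sequence in $\mathbb{X}$ is a functor $E\colon(\mathsf{3}^n)^{\mathrm{op}}\to\mathbb{X}$; so a $1$-sequence is a diagram $E_2\to E_1\to E_0$. It is a short exact sequence when $E_2\to E_1$ is the kernel of $E_1\to E_0$ and $E_1\to E_0$ is the cokernel of $E_2\to E_1$. An $n$-fold arrow is a commutative $n$-cube, i.e. an object of $\mathsf{Arr}^n(\mathbb{X})=\mathsf{Arr}(\mathsf{Arr}^{n-1}(\mathbb{X}))$. $\mathrm{epi}^n(E)$ (resp. $\mathrm{mono}^n(E)$) is the $n$-fold arrow obtained by restricting $E$ to the objects all of whose coordinates are in $\{0,1\}$ (resp. $\{1,2\}$). $\mathrm{KerSeq}^n$ completes an $n$-fold arrow $F$ to an $n$-sequence with $\mathrm{epi}^n(\mathrm{KerSeq}^n(F))=F$ by taking kernels successively in all $n$ directions (for $n=1$, $f$ is sent to $\mathrm{Ker}(f)\to\mathrm{dom}(f)\to\mathrm{cod}(f)$). $\mathrm{CokerSeq}^n$ completes an $n$-fold arrow $M$ to an $n$-sequence with $\mathrm{mono}^n(\mathrm{CokerSeq}^n(M))=M$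 by taking cokernels successively in all $n$ directions. The equality $E=\mathrm{KerSeq}^n(\mathrm{epi}^n(E))$ (resp. $E=\mathrm{CokerSeq}^n(\mathrm{mono}^n(E))$) is understood up to an isomorphism of $n$-sequences that restricts to the identity on $\mathrm{epi}^n(E)$ (resp. $\mathrm{mono}^n(E)$). A $1$-cubic extension is a regular epimorphism in $\mathbb{X}$. For $n\geq 2$, an $n$-fold arrow, viewed as a commutative square in $\mathsf{Arr}^{n-2}(\mathbb{X})$, is an $n$-cubic extension when its four sides and the induced comparison from its initial corner to the pullback are all $(n-1)$-cubic extensions. An $n$-tuple of normal monomorphisms (kernels) $(K_i\to X)_{i\in n}$ with common codomain $X$ induces an $n$-cube by repeated pullbacks of the given normal monomorphisms along each other: its vertices are the intersections $\bigwedge_{i\in I}K_i$, $I\subseteq n$, with terminal vertex $X$, and its arrows are the inclusions. The $n$-tuple is distributive when, for all $k\geq1$ and all $J_0,J_1,\dots,J_k\subseteq n$ with $J_i\cap J_j=\emptyset$ for $i\neq j$, $$\Big(\bigwedge_{j\in J_0}K_j\Big)\wedge\bigvee_{i=1}^k\Big(\bigwedge_{j\in J_i}K_j\Big)=\bigvee_{i=1}^k\Big(\bigwedge_{j\in J_0\cup J_i}K_j\Big)$$ in the lattice of normal subobjects of $X$ (an empty meet being $X$). *)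

theory Defs
  imports "HOL-Algebra.Lattice"
begin

section \<open>Categories\<close>

record ('o, 'm) category =
  Obj :: "'o set"
  Arr :: "'m set"
  Dom :: "'m \<Rightarrow> 'o"
  Cod :: "'m \<Rightarrow> 'o"
  Id :: "'o \<Rightarrow> 'm"
  Cmp :: "'m \<Rightarrow> 'm \<Rightarrow> 'm" (infixl "\<cdot>\<index>" 70)

definition hom :: "('o, 'm) category \<Rightarrow> 'o \<Rightarrow> 'o \<Rightarrow> 'm set" where
  "hom C A B = {f \<in> Arr C. Dom C f = A \<and> Cod C f = B}"

locale category =
  fixes C :: "('o, 'm) category" (structure)
  assumes Dom_Obj: "f \<in> Arr C \<Longrightarrow> Dom C f \<in> Obj C"
    and Cod_Obj: "f \<in> Arr C \<Longrightarrow> Cod C f \<in> Obj C"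
    and Id_hom: "A \<in> Obj C \<Longrightarrow> Id C A \<in> hom C A A"
    and Cmp_hom: "\<lbrakk>f \<in> hom C A B; g \<in> hom C B D\<rbrakk> \<Longrightarrow> g \<cdot> f \<in> hom C A D"
    and Cmp_Id: "f \<in> hom C A B \<Longrightarrow> f \<cdot> Id C A = f"
    and Id_Cmp: "f \<in> hom C A B \<Longrightarrow> Id C B \<cdot> f = f"
    and Cmp_assoc: "\<lbrakk>f \<in> hom C A B; g \<in> hom C B D; h \<in> hom C D E\<rbrakk>
      \<Longrightarrow> (h \<cdot> g) \<cdot> f = h \<cdot> (g \<cdot> f)"

definition opposite :: "('o, 'm) category \<Rightarrow> ('o, 'm) category" where
  "opposite C = \<lparr>Obj = Obj C, Arr = Arr C, Dom = Cod C, Cod = Dom C, Id = Id C,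
     Cmp = (\<lambda>g f. Cmp C f g)\<rparr>"

definition is_iso :: "('o, 'm) category \<Rightarrow> 'm \<Rightarrow> bool" where
  "is_iso C f \<longleftrightarrow> f \<in> Arr C \<and>
     (\<exists>g \<in> hom C (Cod C f) (Dom C f).
        g \<cdot>\<^bsub>C\<^esub> f = Id C (Dom C f) \<and> f \<cdot>\<^bsub>C\<^esub> g = Id C (Cod C f))"

definition terminal_object :: "('o, 'm) category \<Rightarrow> 'o \<Rightarrow> bool" where
  "terminal_object C Z \<longleftrightarrow> Z \<in> Obj C \<and> (\<forall>A \<in> Obj C. \<exists>!f. f \<in> hom C A Z)"

definition initial_object :: "('o, 'm) category \<Rightarrow> 'o \<Rightarrow> bool" where
  "initial_object C Z \<longleftrightarrow> Z \<in> Obj C \<and> (\<forall>A \<in> Obj C. \<exists>!f. f \<in> hom C Z A)"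

definition zero_object :: "('o, 'm) category \<Rightarrow> 'o \<Rightarrow> bool" where
  "zero_object C Z \<longleftrightarrow> initial_object C Z \<and> terminal_object C Z"

definition zero_arrow :: "('o, 'm) category \<Rightarrow> 'm \<Rightarrow> bool" where
  "zero_arrow C f \<longleftrightarrow> f \<in> Arr C \<and>
     (\<exists>Z a b. zero_object C Z \<and> a \<in> hom C (Dom C f) Z \<and> b \<in> hom C Z (Cod C f) \<and> f = b \<cdot>\<^bsub>C\<^esub> a)"

text \<open>
  \<open>is_pullback C f g p q\<close>: the square \<open>f \<cdot> p = g \<cdot> q\<close> is a pullback, \<open>p\<close> being the projection
  to the domain of \<open>f\<close> and \<open>q\<close> the projection to the domain of \<open>g\<close>.
\<close>
definition is_pullback :: "('o, 'm) category \<Rightarrow> 'm \<Rightarrow> 'm \<Rightarrow> 'm \<Rightarrow> 'm \<Rightarrow> bool" where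
  "is_pullback C f g p q \<longleftrightarrow>
     f \<in> Arr C \<and> g \<in> Arr C \<and> Cod C f = Cod C g \<and>
     p \<in> hom C (Dom C p) (Dom C f) \<and> q \<in> hom C (Dom C p) (Dom C g) \<and>
     f \<cdot>\<^bsub>C\<^esub> p = g \<cdot>\<^bsub>C\<^esub> q \<and>
     (\<forall>T \<in> Obj C. \<forall>a \<in> hom C T (Dom C f). \<forall>b \<in> hom C T (Dom C g).
        f \<cdot>\<^bsub>C\<^esub> a = g \<cdot>\<^bsub>C\<^esub> b \<longrightarrow>
        (\<exists>!u. u \<in> hom C T (Dom C p) \<and> p \<cdot>\<^bsub>C\<^esub> u = a \<and> q \<cdot>\<^bsub>C\<^esub> u = b))"

definition is_coproduct :: "('o, 'm) category \<Rightarrow> 'o \<Rightarrow> 'o \<Rightarrow> 'm \<Rightarrow> 'm \<Rightarrow> bool" where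
  "is_coproduct C A B i j \<longleftrightarrow>
     i \<in> hom C A (Cod C i) \<and> j \<in> hom C B (Cod C i) \<and>
     (\<forall>T \<in> Obj C. \<forall>a \<in> hom C A T. \<forall>b \<in> hom C B T.
        \<exists>!u. u \<in> hom C (Cod C i) T \<and> u \<cdot>\<^bsub>C\<^esub> i = a \<and> u \<cdot>\<^bsub>C\<^esub> j = b)"

definition is_coequalizer :: "('o, 'm) category \<Rightarrow> 'm \<Rightarrow> 'm \<Rightarrow> 'm \<Rightarrow> bool" where
  "is_coequalizer C f g e \<longleftrightarrow>
     f \<in> Arr C \<and> g \<in> hom C (Dom C f) (Cod C f) \<and> e \<in> Arr C \<and> Dom C e = Cod C f \<and>
     e \<cdot>\<^bsub>C\<^esub> f = e \<cdot>\<^bsub>C\<^esub> g \<and>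
     (\<forall>T \<in> Obj C. \<forall>h \<in> hom C (Cod C f) T. h \<cdot>\<^bsub>C\<^esub> f = h \<cdot>\<^bsub>C\<^esub> g \<longrightarrow>
        (\<exists>!u. u \<in> hom C (Cod C e) T \<and> u \<cdot>\<^bsub>C\<^esub> e = h))"

definition regular_epi :: "('o, 'm) category \<Rightarrow> 'm \<Rightarrow> bool" where
  "regular_epi C e \<longleftrightarrow> (\<exists>f g. is_coequalizer C f g e)"

definition is_kernel :: "('o, 'm) category \<Rightarrow> 'm \<Rightarrow> 'm \<Rightarrow> bool" where
  "is_kernel C k f \<longleftrightarrow>
     k \<in> Arr C \<and> f \<in> Arr C \<and> Cod C k = Dom C f \<and> zero_arrow C (f \<cdot>\<^bsub>C\<^esub> k) \<and>
     (\<forall>T \<in> Obj C. \<forall>h \<in> hom C T (Dom C f). zero_arrow C (f \<cdot>\<^bsub>C\<^esub> h) \<longrightarrow>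
        (\<exists>!u. u \<in> hom C T (Dom C k) \<and> k \<cdot>\<^bsub>C\<^esub> u = h))"

definition is_cokernel :: "('o, 'm) category \<Rightarrow> 'm \<Rightarrow> 'm \<Rightarrow> bool" where
  "is_cokernel C q f \<longleftrightarrow>
     q \<in> Arr C \<and> f \<in> Arr C \<and> Dom C q = Cod C f \<and> zero_arrow C (q \<cdot>\<^bsub>C\<^esub> f) \<and>
     (\<forall>T \<in> Obj C. \<forall>h \<in> hom C (Cod C f) T. zero_arrow C (h \<cdot>\<^bsub>C\<^esub> f) \<longrightarrow>
        (\<exists>!u. u \<in> hom C (Cod C q) T \<and> u \<cdot>\<^bsub>C\<^esub> q = h))"

definition normal_mono :: "('o, 'm) category \<Rightarrow> 'm \<Rightarrow> bool" where
  "normal_mono C k \<longleftrightarrow> (\<exists>f. is_kernel C k f)"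


section \<open>Semi-abelian categories\<close>

text \<open>
  A pair \<open>r, s\<close> of parallel arrows is an internal equivalence relation on \<open>A\<close> when it is jointly
  monic and represents, for every \<open>T\<close>, an equivalence relation on the set of arrows from \<open>T\<close> to \<open>A\<close>.
\<close>
definition internal_equivalence :: "('o, 'm) category \<Rightarrow> 'o \<Rightarrow> 'm \<Rightarrow> 'm \<Rightarrow> bool" where
  "internal_equivalence C A r s \<longleftrightarrow>
     r \<in> hom C (Dom C r) A \<and> s \<in> hom C (Dom C r) A \<and>
     (\<forall>T \<in> Obj C. \<forall>u \<in> hom C T (Dom C r). \<forall>v \<in> hom C T (Dom C r).
        r \<cdot>\<^bsub>C\<^esub> u = r \<cdot>\<^bsub>C\<^esub> v \<and> s \<cdot>\<^bsub>C\<^esub> u = s \<cdot>\<^bsub>C\<^esub> v \<longrightarrow> u = v) \<and>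
     (\<forall>T \<in> Obj C. equiv (hom C T A) ((\<lambda>h. (r \<cdot>\<^bsub>C\<^esub> h, s \<cdot>\<^bsub>C\<^esub> h)) ` hom C T (Dom C r)))"

text \<open>Finite limits are given by a terminal object and pullbacks.\<close>
locale regular_category = category +
  assumes has_terminal: "\<exists>Z. terminal_object C Z"
    and has_pullbacks: "\<lbrakk>f \<in> Arr C; g \<in> Arr C; Cod C f = Cod C g\<rbrakk> \<Longrightarrow> \<exists>p q. is_pullback C f g p q"
    and kernel_pair_coequalizer: "is_pullback C f f p q \<Longrightarrow> \<exists>e. is_coequalizer C p q e"
    and regular_epi_stable: "\<lbrakk>is_pullback C f g p q; regular_epi C f\<rbrakk> \<Longrightarrow> regular_epi C q"

locale Barr_exact_category = regular_category +
  assumes effective_equivalence: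
    "internal_equivalence C A r s \<Longrightarrow> \<exists>f \<in> Arr C. Dom C f = A \<and> is_pullback C f f r s"

text \<open>\<open>point C B p s\<close>: an object of the fibre over \<open>B\<close> of the fibration of points.\<close>
definition point :: "('o, 'm) category \<Rightarrow> 'o \<Rightarrow> 'm \<Rightarrow> 'm \<Rightarrow> bool" where
  "point C B p s \<longleftrightarrow>
     p \<in> hom C (Dom C p) B \<and> s \<in> hom C B (Dom C p) \<and> p \<cdot>\<^bsub>C\<^esub> s = Id C B"

text \<open>
  Protomodularity: the change-of-base functors of the fibration of points reflect isomorphisms.
  Here \<open>f\<close> is a morphism of points over \<open>B\<close> and \<open>g\<close> is its image under pulling back
  along \<open>v\<close>.
\<close>
definition protomodular :: "('o, 'm) category \<Rightarrow> bool" where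
  "protomodular C \<longleftrightarrow>
     (\<forall>B v p s p' s' f x a x' a' g.
        v \<in> Arr C \<and> Cod C v = B \<and> point C B p s \<and> point C B p' s' \<and>
        f \<in> hom C (Dom C p) (Dom C p') \<and> p' \<cdot>\<^bsub>C\<^esub> f = p \<and> f \<cdot>\<^bsub>C\<^esub> s = s' \<and>
        is_pullback C v p x a \<and> is_pullback C v p' x' a' \<and>
        g \<in> hom C (Dom C x) (Dom C x') \<and> x' \<cdot>\<^bsub>C\<^esub> g = x \<and> a' \<cdot>\<^bsub>C\<^esub> g = f \<cdot>\<^bsub>C\<^esub> a \<and>
        is_iso C g \<longrightarrow> is_iso C f)"

locale semi_abelian_category = Barr_exact_category +
  assumes pointed: "\<exists>Z. zero_object C Z"
    and protomodular: "protomodular C"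
    and has_coproducts: "\<lbrakk>A \<in> Obj C; B \<in> Obj C\<rbrakk> \<Longrightarrow> \<exists>i j. is_coproduct C A B i j"


section \<open>Functors and natural transformations\<close>

record ('a, 'b, 'o, 'm) funct =
  obm :: "'a \<Rightarrow> 'o"
  arm :: "'b \<Rightarrow> 'm"

definition is_functor :: "('a, 'b) category \<Rightarrow> ('o, 'm) category \<Rightarrow> ('a, 'b, 'o, 'm) funct \<Rightarrow> bool" where
  "is_functor J C F \<longleftrightarrow> category J \<and> category C \<and>
     (\<forall>j \<in> Obj J. obm F j \<in> Obj C \<and> arm F (Id J j) = Id C (obm F j)) \<and>
     (\<forall>a \<in> Arr J. arm F a \<in> hom C (obm F (Dom J a)) (obm F (Cod J a))) \<and>
     (\<forall>a \<in> Arr J. \<forall>b \<in> Arr J. Cod J a = Dom J b \<longrightarrow>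
        arm F (b \<cdot>\<^bsub>J\<^esub> a) = arm F b \<cdot>\<^bsub>C\<^esub> arm F a)"

definition natural_transformation :: "('a, 'b) category \<Rightarrow> ('o, 'm) category
    \<Rightarrow> ('a, 'b, 'o, 'm) funct \<Rightarrow> ('a, 'b, 'o, 'm) funct \<Rightarrow> ('a \<Rightarrow> 'm) \<Rightarrow> bool" where
  "natural_transformation J C F G \<eta> \<longleftrightarrow> is_functor J C F \<and> is_functor J C G \<and>
     (\<forall>j \<in> Obj J. \<eta> j \<in> hom C (obm F j) (obm G j)) \<and>
     (\<forall>a \<in> Arr J. \<eta> (Cod J a) \<cdot>\<^bsub>C\<^esub> arm F a = arm G a \<cdot>\<^bsub>C\<^esub> \<eta> (Dom J a))"

definition natural_isomorphism :: "('a, 'b) category \<Rightarrow> ('o, 'm) category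
    \<Rightarrow> ('a, 'b, 'o, 'm) funct \<Rightarrow> ('a, 'b, 'o, 'm) funct \<Rightarrow> ('a \<Rightarrow> 'm) \<Rightarrow> bool" where
  "natural_isomorphism J C F G \<eta> \<longleftrightarrow>
     natural_transformation J C F G \<eta> \<and> (\<forall>j \<in> Obj J. is_iso C (\<eta> j))"

text \<open>
  Objects and arrows are extensional, i.e. \<^term>\<open>undefined\<close> outside the index category, so
  that HOL equality is equality of functors and of natural transformations.
\<close>
definition functor_category :: "('a, 'b) category \<Rightarrow> ('o, 'm) category \<Rightarrow>
    (('a, 'b, 'o, 'm) funct,
     ('a, 'b, 'o, 'm) funct \<times> ('a, 'b, 'o, 'm) funct \<times> ('a \<Rightarrow> 'm)) category" where
  "functor_category J C =
     (let Ob = {F. is_functor J C F \<and> obm F \<in> extensional (Obj J) \<and> arm F \<in> extensional (Arr J)}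
      in \<lparr>Obj = Ob,
          Arr = {(F, G, \<eta>). F \<in> Ob \<and> G \<in> Ob \<and> natural_transformation J C F G \<eta> \<and>
                            \<eta> \<in> extensional (Obj J)},
          Dom = (\<lambda>(F, G, \<eta>). F),
          Cod = (\<lambda>(F, G, \<eta>). G),
          Id = (\<lambda>F. (F, F, \<lambda>j \<in> Obj J. Id C (obm F j))),
          Cmp = (\<lambda>(G', H, \<theta>) (F, G, \<eta>). (F, H, \<lambda>j \<in> Obj J. \<theta> j \<cdot>\<^bsub>C\<^esub> \<eta> j))\<rparr>)"


section \<open>Posets as categories, and their powers\<close>

text \<open>The arrow from \<open>x\<close> to \<open>y\<close>, for \<open>x \<le> y\<close>, is the pair \<open>(x, y)\<close>.\<close>
definition poset_category :: "'a set \<Rightarrow> ('a \<Rightarrow> 'a \<Rightarrow> bool) \<Rightarrow> ('a, 'a \<times> 'a) category" where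
  "poset_category A r =
     \<lparr>Obj = A, Arr = {(x, y). x \<in> A \<and> y \<in> A \<and> r x y}, Dom = fst, Cod = snd,
      Id = (\<lambda>x. (x, x)), Cmp = (\<lambda>b a. (fst a, snd b))\<rparr>"

definition chain :: "nat \<Rightarrow> (nat, nat \<times> nat) category" where
  "chain k = poset_category {..<k} (\<le>)"

text \<open>\<open>chain_power k n\<close> is the \<open>n\<close>-th power of \<^term>\<open>chain k\<close>; tuples are lists of length \<open>n\<close>.\<close>
definition chain_power :: "nat \<Rightarrow> nat \<Rightarrow> (nat list, nat list \<times> nat list) category" where
  "chain_power k n = poset_category {e. length e = n \<and> set e \<subseteq> {..<k}} (list_all2 (\<le>))"

text \<open>
  Restriction of a functor along the monotone map \<open>h\<close>, whose domain is the object set of the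
  thin category \<open>J\<close>.  As \<^const>\<open>opposite\<close> changes neither objects nor arrows, this serves
  for contravariant functors as well.
\<close>
definition restrict_along :: "('a, 'a \<times> 'a) category \<Rightarrow> ('a \<Rightarrow> 'b)
    \<Rightarrow> ('b, 'b \<times> 'b, 'o, 'm) funct \<Rightarrow> ('a, 'a \<times> 'a, 'o, 'm) funct" where
  "restrict_along J h F =
     \<lparr>obm = (\<lambda>x \<in> Obj J. obm F (h x)), arm = (\<lambda>(x, y) \<in> Arr J. arm F (h x, h y))\<rparr>"

type_synonym ('o, 'm) diagram = "(nat list, nat list \<times> nat list, 'o, 'm) funct"


section \<open>Sequences and multiple arrows\<close>

text \<open>
  A diagram on the opposite of \<^term>\<open>chain_power k n\<close> sends the pair \<open>(x, y)\<close>, for \<open>x \<le> y\<close>, to an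
  arrow from the value at \<open>y\<close> to the value at \<open>x\<close>.
\<close>
definition is_sequence :: "('o, 'm) category \<Rightarrow> nat \<Rightarrow> ('o, 'm) diagram \<Rightarrow> bool" where
  "is_sequence C n E \<longleftrightarrow> is_functor (opposite (chain_power 3 n)) C E"

definition short_exact :: "('o, 'm) category \<Rightarrow> (nat, nat \<times> nat, 'o, 'm) funct \<Rightarrow> bool" where
  "short_exact C S \<longleftrightarrow> is_functor (opposite (chain 3)) C S \<and>
     is_kernel C (arm S (1, 2)) (arm S (0, 1)) \<and> is_cokernel C (arm S (0, 1)) (arm S (1, 2))"

text \<open>The embedding of \<open>3\<close> into its \<open>n\<close>-th power, through \<open>e\<close>, parallel to axis \<open>i\<close>.\<close>
definition axis_embedding :: "nat list \<Rightarrow> nat \<Rightarrow> nat \<Rightarrow> nat list" where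
  "axis_embedding e i k = e[i := k]"

definition is_3n_diagram :: "('o, 'm) category \<Rightarrow> nat \<Rightarrow> ('o, 'm) diagram \<Rightarrow> bool" where
  "is_3n_diagram C n E \<longleftrightarrow>
     (\<forall>e \<in> Obj (chain_power 3 n). \<forall>i<n. e ! i = 0 \<longrightarrow>
        short_exact C (restrict_along (opposite (chain 3)) (axis_embedding e i) E))"

text \<open>
  The \<open>n\<close>-fold arrow category as the category of commutative \<open>n\<close>-cubes.  The initial corner
  has all coordinates 1, the terminal one all coordinates 0.  The outermost of the \<open>n\<close>
  successive arrow-category constructions corresponds to coordinate 0 (the head of the list).
\<close>
definition Arrow_category :: "nat \<Rightarrow> ('o, 'm) category \<Rightarrow>
    (('o, 'm) diagram, ('o, 'm) diagram \<times> ('o, 'm) diagram \<times> (nat list \<Rightarrow> 'm)) category" where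
  "Arrow_category n C = functor_category (opposite (chain_power 2 n)) C"

definition epi_part :: "nat \<Rightarrow> ('o, 'm) diagram \<Rightarrow> ('o, 'm) diagram" where
  "epi_part n E = restrict_along (opposite (chain_power 2 n)) (\<lambda>e. e) E"

text \<open>The coordinates 1, 2 of a sequence are renumbered 0, 1.\<close>
definition mono_part :: "nat \<Rightarrow> ('o, 'm) diagram \<Rightarrow> ('o, 'm) diagram" where
  "mono_part n E = restrict_along (opposite (chain_power 2 n)) (map Suc) E"


section \<open>Completion by kernels and by cokernels\<close>

definition chosen_kernel :: "('o, 'm) category \<Rightarrow> 'm \<Rightarrow> 'm" where
  "chosen_kernel C f = (SOME k. is_kernel C k f)"

definition chosen_cokernel :: "('o, 'm) category \<Rightarrow> 'm \<Rightarrow> 'm" where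
  "chosen_cokernel C f = (SOME q. is_cokernel C q f)"

text \<open>
  One step of kernels in direction \<open>i\<close>: a diagram whose \<open>i\<close>-th coordinate ranges over 0, 1 is
  extended to value 2 of that coordinate; \<open>\<kappa> x\<close> is the chosen kernel for the line through \<open>x\<close>.
  The arrows between kernels are those induced by the universal property.
\<close>
definition kernel_step :: "('o, 'm) category \<Rightarrow> nat \<Rightarrow> ('o, 'm) diagram \<Rightarrow> ('o, 'm) diagram" where
  "kernel_step C i D =
     (let \<kappa> = (\<lambda>x. chosen_kernel C (arm D (x[i := 0], x[i := 1]))) in
      \<lparr>obm = (\<lambda>x. if x ! i = 2 then Dom C (\<kappa> x) else obm D x),
       arm = (\<lambda>(x, y).
         if y ! i \<noteq> 2 then arm D (x, y)
         else if x ! i \<noteq> 2 then arm D (x, y[i := 1]) \<cdot>\<^bsub>C\<^esub> \<kappa> y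
         else (THE u. u \<in> hom C (Dom C (\<kappa> y)) (Dom C (\<kappa> x)) \<and>
                      \<kappa> x \<cdot>\<^bsub>C\<^esub> u = arm D (x[i := 1], y[i := 1]) \<cdot>\<^bsub>C\<^esub> \<kappa> y))\<rparr>)"

definition KerSeq :: "('o, 'm) category \<Rightarrow> nat \<Rightarrow> ('o, 'm) diagram \<Rightarrow> ('o, 'm) diagram" where
  "KerSeq C n F = fold (kernel_step C) [0..<n] F"

text \<open>
  Dually: a diagram whose \<open>i\<close>-th coordinate ranges over 1, 2 is extended to the value 0.
\<close>
definition cokernel_step :: "('o, 'm) category \<Rightarrow> nat \<Rightarrow> ('o, 'm) diagram \<Rightarrow> ('o, 'm) diagram" where
  "cokernel_step C i D =
     (let \<gamma> = (\<lambda>x. chosen_cokernel C (arm D (x[i := 1], x[i := 2]))) in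
      \<lparr>obm = (\<lambda>x. if x ! i = 0 then Cod C (\<gamma> x) else obm D x),
       arm = (\<lambda>(x, y).
         if x ! i \<noteq> 0 then arm D (x, y)
         else if y ! i \<noteq> 0 then \<gamma> x \<cdot>\<^bsub>C\<^esub> arm D (x[i := 1], y)
         else (THE u. u \<in> hom C (Cod C (\<gamma> y)) (Cod C (\<gamma> x)) \<and>
                      u \<cdot>\<^bsub>C\<^esub> \<gamma> y = \<gamma> x \<cdot>\<^bsub>C\<^esub> arm D (x[i := 1], y[i := 1])))\<rparr>)"

text \<open>
  The \<open>n\<close>-fold arrow \<open>M\<close> is first placed on the coordinates 1, 2.  (The truncated subtraction
  also yields values where some coordinate is 0; the steps overwrite all of these.)
\<close>
definition CokerSeq :: "('o, 'm) category \<Rightarrow> nat \<Rightarrow> ('o, 'm) diagram \<Rightarrow> ('o, 'm) diagram" where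
  "CokerSeq C n M =
     fold (cokernel_step C) [0..<n] (restrict_along (opposite (chain_power 3 n)) (map (\<lambda>k. k - 1)) M)"

text \<open>There is an isomorphism of \<open>n\<close>-sequences that is the identity at all objects with coordinates in \<open>S\<close>.\<close>
definition isomorphic_fixing :: "('o, 'm) category \<Rightarrow> nat \<Rightarrow> nat set
    \<Rightarrow> ('o, 'm) diagram \<Rightarrow> ('o, 'm) diagram \<Rightarrow> bool" where
  "isomorphic_fixing C n S E E' \<longleftrightarrow>
     (\<exists>\<phi>. natural_isomorphism (opposite (chain_power 3 n)) C E E' \<phi> \<and>
          (\<forall>e \<in> Obj (chain_power 3 n). set e \<subseteq> S \<longrightarrow>
             obm E' e = obm E e \<and> \<phi> e = Id C (obm E e)))"


section \<open>Cubic extensions\<close>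

text \<open>
  The face of an \<open>(n+1)\<close>-fold arrow on which the \<open>i\<close>-th coordinate is \<open>k\<close>, an \<open>n\<close>-fold arrow.
\<close>
definition face :: "nat \<Rightarrow> nat \<Rightarrow> nat \<Rightarrow> ('o, 'm) diagram \<Rightarrow> ('o, 'm) diagram" where
  "face n i k A = restrict_along (opposite (chain_power 2 n)) (\<lambda>e. take i e @ k # drop i e) A"

text \<open>An \<open>(n+1)\<close>-fold arrow regarded as an arrow of \<^term>\<open>Arrow_category n C\<close>.\<close>
definition edge :: "nat \<Rightarrow> ('o, 'm) diagram
    \<Rightarrow> ('o, 'm) diagram \<times> ('o, 'm) diagram \<times> (nat list \<Rightarrow> 'm)" where
  "edge n A = (face n 0 1 A, face n 0 0 A, \<lambda>e \<in> Obj (chain_power 2 n). arm A (0 # e, 1 # e))"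

text \<open>
  For \<open>n = m + 2\<close>, an \<open>n\<close>-fold arrow is the commutative square of \<open>m\<close>-fold arrows indexed by the
  first two coordinates

    \<open>A\<^sub>1\<^sub>1 \<rightarrow> A\<^sub>0\<^sub>1\<close> (\<open>face 1 1\<close>), \<open>A\<^sub>1\<^sub>1 \<rightarrow> A\<^sub>1\<^sub>0\<close> (\<open>face 0 1\<close>),
    \<open>A\<^sub>0\<^sub>1 \<rightarrow> A\<^sub>0\<^sub>0\<close> (\<open>face 0 0\<close>), \<open>A\<^sub>1\<^sub>0 \<rightarrow> A\<^sub>0\<^sub>0\<close> (\<open>face 1 0\<close>),

  and \<open>B\<close> below is the comparison from \<open>A\<^sub>1\<^sub>1\<close> to the pullback.  There is no notion of 0-cubic
  extension; the value at 0 is a dummy.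
\<close>
fun cubic_extension :: "('o, 'm) category \<Rightarrow> nat \<Rightarrow> ('o, 'm) diagram \<Rightarrow> bool" where
  "cubic_extension C 0 A \<longleftrightarrow> False"
| "cubic_extension C (Suc 0) A \<longleftrightarrow>
     A \<in> Obj (Arrow_category 1 C) \<and> regular_epi C (arm A ([0], [1]))"
| "cubic_extension C (Suc (Suc m)) A \<longleftrightarrow>
     A \<in> Obj (Arrow_category (Suc (Suc m)) C) \<and>
     (\<forall>i \<in> {0, 1}. \<forall>k \<in> {0, 1}. cubic_extension C (Suc m) (face (Suc m) i k A)) \<and>
     (\<exists>p q B. is_pullback (Arrow_category m C)
                (edge m (face (Suc m) 0 0 A)) (edge m (face (Suc m) 1 0 A)) p q \<and>
        B \<in> Obj (Arrow_category (Suc m) C) \<and>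
        Dom (Arrow_category m C) (edge m B) = Dom (Arrow_category m C) (edge m (face (Suc m) 1 1 A)) \<and>
        Cod (Arrow_category m C) (edge m B) = Dom (Arrow_category m C) p \<and>
        p \<cdot>\<^bsub>Arrow_category m C\<^esub> edge m B = edge m (face (Suc m) 1 1 A) \<and>
        q \<cdot>\<^bsub>Arrow_category m C\<^esub> edge m B = edge m (face (Suc m) 0 1 A) \<and>
        cubic_extension C (Suc m) B)"


section \<open>Distributive tuples of normal monomorphisms\<close>

text \<open>
  Normal subobjects are represented by normal monomorphisms, two of which are identified by
  the equivalence \<open>eq\<close> of the ordered structure.
\<close>
definition subobject_le :: "('o, 'm) category \<Rightarrow> 'm \<Rightarrow> 'm \<Rightarrow> bool" where
  "subobject_le C k l \<longleftrightarrow> (\<exists>u \<in> hom C (Dom C k) (Dom C l). l \<cdot>\<^bsub>C\<^esub> u = k)"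

definition normal_subobjects :: "('o, 'm) category \<Rightarrow> 'o \<Rightarrow> 'm gorder" where
  "normal_subobjects C X =
     \<lparr>carrier = {k. normal_mono C k \<and> Cod C k = X},
      eq = (\<lambda>k l. subobject_le C k l \<and> subobject_le C l k),
      le = subobject_le C\<rparr>"

definition normal_tuple :: "('o, 'm) category \<Rightarrow> nat \<Rightarrow> 'o \<Rightarrow> (nat \<Rightarrow> 'm) \<Rightarrow> bool" where
  "normal_tuple C n X K \<longleftrightarrow> X \<in> Obj C \<and> (\<forall>i<n. normal_mono C (K i) \<and> Cod C (K i) = X)"

definition distributive_tuple :: "('o, 'm) category \<Rightarrow> nat \<Rightarrow> 'o \<Rightarrow> (nat \<Rightarrow> 'm) \<Rightarrow> bool" where
  "distributive_tuple C n X K \<longleftrightarrow> normal_tuple C n X K \<and>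
     (let L = normal_subobjects C X; M = (\<lambda>I. \<Sqinter>\<^bsub>L\<^esub>(K ` I)) in
      \<forall>k\<ge>1. \<forall>J :: nat \<Rightarrow> nat set.
        (\<forall>i\<le>k. J i \<subseteq> {..<n}) \<and> (\<forall>i\<le>k. \<forall>j\<le>k. i \<noteq> j \<longrightarrow> J i \<inter> J j = {}) \<longrightarrow>
        M (J 0) \<sqinter>\<^bsub>L\<^esub> (\<Squnion>\<^bsub>L\<^esub>((\<lambda>i. M (J i)) ` {1..k})) .=\<^bsub>L\<^esub>
          \<Squnion>\<^bsub>L\<^esub>((\<lambda>i. M (J 0 \<union> J i)) ` {1..k}))"

text \<open>
  \<open>m\<close> is the wide pullback of the arrows \<open>K i\<close>, \<open>i \<in> I\<close>, over their common codomain \<open>X\<close>: an arrow to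
  \<open>X\<close> factors, uniquely, through \<open>m\<close> iff it factors through all \<open>K i\<close>.
\<close>
definition is_intersection :: "('o, 'm) category \<Rightarrow> 'o \<Rightarrow> nat set \<Rightarrow> (nat \<Rightarrow> 'm) \<Rightarrow> 'm \<Rightarrow> bool" where
  "is_intersection C X I K m \<longleftrightarrow>
     m \<in> hom C (Dom C m) X \<and> (\<forall>i \<in> I. subobject_le C m (K i)) \<and>
     (\<forall>T \<in> Obj C. \<forall>h \<in> hom C T X. (\<forall>i \<in> I. subobject_le C h (K i)) \<longrightarrow>
        (\<exists>!u. u \<in> hom C T (Dom C m) \<and> m \<cdot>\<^bsub>C\<^esub> u = h))"

text \<open>
  The vertex at \<open>e\<close> is the intersection of the \<open>K i\<close> with \<open>e ! i = 1\<close>, as a subobject of the terminal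
  vertex \<open>X\<close> via the arrow of the cube to that vertex.  By functoriality all arrows of the
  cube then are the inclusions.
\<close>
definition induced_by :: "('o, 'm) category \<Rightarrow> nat \<Rightarrow> ('o, 'm) diagram \<Rightarrow> 'o \<Rightarrow> (nat \<Rightarrow> 'm) \<Rightarrow> bool" where
  "induced_by C n A X K \<longleftrightarrow>
     A \<in> Obj (Arrow_category n C) \<and> obm A (replicate n 0) = X \<and>
     (\<forall>e \<in> Obj (chain_power 2 n).
        is_intersection C X {i. i < n \<and> e ! i = 1} K (arm A (replicate n 0, e)))"

end

theory Submission
  imports Defs
begin

text \<open>
  Arrows \<open>T \<rightarrow> X\<close> are treated as generalized elements of \<open>X\<close>, and surjectivity is read locally, after
  composition with regular epimorphisms.  Protomodularity enters through the fact that the domain of a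
  split epimorphism is generated by the kernel and the section.

  The two completion conditions say exactly that all lines of the sequence are kernels, respectively
  cokernels, and are dual to each other; this settles (i) and (iv).

  If all lines are cokernels, and \<open>M(T)\<close> is the intersection of the \<open>K\<^sub>t\<close>, \<open>t \<in> T\<close>, then the object
  with coordinates 2 on \<open>T\<close> and 0 on \<open>Z\<close> is the quotient of \<open>M(T)\<close> by the join of the
  \<open>M(T \<union> {z})\<close>, \<open>z \<in> Z\<close>.  Hence the lines are also kernels as soon as the meet of \<open>M(T)\<close> with the join
  of the \<open>K\<^sub>z\<close> is the join of the \<open>M(T \<union> {z})\<close>, and the modular law yields all instances of
  distributivity from these.

  If all lines are kernels, then the objects with coordinates 2 on \<open>S\<close> consist of the elements of a
  vertex of the cube that vanish in the directions in \<open>S\<close>.  So the lines are also cokernels iff all such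
  elements lift locally along the edges of the cube, and by induction on the dimension this lifting
  property characterizes the cubic extensions.
\<close>

section \<open>Regular categories\<close>

text \<open>The conditions speak of chosen kernels, cokernels, infima and suprema; each is first
  turned into a property of arrows that does not depend on choices: membership in a subobject,
  vanishing of all test arrows, kernel or cokernel lines of the given sequence. The axioms enter at
  separate places. Protomodularity gives the split extension principle; that principle makes
  reflexive relations equivalence relations; Barr exactness turns these into kernel pairs, so images
  of normal subobjects along regular epimorphisms are normal; coproducts then yield cokernels. The
  opposite of a semi-abelian category is usually not semi-abelian, so the completion by kernels is
  carried out in any pointed category with kernels, and the opposite category is one because
  cokernels exist. Every regular epimorphism being the cokernel of its kernel, a kernel line is
  exact as soon as its second arrow is a regular epimorphism: surjectivity is all that kernel lines
  lack. What cokernel lines lack is above all injectivity, and this is what distributivity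
  provides.\<close>

context category
begin

lemma in_hom_iff: "f \<in> hom C A B \<longleftrightarrow> f \<in> Arr C \<and> Dom C f = A \<and> Cod C f = B"
  by (auto simp: hom_def)

lemma Arr_Cmp [simp]: "\<lbrakk>f \<in> Arr C; g \<in> Arr C; Cod C f = Dom C g\<rbrakk> \<Longrightarrow> g \<cdot> f \<in> Arr C"
  and Dom_Cmp [simp]: "\<lbrakk>f \<in> Arr C; g \<in> Arr C; Cod C f = Dom C g\<rbrakk> \<Longrightarrow> Dom C (g \<cdot> f) = Dom C f"
  and Cod_Cmp [simp]: "\<lbrakk>f \<in> Arr C; g \<in> Arr C; Cod C f = Dom C g\<rbrakk> \<Longrightarrow> Cod C (g \<cdot> f) = Cod C g"
  using Cmp_hom[of f "Dom C f" "Cod C f" g "Cod C g"] by (auto simp: in_hom_iff)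

lemma Arr_Id [simp]: "A \<in> Obj C \<Longrightarrow> Id C A \<in> Arr C"
  and Dom_Id [simp]: "A \<in> Obj C \<Longrightarrow> Dom C (Id C A) = A"
  and Cod_Id [simp]: "A \<in> Obj C \<Longrightarrow> Cod C (Id C A) = A"
  using Id_hom[of A] by (auto simp: in_hom_iff)

lemma Cmp_Id_right [simp]: "\<lbrakk>f \<in> Arr C; Dom C f = A\<rbrakk> \<Longrightarrow> f \<cdot> Id C A = f"
  using Cmp_Id[of f A "Cod C f"] by (auto simp: in_hom_iff)

lemma Cmp_Id_left [simp]: "\<lbrakk>f \<in> Arr C; Cod C f = A\<rbrakk> \<Longrightarrow> Id C A \<cdot> f = f"
  using Id_Cmp[of f "Dom C f" A] by (auto simp: in_hom_iff)

lemma assoc [simp]: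
  "\<lbrakk>f \<in> Arr C; g \<in> Arr C; h \<in> Arr C; Cod C f = Dom C g; Cod C g = Dom C h\<rbrakk>
    \<Longrightarrow> (h \<cdot> g) \<cdot> f = h \<cdot> (g \<cdot> f)"
  using Cmp_assoc[of f "Dom C f" "Cod C f" g "Cod C g" h "Cod C h"] by (auto simp: in_hom_iff)

lemma Obj_Dom [simp]: "f \<in> Arr C \<Longrightarrow> Dom C f \<in> Obj C"
  and Obj_Cod [simp]: "f \<in> Arr C \<Longrightarrow> Cod C f \<in> Obj C"
  by (auto simp: Dom_Obj Cod_Obj)

text \<open>Since \<open>assoc\<close> nests composites to the right, the left side of an equation
  \<open>g \<cdot> f = k\<close> is no longer a subterm of a longer composite; precomposed with
  \<open>h\<close>, the equation can be used for rewriting there.\<close>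

lemma Cmp_eq_left: "\<lbrakk>g \<cdot> f = k; f \<in> Arr C; g \<in> Arr C; h \<in> Arr C; Cod C h = Dom C f; Cod C f = Dom C g\<rbrakk>
    \<Longrightarrow> g \<cdot> (f \<cdot> h) = k \<cdot> h"
  by (metis assoc)

text \<open>\<open>x\<close> may be any arrow, not only a monomorphism: the relation is read as
  membership of the generalized element \<open>x\<close> in the subobject \<open>m\<close>.\<close>

abbreviation le_arrow (infix "\<preceq>" 50) where "x \<preceq> m \<equiv> subobject_le C x m"

lemma le_arrowI: "\<lbrakk>m \<cdot> u = x; u \<in> Arr C; m \<in> Arr C; Cod C u = Dom C m\<rbrakk> \<Longrightarrow> x \<preceq> m"
  unfolding subobject_le_def by (auto simp: in_hom_iff)

lemma le_arrowE:
  assumes "x \<preceq> m"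
  obtains u where "u \<in> Arr C" "Dom C u = Dom C x" "Cod C u = Dom C m" "m \<cdot> u = x"
  using assms unfolding subobject_le_def by (auto simp: in_hom_iff)

lemma le_arrow_refl: "m \<in> Arr C \<Longrightarrow> m \<preceq> m"
  by (rule le_arrowI[of _ "Id C (Dom C m)"]) auto

lemma le_arrow_trans:
  assumes "k \<preceq> l" "l \<preceq> m" "m \<in> Arr C"
  shows "k \<preceq> m"
proof -
  obtain u where u: "u \<in> Arr C" "Dom C u = Dom C k" "Cod C u = Dom C l" "l \<cdot> u = k"
    using assms(1) by (rule le_arrowE)
  obtain v where v: "v \<in> Arr C" "Dom C v = Dom C l" "Cod C v = Dom C m" "m \<cdot> v = l"
    using assms(2) by (rule le_arrowE)
  show ?thesis using u v assms(3) by (intro le_arrowI[of _ "v \<cdot> u"]) (simp_all add: Cmp_eq_left)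
qed

lemma le_arrow_Cmp:
  assumes "k \<preceq> m" "k \<in> Arr C" "m \<in> Arr C" "x \<in> Arr C" "Cod C x = Dom C k"
  shows "k \<cdot> x \<preceq> m"
  using assms by (intro le_arrow_trans[of "k \<cdot> x" k m] le_arrowI[of k x]) auto

section \<open>Monomorphisms and isomorphisms\<close>

definition monic :: "'m \<Rightarrow> bool" where
  "monic m \<longleftrightarrow> m \<in> Arr C \<and> (\<forall>f g. f \<in> Arr C \<and> g \<in> Arr C \<and> Cod C f = Dom C m \<and> Cod C g = Dom C m
     \<and> m \<cdot> f = m \<cdot> g \<longrightarrow> f = g)"

lemma monicD: "\<lbrakk>monic m; m \<cdot> f = m \<cdot> g; f \<in> Arr C; g \<in> Arr C; Cod C f = Dom C m; Cod C g = Dom C m\<rbrakk> \<Longrightarrow> f = g"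
  by (auto simp: monic_def)

lemma monic_Arr: "monic m \<Longrightarrow> m \<in> Arr C"
  by (simp add: monic_def)

lemma monic_Cmp:
  assumes "monic m" "monic n" "Cod C n = Dom C m"
  shows "monic (m \<cdot> n)"
  unfolding monic_def
proof (intro conjI allI impI)
  note [simp] = assms(1,2)[THEN monic_Arr] assms(3)
  show "m \<cdot> n \<in> Arr C" by simp
  fix f g assume a: "f \<in> Arr C \<and> g \<in> Arr C \<and> Cod C f = Dom C (m \<cdot> n) \<and> Cod C g = Dom C (m \<cdot> n)
     \<and> m \<cdot> n \<cdot> f = m \<cdot> n \<cdot> g"
  then have [simp]: "f \<in> Arr C" "g \<in> Arr C" "Cod C f = Dom C n" "Cod C g = Dom C n" by auto
  from a have "m \<cdot> (n \<cdot> f) = m \<cdot> (n \<cdot> g)" by simp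
  then have "n \<cdot> f = n \<cdot> g" by (rule monicD[OF assms(1)]) auto
  then show "f = g" by (rule monicD[OF assms(2)]) auto
qed

lemma is_iso_iff:
  "is_iso C f \<longleftrightarrow> f \<in> Arr C \<and> (\<exists>g \<in> Arr C. Dom C g = Cod C f \<and> Cod C g = Dom C f
     \<and> g \<cdot> f = Id C (Dom C f) \<and> f \<cdot> g = Id C (Cod C f))"
  unfolding is_iso_def by (auto simp: in_hom_iff)

lemma iso_monic:
  assumes "is_iso C f"
  shows "monic f"
proof -
  obtain g where g: "g \<in> Arr C" "Dom C g = Cod C f" "Cod C g = Dom C f" "g \<cdot> f = Id C (Dom C f)"
    and f: "f \<in> Arr C"
    using assms by (auto simp: is_iso_iff)
  show ?thesis unfolding monic_def
  proof (intro conjI allI impI)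
    fix a b assume *: "a \<in> Arr C \<and> b \<in> Arr C \<and> Cod C a = Dom C f \<and> Cod C b = Dom C f \<and> f \<cdot> a = f \<cdot> b"
    then have "g \<cdot> (f \<cdot> a) = g \<cdot> (f \<cdot> b)" by simp
    moreover have "a \<in> Arr C" "b \<in> Arr C" "Cod C a = Dom C f" "Cod C b = Dom C f" using * by simp_all
    then have "g \<cdot> (f \<cdot> a) = a" "g \<cdot> (f \<cdot> b) = b" using f g(1-3) by (simp_all add: Cmp_eq_left[OF g(4)])
    ultimately show "a = b" by metis
  qed (use f in simp)
qed

text \<open>The object \<open>T\<close> and the hom-sets of the definition are replaced by equations
  between domains and codomains, which simplification settles; \<open>is_coequalizer_iff\<close>
  does the same for coequalizers.\<close>

lemma is_pullback_iff:
  "is_pullback C f g p q \<longleftrightarrow>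
     f \<in> Arr C \<and> g \<in> Arr C \<and> p \<in> Arr C \<and> q \<in> Arr C \<and> Cod C g = Cod C f \<and> Dom C q = Dom C p
     \<and> Cod C p = Dom C f \<and> Cod C q = Dom C g \<and> f \<cdot> p = g \<cdot> q \<and>
     (\<forall>a b. a \<in> Arr C \<and> b \<in> Arr C \<and> Dom C b = Dom C a \<and> Cod C a = Dom C f \<and> Cod C b = Dom C g \<and> f \<cdot> a = g \<cdot> b \<longrightarrow>
        (\<exists>!u. u \<in> Arr C \<and> Dom C u = Dom C a \<and> Cod C u = Dom C p \<and> p \<cdot> u = a \<and> q \<cdot> u = b))"
  (is "?L \<longleftrightarrow> ?R")
proof
  assume L: ?L
  then have 1: "\<forall>T \<in> Obj C. \<forall>a \<in> hom C T (Dom C f). \<forall>b \<in> hom C T (Dom C g). f \<cdot> a = g \<cdot> b \<longrightarrow>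
        (\<exists>!u. u \<in> hom C T (Dom C p) \<and> p \<cdot> u = a \<and> q \<cdot> u = b)"
    unfolding is_pullback_def by blast
  have "\<exists>!u. u \<in> Arr C \<and> Dom C u = Dom C a \<and> Cod C u = Dom C p \<and> p \<cdot> u = a \<and> q \<cdot> u = b"
    if "a \<in> Arr C \<and> b \<in> Arr C \<and> Dom C b = Dom C a \<and> Cod C a = Dom C f \<and> Cod C b = Dom C g \<and> f \<cdot> a = g \<cdot> b" for a b
    using 1[rule_format, of "Dom C a" a b] that by (simp add: in_hom_iff conj_assoc)
  moreover have "f \<in> Arr C \<and> g \<in> Arr C \<and> p \<in> Arr C \<and> q \<in> Arr C \<and> Cod C g = Cod C f \<and> Dom C q = Dom C p
     \<and> Cod C p = Dom C f \<and> Cod C q = Dom C g \<and> f \<cdot> p = g \<cdot> q"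
    using L by (simp add: is_pullback_def in_hom_iff)
  ultimately show ?R by simp
next
  assume R: ?R
  show ?L unfolding is_pullback_def in_hom_iff
  proof (intro conjI ballI impI)
    fix T a b assume "a \<in> hom C T (Dom C f)" "b \<in> hom C T (Dom C g)" "f \<cdot> a = g \<cdot> b"
    then have h: "a \<in> Arr C \<and> b \<in> Arr C \<and> Dom C b = Dom C a \<and> Cod C a = Dom C f \<and> Cod C b = Dom C g \<and> f \<cdot> a = g \<cdot> b"
      and T: "Dom C a = T" by (simp_all add: in_hom_iff)
    have "\<exists>!u. u \<in> Arr C \<and> Dom C u = Dom C a \<and> Cod C u = Dom C p \<and> p \<cdot> u = a \<and> q \<cdot> u = b" using R h by blast
    then show "\<exists>!u. (u \<in> Arr C \<and> Dom C u = T \<and> Cod C u = Dom C p) \<and> p \<cdot> u = a \<and> q \<cdot> u = b"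
      by (simp add: T conj_assoc)
  qed (use R in \<open>simp_all add: in_hom_iff\<close>)
qed

lemma pullback_lift:
  assumes "is_pullback C f g p q" "f \<cdot> a = g \<cdot> b" "a \<in> Arr C" "b \<in> Arr C" "Dom C b = Dom C a"
    "Cod C a = Dom C f" "Cod C b = Dom C g"
  obtains u where "u \<in> Arr C" "Dom C u = Dom C a" "Cod C u = Dom C p" "p \<cdot> u = a" "q \<cdot> u = b"
proof -
  have "\<exists>!u. u \<in> Arr C \<and> Dom C u = Dom C a \<and> Cod C u = Dom C p \<and> p \<cdot> u = a \<and> q \<cdot> u = b"
    using assms unfolding is_pullback_iff by blast
  then show ?thesis using that by blast
qed

lemma pullback_eq:
  assumes pb: "is_pullback C f g p q" and eq: "p \<cdot> u = p \<cdot> v" "q \<cdot> u = q \<cdot> v"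
    and ar: "u \<in> Arr C" "v \<in> Arr C" "Cod C u = Dom C p" "Cod C v = Dom C p"
  shows "u = v"
proof -
  have [simp]: "f \<in> Arr C" "g \<in> Arr C" "p \<in> Arr C" "q \<in> Arr C" "Cod C g = Cod C f" "Dom C q = Dom C p"
    "Cod C p = Dom C f" "Cod C q = Dom C g" and fp: "f \<cdot> p = g \<cdot> q"
    using pb by (auto simp: is_pullback_iff)
  have "Dom C (p \<cdot> u) = Dom C (p \<cdot> v)" using eq(1) by simp
  then have d: "Dom C v = Dom C u" using ar by simp
  have "f \<cdot> (p \<cdot> u) = g \<cdot> (q \<cdot> u)" using ar by (simp add: Cmp_eq_left[OF fp])
  then have h: "p \<cdot> u \<in> Arr C \<and> q \<cdot> u \<in> Arr C \<and> Dom C (q \<cdot> u) = Dom C (p \<cdot> u) \<and> Cod C (p \<cdot> u) = Dom C f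
     \<and> Cod C (q \<cdot> u) = Dom C g \<and> f \<cdot> (p \<cdot> u) = g \<cdot> (q \<cdot> u)"
    using ar by simp
  have "\<exists>!w. w \<in> Arr C \<and> Dom C w = Dom C (p \<cdot> u) \<and> Cod C w = Dom C p \<and> p \<cdot> w = p \<cdot> u \<and> q \<cdot> w = q \<cdot> u"
    using pb h unfolding is_pullback_iff by blast
  then show ?thesis using ar eq d by (metis Dom_Cmp \<open>p \<in> Arr C\<close>)
qed

lemma pullbackD:
  assumes "is_pullback C f g p q"
  shows "f \<in> Arr C" "g \<in> Arr C" "p \<in> Arr C" "q \<in> Arr C" "Cod C g = Cod C f" "Dom C q = Dom C p"
    "Cod C p = Dom C f" "Cod C q = Dom C g" "f \<cdot> p = g \<cdot> q"
  using assms by (auto simp: is_pullback_iff)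

lemma pullback_comm:
  assumes "is_pullback C f g p q" "x \<in> Arr C" "Cod C x = Dom C p"
  shows "f \<cdot> (p \<cdot> x) = g \<cdot> (q \<cdot> x)"
  using assms pullbackD[OF assms(1)] by (metis assoc)

lemma pullback_monic:
  assumes "is_pullback C f g p q" "monic f"
  shows "monic q"
  unfolding monic_def
proof (intro conjI allI impI)
  note [simp] = pullbackD(1-8)[OF assms(1)]
  show "q \<in> Arr C" by simp
  fix a b assume a: "a \<in> Arr C \<and> b \<in> Arr C \<and> Cod C a = Dom C q \<and> Cod C b = Dom C q \<and> q \<cdot> a = q \<cdot> b"
  then have [simp]: "a \<in> Arr C" "b \<in> Arr C" "Cod C a = Dom C p" "Cod C b = Dom C p" and qab: "q \<cdot> a = q \<cdot> b"
    by simp_all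
  have "f \<cdot> (p \<cdot> a) = f \<cdot> (p \<cdot> b)"
    using pullback_comm[OF assms(1), of a] pullback_comm[OF assms(1), of b] qab by simp
  then have "p \<cdot> a = p \<cdot> b" by (rule monicD[OF assms(2)]) simp_all
  then show "a = b" by (rule pullback_eq[OF assms(1) _ qab]) simp_all
qed

text \<open>Pairing turns two arrows with a common domain into one arrow to a product, so that
  equality or a relation between them becomes membership in a subobject of the product and falls
  under the split extension principle.\<close>

definition is_product :: "'m \<Rightarrow> 'm \<Rightarrow> bool" where
  "is_product p q \<longleftrightarrow> p \<in> Arr C \<and> q \<in> Arr C \<and> Dom C q = Dom C p \<and>
     (\<forall>a b. a \<in> Arr C \<and> b \<in> Arr C \<and> Dom C b = Dom C a \<and> Cod C a = Cod C p \<and> Cod C b = Cod C q \<longrightarrow>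
        (\<exists>u. u \<in> Arr C \<and> Dom C u = Dom C a \<and> Cod C u = Dom C p \<and> p \<cdot> u = a \<and> q \<cdot> u = b)) \<and>
     (\<forall>u v. u \<in> Arr C \<and> v \<in> Arr C \<and> Cod C u = Dom C p \<and> Cod C v = Dom C p \<and> p \<cdot> u = p \<cdot> v \<and> q \<cdot> u = q \<cdot> v
        \<longrightarrow> u = v)"

lemma productD:
  assumes "is_product p q"
  shows "p \<in> Arr C" "q \<in> Arr C" "Dom C q = Dom C p"
  using assms by (simp_all add: is_product_def)

lemma product_pair:
  assumes "is_product p q" "a \<in> Arr C" "b \<in> Arr C" "Dom C b = Dom C a" "Cod C a = Cod C p" "Cod C b = Cod C q"
  obtains u where "u \<in> Arr C" "Dom C u = Dom C a" "Cod C u = Dom C p" "p \<cdot> u = a" "q \<cdot> u = b"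
  using assms unfolding is_product_def by blast

lemma product_eq:
  assumes "is_product p q" "p \<cdot> u = p \<cdot> v" "q \<cdot> u = q \<cdot> v" "u \<in> Arr C" "v \<in> Arr C"
    "Cod C u = Dom C p" "Cod C v = Dom C p"
  shows "u = v"
  using assms unfolding is_product_def by blast

lemma is_coequalizer_iff:
  "is_coequalizer C f g e \<longleftrightarrow>
     f \<in> Arr C \<and> g \<in> Arr C \<and> e \<in> Arr C \<and> Dom C g = Dom C f \<and> Cod C g = Cod C f \<and> Dom C e = Cod C f
     \<and> e \<cdot> f = e \<cdot> g \<and>
     (\<forall>h. h \<in> Arr C \<and> Dom C h = Cod C f \<and> h \<cdot> f = h \<cdot> g \<longrightarrow>
        (\<exists>!u. u \<in> Arr C \<and> Dom C u = Cod C e \<and> Cod C u = Cod C h \<and> u \<cdot> e = h))"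
  (is "?L \<longleftrightarrow> ?R")
proof
  assume L: ?L
  then have 1: "\<forall>T \<in> Obj C. \<forall>h \<in> hom C (Cod C f) T. h \<cdot> f = h \<cdot> g \<longrightarrow>
        (\<exists>!u. u \<in> hom C (Cod C e) T \<and> u \<cdot> e = h)"
    unfolding is_coequalizer_def by blast
  have "\<exists>!u. u \<in> Arr C \<and> Dom C u = Cod C e \<and> Cod C u = Cod C h \<and> u \<cdot> e = h"
    if "h \<in> Arr C \<and> Dom C h = Cod C f \<and> h \<cdot> f = h \<cdot> g" for h
    using 1[rule_format, of "Cod C h" h] that by (simp add: in_hom_iff conj_assoc)
  moreover have "f \<in> Arr C \<and> g \<in> Arr C \<and> e \<in> Arr C \<and> Dom C g = Dom C f \<and> Cod C g = Cod C f \<and> Dom C e = Cod C f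
     \<and> e \<cdot> f = e \<cdot> g"
    using L by (simp add: is_coequalizer_def in_hom_iff)
  ultimately show ?R by simp
next
  assume R: ?R
  show ?L unfolding is_coequalizer_def in_hom_iff
  proof (intro conjI ballI impI)
    fix T h assume "h \<in> hom C (Cod C f) T" "h \<cdot> f = h \<cdot> g"
    then have h: "h \<in> Arr C \<and> Dom C h = Cod C f \<and> h \<cdot> f = h \<cdot> g" and T: "Cod C h = T" by (simp_all add: in_hom_iff)
    have "\<exists>!u. u \<in> Arr C \<and> Dom C u = Cod C e \<and> Cod C u = Cod C h \<and> u \<cdot> e = h" using R h by blast
    then show "\<exists>!u. (u \<in> Arr C \<and> Dom C u = Cod C e \<and> Cod C u = T) \<and> u \<cdot> e = h"
      by (simp add: T conj_assoc)
  qed (use R in \<open>simp_all add: in_hom_iff\<close>)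
qed

lemma coequalizer_factor:
  assumes "is_coequalizer C f g e" "h \<cdot> f = h \<cdot> g" "h \<in> Arr C" "Dom C h = Cod C f"
  obtains u where "u \<in> Arr C" "Dom C u = Cod C e" "Cod C u = Cod C h" "u \<cdot> e = h"
  using assms unfolding is_coequalizer_iff by blast

section \<open>Regular epimorphisms: cancellation, extremality, descent\<close>

lemma regular_epi_Arr [simp]: "regular_epi C e \<Longrightarrow> e \<in> Arr C"
  by (auto simp: regular_epi_def is_coequalizer_iff)

lemma regular_epi_epi:
  assumes "regular_epi C e" "a \<cdot> e = b \<cdot> e" "a \<in> Arr C" "b \<in> Arr C" "Dom C a = Cod C e" "Dom C b = Cod C e"
  shows "a = b"
proof -
  obtain f g where fg: "is_coequalizer C f g e" using assms(1) by (auto simp: regular_epi_def)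
  then have [simp]: "f \<in> Arr C" "g \<in> Arr C" "e \<in> Arr C" "Dom C g = Dom C f" "Cod C g = Cod C f" "Dom C e = Cod C f"
     and efg: "e \<cdot> f = e \<cdot> g" by (auto simp: is_coequalizer_iff)
  have "Cod C (a \<cdot> e) = Cod C (b \<cdot> e)" using assms(2) by simp
  then have c: "Cod C b = Cod C a" using assms(3-6) by simp
  have "\<exists>!u. u \<in> Arr C \<and> Dom C u = Cod C e \<and> Cod C u = Cod C (a \<cdot> e) \<and> u \<cdot> e = a \<cdot> e"
  proof -
    have "(a \<cdot> e) \<cdot> f = (a \<cdot> e) \<cdot> g" using assms(3-6) efg by simp
    then have "a \<cdot> e \<in> Arr C \<and> Dom C (a \<cdot> e) = Cod C f \<and> a \<cdot> e \<cdot> f = a \<cdot> e \<cdot> g" using assms(3-6) by simp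
    then show ?thesis using fg unfolding is_coequalizer_iff by blast
  qed
  then show ?thesis using assms c by (metis Cod_Cmp \<open>e \<in> Arr C\<close>)
qed

lemma iso_regular_epi:
  assumes "is_iso C i" "regular_epi C e" "Dom C i = Cod C e"
  shows "regular_epi C (i \<cdot> e)"
proof -
  obtain f g where fg: "is_coequalizer C f g e" using assms(2) by (auto simp: regular_epi_def)
  then have [simp]: "f \<in> Arr C" "g \<in> Arr C" "e \<in> Arr C" "Dom C g = Dom C f" "Cod C g = Cod C f" "Dom C e = Cod C f"
     and efg: "e \<cdot> f = e \<cdot> g" by (auto simp: is_coequalizer_iff)
  obtain j where [simp]: "j \<in> Arr C" "Dom C j = Cod C i" "Cod C j = Cod C e" "i \<in> Arr C" "Dom C i = Cod C e"
    and j: "j \<cdot> i = Id C (Cod C e)" "i \<cdot> j = Id C (Cod C i)"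
    using assms by (auto simp: is_iso_iff)
  have "is_coequalizer C f g (i \<cdot> e)"
    unfolding is_coequalizer_iff
  proof (intro conjI allI impI)
    fix h assume h: "h \<in> Arr C \<and> Dom C h = Cod C f \<and> h \<cdot> f = h \<cdot> g"
    then obtain u where u[simp]: "u \<in> Arr C" "Dom C u = Cod C e" "Cod C u = Cod C h" "u \<cdot> e = h"
      using coequalizer_factor[OF fg, of h] by auto
    show "\<exists>!u. u \<in> Arr C \<and> Dom C u = Cod C (i \<cdot> e) \<and> Cod C u = Cod C h \<and> u \<cdot> (i \<cdot> e) = h"
    proof (rule ex1I[of _ "u \<cdot> j"])
      show "u \<cdot> j \<in> Arr C \<and> Dom C (u \<cdot> j) = Cod C (i \<cdot> e) \<and> Cod C (u \<cdot> j) = Cod C h \<and> u \<cdot> j \<cdot> (i \<cdot> e) = h"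
        using j by (simp add: Cmp_eq_left[of j i])
      fix v assume v: "v \<in> Arr C \<and> Dom C v = Cod C (i \<cdot> e) \<and> Cod C v = Cod C h \<and> v \<cdot> (i \<cdot> e) = h"
      then have [simp]: "v \<in> Arr C" "Dom C v = Cod C i" by simp_all
      have "(v \<cdot> i) \<cdot> e = u \<cdot> e" using v by simp
      then have "v \<cdot> i = u" by (rule regular_epi_epi[OF assms(2)]) simp_all
      then have "(v \<cdot> i) \<cdot> j = u \<cdot> j" by (simp only:)
      then show "v = u \<cdot> j" using j by simp
    qed
  qed (use efg in \<open>simp_all\<close>)
  then show ?thesis by (auto simp: regular_epi_def)
qed

text \<open>Regular epimorphisms are extremal: \<open>m\<close> being monic, \<open>g\<close>
  identifies whatever \<open>e\<close> does and so descends to an arrow \<open>u\<close> with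
  \<open>u \<cdot> e = g\<close>, which inverts \<open>m\<close>.\<close>

lemma regular_epi_factor_monic_iso:
  assumes e: "regular_epi C e" and m: "monic m" and eq: "m \<cdot> g = e"
    and [simp]: "g \<in> Arr C" "Cod C g = Dom C m"
  shows "is_iso C m"
proof -
  have [simp]: "m \<in> Arr C" "e \<in> Arr C" using m e by (auto simp: monic_Arr)
  have [simp]: "Dom C g = Dom C e" "Cod C m = Cod C e" using eq by auto
  obtain p q where pq: "is_coequalizer C p q e" using e by (auto simp: regular_epi_def)
  then have [simp]: "p \<in> Arr C" "q \<in> Arr C" "Dom C q = Dom C p" "Cod C q = Cod C p" "Dom C e = Cod C p"
     and epq: "e \<cdot> p = e \<cdot> q" by (auto simp: is_coequalizer_iff)
  have "m \<cdot> (g \<cdot> p) = m \<cdot> (g \<cdot> q)" using epq by (simp add: Cmp_eq_left[OF eq])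
  then have "g \<cdot> p = g \<cdot> q" by (rule monicD[OF m]) auto
  then obtain u where u[simp]: "u \<in> Arr C" "Dom C u = Cod C e" "Cod C u = Dom C m" and ue: "u \<cdot> e = g"
    using coequalizer_factor[OF pq, of g] by auto
  have "(m \<cdot> u) \<cdot> e = Id C (Cod C e) \<cdot> e" using ue eq by simp
  then have mu: "m \<cdot> u = Id C (Cod C e)" by (rule regular_epi_epi[OF e]) auto
  then have "m \<cdot> (u \<cdot> m) = m \<cdot> Id C (Dom C m)" by (simp add: Cmp_eq_left[OF mu])
  then have "u \<cdot> m = Id C (Dom C m)" by (rule monicD[OF m]) auto
  with mu show ?thesis by (auto simp: is_iso_iff intro!: bexI[of _ u])
qed

lemma regular_epi_Id: "A \<in> Obj C \<Longrightarrow> regular_epi C (Id C A)"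
  unfolding regular_epi_def is_coequalizer_iff
  by (rule exI[of _ "Id C A"], rule exI[of _ "Id C A"]) (auto intro!: ex1I)

text \<open>The factorization of \<open>x \<cdot> c\<close> through the monomorphism
  \<open>m\<close> identifies the two arrows of which \<open>c\<close> is the coequalizer, hence
  descends along \<open>c\<close>. So membership in a subobject may be checked on a cover.\<close>

lemma le_arrow_local:
  assumes m: "monic m" and c: "regular_epi C c" and le: "x \<cdot> c \<preceq> m"
    and [simp]: "x \<in> Arr C" "Cod C c = Dom C x" "Cod C x = Cod C m"
  shows "x \<preceq> m"
proof -
  have [simp]: "m \<in> Arr C" "c \<in> Arr C" using m c by (auto simp: monic_Arr)
  obtain u where [simp]: "u \<in> Arr C" "Dom C u = Dom C c" "Cod C u = Dom C m" and u: "m \<cdot> u = x \<cdot> c"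
    using le by (auto elim!: le_arrowE)
  obtain p q where pq: "is_coequalizer C p q c" using c by (auto simp: regular_epi_def)
  then have [simp]: "p \<in> Arr C" "q \<in> Arr C" "Dom C q = Dom C p" "Cod C q = Cod C p" "Dom C c = Cod C p"
     and epq: "c \<cdot> p = c \<cdot> q" by (auto simp: is_coequalizer_iff)
  have "m \<cdot> (u \<cdot> p) = m \<cdot> (u \<cdot> q)" using epq by (simp add: Cmp_eq_left[OF u])
  then have "u \<cdot> p = u \<cdot> q" by (rule monicD[OF m]) auto
  then obtain d where d[simp]: "d \<in> Arr C" "Dom C d = Cod C c" "Cod C d = Dom C m" and dc: "d \<cdot> c = u"
    using coequalizer_factor[OF pq, of u] by auto
  have "(m \<cdot> d) \<cdot> c = x \<cdot> c" using dc u by simp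
  then have "m \<cdot> d = x" by (rule regular_epi_epi[OF c]) auto
  then show ?thesis by (rule le_arrowI) auto
qed

end

section \<open>Covers, local lifting and image factorization\<close>

context regular_category
begin

text \<open>The cover \<open>c\<close> is the pullback of \<open>e\<close> along \<open>y\<close>, a
  regular epimorphism by stability. This is how an element of the codomain is lifted to an element
  of the domain.\<close>

lemma regular_epi_lift:
  assumes e: "regular_epi C e" and [simp]: "y \<in> Arr C" "Cod C y = Cod C e"
  obtains c x where "regular_epi C c" "Cod C c = Dom C y" "x \<in> Arr C" "Dom C x = Dom C c"
    "Cod C x = Dom C e" "e \<cdot> x = y \<cdot> c"
proof -
  obtain p q where pb: "is_pullback C e y p q"
    using has_pullbacks[of e y] e by auto
  note pullbackD[OF pb]
  moreover have "regular_epi C q" using regular_epi_stable[OF pb e] .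
  ultimately show ?thesis using that[of q p] by auto
qed

text \<open>Composites of regular epimorphisms are shown to be regular only after image
  factorizations exist; until then this cancellation stands in.\<close>

lemma regular_epi_Cmp_epi:
  assumes c: "regular_epi C c" "regular_epi C d" and eq: "a \<cdot> (c \<cdot> d) = b \<cdot> (c \<cdot> d)"
    and ar [simp]: "Cod C d = Dom C c" "a \<in> Arr C" "b \<in> Arr C" "Dom C a = Cod C c" "Dom C b = Cod C c"
  shows "a = b"
proof -
  note [simp] = c[THEN regular_epi_Arr]
  have "(a \<cdot> c) \<cdot> d = (b \<cdot> c) \<cdot> d" using eq by simp
  then have "a \<cdot> c = b \<cdot> c" by (rule regular_epi_epi[OF c(2)]) auto
  then show ?thesis by (rule regular_epi_epi[OF c(1)]) auto
qed

text \<open>\<open>e\<close> is the coequalizer of the kernel pair of \<open>f\<close>. That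
  \<open>m\<close> is monic is checked on elements: two elements with equal value lift locally along
  \<open>e\<close>, and the lifts form a point of the kernel pair, whose projections
  \<open>e\<close> identifies.\<close>

lemma image_factorization:
  assumes [simp]: "f \<in> Arr C"
  obtains e m where "regular_epi C e" "monic m" "Dom C e = Dom C f" "Dom C m = Cod C e"
    "Cod C m = Cod C f" "m \<cdot> e = f"
proof -
  obtain p q where pb: "is_pullback C f f p q" using has_pullbacks[of f f] by auto
  note [simp] = pullbackD(3-)[OF pb, simplified]
  obtain e where co: "is_coequalizer C p q e" using kernel_pair_coequalizer[OF pb] by auto
  then have e: "regular_epi C e" by (auto simp: regular_epi_def)
  have [simp]: "Dom C e = Dom C f" and epq: "e \<cdot> p = e \<cdot> q" "e \<in> Arr C" using co by (auto simp: is_coequalizer_iff)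
  obtain m where [simp]: "m \<in> Arr C" "Dom C m = Cod C e" "Cod C m = Cod C f" and me: "m \<cdot> e = f"
    using coequalizer_factor[OF co, of f] by auto
  have "monic m" unfolding monic_def
  proof (intro conjI allI impI)
    fix a b assume "a \<in> Arr C \<and> b \<in> Arr C \<and> Cod C a = Dom C m \<and> Cod C b = Dom C m \<and> m \<cdot> a = m \<cdot> b"
    then have [simp]: "a \<in> Arr C" "b \<in> Arr C" "Cod C a = Cod C e" "Cod C b = Cod C e" and ab: "m \<cdot> a = m \<cdot> b" by auto
    have "Dom C (m \<cdot> a) = Dom C (m \<cdot> b)" using ab by simp
    then have [simp]: "Dom C b = Dom C a" by simp
    obtain c x where c: "regular_epi C c" and [simp]: "Cod C c = Dom C a" "x \<in> Arr C" "Dom C x = Dom C c"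
      "Cod C x = Dom C f" and x: "e \<cdot> x = a \<cdot> c"
      using regular_epi_lift[OF e, of a] by auto
    note [simp] = c[THEN regular_epi_Arr]
    obtain d y where d: "regular_epi C d" and [simp]: "Cod C d = Dom C c" "y \<in> Arr C" "Dom C y = Dom C d"
      "Cod C y = Dom C f" and y: "e \<cdot> y = b \<cdot> (c \<cdot> d)"
      using regular_epi_lift[OF e, of "b \<cdot> c"] by auto
    note [simp] = d[THEN regular_epi_Arr]
    have "f \<cdot> (x \<cdot> d) = m \<cdot> (e \<cdot> (x \<cdot> d))" using me epq(2) by (simp add: Cmp_eq_left[OF me])
    also have "\<dots> = m \<cdot> (a \<cdot> (c \<cdot> d))" using x epq(2) by (simp add: Cmp_eq_left[OF x])
    also have "\<dots> = m \<cdot> (b \<cdot> (c \<cdot> d))" by (simp add: Cmp_eq_left[OF ab])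
    also have "\<dots> = m \<cdot> (e \<cdot> y)" by (simp add: y)
    also have "\<dots> = f \<cdot> y" using epq(2) by (simp add: Cmp_eq_left[OF me])
    finally obtain u where [simp]: "u \<in> Arr C" "Dom C u = Dom C d" "Cod C u = Dom C p" and u: "p \<cdot> u = x \<cdot> d" "q \<cdot> u = y"
      by (auto elim!: pullback_lift[OF pb])
    have "a \<cdot> (c \<cdot> d) = e \<cdot> (x \<cdot> d)" using x epq(2) by (simp add: Cmp_eq_left[OF x])
    also have "\<dots> = e \<cdot> (p \<cdot> u)" by (simp add: u)
    also have "\<dots> = e \<cdot> (q \<cdot> u)" using epq by (simp add: Cmp_eq_left[OF epq(1)])
    also have "\<dots> = b \<cdot> (c \<cdot> d)" using u y by simp
    finally show "a = b" by (rule regular_epi_Cmp_epi[OF c d]) auto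
  qed simp
  then show ?thesis using that[of e m] e me by auto
qed

text \<open>If \<open>g = m \<cdot> e\<close> is the image factorization, the regular epimorphism
  \<open>g \<cdot> f\<close> factors through the monomorphism \<open>m\<close>, which is therefore
  invertible.\<close>

lemma regular_epi_cancel:
  assumes gf: "regular_epi C (g \<cdot> f)" and [simp]: "g \<in> Arr C" "f \<in> Arr C" "Cod C f = Dom C g"
  shows "regular_epi C g"
proof -
  obtain e m where e: "regular_epi C e" and m: "monic m" and [simp]: "Dom C e = Dom C g" "Dom C m = Cod C e"
    "Cod C m = Cod C g" and me: "m \<cdot> e = g"
    using image_factorization[of g] by auto
  note [simp] = e[THEN regular_epi_Arr] m[THEN monic_Arr]
  have "m \<cdot> (e \<cdot> f) = g \<cdot> f" by (simp add: Cmp_eq_left[OF me])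
  then have "is_iso C m" using regular_epi_factor_monic_iso[OF gf m] by simp
  from iso_regular_epi[OF this e] me show ?thesis by simp
qed

text \<open>Factor the composite as \<open>m \<cdot> e\<close>. What \<open>f\<close> identifies is
  identified by \<open>e\<close>, as \<open>m\<close> is monic, so \<open>e\<close> factors through
  \<open>f\<close>; then \<open>g\<close> factors through \<open>m\<close>, and extremality of
  \<open>g\<close> makes \<open>m\<close> invertible.\<close>

lemma regular_epi_Cmp:
  assumes f: "regular_epi C f" and g: "regular_epi C g" and [simp]: "Cod C f = Dom C g"
  shows "regular_epi C (g \<cdot> f)"
proof -
  note [simp] = f[THEN regular_epi_Arr] g[THEN regular_epi_Arr]
  obtain e m where e: "regular_epi C e" and m: "monic m" and [simp]: "Dom C e = Dom C f" "Dom C m = Cod C e"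
    "Cod C m = Cod C g" and me: "m \<cdot> e = g \<cdot> f"
    using image_factorization[of "g \<cdot> f"] by auto
  note [simp] = e[THEN regular_epi_Arr] m[THEN monic_Arr]
  obtain p q where pq: "is_coequalizer C p q f" using f by (auto simp: regular_epi_def)
  then have [simp]: "p \<in> Arr C" "q \<in> Arr C" "Dom C q = Dom C p" "Cod C q = Cod C p" "Dom C f = Cod C p"
     and fpq: "f \<cdot> p = f \<cdot> q" by (auto simp: is_coequalizer_iff)
  have "m \<cdot> (e \<cdot> p) = m \<cdot> (e \<cdot> q)" by (simp add: Cmp_eq_left[OF me] fpq)
  then have "e \<cdot> p = e \<cdot> q" by (rule monicD[OF m]) auto
  then obtain d where d[simp]: "d \<in> Arr C" "Dom C d = Cod C f" "Cod C d = Dom C m" and df: "d \<cdot> f = e"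
    using coequalizer_factor[OF pq, of e] by auto
  have "(m \<cdot> d) \<cdot> f = g \<cdot> f" using df me by simp
  then have md: "m \<cdot> d = g" by (rule regular_epi_epi[OF f]) auto
  then have "is_iso C m" using regular_epi_factor_monic_iso[OF g m md] by simp
  from iso_regular_epi[OF this e] me show ?thesis by simp
qed

text \<open>Converse to \<open>regular_epi_lift\<close>: a single local lift, that of the identity
  of the codomain, suffices.\<close>

lemma local_lift_regular_epi:
  assumes "regular_epi C c" "f \<cdot> x = c" "f \<in> Arr C" "x \<in> Arr C" "Cod C x = Dom C f"
  shows "regular_epi C f"
  using assms regular_epi_cancel[of f x] by simp

lemma has_products:
  assumes "A \<in> Obj C" "B \<in> Obj C"
  obtains p q where "is_product p q" "Cod C p = A" "Cod C q = B"
proof -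
  obtain Z where Z: "terminal_object C Z" using has_terminal by auto
  obtain a b where [simp]: "a \<in> Arr C" "Dom C a = A" "Cod C a = Z" "b \<in> Arr C" "Dom C b = B" "Cod C b = Z"
    using Z assms unfolding terminal_object_def in_hom_iff by metis
  have un: "f = g" if "f \<in> Arr C" "g \<in> Arr C" "Dom C f = Dom C g" "Cod C f = Z" "Cod C g = Z" for f g
    using Z that unfolding terminal_object_def in_hom_iff by (metis Dom_Obj)
  obtain p q where pb: "is_pullback C a b p q" using has_pullbacks[of a b] by auto
  have [simp]: "p \<in> Arr C" "q \<in> Arr C" "Dom C q = Dom C p" "Cod C p = A" "Cod C q = B"
    using pullbackD[OF pb] by simp_all
  have "is_product p q" unfolding is_product_def
  proof (intro conjI allI impI)
    fix x y assume *: "x \<in> Arr C \<and> y \<in> Arr C \<and> Dom C y = Dom C x \<and> Cod C x = Cod C p \<and> Cod C y = Cod C q"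
    have "a \<cdot> x = b \<cdot> y" by (rule un) (use * in simp_all)
    then obtain u where "u \<in> Arr C" "Dom C u = Dom C x" "Cod C u = Dom C p" "p \<cdot> u = x" "q \<cdot> u = y"
      by (rule pullback_lift[OF pb]) (use * in simp_all)
    then show "\<exists>u. u \<in> Arr C \<and> Dom C u = Dom C x \<and> Cod C u = Dom C p \<and> p \<cdot> u = x \<and> q \<cdot> u = y" by blast
  next
    fix u v assume "u \<in> Arr C \<and> v \<in> Arr C \<and> Cod C u = Dom C p \<and> Cod C v = Dom C p \<and> p \<cdot> u = p \<cdot> v \<and> q \<cdot> u = q \<cdot> v"
    then show "u = v" by (intro pullback_eq[OF pb, of u v]) blast+
  qed simp_all
  then show ?thesis by (rule that) simp_all
qed

end
section \<open>Zero arrows and kernels\<close>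

text \<open>Kept apart from the semi-abelian axioms because the facts on zero arrows and kernels are
  also applied to the opposite category.\<close>

locale pointed_category = category +
  assumes has_zero_object: "\<exists>Z. zero_object C Z"
begin

lemma zero_arrow_Arr [simp]: "zero_arrow C f \<Longrightarrow> f \<in> Arr C"
  by (simp add: zero_arrow_def)

lemma zero_arrowE:
  assumes "zero_arrow C f"
  obtains Z a b where "zero_object C Z" "a \<in> Arr C" "b \<in> Arr C" "Dom C a = Dom C f" "Cod C a = Z"
    "Dom C b = Z" "Cod C b = Cod C f" "f = b \<cdot> a"
  using assms unfolding zero_arrow_def in_hom_iff by blast

lemma zero_arrowI:
  assumes "zero_object C Z" "a \<in> Arr C" "b \<in> Arr C" "Cod C a = Z" "Dom C b = Z"
  shows "zero_arrow C (b \<cdot> a)"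
  using assms unfolding zero_arrow_def in_hom_iff
  by (intro conjI exI[of _ Z] exI[of _ a] exI[of _ b]) simp_all

lemma zero_arrow_Cmp_left [simp]:
  assumes "zero_arrow C f" and [simp]: "g \<in> Arr C" "Cod C f = Dom C g"
  shows "zero_arrow C (g \<cdot> f)"
proof -
  obtain Z a b where Z: "zero_object C Z" and [simp]: "a \<in> Arr C" "b \<in> Arr C" "Dom C a = Dom C f" "Cod C a = Z"
    "Dom C b = Z" "Cod C b = Cod C f" and f: "f = b \<cdot> a"
    using assms(1) by (rule zero_arrowE)
  have "zero_arrow C ((g \<cdot> b) \<cdot> a)" by (rule zero_arrowI[OF Z]) simp_all
  then show ?thesis unfolding f by simp
qed

lemma zero_arrow_Cmp_right [simp]:
  assumes "zero_arrow C g" and [simp]: "f \<in> Arr C" "Cod C f = Dom C g"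
  shows "zero_arrow C (g \<cdot> f)"
proof -
  obtain Z a b where Z: "zero_object C Z" and [simp]: "a \<in> Arr C" "b \<in> Arr C" "Dom C a = Dom C g" "Cod C a = Z"
    "Dom C b = Z" "Cod C b = Cod C g" and g: "g = b \<cdot> a"
    using assms(1) by (rule zero_arrowE)
  have "zero_arrow C (b \<cdot> (a \<cdot> f))" by (rule zero_arrowI[OF Z]) simp_all
  then show ?thesis unfolding g by simp
qed

text \<open>The two arrows may run through different zero objects; the arrow \<open>i\<close>
  between these reconciles them, the triangles commuting because the objects are terminal and
  initial.\<close>

lemma zero_arrow_unique:
  assumes f: "zero_arrow C f" and g: "zero_arrow C g" and d: "Dom C f = Dom C g" "Cod C f = Cod C g"
  shows "f = g"
proof -
  obtain Z a b where Z: "zero_object C Z" and [simp]: "a \<in> Arr C" "b \<in> Arr C" "Dom C a = Dom C f" "Cod C a = Z"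
    "Dom C b = Z" "Cod C b = Cod C f" and f': "f = b \<cdot> a"
    using f by (rule zero_arrowE)
  obtain Z' a' b' where Z': "zero_object C Z'" and [simp]: "a' \<in> Arr C" "b' \<in> Arr C" "Dom C a' = Dom C g"
    "Cod C a' = Z'" "Dom C b' = Z'" "Cod C b' = Cod C g" and g': "g = b' \<cdot> a'"
    using g by (rule zero_arrowE)
  obtain i where [simp]: "i \<in> Arr C" "Dom C i = Z" "Cod C i = Z'"
    using Z Z' unfolding zero_object_def terminal_object_def in_hom_iff by (metis)
  have "i \<cdot> a \<in> hom C (Dom C f) Z'" "a' \<in> hom C (Dom C f) Z'" by (simp_all add: in_hom_iff d)
  then have 1: "i \<cdot> a = a'"
    using Z' Dom_Obj[of f] f unfolding zero_object_def terminal_object_def by (metis zero_arrow_Arr)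
  have "b' \<cdot> i \<in> hom C Z (Cod C f)" "b \<in> hom C Z (Cod C f)" by (simp_all add: in_hom_iff d)
  then have 2: "b' \<cdot> i = b"
    using Z Cod_Obj[of f] f unfolding zero_object_def initial_object_def by (metis zero_arrow_Arr)
  show ?thesis unfolding f' g' 1[symmetric] 2[symmetric] by simp
qed

lemma zero_arrow_exists:
  assumes "A \<in> Obj C" "B \<in> Obj C"
  obtains z where "zero_arrow C z" "Dom C z = A" "Cod C z = B"
proof -
  obtain Z where Z: "zero_object C Z" using has_zero_object by auto
  then obtain a b where [simp]: "a \<in> Arr C" "Dom C a = A" "Cod C a = Z" "b \<in> Arr C" "Dom C b = Z" "Cod C b = B"
    using assms unfolding zero_object_def terminal_object_def initial_object_def in_hom_iff by metis
  show ?thesis using that[of "b \<cdot> a"] zero_arrowI[OF Z, of a b] by simp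
qed

lemma monic_zero_arrow:
  assumes m: "monic m" and z: "zero_arrow C (m \<cdot> f)" and [simp]: "f \<in> Arr C" "Cod C f = Dom C m"
  shows "zero_arrow C f"
proof -
  note [simp] = monic_Arr[OF m]
  obtain y where y: "zero_arrow C y" and [simp]: "Dom C y = Dom C f" "Cod C y = Dom C m"
    by (rule zero_arrow_exists[of "Dom C f" "Dom C m"]) simp_all
  have "m \<cdot> f = m \<cdot> y" using y by (intro zero_arrow_unique z zero_arrow_Cmp_left) simp_all
  then have "f = y" by (rule monicD[OF m]) (simp_all add: y)
  with y show ?thesis by simp
qed

lemma regular_epi_zero_arrow:
  assumes e: "regular_epi C e" and z: "zero_arrow C (f \<cdot> e)" and [simp]: "f \<in> Arr C" "Cod C e = Dom C f"
  shows "zero_arrow C f"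
proof -
  note [simp] = regular_epi_Arr[OF e]
  obtain y where y: "zero_arrow C y" and [simp]: "Dom C y = Dom C f" "Cod C y = Cod C f"
    by (rule zero_arrow_exists[of "Dom C f" "Cod C f"]) simp_all
  have "f \<cdot> e = y \<cdot> e" using y by (intro zero_arrow_unique z zero_arrow_Cmp_right) simp_all
  then have "f = y" by (rule regular_epi_epi[OF e]) (simp_all add: y)
  with y show ?thesis by simp
qed

lemma zero_arrow_le:
  assumes z: "zero_arrow C x" and [simp]: "m \<in> Arr C" "Cod C x = Cod C m"
  shows "x \<preceq> m"
proof -
  obtain y where y: "zero_arrow C y" and [simp]: "Dom C y = Dom C x" "Cod C y = Dom C m"
    by (rule zero_arrow_exists[of "Dom C x" "Dom C m"]) (simp_all add: z)
  have "m \<cdot> y = x" using y by (intro zero_arrow_unique z zero_arrow_Cmp_left) simp_all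
  then show ?thesis by (rule le_arrowI) (simp_all add: y)
qed

text \<open>Existence and uniqueness in the universal property come apart: uniqueness is monicity of
  \<open>k\<close>, existence is membership in \<open>k\<close> of every arrow that \<open>f\<close>
  kills. Kernels are handled in this form throughout.\<close>

lemma kernelI:
  assumes "monic k" "f \<in> Arr C" "Cod C k = Dom C f" "zero_arrow C (f \<cdot> k)"
    "\<And>x. \<lbrakk>x \<in> Arr C; Cod C x = Dom C f; zero_arrow C (f \<cdot> x)\<rbrakk> \<Longrightarrow> x \<preceq> k"
  shows "is_kernel C k f"
  unfolding is_kernel_def
proof (intro conjI ballI impI)
  note [simp] = monic_Arr[OF assms(1)]
  fix T h assume "h \<in> hom C T (Dom C f)" "zero_arrow C (f \<cdot> h)"
  then have h: "h \<in> Arr C" "Cod C h = Dom C f" "Dom C h = T" "h \<preceq> k" using assms(5)[of h] by (simp_all add: in_hom_iff)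
  obtain u where u: "u \<in> Arr C" "Dom C u = Dom C h" "Cod C u = Dom C k" "k \<cdot> u = h"
    using h(4) by (rule le_arrowE)
  show "\<exists>!u. u \<in> hom C T (Dom C k) \<and> k \<cdot> u = h"
  proof (rule ex1I[of _ u])
    fix v assume "v \<in> hom C T (Dom C k) \<and> k \<cdot> v = h"
    then have v: "v \<in> Arr C" "Cod C v = Dom C k" "k \<cdot> v = k \<cdot> u" using u by (simp_all add: in_hom_iff)
    show "v = u" by (rule monicD[OF assms(1) v(3)]) (simp_all add: v(1,2) u)
  qed (use u h in \<open>simp add: in_hom_iff\<close>)
qed (use assms in \<open>simp_all add: monic_Arr\<close>)

lemma kernelD:
  assumes "is_kernel C k f"
  shows "k \<in> Arr C" "f \<in> Arr C" "Cod C k = Dom C f" "zero_arrow C (f \<cdot> k)" "monic k"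
    "\<And>x. \<lbrakk>x \<in> Arr C; Cod C x = Dom C f; zero_arrow C (f \<cdot> x)\<rbrakk> \<Longrightarrow> x \<preceq> k"
proof -
  show [simp]: "k \<in> Arr C" "f \<in> Arr C" "Cod C k = Dom C f" and z: "zero_arrow C (f \<cdot> k)"
    using assms by (simp_all add: is_kernel_def)
  have un: "\<exists>!u. u \<in> hom C (Dom C h) (Dom C k) \<and> k \<cdot> u = h" if "h \<in> Arr C" "Cod C h = Dom C f" "zero_arrow C (f \<cdot> h)" for h
    using assms that unfolding is_kernel_def by (metis Dom_Obj in_hom_iff)
  show "monic k" unfolding monic_def
  proof (intro conjI allI impI)
    fix a b assume *: "a \<in> Arr C \<and> b \<in> Arr C \<and> Cod C a = Dom C k \<and> Cod C b = Dom C k \<and> k \<cdot> a = k \<cdot> b"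
    then have ab[simp]: "a \<in> Arr C" "b \<in> Arr C" "Cod C a = Dom C k" "Cod C b = Dom C k" and eq: "k \<cdot> a = k \<cdot> b" by simp_all
    have d: "Dom C b = Dom C a" using arg_cong[OF eq, of "Dom C"] by simp
    have "zero_arrow C ((f \<cdot> k) \<cdot> a)" by (rule zero_arrow_Cmp_right[OF z]) simp_all
    then have "\<exists>!u. u \<in> hom C (Dom C (k \<cdot> a)) (Dom C k) \<and> k \<cdot> u = k \<cdot> a" by (intro un) simp_all
    then show "a = b" using d eq ab by (metis Dom_Cmp \<open>k \<in> Arr C\<close> in_hom_iff)
  qed simp
  show "x \<preceq> k" if "x \<in> Arr C" "Cod C x = Dom C f" "zero_arrow C (f \<cdot> x)" for x
    using un[OF that] unfolding subobject_le_def by blast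
qed

lemma kernel_le_iff:
  assumes k: "is_kernel C k f" and [simp]: "x \<in> Arr C" "Cod C x = Dom C f"
  shows "x \<preceq> k \<longleftrightarrow> zero_arrow C (f \<cdot> x)"
proof
  note [simp] = kernelD(1,2,3)[OF k]
  assume "x \<preceq> k"
  then obtain u where u: "u \<in> Arr C" "Dom C u = Dom C x" "Cod C u = Dom C k" "k \<cdot> u = x" by (rule le_arrowE)
  have "zero_arrow C ((f \<cdot> k) \<cdot> u)" by (rule zero_arrow_Cmp_right[OF kernelD(4)[OF k]]) (simp_all add: u)
  then show "zero_arrow C (f \<cdot> x)" using u by simp
qed (rule kernelD(6)[OF k]; simp)

lemma normal_monoE:
  assumes "normal_mono C k"
  obtains h where "is_kernel C k h"
  using assms unfolding normal_mono_def by auto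

lemma normal_mono_monic: "normal_mono C k \<Longrightarrow> monic k"
  by (auto elim!: normal_monoE dest: kernelD)

lemma cokernelI:
  assumes [simp]: "q \<in> Arr C" "f \<in> Arr C" "Dom C q = Cod C f" and "zero_arrow C (q \<cdot> f)"
    "\<And>h. \<lbrakk>h \<in> Arr C; Dom C h = Cod C f; zero_arrow C (h \<cdot> f)\<rbrakk>
       \<Longrightarrow> \<exists>u. u \<in> Arr C \<and> Dom C u = Cod C q \<and> Cod C u = Cod C h \<and> u \<cdot> q = h"
    and epi: "\<And>u v. \<lbrakk>u \<in> Arr C; v \<in> Arr C; Dom C u = Cod C q; Dom C v = Cod C q; u \<cdot> q = v \<cdot> q\<rbrakk> \<Longrightarrow> u = v"
  shows "is_cokernel C q f"
  unfolding is_cokernel_def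
proof (intro conjI ballI impI)
  fix T h assume *: "h \<in> hom C (Cod C f) T" "zero_arrow C (h \<cdot> f)"
  then obtain u where u: "u \<in> Arr C" "Dom C u = Cod C q" "Cod C u = Cod C h" "u \<cdot> q = h"
    using assms(5)[of h] unfolding in_hom_iff by blast
  show "\<exists>!u. u \<in> hom C (Cod C q) T \<and> u \<cdot> q = h"
  proof (rule ex1I[of _ u])
    fix v assume "v \<in> hom C (Cod C q) T \<and> v \<cdot> q = h"
    then have "v \<in> Arr C" "Dom C v = Cod C q" "v \<cdot> q = u \<cdot> q" using u by (simp_all add: in_hom_iff)
    then show "v = u" using u by (rule_tac epi) simp_all
  qed (use u * in \<open>simp add: in_hom_iff\<close>)
qed (use assms in simp_all)

lemma cokernelD:
  assumes "is_cokernel C q f"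
  shows "q \<in> Arr C" "f \<in> Arr C" "Dom C q = Cod C f" "zero_arrow C (q \<cdot> f)"
  using assms by (simp_all add: is_cokernel_def)

lemma cokernel_factor:
  assumes "is_cokernel C q f" "h \<in> Arr C" "Dom C h = Cod C f" "zero_arrow C (h \<cdot> f)"
  obtains u where "u \<in> Arr C" "Dom C u = Cod C q" "Cod C u = Cod C h" "u \<cdot> q = h"
proof -
  have "\<exists>!u. u \<in> hom C (Cod C q) (Cod C h) \<and> u \<cdot> q = h"
    using assms unfolding is_cokernel_def by (metis Cod_Obj in_hom_iff)
  then show ?thesis using that by (auto simp: in_hom_iff)
qed

text \<open>A cokernel of \<open>f\<close> is a coequalizer of \<open>f\<close> and the zero arrow
  parallel to it.\<close>

lemma cokernel_regular_epi:
  assumes q: "is_cokernel C q f"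
  shows "regular_epi C q"
proof -
  note [simp] = cokernelD(1,2,3)[OF q]
  obtain z where z: "zero_arrow C z" and [simp]: "Dom C z = Dom C f" "Cod C z = Cod C f"
    by (rule zero_arrow_exists[of "Dom C f" "Cod C f"]) simp_all
  note [simp] = zero_arrow_Arr[OF z]
  have "is_coequalizer C f z q" unfolding is_coequalizer_iff
  proof (intro conjI allI impI)
    show "q \<cdot> f = q \<cdot> z" by (intro zero_arrow_unique cokernelD(4)[OF q] zero_arrow_Cmp_left z) simp_all
    fix h assume h: "h \<in> Arr C \<and> Dom C h = Cod C f \<and> h \<cdot> f = h \<cdot> z"
    then have "zero_arrow C (h \<cdot> z)" by (intro zero_arrow_Cmp_left z) simp_all
    then have "\<exists>!u. u \<in> hom C (Cod C q) (Cod C h) \<and> u \<cdot> q = h"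
      using h q unfolding is_cokernel_def by (metis Cod_Obj in_hom_iff)
    then show "\<exists>!u. u \<in> Arr C \<and> Dom C u = Cod C q \<and> Cod C u = Cod C h \<and> u \<cdot> q = h"
      by (simp add: in_hom_iff conj_assoc)
  qed simp_all
  then show ?thesis by (auto simp: regular_epi_def)
qed

end

section \<open>Protomodularity\<close>

sublocale semi_abelian_category \<subseteq> pointed_category
  by unfold_locales (rule pointed)

context semi_abelian_category
begin

text \<open>The kernel is the pullback along \<open>f\<close> of the arrow \<open>v\<close> from a
  zero object; \<open>v\<close> is monic since arrows into a zero object agree as soon as their
  domains do.\<close>

lemma kernel_exists:
  assumes [simp]: "f \<in> Arr C"
  obtains k where "is_kernel C k f"
proof -
  obtain Z where Z: "zero_object C Z" using pointed by auto
  obtain v where [simp]: "v \<in> Arr C" "Dom C v = Z" "Cod C v = Cod C f"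
    using Z unfolding zero_object_def initial_object_def in_hom_iff by (metis Cod_Obj assms)
  have vz: "zero_arrow C (v \<cdot> x)" if "x \<in> Arr C" "Cod C x = Z" for x
    using Z that by (intro zero_arrowI[of Z]) simp_all
  have unZ: "x = y" if "x \<in> Arr C" "y \<in> Arr C" "Dom C x = Dom C y" "Cod C x = Z" "Cod C y = Z" for x y
    using Z that unfolding zero_object_def terminal_object_def in_hom_iff by (metis Dom_Obj)
  have exZ: "\<exists>y. y \<in> Arr C \<and> Dom C y = A \<and> Cod C y = Z" if "A \<in> Obj C" for A
    using Z that unfolding zero_object_def terminal_object_def in_hom_iff by metis
  obtain p k where pb: "is_pullback C v f p k" using has_pullbacks[of v f] by auto
  note [simp] = pullbackD(3,4,6-8)[OF pb]
  have mv: "monic v" unfolding monic_def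
  proof (intro conjI allI impI)
    fix a b assume "a \<in> Arr C \<and> b \<in> Arr C \<and> Cod C a = Dom C v \<and> Cod C b = Dom C v \<and> v \<cdot> a = v \<cdot> b"
    then have [simp]: "a \<in> Arr C" "b \<in> Arr C" "Cod C a = Z" "Cod C b = Z" and eq: "v \<cdot> a = v \<cdot> b" by simp_all
    have "Dom C a = Dom C b" using arg_cong[OF eq, of "Dom C"] by simp
    then show "a = b" by (rule_tac unZ) simp_all
  qed simp
  have "is_kernel C k f"
  proof (rule kernelI)
    show "monic k" by (rule pullback_monic[OF pb mv])
    show "zero_arrow C (f \<cdot> k)" using vz[of p] pullbackD(9)[OF pb] by simp
    fix x assume [simp]: "x \<in> Arr C" "Cod C x = Dom C f" and z: "zero_arrow C (f \<cdot> x)"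
    obtain y where [simp]: "y \<in> Arr C" "Dom C y = Dom C x" "Cod C y = Z" using exZ[of "Dom C x"] by auto
    have "v \<cdot> y = f \<cdot> x" by (rule zero_arrow_unique[OF vz z]) simp_all
    then obtain u where "u \<in> Arr C" "Dom C u = Dom C y" "Cod C u = Dom C p" "p \<cdot> u = y" "k \<cdot> u = x"
      by (rule pullback_lift[OF pb]) simp_all
    then show "x \<preceq> k" by (intro le_arrowI[of k u]) simp_all
  qed simp_all
  then show ?thesis using that by blast
qed

text \<open>Protomodularity, applied to base change along the arrow \<open>v\<close> from a zero
  object to \<open>Cod C p\<close>. The factorization \<open>t\<close> of the section makes
  \<open>m\<close> a morphism of points from \<open>(p \<cdot> m, t)\<close> to
  \<open>(p, s)\<close>, and the fibre over zero of a point is its kernel; so \<open>m\<close> is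
  invertible once it is so on kernels.\<close>

lemma split_extension_iso:
  assumes pt: "p \<in> Arr C" "s \<in> Arr C" "Dom C s = Cod C p" "Cod C s = Dom C p" "p \<cdot> s = Id C (Cod C p)"
    and m: "monic m" "Cod C m = Dom C p" and sm: "s \<preceq> m"
    and ker: "\<And>x. \<lbrakk>x \<in> Arr C; Cod C x = Dom C p; zero_arrow C (p \<cdot> x)\<rbrakk> \<Longrightarrow> x \<preceq> m"
  shows "is_iso C m"
proof -
  note [simp] = pt(1-4) monic_Arr[OF m(1)] m(2)
  obtain t where [simp]: "t \<in> Arr C" "Dom C t = Dom C s" "Cod C t = Dom C m" and mt: "m \<cdot> t = s"
    using sm by (rule le_arrowE)
  obtain Z where Z: "zero_object C Z" using pointed by auto
  obtain v where [simp]: "v \<in> Arr C" "Dom C v = Z" "Cod C v = Cod C p"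
    using Z unfolding zero_object_def initial_object_def in_hom_iff by (metis Cod_Obj pt(1))
  have vz: "zero_arrow C (v \<cdot> x)" if "x \<in> Arr C" "Cod C x = Z" for x
    using Z that by (intro zero_arrowI[of Z]) simp_all
  obtain x a where xa: "is_pullback C v (p \<cdot> m) x a" using has_pullbacks[of v "p \<cdot> m"] by auto
  obtain x' a' where xa': "is_pullback C v p x' a'" using has_pullbacks[of v p] by auto
  have [simp]: "x \<in> Arr C" "a \<in> Arr C" "Dom C a = Dom C x" "Cod C x = Z" "Cod C a = Dom C m"
    using pullbackD[OF xa] by simp_all
  have [simp]: "x' \<in> Arr C" "a' \<in> Arr C" "Dom C a' = Dom C x'" "Cod C x' = Z" "Cod C a' = Dom C p"
    using pullbackD[OF xa'] by simp_all
  have c: "v \<cdot> x = p \<cdot> (m \<cdot> a)" using pullbackD(9)[OF xa] by simp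
  have c': "v \<cdot> x' = p \<cdot> a'" using pullbackD(9)[OF xa'] by simp
  obtain g where [simp]: "g \<in> Arr C" "Dom C g = Dom C x" "Cod C g = Dom C x'" and g: "x' \<cdot> g = x" "a' \<cdot> g = m \<cdot> a"
    by (rule pullback_lift[OF xa' c]) simp_all
  \<comment> \<open>\<open>a'\<close> is the kernel of \<open>p\<close>, so by hypothesis it factors
    through \<open>m\<close>; the factorization provides the inverse \<open>h\<close> of the
    comparison \<open>g\<close> of the kernels.\<close>
  have "zero_arrow C (p \<cdot> a')" using vz[of x'] c' by simp
  then have "a' \<preceq> m" by (intro ker) simp_all
  then obtain w where [simp]: "w \<in> Arr C" "Dom C w = Dom C x'" "Cod C w = Dom C m" and w: "m \<cdot> w = a'"
    by (rule le_arrowE) simp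
  have "v \<cdot> x' = (p \<cdot> m) \<cdot> w" using c' w by simp
  then obtain h where [simp]: "h \<in> Arr C" "Dom C h = Dom C x'" "Cod C h = Dom C x" and h: "x \<cdot> h = x'" "a \<cdot> h = w"
    by (rule pullback_lift[OF xa]) simp_all
  have "g \<cdot> h = Id C (Dom C x')"
    by (rule pullback_eq[OF xa']) (simp_all add: Cmp_eq_left[OF g(1)] Cmp_eq_left[OF g(2)] h w)
  moreover have "h \<cdot> g = Id C (Dom C x)"
  proof (rule pullback_eq[OF xa])
    show "x \<cdot> (h \<cdot> g) = x \<cdot> Id C (Dom C x)" by (simp add: Cmp_eq_left[OF h(1)] g)
    have "m \<cdot> (w \<cdot> g) = m \<cdot> a" by (simp add: Cmp_eq_left[OF w] g)
    then have "w \<cdot> g = a" by (rule monicD[OF m(1)]) simp_all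
    then show "a \<cdot> (h \<cdot> g) = a \<cdot> Id C (Dom C x)" by (simp add: Cmp_eq_left[OF h(2)])
  qed simp_all
  ultimately have "is_iso C g" unfolding is_iso_iff by (intro conjI bexI[of _ h]) simp_all
  moreover have "point C (Cod C p) (p \<cdot> m) t" "point C (Cod C p) p s"
    using pt by (simp_all add: point_def in_hom_iff mt)
  ultimately show ?thesis
    using protomodular[unfolded protomodular_def, THEN spec, of "Cod C p", THEN spec, of v, THEN spec,
        of "p \<cdot> m", THEN spec, of t, THEN spec, of p, THEN spec, of s, THEN spec, of m, THEN spec, of x,
        THEN spec, of a, THEN spec, of x', THEN spec, of a', THEN spec, of g]
    by (simp add: in_hom_iff xa xa' g mt)
qed

text \<open>The elementwise form of protomodularity: the domain of a split epimorphism is covered by the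
  kernel and the section, so that membership of an arrow in a subobject can be tested on these two.\<close>

lemma split_extension_le:
  assumes pt: "p \<in> Arr C" "s \<in> Arr C" "Dom C s = Cod C p" "Cod C s = Dom C p" "p \<cdot> s = Id C (Cod C p)"
    and m: "monic m" and [simp]: "f \<in> Arr C" "Dom C f = Dom C p" "Cod C f = Cod C m"
    and fs: "f \<cdot> s \<preceq> m"
    and ker: "\<And>x. \<lbrakk>x \<in> Arr C; Cod C x = Dom C p; zero_arrow C (p \<cdot> x)\<rbrakk> \<Longrightarrow> f \<cdot> x \<preceq> m"
  shows "f \<preceq> m"
proof -
  note [simp] = pt(1-4) monic_Arr[OF m]
  \<comment> \<open>\<open>n\<close> is the inverse image of \<open>m\<close> under
    \<open>f\<close>; it contains the section and the kernel, hence is invertible.\<close>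
  obtain l n where pb: "is_pullback C m f l n" using has_pullbacks[of m f] by auto
  note [simp] = pullbackD(3,4,6-8)[OF pb]
  have le: "x \<preceq> n" if fx: "f \<cdot> x \<preceq> m" and [simp]: "x \<in> Arr C" "Cod C x = Dom C p" for x
  proof -
    obtain y where y: "y \<in> Arr C" "Dom C y = Dom C (f \<cdot> x)" "Cod C y = Dom C m" "m \<cdot> y = f \<cdot> x"
      using fx by (rule le_arrowE)
    from y(4) obtain u where "u \<in> Arr C" "Dom C u = Dom C y" "Cod C u = Dom C l" "l \<cdot> u = y" "n \<cdot> u = x"
      by (rule pullback_lift[OF pb]) (use y(1-3) in simp_all)
    then show ?thesis by (intro le_arrowI[of n u]) simp_all
  qed
  have "is_iso C n"
    by (rule split_extension_iso[OF pt pullback_monic[OF pb m]]) (simp_all add: le fs ker)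
  then obtain j where j: "j \<in> Arr C" "Dom C j = Dom C p" "Cod C j = Dom C l" "n \<cdot> j = Id C (Dom C p)"
    by (auto simp: is_iso_iff)
  have "m \<cdot> (l \<cdot> j) = f" using pullback_comm[OF pb, of j] j by simp
  then show ?thesis by (rule le_arrowI) (simp_all add: j)
qed

text \<open>Two arrows are equal iff their pairing lies in the diagonal, so the membership form
  applies to the pairing \<open>u\<close> of \<open>f\<close> and \<open>g\<close> and to the
  diagonal \<open>d\<close>.\<close>

lemma split_extension_eq:
  assumes pt: "p \<in> Arr C" "s \<in> Arr C" "Dom C s = Cod C p" "Cod C s = Dom C p" "p \<cdot> s = Id C (Cod C p)"
    and [simp]: "f \<in> Arr C" "Dom C f = Dom C p" "g \<in> Arr C" "Dom C g = Dom C p" "Cod C g = Cod C f"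
    and fs: "f \<cdot> s = g \<cdot> s"
    and ker: "\<And>x. \<lbrakk>x \<in> Arr C; Cod C x = Dom C p; zero_arrow C (p \<cdot> x)\<rbrakk> \<Longrightarrow> f \<cdot> x = g \<cdot> x"
  shows "f = g"
proof -
  note [simp] = pt(1-4)
  let ?A = "Cod C f"
  obtain p1 p2 where pr: "is_product p1 p2" and [simp]: "Cod C p1 = ?A" "Cod C p2 = ?A"
    by (rule has_products[of ?A ?A]) simp_all
  note [simp] = productD[OF pr]
  obtain d where [simp]: "d \<in> Arr C" "Dom C d = ?A" "Cod C d = Dom C p1" and d: "p1 \<cdot> d = Id C ?A" "p2 \<cdot> d = Id C ?A"
    by (rule product_pair[OF pr, of "Id C ?A" "Id C ?A"]) simp_all
  obtain u where [simp]: "u \<in> Arr C" "Dom C u = Dom C p" "Cod C u = Dom C p1" and u: "p1 \<cdot> u = f" "p2 \<cdot> u = g"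
    by (rule product_pair[OF pr, of f g]) simp_all
  have dm: "monic d" unfolding monic_def
  proof (intro conjI allI impI)
    fix a b assume "a \<in> Arr C \<and> b \<in> Arr C \<and> Cod C a = Dom C d \<and> Cod C b = Dom C d \<and> d \<cdot> a = d \<cdot> b"
    then have [simp]: "a \<in> Arr C" "b \<in> Arr C" "Cod C a = ?A" "Cod C b = ?A" and ab: "p1 \<cdot> (d \<cdot> a) = p1 \<cdot> (d \<cdot> b)" by simp_all
    have "p1 \<cdot> (d \<cdot> a) = a" "p1 \<cdot> (d \<cdot> b) = b" by (simp_all add: Cmp_eq_left[OF d(1)])
    with ab show "a = b" by metis
  qed simp
  have le: "u \<cdot> x \<preceq> d" if "f \<cdot> x = g \<cdot> x" and [simp]: "x \<in> Arr C" "Cod C x = Dom C p" for x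
  proof -
    have "d \<cdot> (f \<cdot> x) = u \<cdot> x"
      by (rule product_eq[OF pr]) (simp_all add: Cmp_eq_left[OF d(1)] Cmp_eq_left[OF d(2)] Cmp_eq_left[OF u(1)] Cmp_eq_left[OF u(2)] that(1))
    then show ?thesis by (rule le_arrowI) simp_all
  qed
  have "u \<preceq> d"
    by (rule split_extension_le[OF pt dm]) (simp_all add: le fs ker)
  then obtain w where [simp]: "w \<in> Arr C" "Dom C w = Dom C u" "Cod C w = Dom C d" and w: "d \<cdot> w = u" by (rule le_arrowE)
  have "p1 \<cdot> (d \<cdot> w) = w" "p2 \<cdot> (d \<cdot> w) = w" by (simp_all add: Cmp_eq_left[OF d(1)] Cmp_eq_left[OF d(2)])
  with w u show ?thesis by simp
qed

text \<open>Pulling \<open>p\<close> back along \<open>p \<cdot> g\<close> reduces this to the split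
  case: the projection \<open>a\<close> acquires the section \<open>s\<close> induced by
  \<open>g\<close>, its kernel maps to the kernel of \<open>p\<close>, and \<open>b\<close> is a
  cover of the domain of \<open>p\<close>, on which membership may be checked.\<close>

lemma regular_extension_le:
  assumes [simp]: "p \<in> Arr C" and pg: "regular_epi C (p \<cdot> g)" and [simp]: "g \<in> Arr C" "Cod C g = Dom C p"
    and m: "monic m" and [simp]: "f \<in> Arr C" "Dom C f = Dom C p" "Cod C f = Cod C m"
    and fg: "f \<cdot> g \<preceq> m"
    and ker: "\<And>x. \<lbrakk>x \<in> Arr C; Cod C x = Dom C p; zero_arrow C (p \<cdot> x)\<rbrakk> \<Longrightarrow> f \<cdot> x \<preceq> m"
  shows "f \<preceq> m"
proof -
  note [simp] = monic_Arr[OF m]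
  obtain a b where pb: "is_pullback C (p \<cdot> g) p a b" using has_pullbacks[of "p \<cdot> g" p] by auto
  have [simp]: "a \<in> Arr C" "b \<in> Arr C" "Dom C b = Dom C a" "Cod C a = Dom C g" "Cod C b = Dom C p"
    using pullbackD[OF pb] by simp_all
  have "(p \<cdot> g) \<cdot> Id C (Dom C g) = p \<cdot> g" by simp
  then obtain s where [simp]: "s \<in> Arr C" "Dom C s = Dom C g" "Cod C s = Dom C a"
    and s: "a \<cdot> s = Id C (Dom C g)" "b \<cdot> s = g"
    by (rule pullback_lift[OF pb]) simp_all
  have b: "regular_epi C b" by (rule regular_epi_stable[OF pb pg])
  have "f \<cdot> b \<preceq> m"
  proof (rule split_extension_le[of a s])
    show "(f \<cdot> b) \<cdot> s \<preceq> m" using fg by (simp add: s)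
    fix x assume [simp]: "x \<in> Arr C" "Cod C x = Dom C a" and z: "zero_arrow C (a \<cdot> x)"
    have "p \<cdot> (b \<cdot> x) = (p \<cdot> g) \<cdot> (a \<cdot> x)" using pullback_comm[OF pb, of x] by simp
    moreover have "zero_arrow C ((p \<cdot> g) \<cdot> (a \<cdot> x))" by (rule zero_arrow_Cmp_left[OF z]) simp_all
    ultimately have "f \<cdot> (b \<cdot> x) \<preceq> m" by (intro ker) simp_all
    then show "(f \<cdot> b) \<cdot> x \<preceq> m" by simp
  qed (simp_all add: s m)
  then show ?thesis by (rule le_arrow_local[OF m b]) simp_all
qed

section \<open>Monomorphisms and cokernels by means of kernel pairs\<close>

lemma kernel_pair_diagonal:
  assumes pb: "is_pullback C e e a b"
  obtains s where "s \<in> Arr C" "Dom C s = Dom C e" "Cod C s = Dom C a" "a \<cdot> s = Id C (Dom C e)" "b \<cdot> s = Id C (Dom C e)"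
proof -
  note [simp] = pullbackD(1,3,4,6,7,8)[OF pb]
  show ?thesis by (rule pullback_lift[OF pb, of "Id C (Dom C e)" "Id C (Dom C e)"]) (simp_all add: that)
qed

text \<open>The projections \<open>a\<close> and \<open>b\<close> of the kernel pair agree on the
  diagonal, and also on the kernel of \<open>a\<close>: there \<open>f\<close> kills the second
  component, which therefore vanishes. By the split extension principle they are equal.\<close>

lemma trivial_kernel_monic:
  assumes [simp]: "f \<in> Arr C"
    and triv: "\<And>x. \<lbrakk>x \<in> Arr C; Cod C x = Dom C f; zero_arrow C (f \<cdot> x)\<rbrakk> \<Longrightarrow> zero_arrow C x"
  shows "monic f"
proof -
  obtain a b where pb: "is_pullback C f f a b" using has_pullbacks[of f f] by auto
  note [simp] = pullbackD(3,4,6,7,8)[OF pb]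
  obtain s where [simp]: "s \<in> Arr C" "Dom C s = Dom C f" "Cod C s = Dom C a"
    and s: "a \<cdot> s = Id C (Dom C f)" "b \<cdot> s = Id C (Dom C f)" by (rule kernel_pair_diagonal[OF pb])
  have ab: "a = b"
  proof (rule split_extension_eq[of a s])
    fix x assume [simp]: "x \<in> Arr C" "Cod C x = Dom C a" and z: "zero_arrow C (a \<cdot> x)"
    have "zero_arrow C (f \<cdot> (a \<cdot> x))" using z by (rule zero_arrow_Cmp_left) simp_all
    then have "zero_arrow C (b \<cdot> x)" by (rule_tac triv) (simp_all add: pullback_comm[OF pb])
    then show "a \<cdot> x = b \<cdot> x" by (intro zero_arrow_unique[OF z]) simp_all
  qed (simp_all add: s)
  show ?thesis unfolding monic_def
  proof (intro conjI allI impI)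
    fix x y assume *: "x \<in> Arr C \<and> y \<in> Arr C \<and> Cod C x = Dom C f \<and> Cod C y = Dom C f \<and> f \<cdot> x = f \<cdot> y"
    then have [simp]: "x \<in> Arr C" "y \<in> Arr C" "Cod C x = Dom C f" "Cod C y = Dom C f" and eq: "f \<cdot> x = f \<cdot> y" by simp_all
    have d: "Dom C y = Dom C x" using arg_cong[OF eq, of "Dom C"] by simp
    obtain u where "a \<cdot> u = x" "b \<cdot> u = y" by (rule pullback_lift[OF pb eq]) (simp_all add: d)
    then show "x = y" unfolding ab by simp
  qed simp
qed

text \<open>The kernel pair of \<open>e\<close> is split by the diagonal, and on the kernel of
  \<open>a\<close> the second component lies in \<open>k\<close>, so \<open>h\<close> kills it.
  Hence \<open>h\<close> identifies the two projections and descends along \<open>e\<close>.\<close>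

lemma regular_epi_is_cokernel:
  assumes e: "regular_epi C e" and k: "is_kernel C k e"
  shows "is_cokernel C e k"
proof (rule cokernelI)
  note [simp] = kernelD(1,2,3)[OF k]
  show "u = v" if "u \<in> Arr C" "v \<in> Arr C" "Dom C u = Cod C e" "Dom C v = Cod C e" "u \<cdot> e = v \<cdot> e" for u v
    using regular_epi_epi[OF e that(5)] that by simp
  fix h assume [simp]: "h \<in> Arr C" "Dom C h = Cod C k" and hk: "zero_arrow C (h \<cdot> k)"
  obtain a b where pb: "is_pullback C e e a b" using has_pullbacks[of e e] by auto
  note [simp] = pullbackD(3,4,6,7,8)[OF pb]
  obtain s where [simp]: "s \<in> Arr C" "Dom C s = Dom C e" "Cod C s = Dom C a"
    and s: "a \<cdot> s = Id C (Dom C e)" "b \<cdot> s = Id C (Dom C e)" by (rule kernel_pair_diagonal[OF pb])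
  have hab: "h \<cdot> a = h \<cdot> b"
  proof (rule split_extension_eq[of a s])
    fix x assume [simp]: "x \<in> Arr C" "Cod C x = Dom C a" and z: "zero_arrow C (a \<cdot> x)"
    have "zero_arrow C (e \<cdot> (a \<cdot> x))" using z by (rule zero_arrow_Cmp_left) simp_all
    then have "zero_arrow C (e \<cdot> (b \<cdot> x))" by (simp add: pullback_comm[OF pb])
    then have "b \<cdot> x \<preceq> k" by (intro kernelD(6)[OF k]) simp_all
    then obtain y where y[simp]: "y \<in> Arr C" "Dom C y = Dom C (b \<cdot> x)" "Cod C y = Dom C k" and ky: "k \<cdot> y = b \<cdot> x" by (rule le_arrowE)
    have "zero_arrow C ((h \<cdot> k) \<cdot> y)" using hk by (rule zero_arrow_Cmp_right) simp_all
    then have "zero_arrow C (h \<cdot> (b \<cdot> x))" by (simp add: ky)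
    moreover have "zero_arrow C (h \<cdot> (a \<cdot> x))" using z by (rule zero_arrow_Cmp_left) simp_all
    ultimately have "h \<cdot> (a \<cdot> x) = h \<cdot> (b \<cdot> x)" by (intro zero_arrow_unique) simp_all
    then show "(h \<cdot> a) \<cdot> x = (h \<cdot> b) \<cdot> x" by simp
  qed (simp_all add: s)
  obtain f g where fg: "is_coequalizer C f g e" using e by (auto simp: regular_epi_def)
  then have [simp]: "f \<in> Arr C" "g \<in> Arr C" "Dom C g = Dom C f" "Cod C f = Dom C e" "Cod C g = Dom C e"
     and efg: "e \<cdot> f = e \<cdot> g" by (simp_all add: is_coequalizer_iff)
  obtain w where [simp]: "w \<in> Arr C" "Dom C w = Dom C f" "Cod C w = Dom C a" and w: "a \<cdot> w = f" "b \<cdot> w = g"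
    by (rule pullback_lift[OF pb efg]) simp_all
  have "h \<cdot> (a \<cdot> w) = h \<cdot> (b \<cdot> w)" by (simp add: Cmp_eq_left[OF hab])
  then have "h \<cdot> f = h \<cdot> g" by (simp only: w)
  then obtain u where "u \<in> Arr C" "Dom C u = Cod C e" "Cod C u = Cod C h" "u \<cdot> e = h"
    by (rule coequalizer_factor[OF fg]) simp_all
  then show "\<exists>u. u \<in> Arr C \<and> Dom C u = Cod C e \<and> Cod C u = Cod C h \<and> u \<cdot> e = h" by blast
qed (use e kernelD[OF k] in simp_all)

end
section \<open>Images of normal subobjects and cokernels\<close>

context semi_abelian_category
begin

text \<open>The axes lemma, applied to triples \<open>(a,b), (c,b), (c,d)\<close> of elements of the relation: the object of
  such triples is split over that of the pairs \<open>(c,b), (c,d)\<close>, and both the section and the kernel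
  satisfy that \<open>(a,d)\<close> is in the relation.\<close>
lemma reflexive_relation_difunctional:
  assumes [simp]: "r \<in> Arr C" "s \<in> Arr C" "Dom C s = Dom C r" "Cod C r = X" "Cod C s = X"
    and jm: "\<And>u v. \<lbrakk>u \<in> Arr C; v \<in> Arr C; Cod C u = Dom C r; Cod C v = Dom C r; r \<cdot> u = r \<cdot> v; s \<cdot> u = s \<cdot> v\<rbrakk> \<Longrightarrow> u = v"
    and [simp]: "u \<in> Arr C" "v \<in> Arr C" "w \<in> Arr C" "Dom C v = Dom C u" "Dom C w = Dom C u"
      "Cod C u = Dom C r" "Cod C v = Dom C r" "Cod C w = Dom C r"
    and uv: "s \<cdot> u = s \<cdot> v" and vw: "r \<cdot> v = r \<cdot> w"
  obtains t where "t \<in> Arr C" "Dom C t = Dom C u" "Cod C t = Dom C r" "r \<cdot> t = r \<cdot> u" "s \<cdot> t = s \<cdot> w"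
proof -
  have [simp]: "X \<in> Obj C" using Obj_Cod[of r] by simp
  obtain v1 w1 where pb1: "is_pullback C r r v1 w1" using has_pullbacks[of r r] by auto
  note [simp] = pullbackD(3,4,6-8)[OF pb1]
  obtain u2 z where pb2: "is_pullback C s (s \<cdot> v1) u2 z" using has_pullbacks[of s "s \<cdot> v1"] by auto
  have [simp]: "u2 \<in> Arr C" "z \<in> Arr C" "Dom C z = Dom C u2" "Cod C u2 = Dom C r" "Cod C z = Dom C v1"
    using pullbackD[OF pb2] by simp_all
  have "s \<cdot> v1 = (s \<cdot> v1) \<cdot> Id C (Dom C v1)" by simp
  then obtain \<sigma> where [simp]: "\<sigma> \<in> Arr C" "Dom C \<sigma> = Dom C v1" "Cod C \<sigma> = Dom C u2"
    and \<sigma>: "u2 \<cdot> \<sigma> = v1" "z \<cdot> \<sigma> = Id C (Dom C v1)"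
    by (rule pullback_lift[OF pb2]) simp_all
  obtain p1 p2 where pr: "is_product p1 p2" and [simp]: "Cod C p1 = X" "Cod C p2 = X"
    by (rule has_products[of X X]) simp_all
  note [simp] = productD[OF pr]
  \<comment> \<open>\<open>m\<close> is the relation as a subobject of the product, and
    \<open>f\<close> below is the pair \<open>(a, d)\<close> taken on the object of all
    triples.\<close>
  obtain m where [simp]: "m \<in> Arr C" "Dom C m = Dom C r" "Cod C m = Dom C p1" and m: "p1 \<cdot> m = r" "p2 \<cdot> m = s"
    by (rule product_pair[OF pr, of r s]) simp_all
  note m' = Cmp_eq_left[OF m(1)] Cmp_eq_left[OF m(2)]
  have mm: "monic m" unfolding monic_def
  proof (intro conjI allI impI)
    fix a b assume "a \<in> Arr C \<and> b \<in> Arr C \<and> Cod C a = Dom C m \<and> Cod C b = Dom C m \<and> m \<cdot> a = m \<cdot> b"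
    then have [simp]: "a \<in> Arr C" "b \<in> Arr C" "Cod C a = Dom C r" "Cod C b = Dom C r" and ab: "m \<cdot> a = m \<cdot> b"
      by simp_all
    have "r \<cdot> a = r \<cdot> b" using arg_cong[OF ab, of "(\<cdot>) p1"] by (simp add: m')
    moreover have "s \<cdot> a = s \<cdot> b" using arg_cong[OF ab, of "(\<cdot>) p2"] by (simp add: m')
    ultimately show "a = b" by (rule_tac jm) simp_all
  qed simp
  obtain f where [simp]: "f \<in> Arr C" "Dom C f = Dom C u2" "Cod C f = Dom C p1"
    and f: "p1 \<cdot> f = r \<cdot> u2" "p2 \<cdot> f = s \<cdot> (w1 \<cdot> z)"
    by (rule product_pair[OF pr, of "r \<cdot> u2" "s \<cdot> (w1 \<cdot> z)"]) simp_all
  note f' = Cmp_eq_left[OF f(1)] Cmp_eq_left[OF f(2)]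
  have "f \<preceq> m"
  proof (rule split_extension_le[of z \<sigma>])
    \<comment> \<open>On the section the first pair repeats the second, so the outer entries are
      those of the third pair.\<close>
    have "m \<cdot> w1 = f \<cdot> \<sigma>"
      by (rule product_eq[OF pr]) (simp_all add: m' f' \<sigma> pullbackD(9)[OF pb1])
    then show "f \<cdot> \<sigma> \<preceq> m" by (rule le_arrowI) simp_all
    fix x assume [simp]: "x \<in> Arr C" "Cod C x = Dom C z" and zx: "zero_arrow C (z \<cdot> x)"
    \<comment> \<open>On the kernel of \<open>z\<close> the second and third pairs vanish, so
      \<open>b\<close> and \<open>d\<close> are both zero and the outer entries are those of the
      first pair.\<close>
    have 1: "zero_arrow C (s \<cdot> (v1 \<cdot> (z \<cdot> x)))" "zero_arrow C (s \<cdot> (w1 \<cdot> (z \<cdot> x)))"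
      by (intro zero_arrow_Cmp_left zx; simp)+
    have "s \<cdot> (u2 \<cdot> x) = s \<cdot> (v1 \<cdot> (z \<cdot> x))" using pullback_comm[OF pb2, of x] by simp
    also have "\<dots> = s \<cdot> (w1 \<cdot> (z \<cdot> x))" by (rule zero_arrow_unique[OF 1]) simp_all
    finally have "m \<cdot> (u2 \<cdot> x) = f \<cdot> x"
      by (intro product_eq[OF pr, of "m \<cdot> (u2 \<cdot> x)" "f \<cdot> x"]) (simp_all add: m' f')
    then show "f \<cdot> x \<preceq> m" by (rule le_arrowI) simp_all
  qed (simp_all add: mm \<sigma>)
  then obtain g where [simp]: "g \<in> Arr C" "Dom C g = Dom C f" "Cod C g = Dom C m" and g: "m \<cdot> g = f"
    by (rule le_arrowE)
  obtain vw where [simp]: "vw \<in> Arr C" "Dom C vw = Dom C u" "Cod C vw = Dom C v1" and vw': "v1 \<cdot> vw = v" "w1 \<cdot> vw = w"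
    using vw by (rule pullback_lift[OF pb1]) simp_all
  have "s \<cdot> u = (s \<cdot> v1) \<cdot> vw" using uv vw' by simp
  then obtain t where [simp]: "t \<in> Arr C" "Dom C t = Dom C u" "Cod C t = Dom C u2" and t: "u2 \<cdot> t = u" "z \<cdot> t = vw"
    by (rule pullback_lift[OF pb2]) simp_all
  have "r \<cdot> (g \<cdot> t) = p1 \<cdot> ((m \<cdot> g) \<cdot> t)" by (simp add: m')
  also have "\<dots> = r \<cdot> u" by (simp only: g) (simp add: f' t)
  finally have 1: "r \<cdot> (g \<cdot> t) = r \<cdot> u" .
  have "s \<cdot> (g \<cdot> t) = p2 \<cdot> ((m \<cdot> g) \<cdot> t)" by (simp add: m')
  also have "\<dots> = s \<cdot> w" by (simp only: g) (simp add: f' t vw')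
  finally show ?thesis using 1 by (intro that[of "g \<cdot> t"]) simp_all
qed

text \<open>The Mal'tsev property: symmetry and transitivity are instances of difunctionality in
  which diagonal pairs, supplied by \<open>d\<close>, are inserted.\<close>

lemma reflexive_relation_internal_equivalence:
  assumes [simp]: "r \<in> Arr C" "s \<in> Arr C" "Dom C s = Dom C r" "Cod C r = X" "Cod C s = X"
    and jm: "\<And>u v. \<lbrakk>u \<in> Arr C; v \<in> Arr C; Cod C u = Dom C r; Cod C v = Dom C r; r \<cdot> u = r \<cdot> v; s \<cdot> u = s \<cdot> v\<rbrakk> \<Longrightarrow> u = v"
    and [simp]: "d \<in> Arr C" "Dom C d = X" "Cod C d = Dom C r" and d: "r \<cdot> d = Id C X" "s \<cdot> d = Id C X"
  shows "internal_equivalence C X r s"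
  unfolding internal_equivalence_def
proof (intro conjI ballI impI)
  have [simp]: "X \<in> Obj C" using Obj_Cod[of r] by simp
  note d' = Cmp_eq_left[OF d(1)] Cmp_eq_left[OF d(2)]
  note difun = reflexive_relation_difunctional[OF assms(1-5) jm]
  fix T assume T: "T \<in> Obj C"
  show "u = v" if "u \<in> hom C T (Dom C r)" "v \<in> hom C T (Dom C r)" "r \<cdot> u = r \<cdot> v \<and> s \<cdot> u = s \<cdot> v" for u v
    using that by (rule_tac jm) (simp_all add: in_hom_iff)
  let ?R = "(\<lambda>h. (r \<cdot> h, s \<cdot> h)) ` hom C T (Dom C r)"
  have R: "(x, y) \<in> ?R" if "u \<in> Arr C" "Dom C u = T" "Cod C u = Dom C r" "r \<cdot> u = x" "s \<cdot> u = y" for x y u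
    using that by (intro image_eqI[of _ _ u]) (simp_all add: in_hom_iff)
  show "equiv (hom C T X) ?R"
  proof (rule equivI)
    show "?R \<subseteq> hom C T X \<times> hom C T X" by (auto simp: in_hom_iff)
    show "refl_on (hom C T X) ?R"
    proof (rule refl_onI)
      fix x assume x: "x \<in> hom C T X"
      then have [simp]: "x \<in> Arr C" "Dom C x = T" "Cod C x = X" by (simp_all add: in_hom_iff)
      show "(x, x) \<in> ?R" by (rule R[of "d \<cdot> x"]) (simp_all add: d')
    qed
    show "sym ?R"
    proof (rule symI)
      fix x y assume "(x, y) \<in> ?R"
      then obtain h where [simp]: "h \<in> Arr C" "Dom C h = T" "Cod C h = Dom C r" and xy: "x = r \<cdot> h" "y = s \<cdot> h"
        by (auto simp: in_hom_iff)
      \<comment> \<open>Difunctionality for the pairs \<open>(y, y)\<close>, \<open>(x, y)\<close>,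
        \<open>(x, x)\<close>.\<close>
      obtain t where "t \<in> Arr C" "Dom C t = Dom C (d \<cdot> (s \<cdot> h))" "Cod C t = Dom C r" "r \<cdot> t = r \<cdot> (d \<cdot> (s \<cdot> h))" "s \<cdot> t = s \<cdot> (d \<cdot> (r \<cdot> h))"
        by (rule difun[of "d \<cdot> (s \<cdot> h)" h "d \<cdot> (r \<cdot> h)"]) (simp_all add: d')
      then show "(y, x) \<in> ?R" by (intro R[of t]) (simp_all add: d' xy)
    qed
    show "trans ?R"
    proof (rule transI)
      fix x y z assume "(x, y) \<in> ?R" "(y, z) \<in> ?R"
      then obtain h k where [simp]: "h \<in> Arr C" "Dom C h = T" "Cod C h = Dom C r" "k \<in> Arr C" "Dom C k = T" "Cod C k = Dom C r"
        and xy: "x = r \<cdot> h" "y = s \<cdot> h" "y = r \<cdot> k" "z = s \<cdot> k"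
        by (auto simp: in_hom_iff)
      then have hk: "s \<cdot> h = r \<cdot> k" by simp
      \<comment> \<open>Difunctionality for the pairs \<open>(x, y)\<close>, \<open>(y, y)\<close>,
        \<open>(y, z)\<close>.\<close>
      obtain t where "t \<in> Arr C" "Dom C t = Dom C h" "Cod C t = Dom C r" "r \<cdot> t = r \<cdot> h" "s \<cdot> t = s \<cdot> k"
        by (rule difun[of h "d \<cdot> (s \<cdot> h)" k]) (simp_all add: d' hk)
      then show "(x, z) \<in> ?R" by (intro R[of t]) (simp_all add: xy(1,4))
    qed
  qed
qed (simp_all add: in_hom_iff)

text \<open>Write \<open>k\<close> as the kernel of \<open>h\<close>. The kernel pair of
  \<open>h\<close>, pushed forward along \<open>e\<close>, is a reflexive relation on
  \<open>Cod C e\<close>, hence an equivalence relation, hence by exactness the kernel pair of some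
  \<open>g\<close>; the image \<open>m\<close> of \<open>k\<close> is then the kernel of
  \<open>g\<close>.\<close>

theorem normal_image:
  assumes k: "normal_mono C k" and e: "regular_epi C e" and dk: "Cod C k = Dom C e"
    and m: "monic m" and \<epsilon>: "regular_epi C \<epsilon>" and dm: "Cod C \<epsilon> = Dom C m" and fac: "m \<cdot> \<epsilon> = e \<cdot> k"
  shows "normal_mono C m"
proof -
  obtain h where h: "is_kernel C k h" using k by (rule normal_monoE)
  note [simp] = kernelD(1-3)[OF h] regular_epi_Arr[OF e] regular_epi_Arr[OF \<epsilon>] monic_Arr[OF m]
  have dh[simp]: "Dom C h = Dom C e" using kernelD(3)[OF h] dk by simp
  note [simp] = dk dm
  have [simp]: "Dom C \<epsilon> = Dom C k" using arg_cong[OF fac, of "Dom C"] by simp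
  have [simp]: "Cod C m = Cod C e" using arg_cong[OF fac, of "Cod C"] by simp
  let ?B = "Cod C e"
  obtain r s where pb: "is_pullback C h h r s" using has_pullbacks[of h h] by auto
  have rs[simp]: "r \<in> Arr C" "s \<in> Arr C" "Dom C s = Dom C r" "Cod C r = Dom C e" "Cod C s = Dom C e"
    using pullbackD[OF pb] by simp_all
  obtain \<delta> where "\<delta> \<in> Arr C" "Dom C \<delta> = Dom C h" "Cod C \<delta> = Dom C r"
    and \<delta>: "r \<cdot> \<delta> = Id C (Dom C h)" "s \<cdot> \<delta> = Id C (Dom C h)" by (rule kernel_pair_diagonal[OF pb])
  then have [simp]: "\<delta> \<in> Arr C" "Dom C \<delta> = Dom C e" "Cod C \<delta> = Dom C r" by simp_all
  have \<delta>': "r \<cdot> \<delta> = Id C (Dom C e)" "s \<cdot> \<delta> = Id C (Dom C e)" using \<delta> by simp_all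
  obtain p1 p2 where pr: "is_product p1 p2" and [simp]: "Cod C p1 = ?B" "Cod C p2 = ?B"
    by (rule has_products[of ?B ?B]) simp_all
  note [simp] = productD[OF pr]
  obtain \<phi> where [simp]: "\<phi> \<in> Arr C" "Dom C \<phi> = Dom C r" "Cod C \<phi> = Dom C p1" and \<phi>: "p1 \<cdot> \<phi> = e \<cdot> r" "p2 \<cdot> \<phi> = e \<cdot> s"
    by (rule product_pair[OF pr, of "e \<cdot> r" "e \<cdot> s"]) simp_all
  obtain \<eta> n where \<eta>: "regular_epi C \<eta>" and n: "monic n" and \<eta>d: "Dom C \<eta> = Dom C \<phi>" "Dom C n = Cod C \<eta>"
    "Cod C n = Cod C \<phi>" and n\<eta>: "n \<cdot> \<eta> = \<phi>" by (rule image_factorization[of \<phi>]) simp_all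
  note [simp] = regular_epi_Arr[OF \<eta>] monic_Arr[OF n] \<eta>d
  define r' s' where rs'_def: "r' = p1 \<cdot> n" "s' = p2 \<cdot> n"
  have [simp]: "r' \<in> Arr C" "s' \<in> Arr C" "Dom C r' = Cod C \<eta>" "Dom C s' = Cod C \<eta>" "Cod C r' = ?B" "Cod C s' = ?B"
    by (simp_all add: rs'_def)
  have r'\<eta>: "r' \<cdot> \<eta> = e \<cdot> r" "s' \<cdot> \<eta> = e \<cdot> s" by (simp_all add: rs'_def n\<eta> \<phi>)
  note r'\<eta>' = Cmp_eq_left[OF r'\<eta>(1)] Cmp_eq_left[OF r'\<eta>(2)]
  have jm: "u = v" if "u \<in> Arr C" "v \<in> Arr C" "Cod C u = Dom C r'" "Cod C v = Dom C r'" "r' \<cdot> u = r' \<cdot> v" "s' \<cdot> u = s' \<cdot> v" for u v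
  proof -
    have "n \<cdot> u = n \<cdot> v" using that by (intro product_eq[OF pr, of "n \<cdot> u" "n \<cdot> v"]) (simp_all add: rs'_def)
    then show ?thesis by (rule monicD[OF n]) (use that in simp_all)
  qed
  \<comment> \<open>The diagonal of \<open>Cod C e\<close> lies in the relation pushed forward
    because it does so on the cover \<open>e\<close>, where it is the image of the diagonal of the
    kernel pair of \<open>h\<close>.\<close>
  obtain d where d: "d \<in> Arr C" "Dom C d = ?B" "Cod C d = Dom C r'" "r' \<cdot> d = Id C ?B" "s' \<cdot> d = Id C ?B"
  proof -
    obtain \<Delta> where [simp]: "\<Delta> \<in> Arr C" "Dom C \<Delta> = ?B" "Cod C \<Delta> = Dom C p1" and \<Delta>: "p1 \<cdot> \<Delta> = Id C ?B" "p2 \<cdot> \<Delta> = Id C ?B"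
      by (rule product_pair[OF pr, of "Id C ?B" "Id C ?B"]) simp_all
    have "n \<cdot> (\<eta> \<cdot> \<delta>) = \<Delta> \<cdot> e"
      by (rule product_eq[OF pr]) (simp_all add: Cmp_eq_left[OF n\<eta>] Cmp_eq_left[OF \<phi>(1)] Cmp_eq_left[OF \<phi>(2)] Cmp_eq_left[OF \<Delta>(1)] Cmp_eq_left[OF \<Delta>(2)] \<delta>')
    then have "\<Delta> \<cdot> e \<preceq> n" by (rule le_arrowI) simp_all
    then have "\<Delta> \<preceq> n" by (rule le_arrow_local[OF n e]) simp_all
    then obtain d where "d \<in> Arr C" "Dom C d = Dom C \<Delta>" "Cod C d = Dom C n" "n \<cdot> d = \<Delta>" by (rule le_arrowE)
    then show ?thesis using that[of d] \<Delta> by (simp add: rs'_def)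
  qed
  have "internal_equivalence C ?B r' s'"
    by (rule reflexive_relation_internal_equivalence[of r' s' ?B d]) (simp_all add: jm d)
  then obtain g where g: "g \<in> Arr C" "Dom C g = ?B" and pbg: "is_pullback C g g r' s'"
    using effective_equivalence by blast
  note [simp] = g
  text \<open>Elements that are related to zero lie in the image: the pairs \<open>(a, a')\<close> with \<open>e a = 0\<close> are
    split over the kernel of \<open>e\<close>, with kernel consisting of the pairs \<open>(0, a')\<close>, \<open>a' \<in> k\<close>.\<close>
  obtain \<kappa> where \<kappa>: "is_kernel C \<kappa> e" by (rule kernel_exists[of e]) simp_all
  note [simp] = kernelD(1,3)[OF \<kappa>]
  obtain \<rho> z where pb\<rho>: "is_pullback C r \<kappa> \<rho> z" using has_pullbacks[of r \<kappa>] by auto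
  have [simp]: "\<rho> \<in> Arr C" "z \<in> Arr C" "Dom C z = Dom C \<rho>" "Cod C \<rho> = Dom C r" "Cod C z = Dom C \<kappa>"
    using pullbackD[OF pb\<rho>] by simp_all
  have "r \<cdot> (\<delta> \<cdot> \<kappa>) = \<kappa> \<cdot> Id C (Dom C \<kappa>)" by (simp add: Cmp_eq_left[OF \<delta>'(1)])
  then obtain \<sigma> where [simp]: "\<sigma> \<in> Arr C" "Dom C \<sigma> = Dom C \<kappa>" "Cod C \<sigma> = Dom C \<rho>"
    and \<sigma>: "\<rho> \<cdot> \<sigma> = \<delta> \<cdot> \<kappa>" "z \<cdot> \<sigma> = Id C (Dom C \<kappa>)"
    by (rule pullback_lift[OF pb\<rho>]) simp_all
  have key: "e \<cdot> (s \<cdot> \<rho>) \<preceq> m"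
  proof (rule split_extension_le[of z \<sigma>])
    have "(e \<cdot> (s \<cdot> \<rho>)) \<cdot> \<sigma> = e \<cdot> \<kappa>" by (simp add: \<sigma> Cmp_eq_left[OF \<delta>'(2)])
    then show "(e \<cdot> (s \<cdot> \<rho>)) \<cdot> \<sigma> \<preceq> m" using kernelD(4)[OF \<kappa>] by (simp add: zero_arrow_le)
    fix x assume [simp]: "x \<in> Arr C" "Cod C x = Dom C z" and zx: "zero_arrow C (z \<cdot> x)"
    have "h \<cdot> (s \<cdot> (\<rho> \<cdot> x)) = h \<cdot> (\<kappa> \<cdot> (z \<cdot> x))"
      using pullback_comm[OF pb\<rho>, of x] pullback_comm[OF pb, of "\<rho> \<cdot> x"] by simp
    moreover have "zero_arrow C (h \<cdot> (\<kappa> \<cdot> (z \<cdot> x)))" by (intro zero_arrow_Cmp_left zx) simp_all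
    ultimately have "s \<cdot> (\<rho> \<cdot> x) \<preceq> k" by (intro kernelD(6)[OF h]) simp_all
    then obtain y where [simp]: "y \<in> Arr C" "Dom C y = Dom C (s \<cdot> (\<rho> \<cdot> x))" "Cod C y = Dom C k" and y: "k \<cdot> y = s \<cdot> (\<rho> \<cdot> x)"
      by (rule le_arrowE)
    have "m \<cdot> (\<epsilon> \<cdot> y) = e \<cdot> (s \<cdot> (\<rho> \<cdot> x))" by (simp add: Cmp_eq_left[OF fac] y)
    then have "e \<cdot> (s \<cdot> (\<rho> \<cdot> x)) \<preceq> m" by (rule le_arrowI) simp_all
    then show "(e \<cdot> (s \<cdot> \<rho>)) \<cdot> x \<preceq> m" by simp
  qed (simp_all add: \<sigma> m)
  have "is_kernel C m g"
  proof (rule kernelI[OF m])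
    obtain zr where zr: "zero_arrow C zr" and [simp]: "Dom C zr = Dom C k" "Cod C zr = Dom C e"
      by (rule zero_arrow_exists[of "Dom C k" "Dom C e"]) simp_all
    have 1: "zero_arrow C (h \<cdot> zr)" "zero_arrow C (e \<cdot> zr)" "zero_arrow C (g \<cdot> (e \<cdot> zr))"
      by (intro zero_arrow_Cmp_left zr; simp add: zr)+
    \<comment> \<open>The pair of zero and \<open>k\<close> is in the kernel pair of
      \<open>h\<close>; its image in the relation shows that \<open>g\<close> sends the image of
      \<open>k\<close> where it sends zero.\<close>
    have "h \<cdot> zr = h \<cdot> k" by (intro zero_arrow_unique 1 kernelD(4)[OF h]) (simp_all add: zr)
    then obtain u where [simp]: "u \<in> Arr C" "Dom C u = Dom C zr" "Cod C u = Dom C r" and u: "r \<cdot> u = zr" "s \<cdot> u = k"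
      by (rule pullback_lift[OF pb]) (simp_all add: zr)
    have "g \<cdot> (r' \<cdot> (\<eta> \<cdot> u)) = g \<cdot> (s' \<cdot> (\<eta> \<cdot> u))" by (rule pullback_comm[OF pbg]) simp_all
    then have "g \<cdot> (e \<cdot> zr) = g \<cdot> (e \<cdot> k)" by (simp add: r'\<eta>' u)
    also have "\<dots> = (g \<cdot> m) \<cdot> \<epsilon>" by (simp add: fac)
    finally have "zero_arrow C ((g \<cdot> m) \<cdot> \<epsilon>)" using 1 by simp
    then show "zero_arrow C (g \<cdot> m)" by (rule regular_epi_zero_arrow[OF \<epsilon>]) simp_all
    fix x assume [simp]: "x \<in> Arr C" "Cod C x = Dom C g" and gx: "zero_arrow C (g \<cdot> x)"
    \<comment> \<open>An element \<open>x\<close> killed by \<open>g\<close> is related to zero.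
      Locally this relation lifts to a pair \<open>w\<close> in the kernel pair of \<open>h\<close>
      whose first entry is killed by \<open>e\<close>, and \<open>key\<close> applies.\<close>
    obtain zr where zr: "zero_arrow C zr" and [simp]: "Dom C zr = Dom C x" "Cod C zr = ?B"
      by (rule zero_arrow_exists[of "Dom C x" ?B]) simp_all
    have "zero_arrow C (g \<cdot> zr)" by (intro zero_arrow_Cmp_left zr) simp_all
    then have "g \<cdot> zr = g \<cdot> x" by (intro zero_arrow_unique gx) (simp_all add: zr)
    then obtain u where [simp]: "u \<in> Arr C" "Dom C u = Dom C zr" "Cod C u = Dom C r'" and u: "r' \<cdot> u = zr" "s' \<cdot> u = x"
      by (rule pullback_lift[OF pbg]) (simp_all add: zr)
    obtain c w where c: "regular_epi C c" and [simp]: "Cod C c = Dom C u" "w \<in> Arr C" "Dom C w = Dom C c" "Cod C w = Dom C \<eta>"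
      and w: "\<eta> \<cdot> w = u \<cdot> c" by (rule regular_epi_lift[OF \<eta>, of u]) simp_all
    note [simp] = regular_epi_Arr[OF c]
    have "e \<cdot> (r \<cdot> w) = r' \<cdot> (u \<cdot> c)" using w r'\<eta>'(1)[of w] by simp
    also have "\<dots> = zr \<cdot> c" by (simp add: Cmp_eq_left[OF u(1)])
    finally have "zero_arrow C (e \<cdot> (r \<cdot> w))" using zr by simp
    then have "r \<cdot> w \<preceq> \<kappa>" by (intro kernelD(6)[OF \<kappa>]) simp_all
    then obtain y where [simp]: "y \<in> Arr C" "Dom C y = Dom C (r \<cdot> w)" "Cod C y = Dom C \<kappa>" and y: "\<kappa> \<cdot> y = r \<cdot> w"
      by (rule le_arrowE)
    obtain t where [simp]: "t \<in> Arr C" "Dom C t = Dom C w" "Cod C t = Dom C \<rho>" and t: "\<rho> \<cdot> t = w" "z \<cdot> t = y"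
      using y[symmetric] by (rule pullback_lift[OF pb\<rho>]) simp_all
    have "(e \<cdot> (s \<cdot> \<rho>)) \<cdot> t \<preceq> m" by (rule le_arrow_Cmp[OF key]) simp_all
    moreover have "(e \<cdot> (s \<cdot> \<rho>)) \<cdot> t = x \<cdot> c"
    proof -
      have "(e \<cdot> (s \<cdot> \<rho>)) \<cdot> t = s' \<cdot> (\<eta> \<cdot> w)" by (simp add: t r'\<eta>')
      also have "\<dots> = x \<cdot> c" by (simp add: w Cmp_eq_left[OF u(2)])
      finally show ?thesis .
    qed
    ultimately have "x \<cdot> c \<preceq> m" by simp
    then show "x \<preceq> m" by (rule le_arrow_local[OF m c]) simp_all
  qed simp_all
  then show ?thesis by (auto simp: normal_mono_def)
qed

text \<open>Replacing \<open>h\<close> by the regular epimorphism of its image factorization keeps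
  the kernel, since the other factor is monic, and a regular epimorphism is the cokernel of its
  kernel.\<close>

lemma normal_quotient:
  assumes "normal_mono C k"
  obtains q where "regular_epi C q" "is_kernel C k q" "is_cokernel C q k"
proof -
  obtain h where h: "is_kernel C k h" using assms by (rule normal_monoE)
  note [simp] = kernelD(1-3)[OF h]
  obtain e m where e: "regular_epi C e" and m: "monic m" and [simp]: "Dom C e = Dom C h" "Dom C m = Cod C e"
    "Cod C m = Cod C h" and me: "m \<cdot> e = h" by (rule image_factorization[of h]) simp_all
  note [simp] = regular_epi_Arr[OF e] monic_Arr[OF m]
  have z: "zero_arrow C (e \<cdot> x) \<longleftrightarrow> zero_arrow C (h \<cdot> x)" if [simp]: "x \<in> Arr C" "Cod C x = Dom C h" for x
  proof
    assume "zero_arrow C (e \<cdot> x)"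
    then have "zero_arrow C (m \<cdot> (e \<cdot> x))" by (rule zero_arrow_Cmp_left) simp_all
    then show "zero_arrow C (h \<cdot> x)" by (simp add: Cmp_eq_left[OF me])
  next
    assume "zero_arrow C (h \<cdot> x)"
    then have "zero_arrow C (m \<cdot> (e \<cdot> x))" by (simp add: Cmp_eq_left[OF me])
    then show "zero_arrow C (e \<cdot> x)" by (rule monic_zero_arrow[OF m]) simp_all
  qed
  have "is_kernel C k e"
    by (rule kernelI) (use kernelD[OF h] in \<open>simp_all add: z\<close>)
  then show ?thesis using that e regular_epi_is_cokernel by blast
qed

text \<open>The normal closure of \<open>f: A \<rightarrow> X\<close> is the image under \<open>[f, 1]: A + X \<rightarrow> X\<close> of the kernel
  of \<open>[0, 1]\<close>.\<close>
lemma cokernel_exists: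
  assumes [simp]: "f \<in> Arr C"
  obtains q where "is_cokernel C q f"
proof -
  let ?X = "Cod C f"
  obtain i j where co: "is_coproduct C (Dom C f) ?X i j" using has_coproducts[of "Dom C f" ?X] by auto
  then have [simp]: "i \<in> Arr C" "j \<in> Arr C" "Dom C i = Dom C f" "Dom C j = ?X" "Cod C j = Cod C i"
    by (simp_all add: is_coproduct_def in_hom_iff)
  have cop: "\<exists>!u. u \<in> hom C (Cod C i) (Cod C a) \<and> u \<cdot> i = a \<and> u \<cdot> j = b"
    if "a \<in> Arr C" "b \<in> Arr C" "Dom C a = Dom C f" "Dom C b = ?X" "Cod C b = Cod C a" for a b
  proof -
    have "Cod C a \<in> Obj C" "a \<in> hom C (Dom C f) (Cod C a)" "b \<in> hom C ?X (Cod C a)" using that by (simp_all add: in_hom_iff)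
    then show ?thesis using co unfolding is_coproduct_def by blast
  qed
  have co_eq: "u = v" if uv: "u \<cdot> i = v \<cdot> i" "u \<cdot> j = v \<cdot> j" and [simp]: "u \<in> Arr C" "v \<in> Arr C" "Dom C u = Cod C i" "Dom C v = Cod C i" for u v
  proof -
    have c: "Cod C v = Cod C u" using arg_cong[OF uv(1), of "Cod C"] by simp
    have "\<exists>!w. w \<in> hom C (Cod C i) (Cod C (u \<cdot> i)) \<and> w \<cdot> i = u \<cdot> i \<and> w \<cdot> j = u \<cdot> j" by (rule cop) simp_all
    moreover have "u \<in> hom C (Cod C i) (Cod C (u \<cdot> i))" "v \<in> hom C (Cod C i) (Cod C (u \<cdot> i))" by (simp_all add: in_hom_iff c)
    ultimately show ?thesis using uv by metis
  qed
  obtain zr where zr: "zero_arrow C zr" and [simp]: "Dom C zr = Dom C f" "Cod C zr = ?X"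
    by (rule zero_arrow_exists[of "Dom C f" ?X]) simp_all
  note [simp] = zero_arrow_Arr[OF zr]
  obtain g where "g \<in> hom C (Cod C i) ?X" and g: "g \<cdot> i = f" "g \<cdot> j = Id C ?X" using cop[of f "Id C ?X"] by auto
  then have [simp]: "g \<in> Arr C" "Dom C g = Cod C i" "Cod C g = ?X" by (simp_all add: in_hom_iff)
  obtain o' where "o' \<in> hom C (Cod C i) ?X" and o': "o' \<cdot> i = zr" "o' \<cdot> j = Id C ?X" using cop[of zr "Id C ?X"] by auto
  then have [simp]: "o' \<in> Arr C" "Dom C o' = Cod C i" "Cod C o' = ?X" by (simp_all add: in_hom_iff)
  obtain l where l: "is_kernel C l o'" by (rule kernel_exists[of o']) simp_all
  note [simp] = kernelD(1,3)[OF l]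
  \<comment> \<open>\<open>g\<close> is split by \<open>j\<close>, so it is a regular epimorphism
    and the image under it of the kernel \<open>l\<close> is normal.\<close>
  have ge: "regular_epi C g" by (rule local_lift_regular_epi[OF regular_epi_Id g(2)]) simp_all
  obtain \<epsilon> m where \<epsilon>: "regular_epi C \<epsilon>" and m: "monic m" and [simp]: "Dom C \<epsilon> = Dom C l" "Dom C m = Cod C \<epsilon>"
    "Cod C m = ?X" and m\<epsilon>: "m \<cdot> \<epsilon> = g \<cdot> l" by (rule image_factorization[of "g \<cdot> l"]) simp_all
  note [simp] = regular_epi_Arr[OF \<epsilon>] monic_Arr[OF m]
  have "normal_mono C l" using l by (auto simp: normal_mono_def)
  then have "normal_mono C m" by (rule normal_image[OF _ ge _ m \<epsilon>]) (simp_all add: m\<epsilon>)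
  then obtain q where q: "regular_epi C q" "is_kernel C m q" "is_cokernel C q m" by (rule normal_quotient)
  note [simp] = cokernelD(1,3)[OF q(3)]
  \<comment> \<open>The coprojection \<open>i\<close> is killed by \<open>o'\<close>, so
    \<open>f\<close>, which is \<open>g \<cdot> i\<close>, factors through the image
    \<open>m\<close>.\<close>
  have "i \<preceq> l" using zr by (intro kernelD(6)[OF l]) (simp_all add: o')
  then obtain y where [simp]: "y \<in> Arr C" "Dom C y = Dom C i" "Cod C y = Dom C l" and y: "l \<cdot> y = i" by (rule le_arrowE)
  have fm: "m \<cdot> (\<epsilon> \<cdot> y) = f" by (simp add: Cmp_eq_left[OF m\<epsilon>] y g)
  have "is_cokernel C q f"
  proof (rule cokernelI)
    have "zero_arrow C ((q \<cdot> m) \<cdot> (\<epsilon> \<cdot> y))" using kernelD(4)[OF q(2)] by (rule zero_arrow_Cmp_right) simp_all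
    then show "zero_arrow C (q \<cdot> f)" by (simp add: fm)
    show "u = v" if "u \<in> Arr C" "v \<in> Arr C" "Dom C u = Cod C q" "Dom C v = Cod C q" "u \<cdot> q = v \<cdot> q" for u v
      by (rule regular_epi_epi[OF q(1) that(5)]) (simp_all add: that(1-4))
    fix h assume [simp]: "h \<in> Arr C" "Dom C h = Cod C f" and hf: "zero_arrow C (h \<cdot> f)"
    have "zero_arrow C (h \<cdot> zr)" by (rule zero_arrow_Cmp_left[OF zr]) simp_all
    then have "h \<cdot> f = h \<cdot> zr" by (intro zero_arrow_unique hf) simp_all
    \<comment> \<open>If \<open>h\<close> kills \<open>f\<close>, it cannot tell \<open>g\<close>
      from \<open>o'\<close>, as both coprojections show; hence it kills \<open>g\<close> on the
      kernel of \<open>o'\<close>, that is, \<open>m\<close>.\<close>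
    then have hg: "h \<cdot> g = h \<cdot> o'" by (rule_tac co_eq) (simp_all add: g o')
    have "h \<cdot> (g \<cdot> l) = h \<cdot> (o' \<cdot> l)" by (simp add: Cmp_eq_left[OF hg])
    moreover have "zero_arrow C (h \<cdot> (o' \<cdot> l))" by (rule zero_arrow_Cmp_left[OF kernelD(4)[OF l]]) simp_all
    ultimately have "zero_arrow C ((h \<cdot> m) \<cdot> \<epsilon>)" by (simp add: m\<epsilon>)
    then have "zero_arrow C (h \<cdot> m)" by (rule regular_epi_zero_arrow[OF \<epsilon>]) simp_all
    then obtain u where "u \<in> Arr C" "Dom C u = Cod C q" "Cod C u = Cod C h" "u \<cdot> q = h"
      by (rule_tac cokernel_factor[OF q(3)]) simp_all
    then show "\<exists>u. u \<in> Arr C \<and> Dom C u = Cod C q \<and> Cod C u = Cod C h \<and> u \<cdot> q = h" by blast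
  qed simp_all
  then show ?thesis by (rule that)
qed

end
section \<open>Normal closures and the lattice of normal subobjects\<close>

text \<open>
  Normal closures, and hence joins of normal subobjects, are described by the arrows that vanish on
  the generators; this avoids the choice of representatives.
\<close>
definition (in category) in_closure :: "'o \<Rightarrow> 'm set \<Rightarrow> 'm \<Rightarrow> bool" where
  "in_closure X S x \<longleftrightarrow> (\<forall>h. h \<in> Arr C \<and> Dom C h = X \<and> (\<forall>k \<in> S. zero_arrow C (h \<cdot> k)) \<longrightarrow> zero_arrow C (h \<cdot> x))"

text \<open>A joint cokernel of the arrows in \<open>S\<close>; uniqueness of the factorization is
  implied by \<open>q\<close> being a regular epimorphism.\<close>

definition (in category) is_quotient :: "'m set \<Rightarrow> 'm \<Rightarrow> bool" where
  "is_quotient S q \<longleftrightarrow> regular_epi C q \<and> (\<forall>k \<in> S. zero_arrow C (q \<cdot> k)) \<and>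
     (\<forall>h. h \<in> Arr C \<and> Dom C h = Dom C q \<and> (\<forall>k \<in> S. zero_arrow C (h \<cdot> k)) \<longrightarrow>
       (\<exists>u. u \<in> Arr C \<and> Dom C u = Cod C q \<and> Cod C u = Cod C h \<and> u \<cdot> q = h))"

section \<open>Calculus of normal closures and quotients\<close>

context semi_abelian_category
begin

lemma in_closure_trans:
  assumes "in_closure X S x" "\<And>a. a \<in> S \<Longrightarrow> in_closure X S' a"
  shows "in_closure X S' x"
  using assms unfolding in_closure_def by blast

lemma in_closure_member: "x \<in> S \<Longrightarrow> in_closure X S x"
  unfolding in_closure_def by blast

lemma in_closure_mono: "in_closure X S x \<Longrightarrow> S \<subseteq> S' \<Longrightarrow> in_closure X S' x"
  unfolding in_closure_def by blast

lemma in_closure_Cmp: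
  assumes "in_closure X S x" and [simp]: "x \<in> Arr C" "Cod C x = X" "y \<in> Arr C" "Cod C y = Dom C x"
  shows "in_closure X S (x \<cdot> y)"
  unfolding in_closure_def
proof (intro allI impI)
  fix h assume h: "h \<in> Arr C \<and> Dom C h = X \<and> (\<forall>k \<in> S. zero_arrow C (h \<cdot> k))"
  then have "zero_arrow C (h \<cdot> x)" using assms(1) unfolding in_closure_def by blast
  then have "zero_arrow C ((h \<cdot> x) \<cdot> y)" by (rule zero_arrow_Cmp_right) (use h in simp_all)
  then show "zero_arrow C (h \<cdot> (x \<cdot> y))" using h by simp
qed

lemma in_closure_le:
  assumes "a \<preceq> b" "b \<in> S" and [simp]: "b \<in> Arr C" "Cod C b = X"
  shows "in_closure X S a"
proof -
  obtain u where "u \<in> Arr C" "Dom C u = Dom C a" "Cod C u = Dom C b" "b \<cdot> u = a" using assms(1) by (rule le_arrowE)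
  then show ?thesis using in_closure_Cmp[OF in_closure_member[OF assms(2)], of X u] by simp
qed

lemma in_closure_local:
  assumes "in_closure X S (x \<cdot> c)" and c: "regular_epi C c" and [simp]: "x \<in> Arr C" "Cod C x = X" "Cod C c = Dom C x"
  shows "in_closure X S x"
  unfolding in_closure_def
proof (intro allI impI)
  note [simp] = regular_epi_Arr[OF c]
  fix h assume h: "h \<in> Arr C \<and> Dom C h = X \<and> (\<forall>k \<in> S. zero_arrow C (h \<cdot> k))"
  then have "zero_arrow C ((h \<cdot> x) \<cdot> c)" using assms(1) unfolding in_closure_def by simp
  then show "zero_arrow C (h \<cdot> x)" by (rule regular_epi_zero_arrow[OF c]) (use h in simp_all)
qed

lemma in_closure_empty:
  assumes "in_closure X {} x" and [simp]: "x \<in> Arr C" "Cod C x = X"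
  shows "zero_arrow C x"
proof -
  have [simp]: "X \<in> Obj C" using Obj_Cod[of x] by simp
  show ?thesis using assms(1)[unfolded in_closure_def, rule_format, of "Id C X"] by simp
qed

lemma quotientD:
  assumes "is_quotient S q"
  shows "regular_epi C q" "q \<in> Arr C" "k \<in> S \<Longrightarrow> zero_arrow C (q \<cdot> k)"
  using assms by (simp_all add: is_quotient_def)

lemma quotient_factor:
  assumes "is_quotient S q" "h \<in> Arr C" "Dom C h = Dom C q" "\<And>k. k \<in> S \<Longrightarrow> zero_arrow C (h \<cdot> k)"
  obtains u where "u \<in> Arr C" "Dom C u = Cod C q" "Cod C u = Cod C h" "u \<cdot> q = h"
  using assms unfolding is_quotient_def by blast

text \<open>\<open>q\<close> is one of the test arrows of the closure, and every other one factors
  through it; so the kernel of \<open>q\<close> consists of the elements of the normal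
  closure.\<close>

lemma quotient_zero_iff:
  assumes q: "is_quotient S q" and [simp]: "x \<in> Arr C" "Cod C x = Dom C q"
  shows "zero_arrow C (q \<cdot> x) \<longleftrightarrow> in_closure (Dom C q) S x"
proof
  note [simp] = quotientD(2)[OF q]
  assume z: "zero_arrow C (q \<cdot> x)"
  show "in_closure (Dom C q) S x" unfolding in_closure_def
  proof (intro allI impI)
    fix h assume h: "h \<in> Arr C \<and> Dom C h = Dom C q \<and> (\<forall>k \<in> S. zero_arrow C (h \<cdot> k))"
    then obtain u where u: "u \<in> Arr C" "Dom C u = Cod C q" "Cod C u = Cod C h" "u \<cdot> q = h"
      by (rule_tac quotient_factor[OF q, of h]) auto
    have "zero_arrow C (u \<cdot> (q \<cdot> x))" by (rule zero_arrow_Cmp_left[OF z]) (simp_all add: u)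
    then show "zero_arrow C (h \<cdot> x)" by (simp add: Cmp_eq_left[OF u(4)] u(1,2))
  qed
next
  assume "in_closure (Dom C q) S x"
  then show "zero_arrow C (q \<cdot> x)" using quotientD[OF q] unfolding in_closure_def by blast
qed

text \<open>One generator at a time: the next quotient is the cokernel of the image of the new
  generator in the previous one.\<close>

lemma quotient_exists:
  assumes "finite S" "X \<in> Obj C" "\<And>k. k \<in> S \<Longrightarrow> k \<in> Arr C \<and> Cod C k = X"
  obtains q where "is_quotient S q" "Dom C q = X"
proof -
  have "\<exists>q. is_quotient S q \<and> Dom C q = X" using assms(1,3)
  proof (induction S)
    case empty
    have "is_quotient {} (Id C X)" unfolding is_quotient_def
      using assms(2) by (auto simp: regular_epi_Id)
    then show ?case using assms(2) by (intro exI[of _ "Id C X"]) simp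
  next
    case (insert k S)
    then obtain q where q: "is_quotient S q" and [simp]: "Dom C q = X" by auto
    have k: "k \<in> Arr C" "Cod C k = X" using insert.prems by auto
    have kS: "j \<in> Arr C" "Cod C j = X" if "j \<in> S" for j using insert.prems that by auto
    note [simp] = quotientD(2)[OF q] k
    obtain r where r: "is_cokernel C r (q \<cdot> k)" by (rule cokernel_exists[of "q \<cdot> k"]) simp_all
    have [simp]: "r \<in> Arr C" "Dom C r = Cod C q" using cokernelD[OF r] by simp_all
    have "is_quotient (insert k S) (r \<cdot> q)" unfolding is_quotient_def
    proof (intro conjI ballI allI impI)
      show "regular_epi C (r \<cdot> q)" by (intro regular_epi_Cmp quotientD(1)[OF q] cokernel_regular_epi[OF r]) simp
      show "zero_arrow C (r \<cdot> q \<cdot> j)" if j: "j \<in> insert k S" for j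
      proof (cases "j = k")
        case True then show ?thesis using cokernelD(4)[OF r] by simp
      next
        case False
        then have j: "j \<in> S" using j by simp
        have "zero_arrow C (r \<cdot> (q \<cdot> j))" by (rule zero_arrow_Cmp_left[OF quotientD(3)[OF q j]]) (simp_all add: kS[OF j])
        then show ?thesis by (simp add: kS[OF j])
      qed
      fix h assume h: "h \<in> Arr C \<and> Dom C h = Dom C (r \<cdot> q) \<and> (\<forall>k\<in>insert k S. zero_arrow C (h \<cdot> k))"
      then obtain u where u[simp]: "u \<in> Arr C" "Dom C u = Cod C q" "Cod C u = Cod C h" and uq: "u \<cdot> q = h"
        by (rule_tac quotient_factor[OF q, of h]) auto
      have "zero_arrow C (u \<cdot> (q \<cdot> k))" using h by (simp add: Cmp_eq_left[OF uq])
      then obtain v where v[simp]: "v \<in> Arr C" "Dom C v = Cod C r" "Cod C v = Cod C u" and vr: "v \<cdot> r = u"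
        by (rule_tac cokernel_factor[OF r, of u]) simp_all
      show "\<exists>u. u \<in> Arr C \<and> Dom C u = Cod C (r \<cdot> q) \<and> Cod C u = Cod C h \<and> u \<cdot> (r \<cdot> q) = h"
        by (intro exI[of _ v]) (simp add: Cmp_eq_left[OF vr] uq)
    qed
    then show ?case by (intro exI[of _ "r \<cdot> q"]) simp
  qed
  then show ?thesis using that by blast
qed

text \<open>The image \<open>m\<close> of \<open>k\<close> in the quotient by \<open>S\<close> is
  normal. Composing \<open>q\<close> with the quotient \<open>r\<close> by this image gives a test
  arrow, so \<open>q \<cdot> x\<close> lies in the kernel of \<open>r\<close>, which is
  \<open>m\<close>, and can be lifted to \<open>k\<close> on a cover.\<close>

lemma in_closure_insert:
  assumes q: "is_quotient S q" and k: "normal_mono C k" "Cod C k = Dom C q"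
    and x[simp]: "x \<in> Arr C" "Cod C x = Dom C q" and cl: "in_closure (Dom C q) (insert k S) x"
    and S: "\<And>j. j \<in> S \<Longrightarrow> j \<in> Arr C \<and> Cod C j = Dom C q"
  obtains c y where "regular_epi C c" "Cod C c = Dom C x" "y \<in> Arr C" "Dom C y = Dom C c" "Cod C y = Dom C k"
    "q \<cdot> (x \<cdot> c) = q \<cdot> (k \<cdot> y)"
proof -
  note [simp] = quotientD(2)[OF q] monic_Arr[OF normal_mono_monic[OF k(1)]] k(2)
  obtain \<epsilon> m where \<epsilon>: "regular_epi C \<epsilon>" and m: "monic m" and [simp]: "Dom C \<epsilon> = Dom C k" "Dom C m = Cod C \<epsilon>"
    "Cod C m = Cod C q" and m\<epsilon>: "m \<cdot> \<epsilon> = q \<cdot> k" by (rule image_factorization[of "q \<cdot> k"]) simp_all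
  note [simp] = regular_epi_Arr[OF \<epsilon>] monic_Arr[OF m]
  have "normal_mono C m" by (rule normal_image[OF k(1) quotientD(1)[OF q] k(2) m \<epsilon>]) (simp_all add: m\<epsilon>)
  then obtain r where r: "regular_epi C r" "is_kernel C m r" "is_cokernel C r m" by (rule normal_quotient)
  have [simp]: "r \<in> Arr C" "Dom C r = Cod C q" using cokernelD[OF r(3)] by simp_all
  have "zero_arrow C ((r \<cdot> q) \<cdot> j)" if j: "j \<in> insert k S" for j
  proof (cases "j = k")
    case True
    have "zero_arrow C ((r \<cdot> m) \<cdot> \<epsilon>)" by (rule zero_arrow_Cmp_right[OF kernelD(4)[OF r(2)]]) simp_all
    then show ?thesis by (simp add: m\<epsilon> True)
  next
    case False
    then have j: "j \<in> S" using j by simp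
    have "zero_arrow C (r \<cdot> (q \<cdot> j))" by (rule zero_arrow_Cmp_left[OF quotientD(3)[OF q j]]) (simp_all add: S[OF j])
    then show ?thesis by (simp add: S[OF j])
  qed
  moreover have "r \<cdot> q \<in> Arr C \<and> Dom C (r \<cdot> q) = Dom C q" by simp
  ultimately have "zero_arrow C ((r \<cdot> q) \<cdot> x)" using cl unfolding in_closure_def by blast
  then have "q \<cdot> x \<preceq> m" by (intro kernelD(6)[OF r(2)]) simp_all
  then obtain u where [simp]: "u \<in> Arr C" "Dom C u = Dom C (q \<cdot> x)" "Cod C u = Dom C m" and u: "m \<cdot> u = q \<cdot> x" by (rule le_arrowE)
  obtain c y where c: "regular_epi C c" and [simp]: "Cod C c = Dom C u" "y \<in> Arr C" "Dom C y = Dom C c" "Cod C y = Dom C \<epsilon>"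
    and y: "\<epsilon> \<cdot> y = u \<cdot> c" by (rule regular_epi_lift[OF \<epsilon>, of u]) simp_all
  note [simp] = regular_epi_Arr[OF c]
  have "q \<cdot> (x \<cdot> c) = m \<cdot> (u \<cdot> c)" by (simp add: Cmp_eq_left[OF u])
  also have "\<dots> = q \<cdot> (k \<cdot> y)" by (simp add: y[symmetric] Cmp_eq_left[OF m\<epsilon>])
  finally show ?thesis by (rule_tac that[OF c]) simp_all
qed

text \<open>Locally \<open>x\<close> equals some \<open>a \<cdot> y\<close> modulo \<open>S\<close>;
  as \<open>S\<close> is contained in \<open>T\<close>, this \<open>a \<cdot> y\<close> lies in the
  closure of \<open>T\<close> along with \<open>x\<close>. This is the modular law of the lattice of
  normal subobjects, expressed by closures.\<close>

lemma modular_in_closure: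
  assumes fin: "finite S" and S: "\<And>j. j \<in> S \<Longrightarrow> j \<in> Arr C \<and> Cod C j = X" and a: "normal_mono C a" "Cod C a = X"
    and [simp]: "x \<in> Arr C" "Cod C x = X" and cl: "in_closure X (insert a S) x" and T: "in_closure X T x" "S \<subseteq> T"
  shows "in_closure X ({b \<in> Arr C. Cod C b = X \<and> b \<preceq> a \<and> in_closure X T b} \<union> S) x"
proof -
  have X: "X \<in> Obj C" using Obj_Cod[of x] by simp
  obtain q where q: "is_quotient S q" and [simp]: "Dom C q = X" by (rule quotient_exists[OF fin X S])
  note [simp] = quotientD(2)[OF q] monic_Arr[OF normal_mono_monic[OF a(1)]] a(2)
  obtain c y where c: "regular_epi C c" and [simp]: "Cod C c = Dom C x" "y \<in> Arr C" "Dom C y = Dom C c" "Cod C y = Dom C a"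
    and eq: "q \<cdot> (x \<cdot> c) = q \<cdot> (a \<cdot> y)"
    by (rule in_closure_insert[OF q a(1), of x]) (use cl S in simp_all)
  note [simp] = regular_epi_Arr[OF c]
  \<comment> \<open>Test arrows that kill \<open>S\<close> factor through \<open>q\<close> and so do
    not distinguish \<open>x \<cdot> c\<close> from \<open>a \<cdot> y\<close>.\<close>
  have hxc: "h \<cdot> (x \<cdot> c) = h \<cdot> (a \<cdot> y)" if hS: "h \<in> Arr C" "Dom C h = X" "\<And>k. k \<in> S \<Longrightarrow> zero_arrow C (h \<cdot> k)" for h
  proof -
    obtain t where t: "t \<in> Arr C" "Dom C t = Cod C q" "Cod C t = Cod C h" "t \<cdot> q = h"
      by (rule quotient_factor[OF q, of h]) (simp_all add: hS)
    have "t \<cdot> (q \<cdot> (x \<cdot> c)) = t \<cdot> (q \<cdot> (a \<cdot> y))" using eq by simp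
    then show ?thesis by (simp add: Cmp_eq_left[OF t(4)] t(1-3))
  qed
  have clxc: "in_closure X T (x \<cdot> c)" by (rule in_closure_Cmp[OF T(1)]) simp_all
  have "in_closure X T (a \<cdot> y)" unfolding in_closure_def
  proof (intro allI impI)
    fix h assume h: "h \<in> Arr C \<and> Dom C h = X \<and> (\<forall>k \<in> T. zero_arrow C (h \<cdot> k))"
    then have "zero_arrow C (h \<cdot> (x \<cdot> c))" using clxc unfolding in_closure_def by blast
    then show "zero_arrow C (h \<cdot> (a \<cdot> y))" using h T(2) by (subst hxc[symmetric]) auto
  qed
  then have mem: "a \<cdot> y \<in> {b \<in> Arr C. Cod C b = X \<and> b \<preceq> a \<and> in_closure X T b}"
    by (simp add: le_arrowI[of a y])
  have "in_closure X ({b \<in> Arr C. Cod C b = X \<and> b \<preceq> a \<and> in_closure X T b} \<union> S) (x \<cdot> c)" unfolding in_closure_def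
  proof (intro allI impI)
    fix h assume h: "h \<in> Arr C \<and> Dom C h = X \<and> (\<forall>k \<in> {b \<in> Arr C. Cod C b = X \<and> b \<preceq> a \<and>
      (\<forall>h. h \<in> Arr C \<and> Dom C h = X \<and> (\<forall>k \<in> T. zero_arrow C (h \<cdot> k)) \<longrightarrow> zero_arrow C (h \<cdot> b))} \<union> S. zero_arrow C (h \<cdot> k))"
    then have "zero_arrow C (h \<cdot> (a \<cdot> y))" using mem unfolding in_closure_def by blast
    then show "zero_arrow C (h \<cdot> (x \<cdot> c))" using h by (subst hxc) auto
  qed
  then show ?thesis by (rule in_closure_local[OF _ c]) simp_all
qed

text \<open>A closure formed in \<open>Cod C n\<close> can be computed in the subobject
  \<open>n\<close> because the generators are normal in the larger object. By induction the quotient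
  \<open>r\<close> of \<open>Dom C n\<close> embeds in the quotient \<open>q\<close> of
  \<open>Cod C n\<close>; the local congruence of \<open>x\<close> to an element of the new
  generator, found modulo \<open>q\<close>, then holds modulo \<open>r\<close>.\<close>

lemma in_closure_restrict:
  assumes n: "monic n" and fin: "finite Z"
    and \<kappa>: "\<And>z. z \<in> Z \<Longrightarrow> \<kappa> z \<in> Arr C \<and> Cod C (\<kappa> z) = Dom C n \<and> normal_mono C (n \<cdot> \<kappa> z)"
    and x: "x \<in> Arr C" "Cod C x = Dom C n"
    and cl: "in_closure (Cod C n) ((\<lambda>z. n \<cdot> \<kappa> z) ` Z) (n \<cdot> x)"
  shows "in_closure (Dom C n) (\<kappa> ` Z) x"
  using fin \<kappa> x cl
proof (induction Z arbitrary: x)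
  case empty
  note [simp] = monic_Arr[OF n] empty(2,3)
  have "zero_arrow C (n \<cdot> x)" using empty(4) by (intro in_closure_empty) simp_all
  then have "zero_arrow C x" by (rule monic_zero_arrow[OF n]) simp_all
  then show ?case unfolding in_closure_def by simp
next
  case (insert z Z)
  note [simp] = monic_Arr[OF n] insert.prems(2,3)
  have \<kappa>z: "\<kappa> w \<in> Arr C" "Cod C (\<kappa> w) = Dom C n" "normal_mono C (n \<cdot> \<kappa> w)" if "w \<in> insert z Z" for w
    using insert.prems(1)[OF that] by simp_all
  note [simp] = \<kappa>z(1,2)[of z, simplified]
  obtain q where q: "is_quotient ((\<lambda>z. n \<cdot> \<kappa> z) ` Z) q" and [simp]: "Dom C q = Cod C n"
    by (rule quotient_exists[of "(\<lambda>z. n \<cdot> \<kappa> z) ` Z" "Cod C n"]) (use insert.hyps \<kappa>z in auto)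
  obtain r where r: "is_quotient (\<kappa> ` Z) r" and [simp]: "Dom C r = Dom C n"
    by (rule quotient_exists[of "\<kappa> ` Z" "Dom C n"]) (use insert.hyps \<kappa>z in auto)
  note [simp] = quotientD(2)[OF q] quotientD(2)[OF r]
  have "zero_arrow C ((q \<cdot> n) \<cdot> k)" if k: "k \<in> \<kappa> ` Z" for k
  proof -
    obtain w where w: "w \<in> Z" "k = \<kappa> w" using k by auto
    then show ?thesis using quotientD(3)[OF q, of "n \<cdot> \<kappa> w"] \<kappa>z[of w] by simp
  qed
  then obtain j where [simp]: "j \<in> Arr C" "Dom C j = Cod C r" "Cod C j = Cod C q" and jr: "j \<cdot> r = q \<cdot> n"
    by (rule_tac quotient_factor[OF r, of "q \<cdot> n"]) simp_all
  have IH: "in_closure (Dom C n) (\<kappa> ` Z) y"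
    if "y \<in> Arr C" "Cod C y = Dom C n" "in_closure (Cod C n) ((\<lambda>z. n \<cdot> \<kappa> z) ` Z) (n \<cdot> y)" for y
    by (rule insert.IH) (use that \<kappa>z in auto)
  \<comment> \<open>The induction hypothesis gives that the comparison \<open>j\<close> of the two
    quotients has trivial kernel.\<close>
  have jm: "monic j"
  proof (rule trivial_kernel_monic)
    fix y assume [simp]: "y \<in> Arr C" "Cod C y = Dom C j" and jy: "zero_arrow C (j \<cdot> y)"
    obtain c t where c: "regular_epi C c" and [simp]: "Cod C c = Dom C y" "t \<in> Arr C" "Dom C t = Dom C c" "Cod C t = Dom C r"
      and t: "r \<cdot> t = y \<cdot> c" by (rule regular_epi_lift[OF quotientD(1)[OF r], of y]) simp_all
    note [simp] = regular_epi_Arr[OF c]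
    have "zero_arrow C ((j \<cdot> y) \<cdot> c)" by (rule zero_arrow_Cmp_right[OF jy]) simp_all
    then have "zero_arrow C (j \<cdot> (r \<cdot> t))" by (simp add: t)
    then have "zero_arrow C (q \<cdot> (n \<cdot> t))" by (simp add: Cmp_eq_left[OF jr])
    then have "in_closure (Dom C n) (\<kappa> ` Z) t" using quotient_zero_iff[OF q, of "n \<cdot> t"] by (intro IH) simp_all
    then have "zero_arrow C (y \<cdot> c)" using quotient_zero_iff[OF r, of t] by (simp add: t)
    then show "zero_arrow C y" by (rule regular_epi_zero_arrow[OF c]) simp_all
  qed simp
  obtain c y where c: "regular_epi C c" and [simp]: "Cod C c = Dom C (n \<cdot> x)" "y \<in> Arr C" "Dom C y = Dom C c" "Cod C y = Dom C (n \<cdot> \<kappa> z)"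
    and eq: "q \<cdot> ((n \<cdot> x) \<cdot> c) = q \<cdot> ((n \<cdot> \<kappa> z) \<cdot> y)"
    by (rule in_closure_insert[OF q \<kappa>z(3)[of z], of "n \<cdot> x"]) (use insert.prems(4) \<kappa>z in \<open>auto\<close>)
  note [simp] = regular_epi_Arr[OF c]
  have "j \<cdot> (r \<cdot> (x \<cdot> c)) = j \<cdot> (r \<cdot> (\<kappa> z \<cdot> y))" using eq by (simp add: Cmp_eq_left[OF jr])
  then have rxc: "r \<cdot> (x \<cdot> c) = r \<cdot> (\<kappa> z \<cdot> y)" by (rule monicD[OF jm]) simp_all
  have "in_closure (Dom C n) (\<kappa> ` insert z Z) (x \<cdot> c)" unfolding in_closure_def
  proof (intro allI impI)
    fix h assume h: "h \<in> Arr C \<and> Dom C h = Dom C n \<and> (\<forall>k\<in>\<kappa> ` insert z Z. zero_arrow C (h \<cdot> k))"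
    then obtain t where t: "t \<in> Arr C" "Dom C t = Cod C r" "Cod C t = Cod C h" "t \<cdot> r = h"
      by (rule_tac quotient_factor[OF r, of h]) auto
    have [simp]: "h \<in> Arr C" "Dom C h = Dom C n" using h by simp_all
    have "zero_arrow C (h \<cdot> \<kappa> z)" using h by simp
    then have "zero_arrow C ((h \<cdot> \<kappa> z) \<cdot> y)" by (rule zero_arrow_Cmp_right) simp_all
    then have z: "zero_arrow C (h \<cdot> (\<kappa> z \<cdot> y))" by simp
    have "t \<cdot> (r \<cdot> (x \<cdot> c)) = t \<cdot> (r \<cdot> (\<kappa> z \<cdot> y))" by (simp add: rxc)
    then have "h \<cdot> (x \<cdot> c) = h \<cdot> (\<kappa> z \<cdot> y)" by (simp add: Cmp_eq_left[OF t(4)] t(1,2))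
    with z show "zero_arrow C (h \<cdot> (x \<cdot> c))" by simp
  qed
  then show ?case by (rule in_closure_local[OF _ c]) simp_all
qed

section \<open>Meets and joins of normal subobjects\<close>

lemma carrier_normal_subobjects: "k \<in> carrier (normal_subobjects C X) \<longleftrightarrow> normal_mono C k \<and> Cod C k = X"
  by (simp add: normal_subobjects_def)

lemma le_normal_subobjects: "le (normal_subobjects C X) k l \<longleftrightarrow> k \<preceq> l"
  by (simp add: normal_subobjects_def)

text \<open>A meet of two kernels is the kernel of the pairing of the arrows they are kernels of;
  the empty meet is the identity, the kernel of a zero arrow.\<close>

lemma normal_intersection_exists:
  assumes X: "X \<in> Obj C" and fin: "finite A" and A: "\<And>a. a \<in> A \<Longrightarrow> normal_mono C a \<and> Cod C a = X"
  shows "\<exists>m. normal_mono C m \<and> Cod C m = X \<and> (\<forall>x. x \<in> Arr C \<and> Cod C x = X \<longrightarrow> (x \<preceq> m \<longleftrightarrow> (\<forall>a \<in> A. x \<preceq> a)))"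
  using fin A
proof (induction A)
  case empty
  obtain z where z: "zero_arrow C z" "Dom C z = X" "Cod C z = X" by (rule zero_arrow_exists[OF X X])
  have i: "x \<preceq> Id C X" if "x \<in> Arr C" "Cod C x = X" for x by (rule le_arrowI[of _ x]) (use that X in simp_all)
  have "is_kernel C (Id C X) z"
    by (rule kernelI) (use z X i in \<open>auto simp: monic_def\<close>)
  then have "normal_mono C (Id C X)" by (auto simp: normal_mono_def)
  then show ?case using X i by (intro exI[of _ "Id C X"]) simp
next
  case (insert a A)
  then obtain m where m: "normal_mono C m" "Cod C m = X" "\<And>x. \<lbrakk>x \<in> Arr C; Cod C x = X\<rbrakk> \<Longrightarrow> x \<preceq> m \<longleftrightarrow> (\<forall>a \<in> A. x \<preceq> a)"
    by auto
  obtain f where f: "is_kernel C m f" using m(1) by (rule normal_monoE)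
  have "normal_mono C a" and ca: "Cod C a = X" using insert.prems by auto
  then obtain g where g: "is_kernel C a g" by (rule_tac normal_monoE)
  have [simp]: "f \<in> Arr C" "Dom C f = X" "g \<in> Arr C" "Dom C g = X" using kernelD(2,3)[OF f] kernelD(2,3)[OF g] m(2) ca by simp_all
  obtain p1 p2 where pr: "is_product p1 p2" and [simp]: "Cod C p1 = Cod C f" "Cod C p2 = Cod C g"
    by (rule has_products[of "Cod C f" "Cod C g"]) simp_all
  note [simp] = productD[OF pr]
  obtain h where [simp]: "h \<in> Arr C" "Dom C h = X" "Cod C h = Dom C p1" and h: "p1 \<cdot> h = f" "p2 \<cdot> h = g"
    by (rule product_pair[OF pr, of f g]) simp_all
  obtain l where l: "is_kernel C l h" by (rule kernel_exists[of h]) simp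
  have "x \<preceq> l \<longleftrightarrow> (\<forall>b \<in> insert a A. x \<preceq> b)" if [simp]: "x \<in> Arr C" "Cod C x = X" for x
  proof -
    have "zero_arrow C (h \<cdot> x) \<longleftrightarrow> zero_arrow C (f \<cdot> x) \<and> zero_arrow C (g \<cdot> x)"
    proof
      assume z: "zero_arrow C (h \<cdot> x)"
      have "zero_arrow C (p1 \<cdot> (h \<cdot> x))" "zero_arrow C (p2 \<cdot> (h \<cdot> x))" by (intro zero_arrow_Cmp_left z; simp)+
      then show "zero_arrow C (f \<cdot> x) \<and> zero_arrow C (g \<cdot> x)" by (simp add: Cmp_eq_left[OF h(1)] Cmp_eq_left[OF h(2)])
    next
      assume z: "zero_arrow C (f \<cdot> x) \<and> zero_arrow C (g \<cdot> x)"
      obtain w where w: "zero_arrow C w" and [simp]: "Dom C w = Dom C x" "Cod C w = Dom C p1"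
        by (rule zero_arrow_exists[of "Dom C x" "Dom C p1"]) simp_all
      note [simp] = zero_arrow_Arr[OF w]
      have 1: "zero_arrow C (p1 \<cdot> w)" "zero_arrow C (p2 \<cdot> w)" by (intro zero_arrow_Cmp_left w; simp)+
      have "h \<cdot> x = w"
      proof (rule product_eq[OF pr])
        show "p1 \<cdot> (h \<cdot> x) = p1 \<cdot> w"
          unfolding Cmp_eq_left[OF h(1), of x, simplified] by (rule zero_arrow_unique[OF _ 1(1)]) (simp_all add: z)
        show "p2 \<cdot> (h \<cdot> x) = p2 \<cdot> w"
          unfolding Cmp_eq_left[OF h(2), of x, simplified] by (rule zero_arrow_unique[OF _ 1(2)]) (simp_all add: z)
      qed simp_all
      with w show "zero_arrow C (h \<cdot> x)" by simp
    qed
    then show ?thesis using kernel_le_iff[OF l, of x] kernel_le_iff[OF f, of x] kernel_le_iff[OF g, of x] m(3)[of x] by auto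
  qed
  moreover have "normal_mono C l" "Cod C l = X" using l kernelD(3)[OF l] by (auto simp: normal_mono_def)
  ultimately show ?case by blast
qed

text \<open>The infimum of the ordered structure is selected by choice among the greatest lower
  bounds; it is compared in both directions with the intersection \<open>l\<close> constructed from
  kernels, and so has the same members.\<close>

lemma inf_normal_subobjects:
  assumes X: "X \<in> Obj C" and fin: "finite A" and A: "A \<subseteq> carrier (normal_subobjects C X)"
  defines "m \<equiv> \<Sqinter>\<^bsub>normal_subobjects C X\<^esub> A"
  shows "m \<in> carrier (normal_subobjects C X)"
    and "\<And>x. \<lbrakk>x \<in> Arr C; Cod C x = X\<rbrakk> \<Longrightarrow> x \<preceq> m \<longleftrightarrow> (\<forall>a \<in> A. x \<preceq> a)"
proof -
  let ?L = "normal_subobjects C X"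
  have A': "normal_mono C a \<and> Cod C a = X" if "a \<in> A" for a using A that by (auto simp: carrier_normal_subobjects)
  from normal_intersection_exists[OF X fin A'] obtain l where l: "normal_mono C l" "Cod C l = X"
      "\<And>x. \<lbrakk>x \<in> Arr C; Cod C x = X\<rbrakk> \<Longrightarrow> x \<preceq> l \<longleftrightarrow> (\<forall>a \<in> A. x \<preceq> a)" by blast
  have [simp]: "l \<in> Arr C" using l(1) by (simp add: monic_Arr normal_mono_monic)
  have low: "y \<in> Lower ?L A \<longleftrightarrow> normal_mono C y \<and> Cod C y = X \<and> (\<forall>a \<in> A. y \<preceq> a)" for y
    using A by (auto simp: Lower_def carrier_normal_subobjects le_normal_subobjects)
  have na: "normal_mono C y \<Longrightarrow> y \<in> Arr C" for y by (simp add: monic_Arr normal_mono_monic)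
  have gl: "greatest ?L l (Lower ?L A)" unfolding greatest_def
  proof (intro conjI ballI)
    show "Lower ?L A \<subseteq> carrier ?L" by (auto simp: Lower_def)
    show "l \<in> Lower ?L A" using l le_arrow_refl[of l] by (simp add: low)
    fix y assume "y \<in> Lower ?L A"
    then show "le ?L y l" using l(3)[of y] na by (simp add: low le_normal_subobjects)
  qed
  then have "greatest ?L m (Lower ?L A)" unfolding m_def inf_def by (rule someI)
  then have m: "m \<in> Lower ?L A" "l \<preceq> m" using gl by (auto simp: greatest_def le_normal_subobjects)
  then have m': "normal_mono C m" "Cod C m = X" "m \<preceq> l" using l(3)[of m] na[of m] by (simp_all add: low)
  then show "m \<in> carrier ?L" by (simp add: carrier_normal_subobjects)
  fix x assume "x \<in> Arr C" "Cod C x = X"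
  then show "x \<preceq> m \<longleftrightarrow> (\<forall>a \<in> A. x \<preceq> a)" using l(3)[of x] le_arrow_trans m' m(2) na[of m] \<open>l \<in> Arr C\<close> by metis
qed

text \<open>The least upper bound is the kernel \<open>l\<close> of the quotient by all of
  \<open>A\<close>: an upper bound \<open>y\<close> is the kernel of some \<open>h\<close>, and
  \<open>h\<close> is a test arrow for the closure of \<open>A\<close>. The selected supremum is
  again compared with \<open>l\<close>.\<close>

lemma sup_normal_subobjects:
  assumes X: "X \<in> Obj C" and fin: "finite A" and A: "A \<subseteq> carrier (normal_subobjects C X)"
  defines "m \<equiv> \<Squnion>\<^bsub>normal_subobjects C X\<^esub> A"
  shows "m \<in> carrier (normal_subobjects C X)"
    and "\<And>x. \<lbrakk>x \<in> Arr C; Cod C x = X\<rbrakk> \<Longrightarrow> x \<preceq> m \<longleftrightarrow> in_closure X A x"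
proof -
  let ?L = "normal_subobjects C X"
  have na: "normal_mono C y \<Longrightarrow> y \<in> Arr C" for y by (simp add: monic_Arr normal_mono_monic)
  have A': "normal_mono C a" "a \<in> Arr C" "Cod C a = X" if "a \<in> A" for a
    using A that na by (auto simp: carrier_normal_subobjects)
  obtain q where q: "is_quotient A q" and [simp]: "Dom C q = X" by (rule quotient_exists[OF fin X]) (auto simp: A')
  note [simp] = quotientD(2)[OF q]
  obtain l where k: "is_kernel C l q" by (rule kernel_exists[of q]) simp_all
  have l: "normal_mono C l" "l \<in> Arr C" "Cod C l = X" "zero_arrow C (q \<cdot> l)" using k kernelD[OF k] by (auto simp: normal_mono_def)
  have lx: "x \<preceq> l \<longleftrightarrow> in_closure X A x" if "x \<in> Arr C" "Cod C x = X" for x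
    using kernel_le_iff[OF k, of x] quotient_zero_iff[OF q, of x] that by simp
  have up: "y \<in> Upper ?L A \<longleftrightarrow> normal_mono C y \<and> Cod C y = X \<and> (\<forall>a \<in> A. a \<preceq> y)" for y
    using A by (auto simp: Upper_def carrier_normal_subobjects le_normal_subobjects)
  have le: "least ?L l (Upper ?L A)" unfolding least_def
  proof (intro conjI ballI)
    show "Upper ?L A \<subseteq> carrier ?L" by (auto simp: Upper_def)
    show "l \<in> Upper ?L A" using l lx A' by (auto simp: up intro: in_closure_member)
    fix y assume "y \<in> Upper ?L A"
    then have y: "normal_mono C y" "Cod C y = X" "\<forall>a \<in> A. a \<preceq> y" by (simp_all add: up)
    obtain h where h: "is_kernel C y h" using y(1) by (rule normal_monoE)
    have "zero_arrow C (h \<cdot> a)" if "a \<in> A" for a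
      using kernel_le_iff[OF h, of a] y(2,3) A'[OF that] that kernelD(3)[OF h] by simp
    moreover have "in_closure X A l" using lx[of l] l le_arrow_refl by simp
    ultimately have "zero_arrow C (h \<cdot> l)" using kernelD(2,3)[OF h] y(2) unfolding in_closure_def by simp
    then show "le ?L l y" using kernelD(6)[OF h, of l] kernelD(3)[OF h] y(2) l by (simp add: le_normal_subobjects)
  qed
  then have "least ?L m (Upper ?L A)" unfolding m_def sup_def by (rule someI)
  then have m: "m \<in> Upper ?L A" "m \<preceq> l" "l \<preceq> m" using le by (auto simp: least_def le_normal_subobjects)
  then have m': "normal_mono C m" "Cod C m = X" by (simp_all add: up)
  then show "m \<in> carrier ?L" by (simp add: carrier_normal_subobjects)
  fix x assume "x \<in> Arr C" "Cod C x = X"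
  then show "x \<preceq> m \<longleftrightarrow> in_closure X A x" using lx[of x] le_arrow_trans m' m(2,3) na[of m] l(2) by metis
qed

section \<open>Distributive tuples\<close>

text \<open>The members of the intersection of the \<open>K i\<close>, not a monomorphism that
  represents it. As a set of arrows it can be put among the generators of a closure, and the closure
  of a union of such sets is a join of meets.\<close>

definition (in category) meets :: "'o \<Rightarrow> (nat \<Rightarrow> 'm) \<Rightarrow> nat set \<Rightarrow> 'm set" where
  "meets X K I = {a \<in> Arr C. Cod C a = X \<and> (\<forall>i \<in> I. a \<preceq> K i)}"

lemma meets_antimono: "I \<subseteq> I' \<Longrightarrow> meets X K I' \<subseteq> meets X K I"
  by (auto simp: meets_def)

text \<open>The instances of distributivity in which \<open>J\<^sub>1, \<dots>, J\<^sub>k\<close> are singletons.\<close>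
definition (in category) singleton_distributive :: "nat \<Rightarrow> 'o \<Rightarrow> (nat \<Rightarrow> 'm) \<Rightarrow> bool" where
  "singleton_distributive n X K \<longleftrightarrow> normal_tuple C n X K \<and>
     (\<forall>J Z. J \<subseteq> {..<n} \<and> Z \<subseteq> {..<n} \<and> J \<inter> Z = {} \<longrightarrow>
       (\<forall>x \<in> meets X K J. in_closure X (K ` Z) x \<longrightarrow> in_closure X (\<Union>z\<in>Z. meets X K (insert z J)) x))"

section \<open>Distributivity for disjoint blocks from the case of single elements\<close>

lemma meets_inf:
  assumes nt: "normal_tuple C n X K" and I: "I \<subseteq> {..<n}"
  defines "m \<equiv> \<Sqinter>\<^bsub>normal_subobjects C X\<^esub> (K ` I)"
  shows "m \<in> carrier (normal_subobjects C X)" "m \<in> meets X K I" "normal_mono C m" "Cod C m = X"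
    and "\<And>x. x \<in> meets X K I \<longleftrightarrow> x \<in> Arr C \<and> Cod C x = X \<and> x \<preceq> m"
proof -
  have X: "X \<in> Obj C" and f: "finite (K ` I)" and A: "K ` I \<subseteq> carrier (normal_subobjects C X)"
    using nt I finite_subset[OF I] by (auto simp: normal_tuple_def carrier_normal_subobjects)
  note i = inf_normal_subobjects[OF X f A, folded m_def]
  show "m \<in> carrier (normal_subobjects C X)" by (rule i(1))
  then show "normal_mono C m" "Cod C m = X" by (simp_all add: carrier_normal_subobjects)
  then show "m \<in> meets X K I" using i(2)[of m] by (simp add: meets_def le_arrow_refl monic_Arr normal_mono_monic)
  show "x \<in> meets X K I \<longleftrightarrow> x \<in> Arr C \<and> Cod C x = X \<and> x \<preceq> m" for x using i(2)[of x] by (auto simp: meets_def)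
qed

text \<open>If \<open>J\<^sub>1 = {i} \<union> J\<close> then by induction \<open>x\<close> lies in the joins obtained by replacing \<open>J\<^sub>1\<close> by \<open>{i}\<close> and by \<open>J\<close>;
  the modular law combines the two.\<close>
lemma singleton_distributive_general:
  assumes sd: "singleton_distributive n X K"
  shows "\<lbrakk>finite F; \<Union>F \<subseteq> {..<n}; pairwise disjnt F; J \<subseteq> {..<n}; J \<inter> \<Union>F = {}; x \<in> meets X K J;
    in_closure X (\<Union>A\<in>F. meets X K A) x\<rbrakk> \<Longrightarrow> in_closure X (\<Union>A\<in>F. meets X K (J \<union> A)) x"
\<comment> \<open>The induction is on the total size of the blocks, for all \<open>J\<close> and
  \<open>x\<close> at once, because \<open>J\<close> is enlarged when a block is split.\<close>
proof (induction "sum card F" arbitrary: F J x rule: less_induct)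
  case less
  have nt: "normal_tuple C n X K" using sd by (simp add: singleton_distributive_def)
  define M where "M = (\<lambda>I. \<Sqinter>\<^bsub>normal_subobjects C X\<^esub> (K ` I))"
  have M: "M I \<in> carrier (normal_subobjects C X)" "M I \<in> meets X K I" "normal_mono C (M I)" "Cod C (M I) = X"
    "\<And>x. x \<in> meets X K I \<longleftrightarrow> x \<in> Arr C \<and> Cod C x = X \<and> x \<preceq> M I" if "I \<subseteq> {..<n}" for I
    unfolding M_def by (rule meets_inf[OF nt that])+
  have M': "M I \<in> meets X K I" "normal_mono C (M I)" "Cod C (M I) = X" "M I \<in> Arr C" if "I \<subseteq> {..<n}" for I
    using M(2-4)[OF that] by (auto simp: meets_def)
  have cl_meets: "in_closure X S b" if b: "b \<in> meets X K I" "M I \<in> S" "I \<subseteq> {..<n}" for b I S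
  proof (rule in_closure_le[OF _ b(2)])
    show "b \<preceq> M I" using M(5)[OF b(3)] b(1) by blast
  qed (rule M'[OF b(3)])+
  have Fin: "finite A" if "A \<in> F" for A
    by (rule finite_subset[of A "{..<n}"]) (use less.prems(2) that in \<open>auto\<close>)
  consider (empty) "{} \<in> F" | (big) J1 where "J1 \<in> F" "2 \<le> card J1" | (single) "\<forall>A\<in>F. card A = 1"
  proof -
    have "card A = 1" if "{} \<notin> F" "\<not> (\<exists>B\<in>F. 2 \<le> card B)" "A \<in> F" for A
    proof -
      have "card A \<noteq> 0" using that Fin[of A] by auto
      moreover have "\<not> 2 \<le> card A" using that(2,3) by blast
      ultimately show ?thesis by linarith
    qed
    then show thesis using empty big single by blast
  qed
  then show ?case
  proof cases
    case empty
    then have "x \<in> (\<Union>A\<in>F. meets X K (J \<union> A))" using less.prems(6) by (intro UN_I[of "{}"]) simp_all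
    then show ?thesis by (rule in_closure_member)
  next
    case single
    have sing: "\<exists>z. A = {z}" if "A \<in> F" for A using single that by (simp add: card_1_singleton_iff)
    have Feq: "A \<in> F \<longleftrightarrow> (\<exists>z\<in>\<Union>F. A = {z})" for A
    proof
      assume "\<exists>z\<in>\<Union>F. A = {z}"
      then obtain z B where "A = {z}" "z \<in> B" "B \<in> F" by auto
      then show "A \<in> F" using sing[of B] by auto
    qed (use sing in blast)
    have "in_closure X (K ` \<Union>F) x"
    proof (rule in_closure_trans[OF less.prems(7)])
      fix a assume "a \<in> (\<Union>A\<in>F. meets X K A)"
      then obtain A where A: "A \<in> F" "a \<in> meets X K A" by blast
      obtain z where "A = {z}" using sing[OF A(1)] by blast
      then have z: "z \<in> \<Union>F" "a \<in> meets X K {z}" using A by auto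
      have "normal_mono C (K z)" "Cod C (K z) = X" using nt z(1) less.prems(2) by (auto simp: normal_tuple_def)
      then show "in_closure X (K ` \<Union>F) a" using z
        by (intro in_closure_le[of a "K z"]) (auto simp: meets_def monic_Arr normal_mono_monic)
    qed
    moreover have "J \<subseteq> {..<n} \<and> \<Union>F \<subseteq> {..<n} \<and> J \<inter> \<Union>F = {}" using less.prems(2,4,5) by simp
    ultimately have "in_closure X (\<Union>z\<in>\<Union>F. meets X K (insert z J)) x"
      using sd[unfolded singleton_distributive_def, THEN conjunct2, THEN spec, THEN spec, of J "\<Union>F"] less.prems(6) by simp
    moreover have "(\<Union>z\<in>\<Union>F. meets X K (insert z J)) \<subseteq> (\<Union>A\<in>F. meets X K (J \<union> A))"
    proof
      fix a assume "a \<in> (\<Union>z\<in>\<Union>F. meets X K (insert z J))"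
      then obtain z where z: "z \<in> \<Union>F" "a \<in> meets X K (insert z J)" by blast
      then have "{z} \<in> F" using Feq[of "{z}"] by blast
      then show "a \<in> (\<Union>A\<in>F. meets X K (J \<union> A))" using z by (intro UN_I[of "{z}"]) simp_all
    qed
    ultimately show ?thesis by (rule in_closure_mono)
  next
    case (big J1)
    then have "J1 \<noteq> {}" by auto
    then obtain i where i: "i \<in> J1" by blast
    define J' where "J' = J1 - {i}"
    have J1: "J1 = insert i J'" "i \<notin> J'" using i by (auto simp: J'_def)
    define F' where "F' = F - {J1}"
    have F: "F = insert J1 F'" "J1 \<notin> F'" using big by (auto simp: F'_def)
    have finF': "finite F'" using less.prems(1) by (simp add: F'_def)
    have sumF: "sum card F = card J1 + sum card F'" using F finF' by simp
    have cJ': "card J1 = Suc (card J')" using J1 Fin[OF big(1)] by simp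
    have dis: "B \<inter> A = {}" if "A \<in> F'" "B \<subseteq> J1" for A B
    proof -
      have "disjnt J1 A" using less.prems(3) F that(1) by (auto simp: pairwise_insert)
      then show ?thesis using that(2) by (auto simp: disjnt_def)
    qed
    have pF': "pairwise disjnt F'" using less.prems(3) F by (simp add: pairwise_insert)
    have pw: "pairwise disjnt (insert B F')" if "B \<subseteq> J1" for B
      using pF' dis[OF _ that] by (auto simp: pairwise_insert disjnt_def)
    have IH: "in_closure X (\<Union>A\<in>insert B F'. meets X K (I \<union> A)) y"
      if "B \<subseteq> J1" "card B < card J1" "I \<subseteq> {..<n}" "I \<inter> (B \<union> \<Union>F') = {}" "y \<in> meets X K I"
        "in_closure X (\<Union>A\<in>insert B F'. meets X K A) y" for B I y
    proof (rule less.hyps)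
      have "sum card (insert B F') \<le> card B + sum card F'" using finF' by (simp add: sum.insert_if)
      then show "sum card (insert B F') < sum card F" using that(2) sumF by simp
      show "\<Union>(insert B F') \<subseteq> {..<n}" using less.prems(2) F that(1) by auto
    qed (use that finF' pw in auto)
    have cx: "in_closure X (\<Union>A\<in>insert B F'. meets X K A) x" if "B \<subseteq> J1" for B
      by (rule in_closure_mono[OF less.prems(7)]) (use F meets_antimono[OF that, of X K] in auto)
    have sub: "J1 \<subseteq> {..<n}" "J \<subseteq> {..<n}" "\<Union>F' \<subseteq> {..<n}" "J \<inter> J1 = {}" "J \<inter> \<Union>F' = {}"
      using less.prems(2,4,5) F by auto
    have x1: "in_closure X (\<Union>A\<in>insert {i} F'. meets X K (J \<union> A)) x"
      by (rule IH) (use i big less.prems(6) cx[of "{i}"] sub in auto)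
    have x2: "in_closure X (\<Union>A\<in>insert J' F'. meets X K (J \<union> A)) x"
      by (rule IH) (use J1 cJ' less.prems(6) cx[of J'] sub in auto)
    \<comment> \<open>The modular law requires finitely many generators, so the blocks other than
      \<open>J1\<close> are represented by the selected meets \<open>M (J \<union> A)\<close>
      instead of the sets of their members.\<close>
    define S where "S = (\<lambda>A. M (J \<union> A)) ` F'"
    have JA: "J \<union> A \<subseteq> {..<n}" if "A \<in> F'" for A using sub(2,3) that by auto
    have S: "finite S" "j \<in> S \<Longrightarrow> j \<in> Arr C \<and> Cod C j = X" for j
    proof -
      show "finite S" using finF' by (simp add: S_def)
      assume "j \<in> S"
      then obtain A where A: "A \<in> F'" "j = M (J \<union> A)" by (auto simp: S_def)
      show "j \<in> Arr C \<and> Cod C j = X" unfolding A(2) using M'(3,4)[OF JA[OF A(1)]] by simp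
    qed
    have FS: "in_closure X (insert (M (J \<union> B)) S) a" if aB: "a \<in> (\<Union>A\<in>insert B F'. meets X K (J \<union> A))" "B \<subseteq> J1" for a B
    proof -
      obtain A where A: "A \<in> insert B F'" "a \<in> meets X K (J \<union> A)" using aB(1) by blast
      then have "M (J \<union> A) \<in> insert (M (J \<union> B)) S" by (auto simp: S_def)
      moreover have "J \<union> A \<subseteq> {..<n}" using A(1) JA[of A] sub(1,2) aB(2) by auto
      ultimately show ?thesis by (rule cl_meets[OF A(2)])
    qed
    have xA: "x \<in> Arr C" "Cod C x = X" using less.prems(6) by (simp_all add: meets_def)
    have Ji: "J \<union> {i} \<subseteq> {..<n}" "J \<union> J' \<subseteq> {..<n}" using sub J1 by auto
    \<comment> \<open>\<open>x\<close> lies below the join over \<open>F'\<close> completed by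
      \<open>{i}\<close> and below the one completed by \<open>J'\<close>; the modular law moves the
      meet with the second join inside the first.\<close>
    have "in_closure X ({b \<in> Arr C. Cod C b = X \<and> b \<preceq> M (J \<union> {i}) \<and> in_closure X (insert (M (J \<union> J')) S) b} \<union> S) x"
    proof (rule modular_in_closure[OF S(1) S(2) M'(2,3)[OF Ji(1)] xA])
      show "in_closure X (insert (M (J \<union> {i})) S) x" by (rule in_closure_trans[OF x1 FS]) (use i in simp_all)
      show "in_closure X (insert (M (J \<union> J')) S) x" by (rule in_closure_trans[OF x2 FS]) (use J1 in auto)
    qed auto
    then show ?thesis
    proof (rule in_closure_trans)
      fix b assume b: "b \<in> {b \<in> Arr C. Cod C b = X \<and> b \<preceq> M (J \<union> {i}) \<and> in_closure X (insert (M (J \<union> J')) S) b} \<union> S"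
      show "in_closure X (\<Union>A\<in>F. meets X K (J \<union> A)) b"
      proof (cases "b \<in> S")
        case True
        then obtain A where A: "A \<in> F'" "b = M (J \<union> A)" by (auto simp: S_def)
        have "b \<in> meets X K (J \<union> A)" unfolding A(2) by (rule M'(1)[OF JA[OF A(1)]])
        then have "b \<in> (\<Union>A\<in>F. meets X K (J \<union> A))" using A(1) F by blast
        then show ?thesis by (rule in_closure_member)
      next
        case False
        then have b: "b \<in> meets X K (J \<union> {i})" "in_closure X (insert (M (J \<union> J')) S) b"
          using b M(5)[OF Ji(1), of b] by simp_all
        have "in_closure X (\<Union>A\<in>insert J' F'. meets X K A) b"
        proof (rule in_closure_mono[OF b(2)])
          have "M (J \<union> A) \<in> meets X K A" if "A \<in> insert J' F'" for A
          proof -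
            have "J \<union> A \<subseteq> {..<n}" using that sub J1 by auto
            then show ?thesis using M'(1)[of "J \<union> A"] meets_antimono[of A "J \<union> A" X K] by auto
          qed
          then show "insert (M (J \<union> J')) S \<subseteq> (\<Union>A\<in>insert J' F'. meets X K A)" by (auto simp: S_def)
        qed
        \<comment> \<open>The induction hypothesis with \<open>J\<close> enlarged by
          \<open>i\<close> and \<open>J1\<close> shrunk to \<open>J'\<close>: the block
          \<open>J'\<close> now contributes the meet over \<open>J \<union> J1\<close>.\<close>
        then have "in_closure X (\<Union>A\<in>insert J' F'. meets X K ((J \<union> {i}) \<union> A)) b"
          by (rule_tac IH) (use J1 cJ' b(1) sub dis[of _ "{i}"] in auto)
        moreover have "meets X K ((J \<union> {i}) \<union> A) \<subseteq> (\<Union>A\<in>F. meets X K (J \<union> A))" if A: "A \<in> insert J' F'" for A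
        proof (cases "A = J'")
          case True
          have "J \<union> {i} \<union> J' = J \<union> J1" using J1 by auto
          then show ?thesis using True F by auto
        next
          case False
          then have "A \<in> F" using A F by auto
          moreover have "meets X K ((J \<union> {i}) \<union> A) \<subseteq> meets X K (J \<union> A)" by (rule meets_antimono) auto
          ultimately show ?thesis by blast
        qed
        ultimately show ?thesis by (elim in_closure_mono) blast
      qed
    qed
  qed
qed

text \<open>The right side of each distributive equation is always below the left one, so the
  equation only says that the members of the left side lie in a closure (\<open>sem\<close>). Single
  elements become blocks indexed by an enumeration of \<open>Z\<close>; conversely a family of
  blocks is passed to the general case as a set, in which only empty blocks can coincide.\<close>

theorem distributive_tuple_iff:
  "distributive_tuple C n X K \<longleftrightarrow> singleton_distributive n X K"
proof (cases "normal_tuple C n X K")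
  case nt: True
  let ?L = "normal_subobjects C X"
  have X: "X \<in> Obj C" using nt by (simp add: normal_tuple_def)
  define M where "M = (\<lambda>I. \<Sqinter>\<^bsub>?L\<^esub> (K ` I))"
  have M: "M I \<in> carrier (normal_subobjects C X)" "M I \<in> meets X K I" "normal_mono C (M I)" "Cod C (M I) = X"
    "\<And>x. x \<in> meets X K I \<longleftrightarrow> x \<in> Arr C \<and> Cod C x = X \<and> x \<preceq> M I" if "I \<subseteq> {..<n}" for I
    unfolding M_def by (rule meets_inf[OF nt that])+
  define lhs where "lhs = (\<lambda>(k::nat) (J::nat \<Rightarrow> nat set). M (J 0) \<sqinter>\<^bsub>?L\<^esub> (\<Squnion>\<^bsub>?L\<^esub> ((\<lambda>i. M (J i)) ` {1..k})))"
  define rhs where "rhs = (\<lambda>(k::nat) (J::nat \<Rightarrow> nat set). \<Squnion>\<^bsub>?L\<^esub> ((\<lambda>i. M (J 0 \<union> J i)) ` {1..k}))"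
  define adm where "adm = (\<lambda>(k::nat) (J::nat \<Rightarrow> nat set). (\<forall>i\<le>k. J i \<subseteq> {..<n}) \<and> (\<forall>i\<le>k. \<forall>j\<le>k. i \<noteq> j \<longrightarrow> J i \<inter> J j = {}))"
  have sup: "\<Squnion>\<^bsub>?L\<^esub> ((\<lambda>i. M (J i)) ` {1..k}) \<in> carrier ?L"
    "\<And>x. \<lbrakk>x \<in> Arr C; Cod C x = X\<rbrakk> \<Longrightarrow> x \<preceq> \<Squnion>\<^bsub>?L\<^esub> ((\<lambda>i. M (J i)) ` {1..k}) \<longleftrightarrow> in_closure X (\<Union>i\<in>{1..k}. meets X K (J i)) x"
    if "\<And>i. i \<in> {1..k} \<Longrightarrow> J i \<subseteq> {..<n}" for J :: "nat \<Rightarrow> nat set" and k :: nat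
  proof -
    have s: "finite ((\<lambda>i. M (J i)) ` {1..k})" "(\<lambda>i. M (J i)) ` {1..k} \<subseteq> carrier ?L" using M(1) that by auto
    note s' = sup_normal_subobjects[OF X s]
    show "\<Squnion>\<^bsub>?L\<^esub> ((\<lambda>i. M (J i)) ` {1..k}) \<in> carrier ?L" by (rule s')
    have "in_closure X ((\<lambda>i. M (J i)) ` {1..k}) x \<longleftrightarrow> in_closure X (\<Union>i\<in>{1..k}. meets X K (J i)) x" for x
    proof
      assume "in_closure X ((\<lambda>i. M (J i)) ` {1..k}) x"
      then show "in_closure X (\<Union>i\<in>{1..k}. meets X K (J i)) x"
        by (rule in_closure_mono) (use M(2) that in blast)
    next
      assume "in_closure X (\<Union>i\<in>{1..k}. meets X K (J i)) x"
      then show "in_closure X ((\<lambda>i. M (J i)) ` {1..k}) x"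
      proof (rule in_closure_trans)
        fix a assume "a \<in> (\<Union>i\<in>{1..k}. meets X K (J i))"
        then obtain i where i: "i \<in> {1..k}" "a \<in> meets X K (J i)" by blast
        then have "a \<preceq> M (J i)" using M(5)[OF that[OF i(1)], of a] by simp
        then show "in_closure X ((\<lambda>i. M (J i)) ` {1..k}) a"
          using i M(3,4)[OF that[OF i(1)]] by (intro in_closure_le[of a "M (J i)"]) (auto simp: monic_Arr normal_mono_monic)
      qed
    qed
    then show "x \<preceq> \<Squnion>\<^bsub>?L\<^esub> ((\<lambda>i. M (J i)) ` {1..k}) \<longleftrightarrow> in_closure X (\<Union>i\<in>{1..k}. meets X K (J i)) x"
      if "x \<in> Arr C" "Cod C x = X" for x using s'(2)[OF that] by simp
  qed
  have sem: "(lhs k J .=\<^bsub>?L\<^esub> rhs k J) \<longleftrightarrow> (\<forall>x \<in> meets X K (J 0). in_closure X (\<Union>i\<in>{1..k}. meets X K (J i)) x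
      \<longrightarrow> in_closure X (\<Union>i\<in>{1..k}. meets X K (J 0 \<union> J i)) x)" if adm: "adm k J" for k J
  proof -
    have J: "\<And>i. i \<le> k \<Longrightarrow> J i \<subseteq> {..<n}" using adm by (auto simp: adm_def)
    have s1: "\<Squnion>\<^bsub>?L\<^esub> ((\<lambda>i. M (J i)) ` {1..k}) \<in> carrier ?L"
      "\<And>x. \<lbrakk>x \<in> Arr C; Cod C x = X\<rbrakk> \<Longrightarrow> x \<preceq> \<Squnion>\<^bsub>?L\<^esub> ((\<lambda>i. M (J i)) ` {1..k}) \<longleftrightarrow> in_closure X (\<Union>i\<in>{1..k}. meets X K (J i)) x"
      using sup[of k J] J by auto
    have s2: "rhs k J \<in> carrier ?L"
      "\<And>x. \<lbrakk>x \<in> Arr C; Cod C x = X\<rbrakk> \<Longrightarrow> x \<preceq> rhs k J \<longleftrightarrow> in_closure X (\<Union>i\<in>{1..k}. meets X K (J 0 \<union> J i)) x"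
      using sup[of k "\<lambda>i. J 0 \<union> J i"] J by (auto simp: rhs_def)
    have m: "{M (J 0), \<Squnion>\<^bsub>?L\<^esub> ((\<lambda>i. M (J i)) ` {1..k})} \<subseteq> carrier ?L" using M(1)[OF J[of 0]] s1(1) by simp
    have l: "lhs k J \<in> carrier ?L"
      "\<And>x. \<lbrakk>x \<in> Arr C; Cod C x = X\<rbrakk> \<Longrightarrow> x \<preceq> lhs k J \<longleftrightarrow> x \<preceq> M (J 0) \<and> x \<preceq> \<Squnion>\<^bsub>?L\<^esub> ((\<lambda>i. M (J i)) ` {1..k})"
      using inf_normal_subobjects[OF X _ m] by (simp_all add: lhs_def meet_def)
    have ar: "lhs k J \<in> Arr C" "Cod C (lhs k J) = X" "rhs k J \<in> Arr C" "Cod C (rhs k J) = X"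
      using l(1) s2(1) by (simp_all add: carrier_normal_subobjects monic_Arr normal_mono_monic)
    have "rhs k J \<preceq> M (J 0)"
    proof -
      have "in_closure X (\<Union>i\<in>{1..k}. meets X K (J 0 \<union> J i)) (rhs k J)" using s2(2)[OF ar(3,4)] ar le_arrow_refl by simp
      moreover have "(\<Union>i\<in>{1..k}. meets X K (J 0 \<union> J i)) \<subseteq> meets X K (J 0)" using meets_antimono[of "J 0" "J 0 \<union> J i" X K for i] by auto
      ultimately have cl: "in_closure X (meets X K (J 0)) (rhs k J)" by (rule in_closure_mono)
      obtain h where h: "is_kernel C (M (J 0)) h" using M(3)[OF J[of 0]] by (auto elim: normal_monoE)
      note hD = kernelD(2,3)[OF h] M(4)[OF J[of 0]]
      have "zero_arrow C (h \<cdot> a)" if "a \<in> meets X K (J 0)" for a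
        using that M(5)[OF J[of 0], of a] kernel_le_iff[OF h, of a] hD by simp
      then have "zero_arrow C (h \<cdot> rhs k J)" using cl hD unfolding in_closure_def by simp
      then show ?thesis using kernel_le_iff[OF h, of "rhs k J"] hD ar by simp
    qed
    moreover have "rhs k J \<preceq> \<Squnion>\<^bsub>?L\<^esub> ((\<lambda>i. M (J i)) ` {1..k})"
    proof -
      have "in_closure X (\<Union>i\<in>{1..k}. meets X K (J 0 \<union> J i)) (rhs k J)" using s2(2)[OF ar(3,4)] ar le_arrow_refl by simp
      moreover have "(\<Union>i\<in>{1..k}. meets X K (J 0 \<union> J i)) \<subseteq> (\<Union>i\<in>{1..k}. meets X K (J i))"
        using meets_antimono[of "J i" "J 0 \<union> J i" X K for i] by auto
      ultimately show ?thesis using s1(2)[OF ar(3,4)] in_closure_mono by blast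
    qed
    ultimately have rl: "rhs k J \<preceq> lhs k J" using l(2)[OF ar(3,4)] by simp
    have "(lhs k J .=\<^bsub>?L\<^esub> rhs k J) \<longleftrightarrow> lhs k J \<preceq> rhs k J" using rl by (simp add: normal_subobjects_def)
    also have "\<dots> \<longleftrightarrow> (\<forall>x. x \<in> Arr C \<and> Cod C x = X \<and> x \<preceq> lhs k J \<longrightarrow> x \<preceq> rhs k J)"
      using ar le_arrow_refl le_arrow_trans by blast
    also have "\<dots> \<longleftrightarrow> (\<forall>x \<in> meets X K (J 0). in_closure X (\<Union>i\<in>{1..k}. meets X K (J i)) x
      \<longrightarrow> in_closure X (\<Union>i\<in>{1..k}. meets X K (J 0 \<union> J i)) x)"
      using l(2) s2(2) s1(2) M(5)[OF J[of 0]] by auto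
    finally show ?thesis .
  qed
  have dist: "distributive_tuple C n X K \<longleftrightarrow> (\<forall>k\<ge>1. \<forall>J. adm k J \<longrightarrow> lhs k J .=\<^bsub>?L\<^esub> rhs k J)"
    using nt by (simp add: distributive_tuple_def Let_def lhs_def rhs_def adm_def M_def)
  show ?thesis
  proof
    assume d: "distributive_tuple C n X K"
    show "singleton_distributive n X K" unfolding singleton_distributive_def
    proof (intro conjI allI impI ballI nt)
      fix J Z x assume JZ: "J \<subseteq> {..<n} \<and> Z \<subseteq> {..<n} \<and> J \<inter> Z = {}" and x: "x \<in> meets X K J" and cl: "in_closure X (K ` Z) x"
      show "in_closure X (\<Union>z\<in>Z. meets X K (insert z J)) x"
      \<comment> \<open>The definition has \<open>k\<close> at least 1, so the empty join is not
        among its instances; for empty \<open>Z\<close> neither closure has generators.\<close>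
      proof (cases "Z = {}")
        case True
        then show ?thesis using cl by simp
      next
        case False
        have fZ: "finite Z" by (rule finite_subset[of Z "{..<n}"]) (use JZ in auto)
        obtain f where f: "bij_betw f {1..card Z} Z"
          using fZ ex_bij_betw_nat_finite_1 by blast
        define I where "I = (\<lambda>i. if i = 0 then J else {f i})"
        have k: "1 \<le> card Z" using False fZ by (simp add: Suc_le_eq card_gt_0_iff)
        have fi: "f i \<in> Z" if "i \<in> {1..card Z}" for i using bij_betwE[OF f] that by blast
        have inj: "f i = f j \<longleftrightarrow> i = j" if "i \<in> {1..card Z}" "j \<in> {1..card Z}" for i j
          using inj_on_eq_iff[OF bij_betw_imp_inj_on[OF f]] that by blast
        have "adm (card Z) I" unfolding adm_def
        proof (intro conjI allI impI)
          fix i assume i: "i \<le> card Z"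
          then show "I i \<subseteq> {..<n}" using JZ fi[of i] by (cases "i = 0") (auto simp: I_def)
          fix j assume j: "j \<le> card Z" "i \<noteq> j"
          show "I i \<inter> I j = {}" using JZ i j fi[of i] fi[of j] inj[of i j]
            by (cases "i = 0"; cases "j = 0") (auto simp: I_def)
        qed
        note ad = this
        have "lhs (card Z) I .=\<^bsub>?L\<^esub> rhs (card Z) I"
          using d[unfolded dist, THEN spec, of "card Z", THEN mp, OF k, THEN spec, of I, THEN mp, OF ad] .
        then have imp: "\<forall>x \<in> meets X K (I 0). in_closure X (\<Union>i\<in>{1..card Z}. meets X K (I i)) x
            \<longrightarrow> in_closure X (\<Union>i\<in>{1..card Z}. meets X K (I 0 \<union> I i)) x"
          by (simp only: sem[OF ad])
        note img = bij_betw_imp_surj_on[OF f]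
        have "(\<Union>i\<in>{1..card Z}. meets X K (I i)) = (\<Union>z\<in>f ` {1..card Z}. meets X K {z})"
          "(\<Union>i\<in>{1..card Z}. meets X K (I 0 \<union> I i)) = (\<Union>z\<in>f ` {1..card Z}. meets X K (insert z J))"
          by (simp_all add: I_def)
        note eq = this[unfolded img]
        have "in_closure X (\<Union>z\<in>Z. meets X K {z}) x"
        proof (rule in_closure_mono[OF cl])
          show "K ` Z \<subseteq> (\<Union>z\<in>Z. meets X K {z})"
          proof
            fix a assume "a \<in> K ` Z"
            then obtain z where z: "z \<in> Z" "a = K z" by blast
            then have "normal_mono C a" "Cod C a = X" using nt JZ by (auto simp: normal_tuple_def)
            then have "a \<in> meets X K {z}" using z by (simp add: meets_def monic_Arr normal_mono_monic le_arrow_refl)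
            then show "a \<in> (\<Union>z\<in>Z. meets X K {z})" using z by blast
          qed
        qed
        then show ?thesis using imp x unfolding eq by (simp add: I_def)
      qed
    qed
  next
    assume sd: "singleton_distributive n X K"
    show "distributive_tuple C n X K" unfolding dist
    proof (intro allI impI)
      fix k :: nat and J assume "1 \<le> k" and adm: "adm k J"
      show "lhs k J .=\<^bsub>?L\<^esub> rhs k J" unfolding sem[OF adm]
      proof (intro ballI impI)
        fix x assume x: "x \<in> meets X K (J 0)" "in_closure X (\<Union>i\<in>{1..k}. meets X K (J i)) x"
        have "in_closure X (\<Union>A\<in>J ` {1..k}. meets X K (J 0 \<union> A)) x"
        proof (rule singleton_distributive_general[OF sd])
          show "pairwise disjnt (J ` {1..k})"
          proof (rule pairwiseI)
            fix A B assume AB: "A \<in> J ` {1..k}" "B \<in> J ` {1..k}" "A \<noteq> B"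
            obtain i where "i \<le> k" "A = J i" using AB(1) by auto
            moreover obtain j where "j \<le> k" "B = J j" using AB(2) by auto
            moreover from calculation have "i \<noteq> j" using \<open>A \<noteq> B\<close> by auto
            ultimately show "disjnt A B" using adm unfolding adm_def disjnt_def by blast
          qed
          show "\<Union>(J ` {1..k}) \<subseteq> {..<n}" "J 0 \<subseteq> {..<n}" using adm by (auto simp: adm_def)
          show "J 0 \<inter> \<Union>(J ` {1..k}) = {}" using adm unfolding adm_def by fastforce
        qed (use x in auto)
        then show "in_closure X (\<Union>i\<in>{1..k}. meets X K (J 0 \<union> J i)) x" by simp
      qed
    qed
  qed
qed (simp_all add: distributive_tuple_def singleton_distributive_def)

end
section \<open>Diagrams indexed by lists\<close>

text \<open>The coordinate 1 is not to be rewritten to \<open>Suc 0\<close>.\<close>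
declare One_nat_def [simp del]

abbreviation list_le (infix "\<unlhd>" 50) where "x \<unlhd> y \<equiv> list_all2 (\<le>) (x :: nat list) y"

text \<open>The bounds depend on the coordinate because a completion extends one direction at a
  time: halfway, some coordinates range over three values and the others over two.\<close>

definition box :: "(nat \<Rightarrow> nat) \<Rightarrow> nat \<Rightarrow> nat list set" where
  "box b n = {x. length x = n \<and> (\<forall>j<n. x ! j < b j)}"

abbreviation grid :: "nat \<Rightarrow> nat \<Rightarrow> nat list set" where "grid k n \<equiv> box (\<lambda>_. k) n"

lemma list_le_iff: "x \<unlhd> y \<longleftrightarrow> length x = length y \<and> (\<forall>i<length x. x ! i \<le> y ! i)"
  by (auto simp: list_all2_conv_all_nth)

lemma list_le_refl: "x \<unlhd> x"
  by (simp add: list_le_iff)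

lemma list_le_update:
  assumes "x \<unlhd> y" "a \<le> b"
  shows "x[i := a] \<unlhd> y[i := b]"
  using assms by (cases "i < length x") (auto simp: list_le_iff nth_list_update)

lemma list_le_update_self: "a \<le> b \<Longrightarrow> x[i := a] \<unlhd> x[i := b]"
  by (rule list_le_update[OF list_le_refl])

lemma box_length: "x \<in> box b n \<Longrightarrow> length x = n"
  by (simp add: box_def)

lemma box_update: "x \<in> box b n \<Longrightarrow> (i < n \<Longrightarrow> a < c) \<Longrightarrow> x[i := a] \<in> box (b(i := c)) n"
  by (cases "i < n") (auto simp: box_def nth_list_update)

lemma box_update_same: "x \<in> box b n \<Longrightarrow> (i < n \<Longrightarrow> a < b i) \<Longrightarrow> x[i := a] \<in> box b n"
  by (cases "i < n") (auto simp: box_def nth_list_update)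

lemma Obj_chain_power: "Obj (chain_power k n) = grid k n"
  unfolding chain_power_def poset_category_def box_def
  by (auto simp: set_conv_nth)

section \<open>Chain powers and diagrams on sets of lists\<close>

lemma category_poset:
  assumes "\<And>x. x \<in> A \<Longrightarrow> r x x" "\<And>x y z. \<lbrakk>x \<in> A; y \<in> A; z \<in> A; r x y; r y z\<rbrakk> \<Longrightarrow> r x z"
  shows "category (poset_category A r)"
proof unfold_locales
  fix x y z w f g h
  let ?P = "poset_category A r"
  have hom: "f \<in> hom ?P x y \<longleftrightarrow> f = (x, y) \<and> x \<in> A \<and> y \<in> A \<and> r x y" for f x y
    by (auto simp: poset_category_def hom_def)
  have cmp: "Cmp ?P q p = (fst p, snd q)" "Id ?P x = (x, x)" for p q x by (simp_all add: poset_category_def)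
  show "f \<in> Arr ?P \<Longrightarrow> Dom ?P f \<in> Obj ?P" "f \<in> Arr ?P \<Longrightarrow> Cod ?P f \<in> Obj ?P"
    by (auto simp: poset_category_def)
  show "x \<in> Obj ?P \<Longrightarrow> Id ?P x \<in> hom ?P x x" unfolding hom cmp using assms(1) by (simp add: poset_category_def)
  show "\<lbrakk>f \<in> hom ?P x y; g \<in> hom ?P y z\<rbrakk> \<Longrightarrow> g \<cdot>\<^bsub>?P\<^esub> f \<in> hom ?P x z"
    unfolding hom cmp using assms(2)[of x y z] by simp
qed (auto simp: poset_category_def hom_def)

lemma list_le_trans: "\<lbrakk>x \<unlhd> y; y \<unlhd> z\<rbrakk> \<Longrightarrow> x \<unlhd> z"
  by (rule list_all2_trans[of "(\<le>)" "(\<le>)" "(\<le>)"]) auto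

lemma category_chain_power: "category (chain_power k n)"
  unfolding chain_power_def by (rule category_poset) (auto intro: list_le_refl list_le_trans)

lemma opposite_simps [simp]:
  "Obj (opposite D) = Obj D" "Arr (opposite D) = Arr D" "Dom (opposite D) = Cod D" "Cod (opposite D) = Dom D"
  "Id (opposite D) = Id D" "Cmp (opposite D) g f = Cmp D f g"
  by (simp_all add: opposite_def)

lemma hom_opposite [simp]: "hom (opposite D) A B = hom D B A"
  by (auto simp: hom_def)

lemma category_opposite:
  assumes "category D"
  shows "category (opposite D)"
proof -
  interpret D: category D by (rule assms)
  show ?thesis by unfold_locales (auto simp: D.in_hom_iff)
qed

lemma chain_power_simps [simp]:
  "(x, y) \<in> Arr (chain_power k n) \<longleftrightarrow> x \<in> grid k n \<and> y \<in> grid k n \<and> x \<unlhd> y"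
  "Dom (chain_power k n) p = fst p" "Cod (chain_power k n) p = snd p"
  "Id (chain_power k n) x = (x, x)" "Cmp (chain_power k n) q p = (fst p, snd q)"
proof -
  show "(x, y) \<in> Arr (chain_power k n) \<longleftrightarrow> x \<in> grid k n \<and> y \<in> grid k n \<and> x \<unlhd> y"
    using Obj_chain_power[of k n] by (auto simp: chain_power_def poset_category_def)
qed (simp_all add: chain_power_def poset_category_def)

text \<open>Contravariant functoriality on a set of lists, without the extensionality of a functor
  category; the partial completions live on boxes, which need not be powers of a chain.\<close>

definition (in category) diagram_on :: "nat list set \<Rightarrow> ('o, 'm) diagram \<Rightarrow> bool" where
  "diagram_on S D \<longleftrightarrow> (\<forall>x\<in>S. obm D x \<in> Obj C \<and> arm D (x, x) = Id C (obm D x)) \<and>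
     (\<forall>x\<in>S. \<forall>y\<in>S. x \<unlhd> y \<longrightarrow> arm D (x, y) \<in> Arr C \<and> Dom C (arm D (x, y)) = obm D y \<and> Cod C (arm D (x, y)) = obm D x) \<and>
     (\<forall>x\<in>S. \<forall>y\<in>S. \<forall>z\<in>S. x \<unlhd> y \<and> y \<unlhd> z \<longrightarrow> arm D (x, y) \<cdot> arm D (y, z) = arm D (x, z))"

text \<open>Equality of functors where it is meaningful: completions and restrictions carry
  arbitrary values outside their index sets.\<close>

definition diagrams_agree :: "nat list set \<Rightarrow> ('o, 'm) diagram \<Rightarrow> ('o, 'm) diagram \<Rightarrow> bool" where
  "diagrams_agree S D D' \<longleftrightarrow> (\<forall>x\<in>S. obm D x = obm D' x) \<and> (\<forall>x\<in>S. \<forall>y\<in>S. x \<unlhd> y \<longrightarrow> arm D (x, y) = arm D' (x, y))"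

definition (in category) diagram_iso :: "nat list set \<Rightarrow> ('o, 'm) diagram \<Rightarrow> ('o, 'm) diagram \<Rightarrow> (nat list \<Rightarrow> 'm) \<Rightarrow> bool" where
  "diagram_iso S D D' \<phi> \<longleftrightarrow>
     (\<forall>x\<in>S. is_iso C (\<phi> x) \<and> Dom C (\<phi> x) = obm D x \<and> Cod C (\<phi> x) = obm D' x) \<and>
     (\<forall>x\<in>S. \<forall>y\<in>S. x \<unlhd> y \<longrightarrow> \<phi> x \<cdot> arm D (x, y) = arm D' (x, y) \<cdot> \<phi> y)"

text \<open>\<open>x\<close> stands for the line through it in direction \<open>i\<close>: its own
  \<open>i\<close>-th coordinate is overwritten.\<close>

definition ker_lines :: "('o, 'm) category \<Rightarrow> nat \<Rightarrow> ('o, 'm) diagram \<Rightarrow> bool" where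
  "ker_lines C n D \<longleftrightarrow> (\<forall>x\<in>grid 3 n. \<forall>i<n. is_kernel C (arm D (x[i := 1], x[i := 2])) (arm D (x[i := 0], x[i := 1])))"

definition coker_lines :: "('o, 'm) category \<Rightarrow> nat \<Rightarrow> ('o, 'm) diagram \<Rightarrow> bool" where
  "coker_lines C n D \<longleftrightarrow> (\<forall>x\<in>grid 3 n. \<forall>i<n. is_cokernel C (arm D (x[i := 0], x[i := 1])) (arm D (x[i := 1], x[i := 2])))"

lemma diagrams_agree_sym: "diagrams_agree S D D' \<Longrightarrow> diagrams_agree S D' D"
  by (simp add: diagrams_agree_def)

lemma diagrams_agree_trans: "\<lbrakk>diagrams_agree S D D'; diagrams_agree S D' D''\<rbrakk> \<Longrightarrow> diagrams_agree S D D''"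
  by (simp add: diagrams_agree_def)

lemma diagrams_agree_subset: "\<lbrakk>diagrams_agree S D D'; S' \<subseteq> S\<rbrakk> \<Longrightarrow> diagrams_agree S' D D'"
  unfolding diagrams_agree_def by blast

context category
begin

lemma diagramD:
  assumes "diagram_on S D" "x \<in> S"
  shows "obm D x \<in> Obj C" "arm D (x, x) = Id C (obm D x)"
    and "\<lbrakk>y \<in> S; x \<unlhd> y\<rbrakk> \<Longrightarrow> arm D (x, y) \<in> Arr C"
    and "\<lbrakk>y \<in> S; x \<unlhd> y\<rbrakk> \<Longrightarrow> Dom C (arm D (x, y)) = obm D y"
    and "\<lbrakk>y \<in> S; x \<unlhd> y\<rbrakk> \<Longrightarrow> Cod C (arm D (x, y)) = obm D x"
    and "\<lbrakk>y \<in> S; z \<in> S; x \<unlhd> y; y \<unlhd> z\<rbrakk> \<Longrightarrow> arm D (x, y) \<cdot> arm D (y, z) = arm D (x, z)"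
  using assms unfolding diagram_on_def by blast+

lemma diagram_Cmp:
  assumes D: "diagram_on S D" and S: "x \<in> S" "y \<in> S" "z \<in> S" "x \<unlhd> y" "y \<unlhd> z"
    and h: "h \<in> Arr C" "Cod C h = obm D z"
  shows "arm D (x, y) \<cdot> (arm D (y, z) \<cdot> h) = arm D (x, z) \<cdot> h"
  by (rule Cmp_eq_left[OF diagramD(6)[OF D]]) (use S h diagramD[OF D] in simp_all)

lemma diagram_on_cong:
  assumes ag: "diagrams_agree S D D'" and D: "diagram_on S D"
  shows "diagram_on S D'"
proof -
  have o: "obm D' x = obm D x" if "x \<in> S" for x using ag that by (simp add: diagrams_agree_def)
  have a: "arm D' (x, y) = arm D (x, y)" if "x \<in> S" "y \<in> S" "x \<unlhd> y" for x y using ag that by (simp add: diagrams_agree_def)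
  show ?thesis unfolding diagram_on_def
  proof (intro conjI ballI impI)
    fix x y z assume "x \<in> S" "y \<in> S" "z \<in> S" "x \<unlhd> y \<and> y \<unlhd> z"
    then show "arm D' (x, y) \<cdot> arm D' (y, z) = arm D' (x, z)"
      using list_le_trans[of x y z] diagramD(6)[OF D, of x y z] by (simp add: a)
  qed (simp_all add: o a list_le_refl diagramD[OF D])
qed

lemma diagram_on_subset: "diagram_on S D \<Longrightarrow> S' \<subseteq> S \<Longrightarrow> diagram_on S' D"
  unfolding diagram_on_def by blast

lemma is_functor_chain_power_iff:
  "is_functor (opposite (chain_power k n)) C D \<longleftrightarrow> diagram_on (grid k n) D"
proof
  assume F: "is_functor (opposite (chain_power k n)) C D"
  show "diagram_on (grid k n) D" unfolding diagram_on_def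
  proof (intro conjI ballI impI)
    fix x assume x: "x \<in> grid k n"
    then show "obm D x \<in> Obj C" "arm D (x, x) = Id C (obm D x)"
      using F by (simp_all add: is_functor_def Obj_chain_power)
    fix y assume y: "y \<in> grid k n"
    {
      assume "x \<unlhd> y"
      then have "arm D (x, y) \<in> hom C (obm D y) (obm D x)"
        using F x y unfolding is_functor_def by (metis chain_power_simps(1-3) fst_conv snd_conv opposite_simps(2-4))
      then show "arm D (x, y) \<in> Arr C" "Dom C (arm D (x, y)) = obm D y" "Cod C (arm D (x, y)) = obm D x"
        by (simp_all add: in_hom_iff)
    }
    fix z assume z: "z \<in> grid k n" "x \<unlhd> y \<and> y \<unlhd> z"
    have "\<forall>a\<in>Arr (opposite (chain_power k n)). \<forall>b\<in>Arr (opposite (chain_power k n)).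
        Cod (opposite (chain_power k n)) a = Dom (opposite (chain_power k n)) b \<longrightarrow>
        arm D (b \<cdot>\<^bsub>opposite (chain_power k n)\<^esub> a) = arm D b \<cdot> arm D a"
      using F by (simp add: is_functor_def)
    from this[THEN bspec, of "(y, z)", THEN bspec, of "(x, y)"] x y z
    show "arm D (x, y) \<cdot> arm D (y, z) = arm D (x, z)" by simp
  qed
next
  assume D: "diagram_on (grid k n) D"
  show "is_functor (opposite (chain_power k n)) C D" unfolding is_functor_def
  proof (intro conjI ballI impI)
    show "category (opposite (chain_power k n))" by (rule category_opposite[OF category_chain_power])
    show "category C" by (rule category_axioms)
    fix a assume a: "a \<in> Arr (opposite (chain_power k n))"
    then show "arm D a \<in> hom C (obm D (Dom (opposite (chain_power k n)) a)) (obm D (Cod (opposite (chain_power k n)) a))"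
      by (cases a) (simp add: in_hom_iff diagramD[OF D])
    fix b assume "b \<in> Arr (opposite (chain_power k n))"
      "Cod (opposite (chain_power k n)) a = Dom (opposite (chain_power k n)) b"
    with a show "arm D (b \<cdot>\<^bsub>opposite (chain_power k n)\<^esub> a) = arm D b \<cdot> arm D a"
      by (cases a; cases b) (simp add: diagramD(6)[OF D])
  qed (simp_all add: Obj_chain_power diagramD[OF D])
qed

lemma natural_isomorphism_chain_power_iff:
  "natural_isomorphism (opposite (chain_power k n)) C D D' \<phi> \<longleftrightarrow>
     diagram_on (grid k n) D \<and> diagram_on (grid k n) D' \<and> diagram_iso (grid k n) D D' \<phi>"
proof -
  have arr: "(\<forall>a\<in>Arr (chain_power k n). P (fst a) (snd a)) \<longleftrightarrow> (\<forall>x\<in>grid k n. \<forall>y\<in>grid k n. x \<unlhd> y \<longrightarrow> P x y)" for P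
    by (metis chain_power_simps(1) fst_conv snd_conv surj_pair)
  have nat: "(\<forall>a\<in>Arr (chain_power k n). \<phi> (fst a) \<cdot> arm D a = arm D' a \<cdot> \<phi> (snd a)) \<longleftrightarrow>
      (\<forall>x\<in>grid k n. \<forall>y\<in>grid k n. x \<unlhd> y \<longrightarrow> \<phi> x \<cdot> arm D (x, y) = arm D' (x, y) \<cdot> \<phi> y)"
    using arr[of "\<lambda>x y. \<phi> x \<cdot> arm D (x, y) = arm D' (x, y) \<cdot> \<phi> y"] by simp
  show ?thesis
    unfolding natural_isomorphism_def natural_transformation_def is_functor_chain_power_iff diagram_iso_def
    by (simp add: Obj_chain_power nat in_hom_iff) (auto simp: is_iso_iff)
qed

lemma iso_inverse:
  assumes "is_iso C f"
  obtains g where "is_iso C g" "Dom C g = Cod C f" "Cod C g = Dom C f" "g \<cdot> f = Id C (Dom C f)" "f \<cdot> g = Id C (Cod C f)"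
proof -
  obtain g where g: "f \<in> Arr C" "g \<in> Arr C" "Dom C g = Cod C f" "Cod C g = Dom C f" "g \<cdot> f = Id C (Dom C f)" "f \<cdot> g = Id C (Cod C f)"
    using assms by (auto simp: is_iso_iff)
  then have "is_iso C g" unfolding is_iso_iff by (intro conjI bexI[of _ f]) simp_all
  with g that show ?thesis by blast
qed

lemma is_iso_Arr: "is_iso C f \<Longrightarrow> f \<in> Arr C"
  by (simp add: is_iso_iff)

lemma diagram_iso_sym:
  assumes D: "diagram_on S D" "diagram_on S D'" and iso: "diagram_iso S D D' \<phi>"
  obtains \<psi> where "diagram_iso S D' D \<psi>"
proof -
  have "\<forall>x\<in>S. \<exists>g. is_iso C g \<and> Dom C g = obm D' x \<and> Cod C g = obm D x \<and> g \<cdot> \<phi> x = Id C (obm D x) \<and> \<phi> x \<cdot> g = Id C (obm D' x)"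
  proof
    fix x assume "x \<in> S"
    then have *: "is_iso C (\<phi> x)" "Dom C (\<phi> x) = obm D x" "Cod C (\<phi> x) = obm D' x" using iso by (simp_all add: diagram_iso_def)
    obtain g where "is_iso C g" "Dom C g = Cod C (\<phi> x)" "Cod C g = Dom C (\<phi> x)" "g \<cdot> \<phi> x = Id C (Dom C (\<phi> x))" "\<phi> x \<cdot> g = Id C (Cod C (\<phi> x))"
      by (rule iso_inverse[OF *(1)])
    then show "\<exists>g. is_iso C g \<and> Dom C g = obm D' x \<and> Cod C g = obm D x \<and> g \<cdot> \<phi> x = Id C (obm D x) \<and> \<phi> x \<cdot> g = Id C (obm D' x)"
      using * by auto
  qed
  then obtain \<psi> where \<psi>: "\<And>x. x \<in> S \<Longrightarrow> is_iso C (\<psi> x) \<and> Dom C (\<psi> x) = obm D' x \<and> Cod C (\<psi> x) = obm D x \<and>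
      \<psi> x \<cdot> \<phi> x = Id C (obm D x) \<and> \<phi> x \<cdot> \<psi> x = Id C (obm D' x)"
    by (metis (no_types, lifting) bchoice)
  have "diagram_iso S D' D \<psi>" unfolding diagram_iso_def
  proof (intro conjI ballI impI)
    fix x y assume xy: "x \<in> S" "y \<in> S" "x \<unlhd> y"
    have [simp]: "\<phi> x \<in> Arr C" "Dom C (\<phi> x) = obm D x" "Cod C (\<phi> x) = obm D' x"
      "\<phi> y \<in> Arr C" "Dom C (\<phi> y) = obm D y" "Cod C (\<phi> y) = obm D' y"
      using iso xy by (simp_all add: diagram_iso_def is_iso_Arr)
    have [simp]: "\<psi> x \<in> Arr C" "Dom C (\<psi> x) = obm D' x" "Cod C (\<psi> x) = obm D x"
      "\<psi> y \<in> Arr C" "Dom C (\<psi> y) = obm D' y" "Cod C (\<psi> y) = obm D y"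
      using \<psi>[OF xy(1)] \<psi>[OF xy(2)] by (simp_all add: is_iso_Arr)
    note [simp] = diagramD(3-5)[OF D(1) xy] diagramD(3-5)[OF D(2) xy]
    have nat: "\<phi> x \<cdot> arm D (x, y) = arm D' (x, y) \<cdot> \<phi> y" using iso xy by (simp add: diagram_iso_def)
    have inv: "\<psi> x \<cdot> \<phi> x = Id C (obm D x)" "\<phi> y \<cdot> \<psi> y = Id C (obm D' y)" using \<psi> xy by simp_all
    have "\<psi> x \<cdot> (\<phi> x \<cdot> (arm D (x, y) \<cdot> \<psi> y)) = \<psi> x \<cdot> (arm D' (x, y) \<cdot> (\<phi> y \<cdot> \<psi> y))"
      by (simp add: Cmp_eq_left[OF nat])
    then show "\<psi> x \<cdot> arm D' (x, y) = arm D (x, y) \<cdot> \<psi> y"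
      by (simp add: inv(2)) (simp add: Cmp_eq_left[OF inv(1)])
  qed (use \<psi> in simp_all)
  then show ?thesis by (rule that)
qed

end

section \<open>Completion by kernels\<close>

text \<open>To be applied to the opposite category as well, where kernels are cokernels.\<close>
locale category_with_kernels = pointed_category +
  assumes kernels: "f \<in> Arr C \<Longrightarrow> \<exists>k. is_kernel C k f"

sublocale semi_abelian_category \<subseteq> category_with_kernels
  by unfold_locales (metis kernel_exists)

context category_with_kernels
begin

lemma chosen_kernel: "f \<in> Arr C \<Longrightarrow> is_kernel C (chosen_kernel C f) f"
  unfolding chosen_kernel_def using kernels by (rule someI_ex)

lemma monic_right:
  assumes "monic (f \<cdot> g)" and [simp]: "f \<in> Arr C" "g \<in> Arr C" "Cod C g = Dom C f"
  shows "monic g"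
  unfolding monic_def
proof (intro conjI allI impI)
  fix a b assume "a \<in> Arr C \<and> b \<in> Arr C \<and> Cod C a = Dom C g \<and> Cod C b = Dom C g \<and> g \<cdot> a = g \<cdot> b"
  then have [simp]: "a \<in> Arr C" "b \<in> Arr C" "Cod C a = Dom C g" "Cod C b = Dom C g" and ab: "g \<cdot> a = g \<cdot> b" by simp_all
  have "(f \<cdot> g) \<cdot> a = (f \<cdot> g) \<cdot> b" using ab by simp
  then show "a = b" by (rule monicD[OF assms(1)]) simp_all
qed simp

lemma monic_Id: "A \<in> Obj C \<Longrightarrow> monic (Id C A)"
  unfolding monic_def by (metis Arr_Id Cmp_Id_left Dom_Id)

text \<open>The new object at \<open>x\<close> is a subobject, via \<open>\<iota> x\<close>, of an old one, and the new arrows are those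
  compatible with the \<open>\<iota> x\<close>.\<close>
lemma kernel_step_diagram:
  assumes D: "diagram_on (box b n) D" and i: "i < n" "b i = 2"
  defines "D' \<equiv> kernel_step C i D"
  shows "diagram_on (box (b(i := 3)) n) D'"
    and "diagrams_agree (box b n) D D'"
    and "\<And>x. x \<in> box (b(i := 3)) n \<Longrightarrow> is_kernel C (arm D' (x[i := 1], x[i := 2])) (arm D' (x[i := 0], x[i := 1]))"
    and "\<And>x j. \<lbrakk>x \<in> box (b(i := 3)) n; j < n; j \<noteq> i; b j = 3;
        \<And>y. y \<in> box b n \<Longrightarrow> is_kernel C (arm D (y[j := 1], y[j := 2])) (arm D (y[j := 0], y[j := 1]))\<rbrakk>
      \<Longrightarrow> is_kernel C (arm D' (x[j := 1], x[j := 2])) (arm D' (x[j := 0], x[j := 1]))"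
proof -
  let ?S = "box b n" and ?S' = "box (b(i := 3)) n"
  define \<kappa> where "\<kappa> = (\<lambda>x. chosen_kernel C (arm D (x[i := 0], x[i := 1])))"
  \<comment> \<open>\<open>c x\<close> indexes the old object of which the new object at
    \<open>x\<close> is a subobject: the middle of the line if \<open>x ! i = 2\<close>, and
    \<open>x\<close> itself otherwise.\<close>
  define c where "c = (\<lambda>x. if x ! i = 2 then x[i := 1] else x :: nat list)"
  define \<iota> where "\<iota> = (\<lambda>x. if x ! i = 2 then \<kappa> x else Id C (obm D x))"
  have upd: "x[i := a] \<in> ?S" if "x \<in> ?S'" "a < 2" for x a
  proof -
    have "(b(i := 3))(i := 2) = b" using i(2) by auto
    then show ?thesis using box_update[OF \<open>x \<in> ?S'\<close>, of i a 2] \<open>a < 2\<close> by simp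
  qed
  have inS: "x \<in> ?S" if "x \<in> ?S'" "x ! i \<noteq> 2" for x
  proof -
    have "x ! j < b j" if "j < n" "j \<noteq> i" for j
      using \<open>x \<in> ?S'\<close> that i by (auto simp: box_def)
    moreover have "x ! i < 3" using \<open>x \<in> ?S'\<close> i(1) by (auto simp: box_def dest!: spec[of _ i])
    ultimately have "x ! j < b j" if "j < n" for j using that i \<open>x ! i \<noteq> 2\<close> by (cases "j = i") simp_all
    then show ?thesis using \<open>x \<in> ?S'\<close> by (simp add: box_def)
  qed
  have SS': "x \<in> ?S'" "x ! i \<noteq> 2" if "x \<in> ?S" for x
    using that i unfolding box_def by (auto dest!: spec[of _ i])
  have cS: "c x \<in> ?S" if "x \<in> ?S'" for x using that upd inS by (simp add: c_def)
  have cle: "c x \<unlhd> c y" if "x \<in> ?S'" "y \<in> ?S'" "x \<unlhd> y" for x y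
  proof -
    have "x ! i \<le> y ! i" "y ! i < 3" using that i by (auto simp: list_le_iff box_def)
    then consider "x ! i = 2" "y ! i = 2" | "x ! i \<le> 1" "y ! i = 2" | "x ! i \<noteq> 2" "y ! i \<noteq> 2" by linarith
    then show ?thesis
    proof cases
      case 2
      then have "x[i := x ! i] \<unlhd> y[i := 1]" by (intro list_le_update that(3)) simp
      then show ?thesis using 2 by (simp add: c_def)
    qed (use that(3) in \<open>simp_all add: c_def list_le_update\<close>)
  qed
  have f: "arm D (x[i := 0], x[i := 1]) \<in> Arr C" "Dom C (arm D (x[i := 0], x[i := 1])) = obm D (x[i := 1])"
    "Cod C (arm D (x[i := 0], x[i := 1])) = obm D (x[i := 0])" if "x \<in> ?S'" for x
    using diagramD(3-5)[OF D upd[OF that] upd[OF that]] list_le_update_self[of 0 1 x i] by simp_all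
  have \<kappa>: "is_kernel C (\<kappa> x) (arm D (x[i := 0], x[i := 1]))" if "x \<in> ?S'" for x
    unfolding \<kappa>_def by (rule chosen_kernel[OF f(1)[OF that]])
  have \<kappa>': "\<kappa> x \<in> Arr C" "Cod C (\<kappa> x) = obm D (x[i := 1])" "monic (\<kappa> x)"
      "zero_arrow C (arm D (x[i := 0], x[i := 1]) \<cdot> \<kappa> x)" if "x \<in> ?S'" for x
    using kernelD[OF \<kappa>[OF that]] f[OF that] by simp_all
  have \<kappa>upd: "\<kappa> (x[i := a]) = \<kappa> x" for x a by (simp add: \<kappa>_def)
  have D'obm: "obm D' x = (if x ! i = 2 then Dom C (\<kappa> x) else obm D x)" for x
    by (simp add: D'_def kernel_step_def Let_def \<kappa>_def)
  have \<iota>: "\<iota> x \<in> Arr C" "Dom C (\<iota> x) = obm D' x" "Cod C (\<iota> x) = obm D (c x)" "monic (\<iota> x)" if "x \<in> ?S'" for x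
    using \<kappa>'[OF that] diagramD(1)[OF D inS[OF that]]
    by (auto simp: \<iota>_def c_def D'obm monic_Id)
  have D'arm: "arm D' (x, y) = (if y ! i \<noteq> 2 then arm D (x, y) else if x ! i \<noteq> 2 then arm D (x, y[i := 1]) \<cdot> \<kappa> y
      else (THE u. u \<in> hom C (Dom C (\<kappa> y)) (Dom C (\<kappa> x)) \<and> \<kappa> x \<cdot> u = arm D (x[i := 1], y[i := 1]) \<cdot> \<kappa> y))" for x y
    by (simp add: D'_def kernel_step_def Let_def \<kappa>_def)
  have cD: "arm D (c x, c y) \<in> Arr C" "Dom C (arm D (c x, c y)) = obm D (c y)" "Cod C (arm D (c x, c y)) = obm D (c x)"
    if "x \<in> ?S'" "y \<in> ?S'" "x \<unlhd> y" for x y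
    by (rule diagramD(3-5)[OF D cS cS cle]; use that in simp)+
  have arm: "arm D' (x, y) \<in> Arr C \<and> Dom C (arm D' (x, y)) = obm D' y \<and> Cod C (arm D' (x, y)) = obm D' x \<and>
      \<iota> x \<cdot> arm D' (x, y) = arm D (c x, c y) \<cdot> \<iota> y" if xy: "x \<in> ?S'" "y \<in> ?S'" "x \<unlhd> y" for x y
  proof -
    have le: "x ! i \<le> y ! i" "y ! i < 3" using xy i by (auto simp: list_le_iff box_def)
    consider "y ! i \<noteq> 2" "x ! i \<noteq> 2" | "y ! i = 2" "x ! i \<noteq> 2" | "y ! i = 2" "x ! i = 2" using le by linarith
    then show ?thesis
    proof cases
      case 1
      then show ?thesis using diagramD(1)[OF D inS[OF xy(1)]] diagramD(1)[OF D inS[OF xy(2)]]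
          diagramD(3-5)[OF D inS[OF xy(1)] inS[OF xy(2)]] xy(3) by (simp add: D'arm D'obm \<iota>_def c_def)
    next
      case 2
      have "x \<unlhd> y[i := 1]" using cle[OF xy] 2 by (simp add: c_def)
      then have [simp]: "arm D (x, y[i := 1]) \<in> Arr C" "Dom C (arm D (x, y[i := 1])) = obm D (y[i := 1])"
        "Cod C (arm D (x, y[i := 1])) = obm D x" using diagramD(3-5)[OF D inS[OF xy(1)] upd[OF xy(2)]] 2 by simp_all
      show ?thesis using 2 \<kappa>'[OF xy(2)] by (simp add: D'arm D'obm \<iota>_def c_def)
    next
      case 3
      have le1: "x[i := a] \<unlhd> y[i := b]" if "a \<le> b" for a b by (rule list_le_update[OF xy(3) that])
      note [simp] = upd[OF xy(1)] upd[OF xy(2)] diagramD(3-5)[OF D upd[OF xy(1)] upd[OF xy(2)] le1]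
      note [simp] = \<kappa>'(1,2)[OF xy(1)] \<kappa>'(1,2)[OF xy(2)]
      \<comment> \<open>The commuting square in direction \<open>i\<close> shows that what comes
        from the kernel at \<open>y\<close> is killed at \<open>x\<close>, so it factors through the
        kernel \<open>\<kappa> x\<close>.\<close>
      have "arm D (x[i := 0], x[i := 1]) \<cdot> (arm D (x[i := 1], y[i := 1]) \<cdot> \<kappa> y)
          = arm D (x[i := 0], y[i := 0]) \<cdot> (arm D (y[i := 0], y[i := 1]) \<cdot> \<kappa> y)"
        using diagram_Cmp[OF D, of "x[i := 0]" "x[i := 1]" "y[i := 1]" "\<kappa> y"]
          diagram_Cmp[OF D, of "x[i := 0]" "y[i := 0]" "y[i := 1]" "\<kappa> y"] le1 list_le_update_self by simp
      moreover have "zero_arrow C (arm D (x[i := 0], y[i := 0]) \<cdot> (arm D (y[i := 0], y[i := 1]) \<cdot> \<kappa> y))"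
        by (rule zero_arrow_Cmp_left[OF \<kappa>'(4)[OF xy(2)]]) (simp_all add: f[OF xy(2)])
      ultimately have "arm D (x[i := 1], y[i := 1]) \<cdot> \<kappa> y \<preceq> \<kappa> x"
        by (intro kernelD(6)[OF \<kappa>[OF xy(1)]]) (simp_all add: f[OF xy(1)])
      then obtain u where u: "u \<in> Arr C" "Dom C u = Dom C (\<kappa> y)" "Cod C u = Dom C (\<kappa> x)" "\<kappa> x \<cdot> u = arm D (x[i := 1], y[i := 1]) \<cdot> \<kappa> y"
        by (rule le_arrowE) simp
      have "(THE u. u \<in> hom C (Dom C (\<kappa> y)) (Dom C (\<kappa> x)) \<and> \<kappa> x \<cdot> u = arm D (x[i := 1], y[i := 1]) \<cdot> \<kappa> y) = u"
      proof (rule the_equality)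
        fix v assume "v \<in> hom C (Dom C (\<kappa> y)) (Dom C (\<kappa> x)) \<and> \<kappa> x \<cdot> v = arm D (x[i := 1], y[i := 1]) \<cdot> \<kappa> y"
        then show "v = u" using u by (intro monicD[OF \<kappa>'(3)[OF xy(1)], of v u]) (simp_all add: in_hom_iff)
      qed (use u in \<open>simp add: in_hom_iff\<close>)
      then have "arm D' (x, y) = u" using 3 by (simp add: D'arm)
      then show ?thesis using u 3 by (simp add: D'obm \<iota>_def c_def)
    qed
  qed
  \<comment> \<open>Identities and composites are checked after composition with the monomorphisms
    \<open>\<iota> x\<close>, where they reduce to those of the old diagram.\<close>
  have diag': "diagram_on ?S' D'" unfolding diagram_on_def
  proof (intro conjI ballI impI)
    fix x assume x: "x \<in> ?S'"
    note \<iota>x = \<iota>[OF x]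
    have "Dom C (\<iota> x) \<in> Obj C" using \<iota>x(1) by simp
    then show o: "obm D' x \<in> Obj C" using \<iota>x by simp
    note ax = arm[OF x x list_le_refl]
    show "arm D' (x, x) = Id C (obm D' x)"
      by (rule monicD[OF \<iota>x(4)]) (use ax o \<iota>x diagramD(2)[OF D cS[OF x]] in simp_all)
    fix y assume y: "y \<in> ?S'"
    {
      assume "x \<unlhd> y"
      from arm[OF x y this] show "arm D' (x, y) \<in> Arr C" "Dom C (arm D' (x, y)) = obm D' y" "Cod C (arm D' (x, y)) = obm D' x"
        by simp_all
    }
    fix z assume z: "z \<in> ?S'" and xyz: "x \<unlhd> y \<and> y \<unlhd> z"
    then have xz: "x \<unlhd> z" using list_le_trans by blast
    have xy: "x \<unlhd> y" "y \<unlhd> z" using xyz by simp_all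
    note [simp] = arm[OF x y xy(1), THEN conjunct1] arm[OF x y xy(1), THEN conjunct2, THEN conjunct1] arm[OF x y xy(1), THEN conjunct2, THEN conjunct2, THEN conjunct1]
      arm[OF y z xy(2), THEN conjunct1] arm[OF y z xy(2), THEN conjunct2, THEN conjunct1] arm[OF y z xy(2), THEN conjunct2, THEN conjunct2, THEN conjunct1]
      arm[OF x z xz, THEN conjunct1] arm[OF x z xz, THEN conjunct2, THEN conjunct1] arm[OF x z xz, THEN conjunct2, THEN conjunct2, THEN conjunct1]
    note e = arm[OF x y xy(1), THEN conjunct2, THEN conjunct2, THEN conjunct2]
      arm[OF y z xy(2), THEN conjunct2, THEN conjunct2, THEN conjunct2] arm[OF x z xz, THEN conjunct2, THEN conjunct2, THEN conjunct2]
    note [simp] = \<iota>(1-3)[OF x] \<iota>(1-3)[OF y] \<iota>(1-3)[OF z] cD[OF x y xy(1)] cD[OF y z xy(2)] cD[OF x z xz]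
    have "\<iota> x \<cdot> (arm D' (x, y) \<cdot> arm D' (y, z)) = arm D (c x, c y) \<cdot> (\<iota> y \<cdot> arm D' (y, z))"
      by (simp add: Cmp_eq_left[OF e(1)])
    also have "\<dots> = arm D (c x, c y) \<cdot> (arm D (c y, c z) \<cdot> \<iota> z)" by (simp only: e(2))
    also have "\<dots> = \<iota> x \<cdot> arm D' (x, z)" unfolding e(3)
      by (rule diagram_Cmp[OF D cS cS cS cle cle]) (simp_all add: x y z xy)
    finally show "arm D' (x, y) \<cdot> arm D' (y, z) = arm D' (x, z)" by (rule monicD[OF \<iota>(4)[OF x]]) simp_all
  qed
  then show "diagram_on ?S' D'" .
  show agree: "diagrams_agree ?S D D'" unfolding diagrams_agree_def using SS'(2) by (simp add: D'arm D'obm)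
  show "is_kernel C (arm D' (x[i := 1], x[i := 2])) (arm D' (x[i := 0], x[i := 1]))" if x: "x \<in> ?S'" for x
  proof -
    have l: "length x = n" using x by (rule box_length)
    have "arm D' (x[i := 1], x[i := 2]) = \<kappa> x" "arm D' (x[i := 0], x[i := 1]) = arm D (x[i := 0], x[i := 1])"
      using i l \<kappa>'[OF x] diagramD(2)[OF D upd[OF x], of 1] by (simp_all add: D'arm \<kappa>upd)
    then show ?thesis using \<kappa>[OF x] by simp
  qed
  show "is_kernel C (arm D' (x[j := 1], x[j := 2])) (arm D' (x[j := 0], x[j := 1]))"
    if x: "x \<in> ?S'" and j: "j < n" "j \<noteq> i" "b j = 3"
      and lines: "\<And>y. y \<in> ?S \<Longrightarrow> is_kernel C (arm D (y[j := 1], y[j := 2])) (arm D (y[j := 0], y[j := 1]))" for x j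
  proof -
    have xj: "x[j := a] \<in> ?S'" if "a < 3" for a by (rule box_update_same[OF x]) (use that j in simp)
    have le: "x[j := a] \<unlhd> x[j := b]" if "a \<le> b" for a b by (rule list_le_update_self[OF that])
    show ?thesis
    proof (cases "x ! i = 2")
      case False
      then have "x \<in> ?S" by (rule inS[OF x])
      then have "x[j := a] \<in> ?S" if "a < 3" for a by (rule box_update_same) (use that j in simp)
      then have "arm D' (x[j := 1], x[j := 2]) = arm D (x[j := 1], x[j := 2])"
        "arm D' (x[j := 0], x[j := 1]) = arm D (x[j := 0], x[j := 1])"
        using agree le by (simp_all add: diagrams_agree_def)
      then show ?thesis using lines[OF \<open>x \<in> ?S\<close>] by simp
    next
      case True
      have xji: "x[j := a] ! i = 2" for a using True j by simp
      have cj: "c (x[j := a]) = x[i := 1, j := a]" for a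
        unfolding c_def using xji[of a] j by (simp add: list_update_swap)
      have \<iota>j: "\<iota> (x[j := a]) = \<kappa> (x[j := a])" for a by (simp add: \<iota>_def xji)
      have sw: "x[j := a, i := b] = x[i := b, j := a]" for a b using j by (simp add: list_update_swap)
      \<comment> \<open>For \<open>x ! i = 2\<close> the line in direction \<open>j\<close> is the
        kernel, taken in direction \<open>i\<close>, of a morphism from the line at
        \<open>x[i := 1]\<close> (arrows \<open>p2\<close>, \<open>p1\<close>) to the line at
        \<open>x[i := 0]\<close> (arrows \<open>r2\<close>, \<open>r1\<close>). Kernels commute with
        kernels, so it is again a line of kernels.\<close>
      define k1 where "k1 = arm D' (x[j := 0], x[j := 1])"
      define k2 where "k2 = arm D' (x[j := 1], x[j := 2])"
      note [simp] = xj le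
      note a1 = arm[of "x[j := 0]" "x[j := 1]", simplified, folded k1_def]
      note a2 = arm[of "x[j := 1]" "x[j := 2]", simplified, folded k2_def]
      note \<kappa>0 = \<kappa>'[of "x[j := 0]", simplified] and \<kappa>1 = \<kappa>'[of "x[j := 1]", simplified] and \<kappa>2 = \<kappa>'[of "x[j := 2]", simplified]
      have u1: "x[i := 1] \<in> ?S" "x[i := 0] \<in> ?S" by (rule upd[OF x]; simp)+
      define p1 where "p1 = arm D (x[i := 1, j := 0], x[i := 1, j := 1])"
      define p2 where "p2 = arm D (x[i := 1, j := 1], x[i := 1, j := 2])"
      define r1 where "r1 = arm D (x[i := 0, j := 0], x[i := 0, j := 1])"
      define r2 where "r2 = arm D (x[i := 0, j := 1], x[i := 0, j := 2])"
      have kp: "is_kernel C p2 p1" and kr: "is_kernel C r2 r1"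
        using lines[OF u1(1)] lines[OF u1(2)] by (simp_all add: p1_def p2_def r1_def r2_def)
      have xij: "x[i := b, j := a] \<in> ?S" if "b < 2" "a < 3" for a b
        by (rule box_update_same[OF upd[OF x that(1)]]) (use that(2) j in simp)
      define f1 where "f1 = arm D (x[i := 0, j := 1], x[i := 1, j := 1])"
      define f2 where "f2 = arm D (x[i := 0, j := 2], x[i := 1, j := 2])"
      have le2: "x[i := b, j := a] \<unlhd> x[i := b', j := a']" if "a \<le> a'" "b \<le> b'" for a a' b b'
        by (intro list_le_update list_le_refl that)
      have ty: "p1 \<in> Arr C" "Dom C p1 = obm D (x[i := 1, j := 1])" "Cod C p1 = obm D (x[i := 1, j := 0])"
        "p2 \<in> Arr C" "Dom C p2 = obm D (x[i := 1, j := 2])" "Cod C p2 = obm D (x[i := 1, j := 1])"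
        "r2 \<in> Arr C" "Dom C r2 = obm D (x[i := 0, j := 2])" "Cod C r2 = obm D (x[i := 0, j := 1])"
        "f1 \<in> Arr C" "Dom C f1 = obm D (x[i := 1, j := 1])" "Cod C f1 = obm D (x[i := 0, j := 1])"
        "f2 \<in> Arr C" "Dom C f2 = obm D (x[i := 1, j := 2])" "Cod C f2 = obm D (x[i := 0, j := 2])"
        using diagramD(3-5)[OF D xij xij le2] by (simp_all add: p1_def p2_def r1_def r2_def f1_def f2_def)
      have rf: "r2 \<cdot> f2 = f1 \<cdot> p2"
        using diagramD(6)[OF D xij xij xij le2 le2] by (simp add: r2_def f2_def f1_def p2_def)
      have kt: "\<kappa> (x[j := 1]) \<in> Arr C" "Cod C (\<kappa> (x[j := 1])) = obm D (x[i := 1, j := 1])" "monic (\<kappa> (x[j := 1]))"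
        "Dom C (\<kappa> (x[j := 1])) = obm D' (x[j := 1])" "zero_arrow C (f1 \<cdot> \<kappa> (x[j := 1]))"
        "\<kappa> (x[j := 2]) \<in> Arr C" "Cod C (\<kappa> (x[j := 2])) = obm D (x[i := 1, j := 2])" "monic (\<kappa> (x[j := 2]))"
        "Dom C (\<kappa> (x[j := 2])) = obm D' (x[j := 2])"
        "\<kappa> (x[j := 0]) \<in> Arr C" "Cod C (\<kappa> (x[j := 0])) = obm D (x[i := 1, j := 0])" "monic (\<kappa> (x[j := 0]))"
        "Dom C (\<kappa> (x[j := 0])) = obm D' (x[j := 0])"
        using \<kappa>0 \<kappa>1 \<kappa>2 by (simp_all add: sw f1_def D'obm xji)
      have kf2: "is_kernel C (\<kappa> (x[j := 2])) f2" using \<kappa>[of "x[j := 2]"] by (simp add: f2_def sw)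
      have t: "k1 \<in> Arr C" "Dom C k1 = obm D' (x[j := 1])" "Cod C k1 = obm D' (x[j := 0])"
        "k2 \<in> Arr C" "Dom C k2 = obm D' (x[j := 2])" "Cod C k2 = obm D' (x[j := 1])"
        and e1: "\<kappa> (x[j := 0]) \<cdot> k1 = p1 \<cdot> \<kappa> (x[j := 1])" and e2: "\<kappa> (x[j := 1]) \<cdot> k2 = p2 \<cdot> \<kappa> (x[j := 2])"
        using a1 a2 by (simp_all add: \<iota>j cj p1_def p2_def)
      note [simp] = ty kt(1,2,4,6,7,9,10,11,13) t
      have "is_kernel C k2 k1"
      proof (rule kernelI)
        have "monic (\<kappa> (x[j := 1]) \<cdot> k2)" unfolding e2 by (intro monic_Cmp kernelD(5)[OF kp] kt) simp
        then show "monic k2" by (rule monic_right) simp_all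
        have "zero_arrow C ((p1 \<cdot> p2) \<cdot> \<kappa> (x[j := 2]))" by (rule zero_arrow_Cmp_right[OF kernelD(4)[OF kp]]) simp_all
        then have "zero_arrow C (\<kappa> (x[j := 0]) \<cdot> (k1 \<cdot> k2))" by (simp add: Cmp_eq_left[OF e1] e2)
        then show "zero_arrow C (k1 \<cdot> k2)" by (rule monic_zero_arrow[OF kt(12)]) simp_all
        fix h assume [simp]: "h \<in> Arr C" "Cod C h = Dom C k1" and h: "zero_arrow C (k1 \<cdot> h)"
        have "zero_arrow C (\<kappa> (x[j := 0]) \<cdot> (k1 \<cdot> h))" by (rule zero_arrow_Cmp_left[OF h]) simp_all
        then have "zero_arrow C (p1 \<cdot> (\<kappa> (x[j := 1]) \<cdot> h))" by (simp add: Cmp_eq_left[OF e1])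
        then have "\<kappa> (x[j := 1]) \<cdot> h \<preceq> p2" by (intro kernelD(6)[OF kp]) simp_all
        then obtain w where [simp]: "w \<in> Arr C" "Dom C w = Dom C (\<kappa> (x[j := 1]) \<cdot> h)" "Cod C w = Dom C p2" and w: "p2 \<cdot> w = \<kappa> (x[j := 1]) \<cdot> h"
          by (rule le_arrowE)
        have "zero_arrow C ((f1 \<cdot> \<kappa> (x[j := 1])) \<cdot> h)" by (rule zero_arrow_Cmp_right[OF kt(5)]) simp_all
        \<comment> \<open>As \<open>r2\<close> is monic, the lift \<open>w\<close> is killed in
          direction \<open>i\<close> too, and so comes from the kernel at
          \<open>x[j := 2]\<close>.\<close>
        then have "zero_arrow C (r2 \<cdot> (f2 \<cdot> w))" by (simp add: Cmp_eq_left[OF rf] w)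
        then have "zero_arrow C (f2 \<cdot> w)" by (rule monic_zero_arrow[OF kernelD(5)[OF kr]]) simp_all
        then have "w \<preceq> \<kappa> (x[j := 2])" by (intro kernelD(6)[OF kf2]) simp_all
        then obtain v where [simp]: "v \<in> Arr C" "Dom C v = Dom C w" "Cod C v = Dom C (\<kappa> (x[j := 2]))" and v: "\<kappa> (x[j := 2]) \<cdot> v = w"
          by (rule le_arrowE)
        have "\<kappa> (x[j := 1]) \<cdot> (k2 \<cdot> v) = \<kappa> (x[j := 1]) \<cdot> h" by (simp add: Cmp_eq_left[OF e2] v w)
        then have "k2 \<cdot> v = h" by (rule monicD[OF kt(3)]) simp_all
        then show "h \<preceq> k2" by (rule le_arrowI) simp_all
      qed simp_all
      then show ?thesis by (simp add: k1_def k2_def)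
    qed
  qed
qed

text \<open>\<open>b i\<close> bounds the coordinates after \<open>i\<close> steps. A line completed
  earlier remains a line of kernels at every later step, by the last clause of
  \<open>kernel_step_diagram\<close>.\<close>

lemma fold_kernel_step:
  assumes F: "diagram_on (grid 2 n) F"
  defines "D \<equiv> fold (kernel_step C) [0..<n] F"
  shows "diagram_on (grid 3 n) D" "ker_lines C n D" "diagrams_agree (grid 2 n) F D"
proof -
  define b where "b = (\<lambda>i j :: nat. if j < i then 3 else 2 :: nat)"
  have bb: "b (Suc i) = (b i)(i := 3)" for i by (auto simp: b_def fun_eq_iff)
  have sub: "grid 2 n \<subseteq> box (b i) n" for i
  proof
    fix x assume x: "x \<in> grid 2 n"
    have "x ! j < b i j" if "j < n" for j
    proof -
      have "x ! j < 2" using x that by (simp add: box_def)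
      then show ?thesis by (simp add: b_def)
    qed
    then show "x \<in> box (b i) n" using x by (simp add: box_def)
  qed
  have "i \<le> n \<Longrightarrow> diagram_on (box (b i) n) (fold (kernel_step C) [0..<i] F) \<and>
      diagrams_agree (grid 2 n) F (fold (kernel_step C) [0..<i] F) \<and>
      (\<forall>x\<in>box (b i) n. \<forall>j<i. is_kernel C (arm (fold (kernel_step C) [0..<i] F) (x[j := 1], x[j := 2]))
        (arm (fold (kernel_step C) [0..<i] F) (x[j := 0], x[j := 1])))" for i
  proof (induction i)
    case 0
    have "b 0 = (\<lambda>_. 2)" by (simp add: b_def)
    then show ?case using F by (simp add: diagrams_agree_def)
  next
    case (Suc i)
    define G where "G = fold (kernel_step C) [0..<i] F"
    have G: "diagram_on (box (b i) n) G" "diagrams_agree (grid 2 n) F G"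
      "\<And>x j. \<lbrakk>x \<in> box (b i) n; j < i\<rbrakk> \<Longrightarrow> is_kernel C (arm G (x[j := 1], x[j := 2])) (arm G (x[j := 0], x[j := 1]))"
      using Suc by (simp_all add: G_def)
    have i: "i < n" "b i i = 2" using Suc.prems by (simp_all add: b_def)
    note st = kernel_step_diagram[OF G(1) i]
    have fo: "fold (kernel_step C) [0..<Suc i] F = kernel_step C i G" by (simp add: G_def)
    show ?case unfolding fo bb
    proof (intro conjI ballI allI impI)
      show "diagrams_agree (grid 2 n) F (kernel_step C i G)"
        by (rule diagrams_agree_trans[OF G(2) diagrams_agree_subset[OF st(2) sub]])
      fix x j assume x: "x \<in> box ((b i)(i := 3)) n" and j: "j < Suc i"
      show "is_kernel C (arm (kernel_step C i G) (x[j := 1], x[j := 2])) (arm (kernel_step C i G) (x[j := 0], x[j := 1]))"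
      proof (cases "j = i")
        case True
        then show ?thesis using st(3)[OF x] by simp
      next
        case False
        then have j: "j < i" using j by simp
        show ?thesis
        proof (rule st(4)[OF x])
          show "j < n" "j \<noteq> i" "b i j = 3" using j i by (simp_all add: b_def)
        qed (rule G(3)[OF _ j])
      qed
    qed (rule st(1))
  qed
  from this[of n] have *: "diagram_on (box (b n) n) D" "diagrams_agree (grid 2 n) F D"
      "\<forall>x\<in>box (b n) n. \<forall>j<n. is_kernel C (arm D (x[j := 1], x[j := 2])) (arm D (x[j := 0], x[j := 1]))"
    by (simp_all add: D_def)
  have "box (b n) n = grid 3 n" by (auto simp: box_def b_def)
  with * show "diagram_on (grid 3 n) D" "ker_lines C n D" "diagrams_agree (grid 2 n) F D"
    by (simp_all add: ker_lines_def)
qed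

end
section \<open>Comparison of sequences with their completions\<close>

text \<open>Lowers every coordinate 2 to 1. In a sequence with kernel lines the object at
  \<open>x\<close> is a subobject of the object of the cube at \<open>base x\<close>.\<close>

definition base :: "nat list \<Rightarrow> nat list" where "base x = map (min 1) x"

lemma base_props:
  assumes "x \<in> grid 3 n"
  shows "base x \<in> grid 2 n" "base x \<in> grid 3 n" "base x \<unlhd> x"
  using assms by (auto simp: base_def box_def list_le_iff min_def One_nat_def)

lemma base_mono: "x \<unlhd> y \<Longrightarrow> base x \<unlhd> base y"
  by (auto simp: base_def list_le_iff)

lemma base_grid2: "x \<in> grid 2 n \<Longrightarrow> base x = x"
  by (intro nth_equalityI) (auto simp: base_def box_def min_def)

lemma base_update:
  "x ! i = 2 \<Longrightarrow> i < length x \<Longrightarrow> base (x[i := 1]) = base x"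
  "base (x[i := 0]) = (base x)[i := 0]"
  by (auto intro!: nth_equalityI simp: base_def nth_list_update map_update)

section \<open>Sequences with kernel lines are determined by their cubes\<close>

context category_with_kernels
begin

lemma is_kernel_transport:
  assumes k': "is_kernel C k' f'"
    and iso: "is_iso C a" "is_iso C b" "is_iso C c"
    and [simp]: "k \<in> Arr C" "f \<in> Arr C" "Cod C k = Dom C f" "Dom C a = Dom C k" "Cod C a = Dom C k'"
      "Dom C b = Cod C k" "Cod C b = Cod C k'" "Dom C c = Cod C f" "Cod C c = Cod C f'"
    and ka: "b \<cdot> k = k' \<cdot> a" and fb: "c \<cdot> f = f' \<cdot> b"
  shows "is_kernel C k f"
proof (rule kernelI)
  note [simp] = kernelD(1-3)[OF k'] iso[THEN is_iso_Arr]
  have [simp]: "Dom C b = Dom C f" "Cod C b = Dom C f'" by simp_all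
  have "monic (b \<cdot> k)" unfolding ka by (intro monic_Cmp kernelD(5)[OF k'] iso_monic iso) simp
  then show "monic k" by (rule monic_right) simp_all
  have "zero_arrow C ((f' \<cdot> k') \<cdot> a)" by (rule zero_arrow_Cmp_right[OF kernelD(4)[OF k']]) simp_all
  then have "zero_arrow C (c \<cdot> (f \<cdot> k))" by (simp add: Cmp_eq_left[OF fb] ka)
  then show "zero_arrow C (f \<cdot> k)" by (rule monic_zero_arrow[OF iso_monic[OF iso(3)]]) simp_all
  fix h assume [simp]: "h \<in> Arr C" "Cod C h = Dom C f" and h: "zero_arrow C (f \<cdot> h)"
  have "zero_arrow C (c \<cdot> (f \<cdot> h))" by (rule zero_arrow_Cmp_left[OF h]) simp_all
  then have "zero_arrow C (f' \<cdot> (b \<cdot> h))" by (simp add: Cmp_eq_left[OF fb])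
  then have "b \<cdot> h \<preceq> k'" by (rule_tac kernelD(6)[OF k']) simp_all
  then obtain w where [simp]: "w \<in> Arr C" "Dom C w = Dom C (b \<cdot> h)" "Cod C w = Dom C k'" and w: "k' \<cdot> w = b \<cdot> h"
    by (rule le_arrowE)
  obtain a' where a': "is_iso C a'" "Dom C a' = Cod C a" "Cod C a' = Dom C a" "a' \<cdot> a = Id C (Dom C a)" "a \<cdot> a' = Id C (Cod C a)"
    by (rule iso_inverse[OF iso(1)])
  note [simp] = is_iso_Arr[OF a'(1)] a'(2,3)
  have "b \<cdot> (k \<cdot> (a' \<cdot> w)) = b \<cdot> h" by (simp add: Cmp_eq_left[OF ka] Cmp_eq_left[OF a'(5)] w)
  then have "k \<cdot> (a' \<cdot> w) = h" by (rule monicD[OF iso_monic[OF iso(2)]]) simp_all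
  then show "h \<preceq> k" by (rule le_arrowI) simp_all
qed simp_all

lemma grid_update: "x \<in> grid 3 n \<Longrightarrow> a < 3 \<Longrightarrow> x[i := a] \<in> grid 3 n"
  by (rule box_update_same)

lemma ker_lines_iso:
  assumes D: "diagram_on (grid 3 n) D" "diagram_on (grid 3 n) D'" and iso: "diagram_iso (grid 3 n) D D' \<phi>"
    and k: "ker_lines C n D'"
  shows "ker_lines C n D"
  unfolding ker_lines_def
proof (intro ballI allI impI)
  fix x i assume x: "x \<in> grid 3 n" and i: "i < n"
  have [simp]: "x[i := 0] \<in> grid 3 n" "x[i := 1] \<in> grid 3 n" "x[i := 2] \<in> grid 3 n" using grid_update[OF x] by simp_all
  have [simp]: "x[i := 0] \<unlhd> x[i := 1]" "x[i := 1] \<unlhd> x[i := 2]" by (simp_all add: list_le_update_self)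
  have \<phi>: "is_iso C (\<phi> y)" "Dom C (\<phi> y) = obm D y" "Cod C (\<phi> y) = obm D' y" if "y \<in> grid 3 n" for y
    using iso that by (simp_all add: diagram_iso_def)
  have nat: "\<phi> y \<cdot> arm D (y, z) = arm D' (y, z) \<cdot> \<phi> z" if "y \<in> grid 3 n" "z \<in> grid 3 n" "y \<unlhd> z" for y z
    using iso that by (simp add: diagram_iso_def)
  show "is_kernel C (arm D (x[i := 1], x[i := 2])) (arm D (x[i := 0], x[i := 1]))"
    by (rule is_kernel_transport[OF _ \<phi>(1) \<phi>(1) \<phi>(1), of _ _ "x[i := 2]" "x[i := 1]" "x[i := 0]"])
      (use k x i in \<open>simp_all add: ker_lines_def \<phi> nat diagramD[OF D(1)] diagramD[OF D(2)]\<close>)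
qed

text \<open>Induction on the number of coordinates equal to 2. If \<open>x ! i = 2\<close>, the
  object at \<open>x\<close> is the kernel of the arrow from \<open>y = x[i := 1]\<close> to
  \<open>y0 = x[i := 0]\<close>; both of these embed in the cube by the induction hypothesis, so
  being killed at \<open>y0\<close> can be tested at the vertex \<open>(base x)[i := 0]\<close> of
  the cube.\<close>

lemma ker_lines_subobject:
  assumes D: "diagram_on (grid 3 n) D" and k: "ker_lines C n D"
  shows "x \<in> grid 3 n \<Longrightarrow> monic (arm D (base x, x)) \<and>
    (\<forall>z. z \<in> Arr C \<and> Cod C z = obm D (base x) \<longrightarrow>
      (z \<preceq> arm D (base x, x) \<longleftrightarrow> (\<forall>j<n. x ! j = 2 \<longrightarrow> zero_arrow C (arm D ((base x)[j := 0], base x) \<cdot> z))))"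
proof (induction "card {j. j < n \<and> x ! j = 2}" arbitrary: x rule: less_induct)
  case less
  have x: "x \<in> grid 3 n" and l: "length x = n" using less.prems box_length by auto
  show ?case
  proof (cases "\<exists>i<n. x ! i = 2")
    case False
    then have "x \<in> grid 2 n" using x unfolding box_def by (auto simp: less_Suc_eq numeral_3_eq_3 numeral_2_eq_2)
    then have b: "base x = x" by (rule base_grid2)
    have o: "obm D x \<in> Obj C" "arm D (x, x) = Id C (obm D x)" using diagramD(1,2)[OF D x] by simp_all
    have "z \<preceq> Id C (obm D x)" if "z \<in> Arr C" "Cod C z = obm D x" for z
      by (rule le_arrowI[of _ z]) (use that o in simp_all)
    then show ?thesis using False by (simp add: b o monic_Id)
  next
    case True
    then obtain i where i: "i < n" "x ! i = 2" by blast
    define y where "y = x[i := 1]"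
    define y0 where "y0 = x[i := 0]"
    have y: "y \<in> grid 3 n" "y0 \<in> grid 3 n" unfolding y_def y0_def using grid_update[OF x] by simp_all
    have by': "base y = base x" "base y0 = (base x)[i := 0]" using i l by (simp_all add: y_def y0_def base_update)
    have card: "card {j. j < n \<and> x[i := a] ! j = 2} < card {j. j < n \<and> x ! j = 2}" if "a \<noteq> 2" for a
    proof (rule psubset_card_mono)
      have "j \<noteq> i \<Longrightarrow> x[i := a] ! j = x ! j" for j by simp
      moreover have "x[i := a] ! i \<noteq> 2" using i l that by simp
      ultimately show "{j. j < n \<and> x[i := a] ! j = 2} \<subset> {j. j < n \<and> x ! j = 2}" using i by (auto, metis)
    qed simp
    note IH = less.hyps[of y, OF card[of 1, folded y_def] y(1), simplified by']
    have IH0: "monic (arm D ((base x)[i := 0], y0))" using less.hyps[of y0, OF card[of 0, folded y0_def] y(2)] by' by simp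
    let ?b = "base x"
    have b: "?b \<in> grid 3 n" "?b \<unlhd> x" using base_props[OF x] by simp_all
    have b0: "?b[j := 0] \<in> grid 3 n" "?b[j := 0] \<unlhd> ?b" for j
      using grid_update[OF b(1)] list_le_update_self[of 0 "?b ! j" ?b j] by simp_all
    have "x[i := 1] \<unlhd> x[i := x ! i]" by (rule list_le_update_self) (use i in simp)
    then have yx: "x[i := 1] \<unlhd> x" by simp
    have yle: "?b \<unlhd> y" "y0 \<unlhd> y" "y \<unlhd> x" "?b[i := 0] \<unlhd> y0"
      using base_props(3)[OF y(1)] base_props(3)[OF y(2)] list_le_update_self[of 0 1 x i] yx i by'
      by (simp_all add: y_def y0_def)
    define m where "m = arm D (?b, y)"
    define l2 where "l2 = arm D (y, x)"
    define l1 where "l1 = arm D (y0, y)"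
    define m0 where "m0 = arm D (?b[i := 0], y0)"
    define r where "r = arm D (?b[i := 0], ?b)"
    have ty[simp]: "m \<in> Arr C" "Dom C m = obm D y" "Cod C m = obm D ?b" "l2 \<in> Arr C" "Dom C l2 = obm D x" "Cod C l2 = obm D y"
      "l1 \<in> Arr C" "Dom C l1 = obm D y" "Cod C l1 = obm D y0" "m0 \<in> Arr C" "Dom C m0 = obm D y0" "Cod C m0 = obm D (?b[i := 0])"
      "r \<in> Arr C" "Dom C r = obm D ?b" "Cod C r = obm D (?b[i := 0])"
      by (simp_all add: m_def l2_def l1_def m0_def r_def diagramD[OF D] x y b b0 yle)
    have "x[i := 2] = x" using i by (metis list_update_id)
    moreover have "is_kernel C (arm D (x[i := 1], x[i := 2])) (arm D (x[i := 0], x[i := 1]))"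
      using k x i(1) unfolding ker_lines_def by blast
    ultimately have kl: "is_kernel C l2 l1" by (simp only: l1_def l2_def y_def y0_def)
    have ml: "arm D (?b, x) = m \<cdot> l2" unfolding m_def l2_def by (rule diagramD(6)[OF D, symmetric]) (use b x y yle in simp_all)
    have sq: "r \<cdot> m = m0 \<cdot> l1"
      unfolding r_def m_def m0_def l1_def
      using diagramD(6)[OF D b0(1) b(1) y(1) b0(2) yle(1)] diagramD(6)[OF D b0(1) y(2) y(1) yle(4) yle(2)] by simp
    have mm: "monic m" "monic m0" using IH IH0 by (simp_all add: m_def m0_def)
    have IHz: "z \<preceq> m \<longleftrightarrow> (\<forall>j<n. y ! j = 2 \<longrightarrow> zero_arrow C (arm D (?b[j := 0], ?b) \<cdot> z))" if "z \<in> Arr C" "Cod C z = obm D ?b" for z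
      using IH that by (simp add: m_def)
    have y2: "y ! j = 2 \<longleftrightarrow> x ! j = 2 \<and> j \<noteq> i" if "j < n" for j using that i l by (simp add: y_def nth_list_update)
    show ?thesis unfolding ml
    proof (intro conjI allI impI)
      show "monic (m \<cdot> l2)" by (intro monic_Cmp mm kernelD(5)[OF kl]) simp
      fix z assume z: "z \<in> Arr C \<and> Cod C z = obm D ?b"
      then have [simp]: "z \<in> Arr C" "Cod C z = obm D ?b" by simp_all
      show "z \<preceq> m \<cdot> l2 \<longleftrightarrow> (\<forall>j<n. x ! j = 2 \<longrightarrow> zero_arrow C (arm D (?b[j := 0], ?b) \<cdot> z))"
      proof
        assume "z \<preceq> m \<cdot> l2"
        then obtain w where [simp]: "w \<in> Arr C" "Dom C w = Dom C z" "Cod C w = Dom C (m \<cdot> l2)" and w: "(m \<cdot> l2) \<cdot> w = z" by (rule le_arrowE)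
        have "m \<cdot> (l2 \<cdot> w) = z" using w by simp
        then have "z \<preceq> m" by (rule le_arrowI) simp_all
        moreover have "zero_arrow C (r \<cdot> z)"
        proof -
          have "zero_arrow C (m0 \<cdot> ((l1 \<cdot> l2) \<cdot> w))"
            by (intro zero_arrow_Cmp_left zero_arrow_Cmp_right kernelD(4)[OF kl]) simp_all
          then have "zero_arrow C (r \<cdot> (m \<cdot> (l2 \<cdot> w)))" by (simp add: Cmp_eq_left[OF sq])
          then show ?thesis by (simp only: \<open>m \<cdot> (l2 \<cdot> w) = z\<close>)
        qed
        ultimately show "\<forall>j<n. x ! j = 2 \<longrightarrow> zero_arrow C (arm D (?b[j := 0], ?b) \<cdot> z)"
          using IHz[of z] y2 r_def by (metis \<open>z \<in> Arr C\<close> \<open>Cod C z = obm D ?b\<close>)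
      next
        assume a: "\<forall>j<n. x ! j = 2 \<longrightarrow> zero_arrow C (arm D (?b[j := 0], ?b) \<cdot> z)"
        then have "z \<preceq> m" using IHz[of z] y2 by simp
        then obtain w where [simp]: "w \<in> Arr C" "Dom C w = Dom C z" "Cod C w = Dom C m" and w: "m \<cdot> w = z" by (rule le_arrowE)
        have "zero_arrow C (r \<cdot> (m \<cdot> w))" using a i unfolding w r_def by blast
        then have "zero_arrow C (m0 \<cdot> (l1 \<cdot> w))" by (simp add: Cmp_eq_left[OF sq])
        then have "zero_arrow C (l1 \<cdot> w)" by (rule monic_zero_arrow[OF mm(2)]) simp_all
        then have "w \<preceq> l2" by (rule_tac kernelD(6)[OF kl]) simp_all
        then obtain v where [simp]: "v \<in> Arr C" "Dom C v = Dom C w" "Cod C v = Dom C l2" and v: "l2 \<cdot> v = w" by (rule le_arrowE)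
        have "(m \<cdot> l2) \<cdot> v = z" by (simp add: v w)
        then show "z \<preceq> m \<cdot> l2" by (rule le_arrowI) simp_all
      qed
    qed
  qed
qed

lemma grid_2_3: "grid 2 n \<subseteq> grid 3 n"
  by (auto simp: box_def)

text \<open>The objects at \<open>x\<close> in the two sequences are subobjects of the same object
  of the cube and have the same members, hence are isomorphic over it; naturality follows because
  these embeddings are monic.\<close>

lemma ker_lines_unique:
  assumes D: "diagram_on (grid 3 n) D" "diagram_on (grid 3 n) D'" and k: "ker_lines C n D" "ker_lines C n D'"
    and ag: "diagrams_agree (grid 2 n) D D'"
  obtains \<phi> where "diagram_iso (grid 3 n) D D' \<phi>" "\<And>x. x \<in> grid 2 n \<Longrightarrow> \<phi> x = Id C (obm D x)"
proof -
  define m where "m = (\<lambda>x. arm D (base x, x))"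
  define m' where "m' = (\<lambda>x. arm D' (base x, x))"
  have bm: "obm D' (base x) = obm D (base x)" if "x \<in> grid 3 n" for x
    using ag base_props(1)[OF that] by (simp add: diagrams_agree_def)
  have m: "m x \<in> Arr C" "Dom C (m x) = obm D x" "Cod C (m x) = obm D (base x)" "monic (m x)" if "x \<in> grid 3 n" for x
    using that base_props[OF that] diagramD[OF D(1)] ker_lines_subobject[OF D(1) k(1) that] by (simp_all add: m_def)
  have m': "m' x \<in> Arr C" "Dom C (m' x) = obm D' x" "Cod C (m' x) = obm D (base x)" "monic (m' x)" if "x \<in> grid 3 n" for x
    using that base_props[OF that] diagramD[OF D(2)] ker_lines_subobject[OF D(2) k(2) that] bm[OF that] by (simp_all add: m'_def)
  have le: "z \<preceq> m x \<longleftrightarrow> z \<preceq> m' x" if x: "x \<in> grid 3 n" and z: "z \<in> Arr C" "Cod C z = obm D (base x)" for x z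
  proof -
    have "arm D ((base x)[j := 0], base x) = arm D' ((base x)[j := 0], base x)" for j
    proof -
      have "(base x)[j := 0] \<in> grid 2 n" using box_update_same[OF base_props(1)[OF x], of j 0] by simp
      moreover have "(base x)[j := 0] \<unlhd> base x" using list_le_update_self[of 0 "base x ! j" "base x" j] by simp
      ultimately show ?thesis using ag base_props(1)[OF x] by (simp add: diagrams_agree_def)
    qed
    then show ?thesis using ker_lines_subobject[OF D(1) k(1) x] ker_lines_subobject[OF D(2) k(2) x] z bm[OF x]
      by (simp add: m_def m'_def)
  qed
  have "\<exists>u. is_iso C u \<and> Dom C u = obm D x \<and> Cod C u = obm D' x \<and> m' x \<cdot> u = m x" if x: "x \<in> grid 3 n" for x
  proof -
    note [simp] = m(1-3)[OF x] m'(1-3)[OF x]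
    have "m x \<preceq> m' x" "m' x \<preceq> m x" using le[OF x, of "m x"] le[OF x, of "m' x"] le_arrow_refl by simp_all
    then obtain u v where u: "u \<in> Arr C" "Dom C u = Dom C (m x)" "Cod C u = Dom C (m' x)" "m' x \<cdot> u = m x"
      and v: "v \<in> Arr C" "Dom C v = Dom C (m' x)" "Cod C v = Dom C (m x)" "m x \<cdot> v = m' x" by (elim le_arrowE) blast
    note [simp] = u(1-3) v(1-3)
    have o: "obm D x \<in> Obj C" "obm D' x \<in> Obj C" using diagramD(1)[OF D(1) x] diagramD(1)[OF D(2) x] by simp_all
    have "v \<cdot> u = Id C (obm D x)" by (rule monicD[OF m(4)[OF x]]) (simp_all add: o Cmp_eq_left[OF v(4)] u(4))
    moreover have "u \<cdot> v = Id C (obm D' x)" by (rule monicD[OF m'(4)[OF x]]) (simp_all add: o Cmp_eq_left[OF u(4)] v(4))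
    ultimately have "is_iso C u" unfolding is_iso_iff by (intro conjI bexI[of _ v]) simp_all
    then show ?thesis using u by (intro exI[of _ u]) simp
  qed
  then obtain \<phi> where \<phi>: "\<And>x. x \<in> grid 3 n \<Longrightarrow> is_iso C (\<phi> x) \<and> Dom C (\<phi> x) = obm D x \<and> Cod C (\<phi> x) = obm D' x \<and> m' x \<cdot> \<phi> x = m x"
    by metis
  have "diagram_iso (grid 3 n) D D' \<phi>" unfolding diagram_iso_def
  proof (intro conjI ballI impI)
    fix x y assume x: "x \<in> grid 3 n" and y: "y \<in> grid 3 n" and xy: "x \<unlhd> y"
    have \<phi>x: "\<phi> x \<in> Arr C" "Dom C (\<phi> x) = obm D x" "Cod C (\<phi> x) = obm D' x" "m' x \<cdot> \<phi> x = m x"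
      using \<phi>[OF x] by (simp_all add: is_iso_Arr)
    have \<phi>y: "\<phi> y \<in> Arr C" "Dom C (\<phi> y) = obm D y" "Cod C (\<phi> y) = obm D' y" "m' y \<cdot> \<phi> y = m y"
      using \<phi>[OF y] by (simp_all add: is_iso_Arr)
    note [simp] = \<phi>x(1-3) \<phi>y(1-3) diagramD(3-5)[OF D(1) x y xy] diagramD(3-5)[OF D(2) x y xy]
      m(1-3)[OF x] m'(1-3)[OF x] m(1-3)[OF y] m'(1-3)[OF y]
    note bx = base_props[OF x] and by' = base_props[OF y] and bxy = base_mono[OF xy]
    have ab: "arm D' (base x, base y) = arm D (base x, base y)" using ag bx(1) by'(1) bxy by (simp add: diagrams_agree_def)
    have eq: "arm D (base x, base y) \<cdot> m y = m x \<cdot> arm D (x, y)"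
      unfolding m_def using diagramD(6)[OF D(1) bx(2) by'(2) y bxy by'(3)] diagramD(6)[OF D(1) bx(2) x y bx(3) xy] by simp
    have eq': "arm D (base x, base y) \<cdot> m' y = m' x \<cdot> arm D' (x, y)"
      unfolding m'_def ab[symmetric] using diagramD(6)[OF D(2) bx(2) by'(2) y bxy by'(3)] diagramD(6)[OF D(2) bx(2) x y bx(3) xy] by simp
    note [simp] = diagramD(3-5)[OF D(1) bx(2) by'(2) bxy]
    have "m' x \<cdot> (\<phi> x \<cdot> arm D (x, y)) = m x \<cdot> arm D (x, y)" by (simp add: Cmp_eq_left[OF \<phi>x(4)])
    also have "\<dots> = arm D (base x, base y) \<cdot> (m' y \<cdot> \<phi> y)" by (simp only: eq \<phi>y(4))
    also have "\<dots> = m' x \<cdot> (arm D' (x, y) \<cdot> \<phi> y)" by (simp add: Cmp_eq_left[OF eq'])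
    finally show "\<phi> x \<cdot> arm D (x, y) = arm D' (x, y) \<cdot> \<phi> y" by (rule monicD[OF m'(4)[OF x]]) simp_all
  qed (use \<phi> in simp_all)
  moreover have "\<phi> x = Id C (obm D x)" if x: "x \<in> grid 2 n" for x
  proof -
    have x3: "x \<in> grid 3 n" using x grid_2_3 by auto
    have o: "obm D' x = obm D x" "obm D x \<in> Obj C" using ag x diagramD(1)[OF D(1) x3] by (simp_all add: diagrams_agree_def)
    have "m x = Id C (obm D x)" "m' x = Id C (obm D x)" using base_grid2[OF x] diagramD(2)[OF D(1) x3] diagramD(2)[OF D(2) x3] o
      by (simp_all add: m_def m'_def)
    moreover have "\<phi> x \<in> Arr C" using \<phi>[OF x3] is_iso_Arr by blast
    moreover from this have "Id C (obm D x) \<cdot> \<phi> x = \<phi> x" using \<phi>[OF x3] o by (intro Cmp_Id_left) simp_all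
    ultimately show ?thesis using \<phi>[OF x3] by metis
  qed
  ultimately show ?thesis by (rule that)
qed

lemma grid_2_iff: "x \<in> grid 3 n \<Longrightarrow> set x \<subseteq> {0, 1} \<longleftrightarrow> x \<in> grid 2 n"
  by (auto simp: box_def set_conv_nth less_2_cases_iff subset_iff)

text \<open>The completion has kernel lines and extends the given cube. An isomorphism carries its
  kernel lines over to \<open>E\<close>; conversely, if \<open>E\<close> has kernel lines, both
  sequences are determined by the same cube.\<close>

theorem KerSeq_iff:
  assumes E: "is_sequence C n E"
  shows "isomorphic_fixing C n {0, 1} E (KerSeq C n (epi_part n E)) \<longleftrightarrow> ker_lines C n E"
proof -
  let ?D = "KerSeq C n (epi_part n E)"
  have dE: "diagram_on (grid 3 n) E" using E by (simp add: is_sequence_def is_functor_chain_power_iff)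
  have ag: "diagrams_agree (grid 2 n) E (epi_part n E)"
    by (auto simp: diagrams_agree_def epi_part_def restrict_along_def Obj_chain_power)
  have "diagram_on (grid 2 n) (epi_part n E)"
    by (rule diagram_on_cong[OF ag diagram_on_subset[OF dE grid_2_3]])
  note F = fold_kernel_step[OF this, folded KerSeq_def]
  have ag': "diagrams_agree (grid 2 n) E ?D" by (rule diagrams_agree_trans[OF ag F(3)])
  show ?thesis
  proof
    assume "isomorphic_fixing C n {0, 1} E ?D"
    then obtain \<phi> where "diagram_iso (grid 3 n) E ?D \<phi>"
      unfolding isomorphic_fixing_def natural_isomorphism_chain_power_iff by blast
    then show "ker_lines C n E" by (rule ker_lines_iso[OF dE F(1) _ F(2)])
  next
    assume k: "ker_lines C n E"
    obtain \<phi> where \<phi>: "diagram_iso (grid 3 n) E ?D \<phi>" "\<And>x. x \<in> grid 2 n \<Longrightarrow> \<phi> x = Id C (obm E x)"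
      by (rule ker_lines_unique[OF dE F(1) k F(2) ag']) blast
    show "isomorphic_fixing C n {0, 1} E ?D"
      unfolding isomorphic_fixing_def natural_isomorphism_chain_power_iff Obj_chain_power
      using \<phi> dE F(1) ag' by (intro exI[of _ \<phi>]) (auto simp: grid_2_iff diagrams_agree_def)
  qed
qed

end

section \<open>Duality\<close>

text \<open>Reverses the chain 0, 1, 2 in each coordinate, so that the cube with coordinates 1, 2
  and the one with coordinates 0, 1 are exchanged.\<close>

definition reflect :: "nat list \<Rightarrow> nat list" where "reflect x = map (\<lambda>k. 2 - k) x"

text \<open>Reversal of the index order compensates the reversal of arrows: the result is again a
  contravariant diagram on the same grid, now in the opposite category, and cokernel lines have
  become kernel lines.\<close>

definition dual_diagram :: "('o, 'm) diagram \<Rightarrow> ('o, 'm) diagram" where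
  "dual_diagram D = \<lparr>obm = (\<lambda>x. obm D (reflect x)), arm = (\<lambda>(x, y). arm D (reflect y, reflect x))\<rparr>"

lemma dual_diagram_simps [simp]:
  "obm (dual_diagram D) x = obm D (reflect x)" "arm (dual_diagram D) (x, y) = arm D (reflect y, reflect x)"
  by (simp_all add: dual_diagram_def)

lemma reflect_grid: "x \<in> grid 3 n \<Longrightarrow> reflect x \<in> grid 3 n"
  by (auto simp: reflect_def box_def)

lemma reflect_reflect: "x \<in> grid 3 n \<Longrightarrow> reflect (reflect x) = x"
  by (intro nth_equalityI) (auto simp: reflect_def box_def)

lemma reflect_antimono: "x \<unlhd> y \<Longrightarrow> reflect y \<unlhd> reflect x"
  by (auto simp: reflect_def list_le_iff)

lemma reflect_update:
  "reflect (x[i := 0]) = (reflect x)[i := 2]" "reflect (x[i := 1]) = (reflect x)[i := 1]"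
  "reflect (x[i := 2]) = (reflect x)[i := 0]"
  by (simp_all add: reflect_def map_update One_nat_def)

lemma grid_reflect_ball:
  "(\<forall>x\<in>grid 3 n. P (reflect x)) \<longleftrightarrow> (\<forall>x\<in>grid 3 n. P x)"
proof (intro iffI ballI)
  fix x assume "\<forall>x\<in>grid 3 n. P (reflect x)" and x: "x \<in> grid 3 n"
  then have "P (reflect (reflect x))" using reflect_grid by blast
  then show "P x" by (simp only: reflect_reflect[OF x])
qed (simp add: reflect_grid)

lemma grid_reflect_ball2:
  "(\<forall>x\<in>grid 3 n. \<forall>y\<in>grid 3 n. x \<unlhd> y \<longrightarrow> P (reflect y) (reflect x)) \<longleftrightarrow> (\<forall>x\<in>grid 3 n. \<forall>y\<in>grid 3 n. x \<unlhd> y \<longrightarrow> P x y)"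
proof (intro iffI ballI impI)
  fix x y assume "\<forall>x\<in>grid 3 n. \<forall>y\<in>grid 3 n. x \<unlhd> y \<longrightarrow> P (reflect y) (reflect x)"
    and x: "x \<in> grid 3 n" and y: "y \<in> grid 3 n" and "x \<unlhd> y"
  then have "P (reflect (reflect x)) (reflect (reflect y))" using reflect_grid reflect_antimono by blast
  then show "P x y" by (simp only: reflect_reflect[OF x] reflect_reflect[OF y])
qed (simp add: reflect_grid reflect_antimono)

section \<open>Cokernels as kernels in the opposite category\<close>

context semi_abelian_category
begin

lemma zero_object_opposite: "zero_object (opposite C) Z \<longleftrightarrow> zero_object C Z"
  by (auto simp: zero_object_def initial_object_def terminal_object_def)

lemma zero_arrow_opposite: "zero_arrow (opposite C) f \<longleftrightarrow> zero_arrow C f"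
  unfolding zero_arrow_def by (auto simp: zero_object_opposite)

lemma is_kernel_opposite: "is_kernel (opposite C) k f \<longleftrightarrow> is_cokernel C k f"
  unfolding is_kernel_def is_cokernel_def by (auto simp: zero_arrow_opposite)

lemma is_iso_opposite: "is_iso (opposite C) f \<longleftrightarrow> is_iso C f"
  unfolding is_iso_def by auto

text \<open>The opposite category need not be semi-abelian, but existence of cokernels gives it
  kernels, and this is all that the completion and its comparison with a sequence
  presuppose.\<close>

sublocale opp: category_with_kernels "opposite C"
proof -
  interpret op: category "opposite C" by (rule category_opposite[OF category_axioms])
  show "category_with_kernels (opposite C)"
  proof unfold_locales
    show "\<exists>Z. zero_object (opposite C) Z" using pointed by (simp add: zero_object_opposite)
    fix f assume "f \<in> Arr (opposite C)"
    then obtain q where "is_cokernel C q f" by (auto intro: cokernel_exists[of f])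
    then show "\<exists>k. is_kernel (opposite C) k f" by (auto simp: is_kernel_opposite)
  qed
qed

lemma dual_diagram_on:
  assumes D: "diagram_on S0 D" and S: "reflect ` S \<subseteq> S0"
  shows "opp.diagram_on S (dual_diagram D)"
proof -
  have r: "reflect x \<in> S0" if "x \<in> S" for x using S that by auto
  show ?thesis unfolding opp.diagram_on_def
  proof (intro conjI ballI impI)
    fix x y z assume "x \<in> S" "y \<in> S" "z \<in> S" "x \<unlhd> y \<and> y \<unlhd> z"
    then show "arm (dual_diagram D) (x, y) \<cdot>\<^bsub>opposite C\<^esub> arm (dual_diagram D) (y, z) = arm (dual_diagram D) (x, z)"
      using diagramD(6)[OF D, of "reflect z" "reflect y" "reflect x"] by (simp add: r reflect_antimono)
  qed (simp_all add: diagramD[OF D] r reflect_antimono)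
qed

lemma dual_diagram_iso_iff:
  "opp.diagram_iso (grid 3 n) (dual_diagram D') (dual_diagram D) (\<lambda>x. \<phi> (reflect x)) \<longleftrightarrow> diagram_iso (grid 3 n) D D' \<phi>"
proof -
  have 1: "(\<forall>x\<in>grid 3 n. is_iso C (\<phi> (reflect x)) \<and> Cod C (\<phi> (reflect x)) = obm D' (reflect x) \<and> Dom C (\<phi> (reflect x)) = obm D (reflect x))
     \<longleftrightarrow> (\<forall>x\<in>grid 3 n. is_iso C (\<phi> x) \<and> Cod C (\<phi> x) = obm D' x \<and> Dom C (\<phi> x) = obm D x)"
    by (rule grid_reflect_ball)
  have 2: "(\<forall>x\<in>grid 3 n. \<forall>y\<in>grid 3 n. x \<unlhd> y \<longrightarrow> arm D' (reflect y, reflect x) \<cdot> \<phi> (reflect x) = \<phi> (reflect y) \<cdot> arm D (reflect y, reflect x))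
     \<longleftrightarrow> (\<forall>x\<in>grid 3 n. \<forall>y\<in>grid 3 n. x \<unlhd> y \<longrightarrow> arm D' (x, y) \<cdot> \<phi> y = \<phi> x \<cdot> arm D (x, y))"
    by (rule grid_reflect_ball2[of n "\<lambda>x y. arm D' (x, y) \<cdot> \<phi> y = \<phi> x \<cdot> arm D (x, y)"])
  show ?thesis unfolding opp.diagram_iso_def diagram_iso_def
    using 1 2 by (auto simp: is_iso_opposite)
qed

lemma coker_lines_dual: "coker_lines C n D \<longleftrightarrow> ker_lines (opposite C) n (dual_diagram D)"
proof -
  have "ker_lines (opposite C) n (dual_diagram D) \<longleftrightarrow> (\<forall>x\<in>grid 3 n. \<forall>i<n. is_cokernel C
      (arm D ((reflect x)[i := 0], (reflect x)[i := 1])) (arm D ((reflect x)[i := 1], (reflect x)[i := 2])))"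
    unfolding ker_lines_def by (simp add: is_kernel_opposite reflect_update)
  also have "\<dots> \<longleftrightarrow> coker_lines C n D" unfolding coker_lines_def by (rule grid_reflect_ball)
  finally show ?thesis by simp
qed

lemma chosen_kernel_opposite: "chosen_kernel (opposite C) f = chosen_cokernel C f"
  by (simp add: chosen_kernel_def chosen_cokernel_def is_kernel_opposite)

text \<open>The steps correspond exactly, not merely up to isomorphism: a kernel chosen in the
  opposite category and a cokernel chosen in \<open>C\<close> are selected by the same
  description.\<close>

lemma dual_cokernel_step:
  assumes ag: "diagrams_agree (grid 3 n) (dual_diagram D) D'" and i: "i < n"
  shows "diagrams_agree (grid 3 n) (dual_diagram (cokernel_step C i D)) (kernel_step (opposite C) i D')"
proof -
  have i2: "reflect x ! i = 0 \<longleftrightarrow> x ! i = 2" if "x \<in> grid 3 n" for x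
    using that i by (auto simp: reflect_def box_def dest!: spec[of _ i])
  have up: "x[i := a] \<in> grid 3 n" if "x \<in> grid 3 n" "a < 3" for x a using that by (rule opp.grid_update)
  have a: "arm D' (x, y) = arm D (reflect y, reflect x)" if "x \<in> grid 3 n" "y \<in> grid 3 n" "x \<unlhd> y" for x y
    using ag that by (simp add: diagrams_agree_def)
  have \<kappa>: "arm D' (x[i := 0], x[i := 1]) = arm D ((reflect x)[i := 1], (reflect x)[i := 2])" if "x \<in> grid 3 n" for x
    using a[OF up[OF that] up[OF that], of 0 1] list_le_update_self[of 0 1 x i] by (simp add: reflect_update)
  show ?thesis unfolding diagrams_agree_def
  proof (intro conjI ballI impI)
    fix x assume x: "x \<in> grid 3 n"
    have o: "obm D (reflect x) = obm D' x" using ag x by (simp add: diagrams_agree_def)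
    show "obm (dual_diagram (cokernel_step C i D)) x = obm (kernel_step (opposite C) i D') x"
      using \<kappa>[OF x] by (simp add: cokernel_step_def kernel_step_def Let_def chosen_kernel_opposite i2[OF x] o)
    fix y assume y: "y \<in> grid 3 n" and xy: "x \<unlhd> y"
    have 1: "arm D' (x[i := 1], y[i := 1]) = arm D ((reflect y)[i := 1], (reflect x)[i := 1])"
      using a[OF up[OF x] up[OF y], of 1 1] list_le_update[OF xy, of 1 1] by (simp add: reflect_update)
    have 2: "arm D' (x, y[i := 1]) = arm D ((reflect y)[i := 1], reflect x)" if "y ! i = 2" "x ! i \<noteq> 2"
    proof -
      have "x ! i \<le> 1" using x i that unfolding box_def by (auto simp: One_nat_def dest!: spec[of _ i])
      then have "x[i := x ! i] \<unlhd> y[i := 1]" by (rule list_le_update[OF xy])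
      then show ?thesis using a[OF x up[OF y], of 1] by (simp add: reflect_update)
    qed
    show "arm (dual_diagram (cokernel_step C i D)) (x, y) = arm (kernel_step (opposite C) i D') (x, y)"
      using a[OF x y xy] \<kappa>[OF x] \<kappa>[OF y] 1 2
      by (simp add: cokernel_step_def kernel_step_def Let_def chosen_kernel_opposite i2[OF x] i2[OF y] neq0_conv[symmetric] del: neq0_conv)
  qed
qed

lemma dual_fold_cokernel_step:
  "i \<le> n \<Longrightarrow> diagrams_agree (grid 3 n) (dual_diagram (fold (cokernel_step C) [0..<i] D))
    (fold (kernel_step (opposite C)) [0..<i] (dual_diagram D))"
proof (induction i)
  case 0
  show ?case by (simp add: diagrams_agree_def)
next
  case (Suc i)
  then show ?case using dual_cokernel_step[of n "fold (cokernel_step C) [0..<i] D" "fold (kernel_step (opposite C)) [0..<i] (dual_diagram D)" i] by simp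
qed

lemma grid_12_iff: "x \<in> grid 3 n \<Longrightarrow> set x \<subseteq> {1, 2} \<longleftrightarrow> reflect x \<in> grid 2 n"
proof -
  assume x: "x \<in> grid 3 n"
  have "set x \<subseteq> {1, 2} \<longleftrightarrow> (\<forall>j<n. x ! j = 1 \<or> x ! j = 2)" using x by (auto simp: box_def set_conv_nth subset_iff)
  also have "\<dots> \<longleftrightarrow> (\<forall>j<n. 2 - x ! j < 2)"
  proof -
    have "x ! j = 1 \<or> x ! j = 2 \<longleftrightarrow> 2 - x ! j < 2" if "j < n" for j
    proof -
      have "x ! j < 3" using x that by (simp add: box_def)
      then show ?thesis by linarith
    qed
    then show ?thesis by blast
  qed
  also have "\<dots> \<longleftrightarrow> reflect x \<in> grid 2 n" using x by (simp add: box_def reflect_def)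
  finally show ?thesis .
qed

text \<open>Dual of \<open>KerSeq_iff\<close>, read in the opposite category. Passing to the dual
  reverses the direction of an isomorphism of sequences, which is why inverses are taken; the
  truncated subtraction in \<open>CokerSeq\<close> undoes the renumbering wherever all coordinates
  are 1 or 2.\<close>

theorem CokerSeq_iff:
  assumes E: "is_sequence C n E"
  shows "isomorphic_fixing C n {1, 2} E (CokerSeq C n (mono_part n E)) \<longleftrightarrow> coker_lines C n E"
proof -
  let ?D = "CokerSeq C n (mono_part n E)"
  define D0 where "D0 = restrict_along (opposite (chain_power 3 n)) (map (\<lambda>k. k - 1)) (mono_part n E)"
  have dE: "diagram_on (grid 3 n) E" using E by (simp add: is_sequence_def is_functor_chain_power_iff)
  have im: "reflect ` grid 3 n \<subseteq> grid 3 n" "reflect ` grid 2 n \<subseteq> grid 3 n" using reflect_grid opp.grid_2_3 by blast+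
  have pred: "map (\<lambda>k. k - 1) (reflect x) \<in> grid 2 n" "map Suc (map (\<lambda>k. k - 1) (reflect x)) = reflect x" if x: "x \<in> grid 2 n" for x
  proof -
    have x: "length x = n" "\<And>j. j < n \<Longrightarrow> x ! j < 2" using x by (simp_all add: box_def)
    show "map (\<lambda>k. k - 1) (reflect x) \<in> grid 2 n" using x by (auto simp: reflect_def box_def)
    show "map Suc (map (\<lambda>k. k - 1) (reflect x)) = reflect x"
    proof (rule nth_equalityI)
      fix j assume "j < length (map Suc (map (\<lambda>k. k - 1) (reflect x)))"
      then have j: "j < n" using x by (simp add: reflect_def)
      have "x ! j = 0 \<or> x ! j = 1" using x(2)[OF j] by linarith
      with j show "map Suc (map (\<lambda>k. k - 1) (reflect x)) ! j = reflect x ! j" using x(1) by (auto simp: reflect_def One_nat_def)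
    qed simp
  qed
  have ag: "diagrams_agree (grid 2 n) (dual_diagram D0) (dual_diagram E)" unfolding diagrams_agree_def
  proof (intro conjI ballI impI)
    fix x assume x: "x \<in> grid 2 n"
    then have rx: "reflect x \<in> grid 3 n" using im by blast
    have p: "map (Suc \<circ> (\<lambda>k. k - 1)) (reflect x) = reflect x" using pred(2)[OF x] by simp
    show "obm (dual_diagram D0) x = obm (dual_diagram E) x"
      using pred(1)[OF x] p rx by (simp add: D0_def restrict_along_def mono_part_def Obj_chain_power)
    fix y assume y: "y \<in> grid 2 n" and xy: "x \<unlhd> y"
    then have ry: "reflect y \<in> grid 3 n" using im by blast
    have p': "map (Suc \<circ> (\<lambda>k. k - 1)) (reflect y) = reflect y" using pred(2)[OF y] by simp
    have le: "map (\<lambda>k. k - 1) (reflect y) \<unlhd> map (\<lambda>k. k - 1) (reflect x)"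
      using reflect_antimono[OF xy] by (auto simp: list_le_iff diff_le_mono)
    show "arm (dual_diagram D0) (x, y) = arm (dual_diagram E) (x, y)"
      using pred(1)[OF x] pred(1)[OF y] p p' rx ry le reflect_antimono[OF xy]
      by (simp add: D0_def restrict_along_def mono_part_def)
  qed
  have dE2: "opp.diagram_on (grid 3 n) (dual_diagram E)" by (rule dual_diagram_on[OF dE im(1)])
  have "opp.diagram_on (grid 2 n) (dual_diagram D0)"
    by (rule opp.diagram_on_cong[OF diagrams_agree_sym[OF ag] opp.diagram_on_subset[OF dE2 opp.grid_2_3]])
  note F = opp.fold_kernel_step[OF this]
  have agD: "diagrams_agree (grid 3 n) (fold (kernel_step (opposite C)) [0..<n] (dual_diagram D0)) (dual_diagram ?D)"
    unfolding CokerSeq_def D0_def[symmetric] by (rule diagrams_agree_sym[OF dual_fold_cokernel_step]) simp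
  have dD: "opp.diagram_on (grid 3 n) (dual_diagram ?D)" by (rule opp.diagram_on_cong[OF agD F(1)])
  have kD: "ker_lines (opposite C) n (dual_diagram ?D)"
  proof -
    have "arm (fold (kernel_step (opposite C)) [0..<n] (dual_diagram D0)) (x[i := a], x[i := b]) = arm (dual_diagram ?D) (x[i := a], x[i := b])"
      if "x \<in> grid 3 n" "a \<le> b" "b < 3" for x i a b
      using agD opp.grid_update[OF that(1)] that list_le_update_self[OF that(2), of x i] unfolding diagrams_agree_def by auto
    then show ?thesis using F(2) unfolding ker_lines_def by (simp del: dual_diagram_simps)
  qed
  have ag2: "diagrams_agree (grid 2 n) (dual_diagram ?D) (dual_diagram E)"
    using diagrams_agree_trans[OF F(3) diagrams_agree_subset[OF agD opp.grid_2_3]] ag diagrams_agree_sym diagrams_agree_trans by blast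
  have dD': "diagram_on (grid 3 n) ?D"
  proof -
    have r: "obm (dual_diagram ?D) (reflect x) = obm ?D x" "arm (dual_diagram ?D) (reflect y, reflect x) = arm ?D (x, y)"
      if "x \<in> grid 3 n" "y \<in> grid 3 n" for x y using that by (simp_all add: reflect_reflect)
    show ?thesis unfolding diagram_on_def
    proof (intro conjI ballI impI)
      fix x assume x: "x \<in> grid 3 n"
      note rx = reflect_grid[OF x]
      show "obm ?D x \<in> Obj C" "arm ?D (x, x) = Id C (obm ?D x)" using opp.diagramD(1,2)[OF dD rx] r[OF x x] by simp_all
      fix y assume y: "y \<in> grid 3 n"
      note ry = reflect_grid[OF y]
      {
        assume "x \<unlhd> y"
        then show "arm ?D (x, y) \<in> Arr C" "Dom C (arm ?D (x, y)) = obm ?D y" "Cod C (arm ?D (x, y)) = obm ?D x"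
          using opp.diagramD(3-5)[OF dD ry rx reflect_antimono] r[OF x y] r[OF y x] by simp_all
      }
      fix z assume z: "z \<in> grid 3 n" and "x \<unlhd> y \<and> y \<unlhd> z"
      then have "x \<unlhd> y" "y \<unlhd> z" by simp_all
      then show "arm ?D (x, y) \<cdot> arm ?D (y, z) = arm ?D (x, z)"
        using opp.diagramD(6)[OF dD reflect_grid[OF z] ry rx reflect_antimono reflect_antimono] r[OF x y] r[OF y z] r[OF x z] by simp
    qed
  qed
  show ?thesis
  proof
    assume "isomorphic_fixing C n {1, 2} E ?D"
    then obtain \<phi> where "diagram_iso (grid 3 n) E ?D \<phi>"
      unfolding isomorphic_fixing_def natural_isomorphism_chain_power_iff by blast
    then have "opp.diagram_iso (grid 3 n) (dual_diagram ?D) (dual_diagram E) (\<lambda>x. \<phi> (reflect x))"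
      by (simp only: dual_diagram_iso_iff)
    then obtain \<psi> where "opp.diagram_iso (grid 3 n) (dual_diagram E) (dual_diagram ?D) \<psi>"
      by (rule opp.diagram_iso_sym[OF dD dE2])
    then show "coker_lines C n E" unfolding coker_lines_dual by (rule opp.ker_lines_iso[OF dE2 dD _ kD])
  next
    assume "coker_lines C n E"
    then have k: "ker_lines (opposite C) n (dual_diagram E)" by (simp add: coker_lines_dual)
    obtain \<psi> where \<psi>: "opp.diagram_iso (grid 3 n) (dual_diagram ?D) (dual_diagram E) \<psi>"
        "\<And>x. x \<in> grid 2 n \<Longrightarrow> \<psi> x = Id (opposite C) (obm (dual_diagram ?D) x)"
      by (rule opp.ker_lines_unique[OF dD dE2 kD k ag2]) blast
    define \<phi> where "\<phi> = (\<lambda>x. \<psi> (reflect x))"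
    have "opp.diagram_iso (grid 3 n) (dual_diagram ?D) (dual_diagram E) (\<lambda>x. \<phi> (reflect x))"
      using \<psi>(1) unfolding opp.diagram_iso_def by (simp add: \<phi>_def reflect_reflect)
    then have iso: "diagram_iso (grid 3 n) E ?D \<phi>" by (simp only: dual_diagram_iso_iff)
    have "obm ?D x = obm E x \<and> \<phi> x = Id C (obm E x)" if x: "x \<in> grid 3 n" "set x \<subseteq> {1, 2}" for x
    proof -
      have rx: "reflect x \<in> grid 2 n" using x grid_12_iff by blast
      have "obm (dual_diagram ?D) (reflect x) = obm (dual_diagram E) (reflect x)" using ag2 rx by (simp add: diagrams_agree_def del: dual_diagram_simps)
      then show ?thesis using \<psi>(2)[OF rx] x(1) by (simp add: \<phi>_def reflect_reflect)
    qed
    then show "isomorphic_fixing C n {1, 2} E ?D"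
      unfolding isomorphic_fixing_def natural_isomorphism_chain_power_iff Obj_chain_power
      using iso dE dD' by blast
  qed
qed

text \<open>The definition looks at lines through points whose \<open>i\<close>-th coordinate is 0,
  and every line contains such a point; the functoriality demanded of a short exact sequence is
  inherited from \<open>E\<close>.\<close>

theorem is_3n_diagram_iff:
  assumes E: "is_sequence C n E"
  shows "is_3n_diagram C n E \<longleftrightarrow> ker_lines C n E \<and> coker_lines C n E"
proof -
  have dE: "diagram_on (grid 3 n) E" using E by (simp add: is_sequence_def is_functor_chain_power_iff)
  have up: "x[i := a] \<in> grid 3 n" if "x \<in> grid 3 n" "a < 3" for x i a using that by (rule opp.grid_update)
  have ch: "(a, b) \<in> Arr (chain 3) \<longleftrightarrow> a < 3 \<and> b < 3 \<and> a \<le> b" "Obj (chain 3) = {..<3}" "Dom (chain 3) p = fst p"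
    "Cod (chain 3) p = snd p" "Id (chain 3) a = (a, a)" "Cmp (chain 3) q p = (fst p, snd q)" for a b p q
    by (auto simp: chain_def poset_category_def)
  define S where "S = (\<lambda>x i. restrict_along (opposite (chain 3)) (axis_embedding x i) E)"
  have S: "arm (S x i) (a, b) = arm E (x[i := a], x[i := b])" if "a < 3" "b < 3" "a \<le> b" for x i a b
    using that by (simp add: S_def restrict_along_def axis_embedding_def ch)
  have So: "obm (S x i) a = obm E (x[i := a])" if "a < 3" for x i a
    using that by (simp add: S_def restrict_along_def axis_embedding_def ch)
  have catch: "category (chain 3)" unfolding chain_def by (rule category_poset) auto
  have F: "is_functor (opposite (chain 3)) C (S x i)" if x: "x \<in> grid 3 n" for x i
    unfolding is_functor_def
  proof (intro conjI ballI impI)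
    show "category (opposite (chain 3))" by (rule category_opposite[OF catch])
    show "category C" by (rule category_axioms)
    fix a assume a: "a \<in> Arr (opposite (chain 3))"
    obtain a1 a2 where a': "a = (a1, a2)" "a1 < 3" "a2 < 3" "a1 \<le> a2" using a by (cases a) (auto simp: ch)
    show "arm (S x i) a \<in> hom C (obm (S x i) (Dom (opposite (chain 3)) a)) (obm (S x i) (Cod (opposite (chain 3)) a))"
      using a' by (simp add: ch S So in_hom_iff diagramD[OF dE] up[OF x] list_le_update_self)
    fix b assume b: "b \<in> Arr (opposite (chain 3))" "Cod (opposite (chain 3)) a = Dom (opposite (chain 3)) b"
    obtain b1 b2 where b': "b = (b1, b2)" "b1 < 3" "b2 < 3" "b1 \<le> b2" using b by (cases b) (auto simp: ch)
    show "arm (S x i) (b \<cdot>\<^bsub>opposite (chain 3)\<^esub> a) = arm (S x i) b \<cdot> arm (S x i) a"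
      using a' b' b(2) by (simp add: ch S diagramD(6)[OF dE] up[OF x] list_le_update_self)
  next
    fix j assume "j \<in> Obj (opposite (chain 3))"
    then show "obm (S x i) j \<in> Obj C" "arm (S x i) (Id (opposite (chain 3)) j) = Id C (obm (S x i) j)"
      by (simp_all add: ch S So diagramD[OF dE] up[OF x])
  qed
  have se: "short_exact C (S x i) \<longleftrightarrow> is_kernel C (arm E (x[i := 1], x[i := 2])) (arm E (x[i := 0], x[i := 1])) \<and>
      is_cokernel C (arm E (x[i := 0], x[i := 1])) (arm E (x[i := 1], x[i := 2]))" if "x \<in> grid 3 n" for x i
    using F[OF that] by (simp add: short_exact_def S)
  have "is_3n_diagram C n E \<longleftrightarrow> (\<forall>x\<in>grid 3 n. \<forall>i<n. x ! i = 0 \<longrightarrow> short_exact C (S x i))"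
    by (simp add: is_3n_diagram_def Obj_chain_power S_def)
  also have "\<dots> \<longleftrightarrow> (\<forall>x\<in>grid 3 n. \<forall>i<n. short_exact C (S x i))"
  proof (intro iffI ballI allI impI)
    fix x i assume a: "\<forall>x\<in>grid 3 n. \<forall>i<n. x ! i = 0 \<longrightarrow> short_exact C (S x i)" and x: "x \<in> grid 3 n" and i: "i < n"
    have "S (x[i := 0]) i = S x i" by (simp add: S_def axis_embedding_def restrict_along_def)
    moreover have "x[i := 0] ! i = 0" using x i by (simp add: box_def)
    ultimately show "short_exact C (S x i)" using a up[OF x, of 0 i] i by (metis zero_less_numeral)
  qed simp
  also have "\<dots> \<longleftrightarrow> ker_lines C n E \<and> coker_lines C n E"
    unfolding ker_lines_def coker_lines_def using se by blast
  finally show ?thesis .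
qed

end
section \<open>Diagrams with exact lines and distributive tuples\<close>

text \<open>A list over 0, 1, 2 described by the sets \<open>T\<close> and \<open>Z\<close> of its
  coordinates 2 and 0; where they overlap, \<open>T\<close> takes precedence. The object at
  \<open>vertex n {} {}\<close> is the common codomain of the normal monomorphisms.\<close>

definition vertex :: "nat \<Rightarrow> nat set \<Rightarrow> nat set \<Rightarrow> nat list" where
  "vertex n T Z = map (\<lambda>j. if j \<in> T then 2 else if j \<in> Z then 0 else 1) [0..<n]"

lemma vertex_grid: "vertex n T Z \<in> grid 3 n"
  by (auto simp: vertex_def box_def)

lemma vertex_le: "T \<subseteq> T' \<Longrightarrow> Z' \<subseteq> Z \<Longrightarrow> vertex n T Z \<unlhd> vertex n T' Z'"
  by (auto simp: vertex_def list_le_iff)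

lemma vertex_update:
  assumes "i < n"
  shows "(vertex n T Z)[i := 2] = vertex n (insert i T) Z"
    and "i \<notin> T \<Longrightarrow> (vertex n T Z)[i := 0] = vertex n T (insert i Z)"
    and "i \<notin> T \<Longrightarrow> i \<notin> Z \<Longrightarrow> (vertex n T Z)[i := 1] = vertex n T Z"
  using assms by (auto intro!: nth_equalityI simp: vertex_def nth_list_update)

lemma vertex_cases:
  assumes "x \<in> grid 3 n" "i < n"
  obtains T Z where "T \<subseteq> {..<n}" "Z \<subseteq> {..<n}" "T \<inter> Z = {}" "i \<notin> T" "i \<notin> Z" "x[i := 1] = vertex n T Z"
proof -
  have l: "length x = n" "\<And>j. j < n \<Longrightarrow> x ! j < 3" using assms by (simp_all add: box_def)
  have "x[i := 1] = vertex n {j. j < n \<and> j \<noteq> i \<and> x ! j = 2} {j. j < n \<and> j \<noteq> i \<and> x ! j = 0}"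
  proof (rule nth_equalityI)
    fix j assume j: "j < length (x[i := 1])"
    then have "x ! j < 3" using l by simp
    then have "x ! j = 0 \<or> x ! j = 1 \<or> x ! j = 2" by linarith
    then show "x[i := 1] ! j = vertex n {j. j < n \<and> j \<noteq> i \<and> x ! j = 2} {j. j < n \<and> j \<noteq> i \<and> x ! j = 0} ! j"
      using j l assms(2) by (auto simp: vertex_def nth_list_update)
  qed (simp add: l vertex_def)
  then show ?thesis by (rule_tac that[OF _ _ _ _ _ \<open>x[i := 1] = _\<close>]) auto
qed

lemma base_vertex: "T \<inter> Z = {} \<Longrightarrow> base (vertex n T Z) = vertex n {} Z"
  by (auto intro!: nth_equalityI simp: base_def vertex_def)

section \<open>Vertices of a sequence as quotients of intersections\<close>

context semi_abelian_category
begin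

text \<open>If \<open>m \<cdot> k\<close> is the kernel of \<open>h\<close>, then \<open>k\<close>
  is the kernel of \<open>h \<cdot> m\<close>.\<close>

lemma normal_mono_factor:
  assumes k: "normal_mono C (m \<cdot> k)" and m: "monic m" and [simp]: "k \<in> Arr C" "Cod C k = Dom C m"
  shows "normal_mono C k"
proof -
  note [simp] = monic_Arr[OF m]
  obtain h where h: "is_kernel C (m \<cdot> k) h" using k by (rule normal_monoE)
  have [simp]: "h \<in> Arr C" "Dom C h = Cod C m" using kernelD(2,3)[OF h] by simp_all
  have "is_kernel C k (h \<cdot> m)"
  proof (rule kernelI)
    show "monic k" by (rule monic_right[OF kernelD(5)[OF h]]) simp_all
    show "zero_arrow C ((h \<cdot> m) \<cdot> k)" using kernelD(4)[OF h] by simp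
    fix x assume [simp]: "x \<in> Arr C" "Cod C x = Dom C (h \<cdot> m)" and "zero_arrow C ((h \<cdot> m) \<cdot> x)"
    then have "m \<cdot> x \<preceq> m \<cdot> k" by (intro kernelD(6)[OF h]) simp_all
    then obtain u where [simp]: "u \<in> Arr C" "Dom C u = Dom C (m \<cdot> x)" "Cod C u = Dom C (m \<cdot> k)" and u: "(m \<cdot> k) \<cdot> u = m \<cdot> x"
      by (rule le_arrowE)
    have "m \<cdot> (k \<cdot> u) = m \<cdot> x" using u by simp
    then have "k \<cdot> u = x" by (rule monicD[OF m]) simp_all
    then show "x \<preceq> k" by (rule le_arrowI) simp_all
  qed simp_all
  then show ?thesis by (auto simp: normal_mono_def)
qed

text \<open>Test arrows \<open>h\<close> on the codomain of \<open>m\<close> restrict to test arrows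
  \<open>h \<cdot> m\<close> on its domain.\<close>

lemma in_closure_push:
  assumes cl: "in_closure (Dom C m) S x" and [simp]: "m \<in> Arr C" "x \<in> Arr C" "Cod C x = Dom C m"
    and S: "\<And>a. a \<in> S \<Longrightarrow> a \<in> Arr C \<and> Cod C a = Dom C m \<and> in_closure (Cod C m) S' (m \<cdot> a)"
  shows "in_closure (Cod C m) S' (m \<cdot> x)"
  unfolding in_closure_def
proof (intro allI impI)
  fix h assume h: "h \<in> Arr C \<and> Dom C h = Cod C m \<and> (\<forall>k\<in>S'. zero_arrow C (h \<cdot> k))"
  then have [simp]: "h \<in> Arr C" "Dom C h = Cod C m" by simp_all
  have "zero_arrow C ((h \<cdot> m) \<cdot> a)" if "a \<in> S" for a
    using S[OF that] h unfolding in_closure_def by simp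
  then have "zero_arrow C ((h \<cdot> m) \<cdot> x)" using cl[unfolded in_closure_def, rule_format, of "h \<cdot> m"] by simp
  then show "zero_arrow C (h \<cdot> (m \<cdot> x))" by simp
qed

context
  fixes n :: nat and E
  assumes E: "diagram_on (grid 3 n) E"
begin

text \<open>Runs from the vertex \<open>(T', Z')\<close> to the vertex \<open>(T, Z)\<close>, for
  \<open>T\<close> inside \<open>T'\<close> and \<open>Z'\<close> inside \<open>Z\<close>: enlarging
  the first set leads towards kernels, enlarging the second towards quotients.\<close>

abbreviation (input) ar where "ar T Z T' Z' \<equiv> arm E (vertex n T Z, vertex n T' Z')"

lemma ar_simps [simp]:
  assumes "T \<subseteq> T'" "Z' \<subseteq> Z"
  shows "ar T Z T' Z' \<in> Arr C" "Dom C (ar T Z T' Z') = obm E (vertex n T' Z')" "Cod C (ar T Z T' Z') = obm E (vertex n T Z)"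
  using diagramD(3-5)[OF E vertex_grid vertex_grid vertex_le[OF assms]] by simp_all

lemma ar_Cmp:
  assumes "T \<subseteq> T'" "Z' \<subseteq> Z" "T' \<subseteq> T''" "Z'' \<subseteq> Z'"
  shows "ar T Z T' Z' \<cdot> ar T' Z' T'' Z'' = ar T Z T'' Z''"
  by (rule diagramD(6)[OF E vertex_grid vertex_grid vertex_grid vertex_le vertex_le]) (use assms in auto)

lemma ar_Id: "ar T Z T Z = Id C (obm E (vertex n T Z))" "obm E (vertex n T Z) \<in> Obj C"
  using diagramD(1,2)[OF E vertex_grid] by simp_all

lemma vertex_line_coker:
  assumes "coker_lines C n E" "i < n" "i \<notin> T" "i \<notin> Z"
  shows "is_cokernel C (ar T (insert i Z) T Z) (ar T Z (insert i T) Z)"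
  using assms(1)[unfolded coker_lines_def, rule_format, OF vertex_grid assms(2), of T Z]
    vertex_update[OF assms(2), of T Z] assms(3,4) by simp

lemma vertex_line_ker:
  assumes "ker_lines C n E" "i < n" "i \<notin> T" "i \<notin> Z"
  shows "is_kernel C (ar T Z (insert i T) Z) (ar T (insert i Z) T Z)"
  using assms(1)[unfolded ker_lines_def, rule_format, OF vertex_grid assms(2), of T Z]
    vertex_update[OF assms(2), of T Z] assms(3,4) by simp

text \<open>Adding \<open>z\<close> to \<open>Z\<close> passes to the cokernel of an arrow that
  starts at the vertex \<open>(insert z T, Z)\<close>. By induction, with \<open>T\<close> enlarged,
  that vertex is covered by \<open>(insert z T, {})\<close>, so the new generator can be taken at
  the level where the second set is empty.\<close>

lemma vertex_quotient:
  assumes co: "coker_lines C n E" and Z: "finite Z"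
  shows "Z \<subseteq> {..<n} \<Longrightarrow> T \<inter> Z = {} \<Longrightarrow> is_quotient ((\<lambda>z. ar T {} (insert z T) {}) ` Z) (ar T Z T {})"
  using Z
proof (induction Z arbitrary: T)
  case empty
  show ?case unfolding is_quotient_def using ar_Id[of T "{}"] by (auto simp: regular_epi_Id)
next
  case (insert z Z)
  have z: "z < n" "z \<notin> T" "z \<notin> Z" using insert by auto
  have q: "is_quotient ((\<lambda>z. ar T {} (insert z T) {}) ` Z) (ar T Z T {})" using insert.prems by (intro insert.IH) auto
  have q': "regular_epi C (ar (insert z T) Z (insert z T) {})"
    by (rule quotientD(1)[OF insert.IH]) (use insert.prems z in auto)
  note r = vertex_line_coker[OF co z]
  have rq: "ar T (insert z Z) T Z \<cdot> ar T Z T {} = ar T (insert z Z) T {}" by (rule ar_Cmp) auto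
  show ?case unfolding is_quotient_def
  proof (intro conjI ballI allI impI)
    show "regular_epi C (ar T (insert z Z) T {})" unfolding rq[symmetric]
      by (rule regular_epi_Cmp[OF quotientD(1)[OF q] cokernel_regular_epi[OF r]]) (simp add: subset_insertI)
    have sq: "ar T Z T {} \<cdot> ar T {} (insert z T) {} = ar T Z (insert z T) Z \<cdot> ar (insert z T) Z (insert z T) {}"
      by (subst ar_Cmp, blast, blast, blast, blast)+ (rule refl)
    fix k assume "k \<in> (\<lambda>z. ar T {} (insert z T) {}) ` insert z Z"
    then consider "k = ar T {} (insert z T) {}" | "k \<in> (\<lambda>z. ar T {} (insert z T) {}) ` Z" by blast
    then show "zero_arrow C (ar T (insert z Z) T {} \<cdot> k)"
    proof cases
      case 1
      have "zero_arrow C ((ar T (insert z Z) T Z \<cdot> ar T Z (insert z T) Z) \<cdot> ar (insert z T) Z (insert z T) {})"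
        by (rule zero_arrow_Cmp_right[OF cokernelD(4)[OF r]]) (simp_all add: subset_insertI)
      then have "zero_arrow C (ar T (insert z Z) T Z \<cdot> (ar T Z T {} \<cdot> ar T {} (insert z T) {}))"
        by (simp add: sq subset_insertI)
      then show ?thesis unfolding 1 rq[symmetric] by (simp add: subset_insertI)
    next
      case 2
      then obtain w where w: "k = ar T {} (insert w T) {}" by blast
      have "zero_arrow C (ar T (insert z Z) T Z \<cdot> (ar T Z T {} \<cdot> k))"
        by (rule zero_arrow_Cmp_left[OF quotientD(3)[OF q 2]]) (simp_all add: w subset_insertI)
      then show ?thesis unfolding rq[symmetric] w by (simp add: subset_insertI)
    qed
  next
    fix h assume h: "h \<in> Arr C \<and> Dom C h = Dom C (ar T (insert z Z) T {}) \<and>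
      (\<forall>k\<in>(\<lambda>z. ar T {} (insert z T) {}) ` insert z Z. zero_arrow C (h \<cdot> k))"
    have sq: "ar T Z T {} \<cdot> ar T {} (insert z T) {} = ar T Z (insert z T) Z \<cdot> ar (insert z T) Z (insert z T) {}"
      by (subst ar_Cmp, blast, blast, blast, blast)+ (rule refl)
    have [simp]: "h \<in> Arr C" "Dom C h = obm E (vertex n T {})" using h by simp_all
    obtain u where [simp]: "u \<in> Arr C" "Dom C u = Cod C (ar T Z T {})" "Cod C u = Cod C h" and u: "u \<cdot> ar T Z T {} = h"
      by (rule quotient_factor[OF q, of h]) (use h in auto)
    have "zero_arrow C (h \<cdot> ar T {} (insert z T) {})" using h by blast
    then have "zero_arrow C ((u \<cdot> ar T Z T {}) \<cdot> ar T {} (insert z T) {})" by (simp only: u)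
    then have "zero_arrow C ((u \<cdot> ar T Z (insert z T) Z) \<cdot> ar (insert z T) Z (insert z T) {})"
      by (simp add: sq subset_insertI)
    then have "zero_arrow C (u \<cdot> ar T Z (insert z T) Z)" by (rule regular_epi_zero_arrow[OF q']) (simp_all add: subset_insertI)
    then obtain v where v: "v \<in> Arr C" "Dom C v = Cod C (ar T (insert z Z) T Z)" "Cod C v = Cod C u" "v \<cdot> ar T (insert z Z) T Z = u"
      by (rule_tac cokernel_factor[OF r, of u]) (simp_all add: subset_insertI)
    have "v \<cdot> ar T (insert z Z) T {} = h" unfolding rq[symmetric]
      using Cmp_eq_left[OF v(4), of "ar T Z T {}"] v(1-3) u by (simp add: subset_insertI)
    then show "\<exists>u. u \<in> Arr C \<and> Dom C u = Cod C (ar T (insert z Z) T {}) \<and> Cod C u = Cod C h \<and> u \<cdot> ar T (insert z Z) T {} = h"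
      using v by (intro exI[of _ v]) (simp add: subset_insertI)
  qed
qed

lemma vertex_monic:
  assumes k: "ker_lines C n E" and T: "T \<inter> Z = {}"
  shows "monic (ar {} Z T Z)"
  using ker_lines_subobject[OF E k vertex_grid, of T Z] by (simp add: base_vertex[OF T])

lemma vertex_mem_iff:
  assumes k: "ker_lines C n E" and T: "T \<subseteq> {..<n}" and z: "z \<in> Arr C" "Cod C z = obm E (vertex n {} {})"
  shows "z \<preceq> ar {} {} T {} \<longleftrightarrow> (\<forall>j\<in>T. zero_arrow C (ar {} {j} {} {} \<cdot> z))"
proof -
  have "z \<preceq> ar {} {} T {} \<longleftrightarrow> (\<forall>j<n. vertex n T {} ! j = 2 \<longrightarrow> zero_arrow C (arm E ((vertex n {} {})[j := 0], vertex n {} {}) \<cdot> z))"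
    using ker_lines_subobject[OF E k vertex_grid, of T "{}"] z by (simp add: base_vertex)
  also have "\<dots> \<longleftrightarrow> (\<forall>j\<in>T. zero_arrow C (ar {} {j} {} {} \<cdot> z))"
  proof -
    have "vertex n T {} ! j = 2 \<longleftrightarrow> j \<in> T" "(vertex n {} {})[j := 0] = vertex n {} {j}" if "j < n" for j
      using vertex_update(2)[OF that, of "{}" "{}"] that by (simp_all add: vertex_def)
    then show ?thesis using T by auto
  qed
  finally show ?thesis .
qed

lemma mono_part_vertex:
  assumes e: "e \<in> grid 2 n"
  shows "arm (mono_part n E) (replicate n 0, e) = ar {} {} {i. i < n \<and> e ! i = 1} {}"
    and "obm (mono_part n E) (replicate n 0) = obm E (vertex n {} {})"
proof -
  have r: "replicate n 0 \<in> grid 2 n" "replicate n 0 \<unlhd> e" using e by (auto simp: box_def list_le_iff)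
  have l: "length e = n" "\<And>j. j < n \<Longrightarrow> e ! j < 2" using e by (simp_all add: box_def)
  have 1: "map Suc (replicate n 0) = vertex n {} {}" by (intro nth_equalityI) (simp_all add: vertex_def One_nat_def)
  have 2: "map Suc e = vertex n {i. i < n \<and> e ! i = 1} {}"
  proof (rule nth_equalityI)
    fix j assume j: "j < length (map Suc e)"
    then have "e ! j < 2" using l by simp
    then have "e ! j = 0 \<or> e ! j = 1" by linarith
    then show "map Suc e ! j = vertex n {i. i < n \<and> e ! i = 1} {} ! j" using j l by (auto simp: vertex_def One_nat_def)
  qed (simp add: l vertex_def)
  show "arm (mono_part n E) (replicate n 0, e) = ar {} {} {i. i < n \<and> e ! i = 1} {}"
    using r e by (simp add: mono_part_def restrict_along_def 1 2 del: map_replicate)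
  show "obm (mono_part n E) (replicate n 0) = obm E (vertex n {} {})"
    using r by (simp add: mono_part_def restrict_along_def 1 Obj_chain_power del: map_replicate)
qed

lemma mono_part_Obj: "mono_part n E \<in> Obj (Arrow_category n C)"
proof -
  have im: "map Suc x \<in> grid 3 n" if "x \<in> grid 2 n" for x using that by (auto simp: box_def)
  have le: "map Suc x \<unlhd> map Suc y" if "x \<unlhd> y" for x y using that by (auto simp: list_le_iff)
  have "diagram_on (grid 2 n) (mono_part n E)" unfolding diagram_on_def
  proof (intro conjI ballI impI)
    fix x y z assume xyz: "x \<in> grid 2 n" "y \<in> grid 2 n" "z \<in> grid 2 n" "x \<unlhd> y \<and> y \<unlhd> z"
    then have "x \<unlhd> z" using list_le_trans by blast
    with xyz show "arm (mono_part n E) (x, y) \<cdot> arm (mono_part n E) (y, z) = arm (mono_part n E) (x, z)"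
      using diagramD(6)[OF E im im im le le, of x y z] by (simp add: mono_part_def restrict_along_def)
  qed (simp_all add: mono_part_def restrict_along_def Obj_chain_power diagramD[OF E] im le list_le_refl)
  then show ?thesis
    by (auto simp: Arrow_category_def functor_category_def Let_def is_functor_chain_power_iff mono_part_def restrict_along_def)
qed

text \<open>\<open>K j\<close> is the arrow to the vertex with all coordinates 1 from the one with
  its only 2 at \<open>j\<close>. Let \<open>x\<close> belong to the meet over \<open>J\<close> and
  to the join of the \<open>K z\<close>; the latter means that \<open>x\<close> dies at the vertex
  with zeros on \<open>Z\<close>. Since kernel lines make the arrow from \<open>(J, Z)\<close> to
  \<open>({}, Z)\<close> monic, \<open>x\<close> already dies in the quotient of the meet over
  \<open>J\<close>, whose kernel is the join of the meets over \<open>insert z J\<close>.\<close>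

lemma exact_lines_distributive:
  assumes k: "ker_lines C n E" and co: "coker_lines C n E"
  shows "\<exists>X K. distributive_tuple C n X K \<and> induced_by C n (mono_part n E) X K"
proof -
  define X where "X = obm E (vertex n {} {})"
  define K where "K = (\<lambda>j. ar {} {} {j} {})"
  have XO: "X \<in> Obj C" using ar_Id(2) by (simp add: X_def)
  have Kker: "is_kernel C (K i) (ar {} {i} {} {})" if "i < n" for i
    using vertex_line_ker[OF k that, of "{}" "{}"] by (simp add: K_def)
  have CK: "Cod C (K i) = X" "K i \<in> Arr C" for i by (simp_all add: K_def X_def)
  have nt: "normal_tuple C n X K" using Kker XO CK by (auto simp: normal_tuple_def normal_mono_def)
  have Kmem: "z \<preceq> K i \<longleftrightarrow> zero_arrow C (ar {} {i} {} {} \<cdot> z)" if "i < n" "z \<in> Arr C" "Cod C z = X" for i z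
    using kernel_le_iff[OF Kker[OF that(1)] that(2)] that(3) by (simp add: X_def)
  have mem: "z \<preceq> ar {} {} T {} \<longleftrightarrow> (\<forall>i\<in>T. z \<preceq> K i)" if "T \<subseteq> {..<n}" "z \<in> Arr C" "Cod C z = X" for T z
    using vertex_mem_iff[OF k that(1,2)] that Kmem by (auto simp: X_def)
  have meets: "z \<in> meets X K T \<longleftrightarrow> z \<in> Arr C \<and> Cod C z = X \<and> z \<preceq> ar {} {} T {}" if "T \<subseteq> {..<n}" for T z
    using mem[OF that, of z] by (auto simp: meets_def)
  have "singleton_distributive n X K" unfolding singleton_distributive_def
  proof (intro conjI allI impI ballI nt)
    fix J Z x assume JZ: "J \<subseteq> {..<n} \<and> Z \<subseteq> {..<n} \<and> J \<inter> Z = {}" and x: "x \<in> meets X K J" and cl: "in_closure X (K ` Z) x"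
    have fZ: "finite Z" by (rule finite_subset[of Z "{..<n}"]) (use JZ in auto)
    have q0: "is_quotient (K ` Z) (ar {} Z {} {})" using vertex_quotient[OF co fZ, of "{}"] JZ by (simp add: K_def)
    have qJ: "is_quotient ((\<lambda>z. ar J {} (insert z J) {}) ` Z) (ar J Z J {})" using vertex_quotient[OF co fZ, of J] JZ by simp
    have x': "x \<in> Arr C" "Cod C x = X" "x \<preceq> ar {} {} J {}" using x meets[of J x] JZ by simp_all
    obtain y where [simp]: "y \<in> Arr C" "Dom C y = Dom C x" "Cod C y = Dom C (ar {} {} J {})" and y: "ar {} {} J {} \<cdot> y = x"
      using x'(3) by (rule le_arrowE)
    have "zero_arrow C (ar {} Z {} {} \<cdot> x)" using quotient_zero_iff[OF q0, of x] x' cl by (simp add: X_def)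
    then have "zero_arrow C (ar {} Z {} {} \<cdot> (ar {} {} J {} \<cdot> y))" by (simp only: y)
    moreover have "ar {} Z {} {} \<cdot> (ar {} {} J {} \<cdot> y) = ar {} Z J Z \<cdot> (ar J Z J {} \<cdot> y)"
      by (simp add: Cmp_eq_left[OF ar_Cmp])
    ultimately have "zero_arrow C (ar {} Z J Z \<cdot> (ar J Z J {} \<cdot> y))" by (simp only:)
    then have "zero_arrow C (ar J Z J {} \<cdot> y)" by (rule monic_zero_arrow[OF vertex_monic[OF k], rotated]) (use JZ in simp_all)
    then have "in_closure (Dom C (ar {} {} J {})) ((\<lambda>z. ar J {} (insert z J) {}) ` Z) y"
      using quotient_zero_iff[OF qJ, of y] by simp
    then have "in_closure (Cod C (ar {} {} J {})) (\<Union>z\<in>Z. meets X K (insert z J)) (ar {} {} J {} \<cdot> y)"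
    proof (rule in_closure_push)
      fix a assume "a \<in> (\<lambda>z. ar J {} (insert z J) {}) ` Z"
      then obtain z where z: "z \<in> Z" "a = ar J {} (insert z J) {}" by blast
      have e: "ar {} {} J {} \<cdot> a = ar {} {} (insert z J) {}" unfolding z(2) by (rule ar_Cmp) auto
      have "ar {} {} (insert z J) {} \<in> meets X K (insert z J)"
        using meets[of "insert z J" "ar {} {} (insert z J) {}"] JZ z(1) by (auto simp: X_def le_arrow_refl)
      then show "a \<in> Arr C \<and> Cod C a = Dom C (ar {} {} J {}) \<and> in_closure (Cod C (ar {} {} J {})) (\<Union>z\<in>Z. meets X K (insert z J)) (ar {} {} J {} \<cdot> a)"
        unfolding e using z(1) by (auto simp: z(2) subset_insertI intro!: in_closure_member)
    qed simp_all
    then show "in_closure X (\<Union>z\<in>Z. meets X K (insert z J)) x" by (simp add: y X_def)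
  qed
  then have "distributive_tuple C n X K" by (simp add: distributive_tuple_iff)
  moreover have "induced_by C n (mono_part n E) X K" unfolding induced_by_def
  proof (intro conjI ballI mono_part_Obj)
    show "obm (mono_part n E) (replicate n 0) = X"
      unfolding X_def by (rule mono_part_vertex(2)[of "replicate n 0"]) (simp add: box_def)
    fix e assume "e \<in> Obj (chain_power 2 n)"
    then have e: "e \<in> grid 2 n" by (simp add: Obj_chain_power)
    let ?T = "{i. i < n \<and> e ! i = 1}"
    have T: "?T \<subseteq> {..<n}" by auto
    have mm: "monic (ar {} {} ?T {})" by (rule vertex_monic[OF k]) simp
    show "is_intersection C X ?T K (arm (mono_part n E) (replicate n 0, e))"
      unfolding mono_part_vertex(1)[OF e] is_intersection_def
    proof (intro conjI ballI impI)
      show "ar {} {} ?T {} \<in> hom C (Dom C (ar {} {} ?T {})) X" by (simp add: in_hom_iff X_def)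
      show "ar {} {} ?T {} \<preceq> K i" if "i \<in> ?T" for i
        using mem[OF T, of "ar {} {} ?T {}"] that by (simp add: X_def le_arrow_refl)
      fix S h assume h: "h \<in> hom C S X" and "\<forall>i\<in>?T. h \<preceq> K i"
      then have "h \<preceq> ar {} {} ?T {}" using mem[OF T, of h] by (simp add: in_hom_iff)
      then obtain u where u: "u \<in> hom C (Dom C h) (Dom C (ar {} {} ?T {}))" "ar {} {} ?T {} \<cdot> u = h"
        unfolding subobject_le_def by blast
      show "\<exists>!u. u \<in> hom C S (Dom C (ar {} {} ?T {})) \<and> ar {} {} ?T {} \<cdot> u = h"
      proof (rule ex1I[of _ u])
        fix v assume v: "v \<in> hom C S (Dom C (ar {} {} ?T {})) \<and> ar {} {} ?T {} \<cdot> v = h"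
        show "v = u" by (rule monicD[OF mm]) (use u v in \<open>simp_all add: in_hom_iff\<close>)
      qed (use u h in \<open>simp add: in_hom_iff\<close>)
    qed
  qed
  ultimately show ?thesis by blast
qed

text \<open>The line through \<open>(T, Z)\<close> in direction \<open>i\<close> is induced on
  quotients of intersections. An element killed by \<open>l\<close> lifts to the meet over
  \<open>insert i T\<close> and lies in the join of the \<open>K z\<close>; by distributivity it
  lies in the join of the meets over \<open>insert z (insert i T)\<close>, which vanishes in the
  source of \<open>l\<close>. An element killed by \<open>f\<close> comes, modulo the generators for
  \<open>Z\<close>, from the normal subobject \<open>k\<close>, and so from
  \<open>l\<close>.\<close>

lemma distributive_exact_lines:
  assumes co: "coker_lines C n E" and d: "distributive_tuple C n X K" and ind: "induced_by C n (mono_part n E) X K"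
  shows "ker_lines C n E"
proof -
  have sd: "singleton_distributive n X K" using d by (simp add: distributive_tuple_iff)
  have nt: "normal_tuple C n X K" using sd by (simp add: singleton_distributive_def)
  have Xv: "X = obm E (vertex n {} {})"
    using ind mono_part_vertex(2)[of "replicate n 0"] by (simp add: induced_by_def box_def)
  define m where "m = (\<lambda>T. ar {} {} T {})"
  have mt[simp]: "m T \<in> Arr C" "Dom C (m T) = obm E (vertex n T {})" "Cod C (m T) = X" for T by (simp_all add: m_def Xv)
  have int: "is_intersection C X T K (m T)" if T: "T \<subseteq> {..<n}" for T
  proof -
    define e where "e = map (\<lambda>j. if j \<in> T then 1 else 0 :: nat) [0..<n]"
    have e: "e \<in> grid 2 n" "{i. i < n \<and> e ! i = 1} = T" using T by (auto simp: e_def box_def split: if_splits)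
    then show ?thesis using ind mono_part_vertex(1)[OF e(1)] unfolding induced_by_def m_def by (metis Obj_chain_power)
  qed
  have mK: "m T \<preceq> K i" if "T \<subseteq> {..<n}" "i \<in> T" for T i using int[OF that(1)] that(2) by (simp add: is_intersection_def)
  have mm: "monic (m T)" if T: "T \<subseteq> {..<n}" for T unfolding monic_def
  proof (intro conjI allI impI)
    fix a b assume "a \<in> Arr C \<and> b \<in> Arr C \<and> Cod C a = Dom C (m T) \<and> Cod C b = Dom C (m T) \<and> m T \<cdot> a = m T \<cdot> b"
    then have ab[simp]: "a \<in> Arr C" "b \<in> Arr C" "Cod C a = obm E (vertex n T {})" "Cod C b = obm E (vertex n T {})" and eq: "m T \<cdot> a = m T \<cdot> b"
      by simp_all
    have db: "Dom C b = Dom C a" using arg_cong[OF eq, of "Dom C"] by simp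
    have "m T \<cdot> a \<preceq> K i" if "i \<in> T" for i
    proof (rule le_arrow_Cmp[OF mK[OF T that]])
      show "K i \<in> Arr C" using nt T that by (auto simp: normal_tuple_def monic_Arr normal_mono_monic)
    qed simp_all
    then have "\<exists>!u. u \<in> hom C (Dom C a) (Dom C (m T)) \<and> m T \<cdot> u = m T \<cdot> a"
      using int[OF T] unfolding is_intersection_def by (auto simp: in_hom_iff)
    then show "a = b" using db eq ab by (metis in_hom_iff mt(2))
  qed simp
  have mem: "z \<in> meets X K T \<longleftrightarrow> z \<in> Arr C \<and> Cod C z = X \<and> z \<preceq> m T" if T: "T \<subseteq> {..<n}" for z T
  proof
    assume "z \<in> meets X K T"
    then have z: "z \<in> Arr C" "Cod C z = X" "\<forall>i\<in>T. z \<preceq> K i" by (simp_all add: meets_def)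
    then have "\<exists>u. u \<in> hom C (Dom C z) (Dom C (m T)) \<and> m T \<cdot> u = z"
      using int[OF T] unfolding is_intersection_def by (metis Dom_Obj in_hom_iff)
    then show "z \<in> Arr C \<and> Cod C z = X \<and> z \<preceq> m T" using z by (auto simp: subobject_le_def)
  next
    assume z: "z \<in> Arr C \<and> Cod C z = X \<and> z \<preceq> m T"
    have "z \<preceq> K i" if i: "i \<in> T" for i
    proof (rule le_arrow_trans[OF _ mK[OF T i]])
      show "K i \<in> Arr C" using nt T i by (auto simp: normal_tuple_def monic_Arr normal_mono_monic)
    qed (use z in simp)
    then show "z \<in> meets X K T" using z by (simp add: meets_def)
  qed
  \<comment> \<open>\<open>m T\<close> has the same members as the lattice infimum \<open>M\<close>,
    which is the kernel of some \<open>h\<close>; hence it is a kernel of \<open>h\<close> as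
    well.\<close>
  have nm: "normal_mono C (m T)" if T: "T \<subseteq> {..<n}" for T
  proof -
    define M where "M = \<Sqinter>\<^bsub>normal_subobjects C X\<^esub> (K ` T)"
    note M = meets_inf[OF nt T, folded M_def]
    obtain h where h: "is_kernel C M h" using M(3) by (rule normal_monoE)
    have hD: "h \<in> Arr C" "Dom C h = X" using kernelD(2,3)[OF h] M(4) by simp_all
    have eq: "z \<preceq> m T \<longleftrightarrow> zero_arrow C (h \<cdot> z)" if "z \<in> Arr C" "Cod C z = X" for z
      using mem[OF T, of z] M(5)[of z] kernel_le_iff[OF h, of z] that hD by simp
    have "zero_arrow C (h \<cdot> m T)" using eq[of "m T"] le_arrow_refl[of "m T"] by simp
    then have "is_kernel C (m T) h"
      by (rule_tac kernelI[OF mm[OF T]]) (use hD eq in simp_all)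
    then show ?thesis by (auto simp: normal_mono_def)
  qed
  have mCmp: "m T \<cdot> ar T {} T' {} = m T'" if "T \<subseteq> T'" for T T' unfolding m_def by (rule ar_Cmp) (use that in auto)
  show ?thesis unfolding ker_lines_def
  proof (intro ballI allI impI)
    fix x i assume x: "x \<in> grid 3 n" and i: "i < n"
    obtain T Z where TZ: "T \<subseteq> {..<n}" "Z \<subseteq> {..<n}" "T \<inter> Z = {}" "i \<notin> T" "i \<notin> Z" and xv: "x[i := 1] = vertex n T Z"
      by (rule vertex_cases[OF x i])
    have x2: "x[i := 2] = vertex n (insert i T) Z" "x[i := 0] = vertex n T (insert i Z)"
      using vertex_update(1,2)[OF i, of T Z] TZ(4) unfolding xv[symmetric] by simp_all
    define l where "l = ar T Z (insert i T) Z"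
    define f where "f = ar T (insert i Z) T Z"
    define q where "q = ar T Z T {}"
    define q' where "q' = ar (insert i T) Z (insert i T) {}"
    define k where "k = ar T {} (insert i T) {}"
    have iT: "insert i T \<subseteq> {..<n}" using TZ i by auto
    have fZ: "finite Z" "finite (insert i Z)" using finite_subset[OF TZ(2)] by simp_all
    have ty[simp]: "l \<in> Arr C" "Dom C l = obm E (vertex n (insert i T) Z)" "Cod C l = obm E (vertex n T Z)"
      "f \<in> Arr C" "Dom C f = obm E (vertex n T Z)" "Cod C f = obm E (vertex n T (insert i Z))"
      "q \<in> Arr C" "Dom C q = obm E (vertex n T {})" "Cod C q = obm E (vertex n T Z)"
      "q' \<in> Arr C" "Dom C q' = obm E (vertex n (insert i T) {})" "Cod C q' = obm E (vertex n (insert i T) Z)"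
      "k \<in> Arr C" "Dom C k = obm E (vertex n (insert i T) {})" "Cod C k = obm E (vertex n T {})"
      by (simp_all add: l_def f_def q_def q'_def k_def subset_insertI)
    have lq': "l \<cdot> q' = q \<cdot> k" unfolding l_def q_def q'_def k_def
      by (subst ar_Cmp, blast, blast, blast, blast)+ (rule refl)
    have fq: "f \<cdot> q = ar T (insert i Z) T {}" unfolding f_def q_def by (rule ar_Cmp) auto
    have fl: "zero_arrow C (f \<cdot> l)" unfolding f_def l_def by (rule cokernelD(4)[OF vertex_line_coker[OF co i TZ(4,5)]])
    have Q: "is_quotient ((\<lambda>z. ar T {} (insert z T) {}) ` Z) q" unfolding q_def by (rule vertex_quotient[OF co fZ(1) TZ(2,3)])
    have Q': "is_quotient ((\<lambda>z. ar (insert i T) {} (insert z (insert i T)) {}) ` Z) q'"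
      unfolding q'_def by (rule vertex_quotient[OF co fZ(1) TZ(2)]) (use TZ in auto)
    have QF: "is_quotient ((\<lambda>z. ar T {} (insert z T) {}) ` insert i Z) (f \<cdot> q)"
      unfolding fq by (rule vertex_quotient[OF co fZ(2)]) (use TZ i in auto)
    have kn: "normal_mono C k"
    proof (rule normal_mono_factor)
      show "normal_mono C (m T \<cdot> k)" unfolding k_def mCmp[OF subset_insertI] by (rule nm[OF iT])
    qed (simp_all add: mm[OF TZ(1)])
    have "is_kernel C l f"
    proof (rule kernelI)
      show "monic l"
      proof (rule trivial_kernel_monic)
        fix w assume [simp]: "w \<in> Arr C" "Cod C w = Dom C l" and lw: "zero_arrow C (l \<cdot> w)"
        obtain c y where c: "regular_epi C c" and [simp]: "Cod C c = Dom C w" "y \<in> Arr C" "Dom C y = Dom C c" "Cod C y = Dom C q'"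
          and y: "q' \<cdot> y = w \<cdot> c" by (rule regular_epi_lift[OF quotientD(1)[OF Q'], of w]) simp_all
        note [simp] = regular_epi_Arr[OF c]
        have "zero_arrow C ((l \<cdot> w) \<cdot> c)" by (rule zero_arrow_Cmp_right[OF lw]) simp_all
        then have "zero_arrow C (l \<cdot> (q' \<cdot> y))" by (simp add: y)
        then have "zero_arrow C (q \<cdot> (k \<cdot> y))" by (simp add: Cmp_eq_left[OF lq'])
        then have "in_closure (Dom C (m T)) ((\<lambda>z. ar T {} (insert z T) {}) ` Z) (k \<cdot> y)"
          using quotient_zero_iff[OF Q, of "k \<cdot> y"] by simp
        \<comment> \<open>Seen in \<open>X\<close>, each generator on the vertex \<open>T\<close> is
          a member of the corresponding \<open>K z\<close>.\<close>
        then have "in_closure (Cod C (m T)) (K ` Z) (m T \<cdot> (k \<cdot> y))"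
        proof (rule in_closure_push)
          fix a assume "a \<in> (\<lambda>z. ar T {} (insert z T) {}) ` Z"
          then obtain z where z: "z \<in> Z" "a = ar T {} (insert z T) {}" by blast
          have "m T \<cdot> a = m (insert z T)" unfolding z(2) by (rule mCmp[OF subset_insertI])
          moreover have "in_closure X (K ` Z) (m (insert z T))"
            by (rule in_closure_le[OF mK[of "insert z T" z]])
              (use z TZ(1,2) nt in \<open>auto simp: normal_tuple_def monic_Arr normal_mono_monic\<close>)
          ultimately show "a \<in> Arr C \<and> Cod C a = Dom C (m T) \<and> in_closure (Cod C (m T)) (K ` Z) (m T \<cdot> a)"
            by (simp add: z(2) subset_insertI)
        qed simp_all
        then have cl: "in_closure X (K ` Z) (m (insert i T) \<cdot> y)"
          using Cmp_eq_left[OF mCmp[OF subset_insertI], of T i y] by (simp add: k_def subset_insertI)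
        have "m (insert i T) \<cdot> y \<in> meets X K (insert i T)"
          unfolding mem[OF iT] by (simp add: le_arrowI[of _ y])
        then have "in_closure X (\<Union>z\<in>Z. meets X K (insert z (insert i T))) (m (insert i T) \<cdot> y)"
          using sd[unfolded singleton_distributive_def, THEN conjunct2, THEN spec, THEN spec, of "insert i T" Z] cl iT TZ by simp
        then have "in_closure X ((\<lambda>z. m (insert i T) \<cdot> ar (insert i T) {} (insert z (insert i T)) {}) ` Z) (m (insert i T) \<cdot> y)"
        proof (rule in_closure_trans)
          fix a assume "a \<in> (\<Union>z\<in>Z. meets X K (insert z (insert i T)))"
          then obtain z where z: "z \<in> Z" "a \<in> meets X K (insert z (insert i T))" by blast
          have "insert z (insert i T) \<subseteq> {..<n}" using z(1) TZ iT by auto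
          then have "a \<preceq> m (insert z (insert i T))" using mem z(2) by blast
          moreover have "m (insert z (insert i T)) \<in> (\<lambda>z. m (insert i T) \<cdot> ar (insert i T) {} (insert z (insert i T)) {}) ` Z"
            using z(1) mCmp[OF subset_insertI, of "insert i T" z] by (intro image_eqI[of _ _ z]) simp_all
          ultimately show "in_closure X ((\<lambda>z. m (insert i T) \<cdot> ar (insert i T) {} (insert z (insert i T)) {}) ` Z) a"
            by (rule in_closure_le) simp_all
        qed
        then have "in_closure (Cod C (m (insert i T))) ((\<lambda>z. m (insert i T) \<cdot> ar (insert i T) {} (insert z (insert i T)) {}) ` Z) (m (insert i T) \<cdot> y)"
          by simp
        \<comment> \<open>So far the closure is formed in \<open>X\<close>; it restricts to the
          vertex of \<open>insert i T\<close> because the generators are normal in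
          \<open>X\<close>.\<close>
        then have "in_closure (Dom C (m (insert i T))) ((\<lambda>z. ar (insert i T) {} (insert z (insert i T)) {}) ` Z) y"
        proof (rule in_closure_restrict[OF mm[OF iT] fZ(1), rotated -1])
          fix z assume "z \<in> Z"
          then have "insert z (insert i T) \<subseteq> {..<n}" using TZ iT by auto
          then show "ar (insert i T) {} (insert z (insert i T)) {} \<in> Arr C \<and>
              Cod C (ar (insert i T) {} (insert z (insert i T)) {}) = Dom C (m (insert i T)) \<and>
              normal_mono C (m (insert i T) \<cdot> ar (insert i T) {} (insert z (insert i T)) {})"
            using mCmp[OF subset_insertI, of "insert i T" z] by (simp add: subset_insertI nm)
        qed simp_all
        then have "zero_arrow C (w \<cdot> c)" using quotient_zero_iff[OF Q', of y] by (simp add: y)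
        then show "zero_arrow C w" by (rule regular_epi_zero_arrow[OF c]) simp_all
      qed simp
      fix w assume [simp]: "w \<in> Arr C" "Cod C w = Dom C f" and fw: "zero_arrow C (f \<cdot> w)"
      obtain c y where c: "regular_epi C c" and [simp]: "Cod C c = Dom C w" "y \<in> Arr C" "Dom C y = Dom C c" "Cod C y = Dom C q"
        and y: "q \<cdot> y = w \<cdot> c" by (rule regular_epi_lift[OF quotientD(1)[OF Q], of w]) simp_all
      note [simp] = regular_epi_Arr[OF c]
      have "zero_arrow C ((f \<cdot> w) \<cdot> c)" by (rule zero_arrow_Cmp_right[OF fw]) simp_all
      then have "zero_arrow C ((f \<cdot> q) \<cdot> y)" by (simp add: y)
      then have cl: "in_closure (Dom C q) (insert k ((\<lambda>z. ar T {} (insert z T) {}) ` Z)) y"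
        using quotient_zero_iff[OF QF, of y] by (simp add: k_def)
      \<comment> \<open>The kernel of \<open>f \<cdot> q\<close> is the closure of \<open>k\<close>
        and the generators for \<open>Z\<close>, so locally \<open>y\<close> agrees with an element
        of \<open>k\<close> after composition with \<open>q\<close>.\<close>
      obtain c' v where c': "regular_epi C c'" and [simp]: "Cod C c' = Dom C y" "v \<in> Arr C" "Dom C v = Dom C c'" "Cod C v = Dom C k"
        and v: "q \<cdot> (y \<cdot> c') = q \<cdot> (k \<cdot> v)"
        by (rule in_closure_insert[OF Q kn _ _ _ cl]) (auto simp: subset_insertI)
      note [simp] = regular_epi_Arr[OF c']
      have "l \<cdot> (q' \<cdot> v) = w \<cdot> (c \<cdot> c')" using v by (simp add: Cmp_eq_left[OF lq'] Cmp_eq_left[OF y])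
      then have "w \<cdot> (c \<cdot> c') \<preceq> l" by (rule le_arrowI) simp_all
      moreover have "regular_epi C (c \<cdot> c')" by (rule regular_epi_Cmp[OF c' c]) simp
      ultimately show "w \<preceq> l" by (rule_tac le_arrow_local[OF \<open>monic l\<close>, of "c \<cdot> c'"]) simp_all
    qed (simp_all add: fl)
    then show "is_kernel C (arm E (x[i := 1], x[i := 2])) (arm E (x[i := 0], x[i := 1]))"
      by (simp only: xv x2 l_def f_def)
  qed
qed

end

end
section \<open>Multiple arrows and their pullbacks\<close>

lemma insert_grid:
  assumes "e \<in> grid k m" "a < k"
  shows "take i e @ a # drop i e \<in> grid k (Suc m)"
proof -
  have e: "length e = m \<and> set e \<subseteq> {..<k}" using assms(1) unfolding Obj_chain_power[symmetric] by (simp add: chain_power_def poset_category_def)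
  have "length (take i e @ a # drop i e) = Suc m" using e by simp
  moreover have "set (take i e @ a # drop i e) \<subseteq> {..<k}"
    using e assms(2) set_take_subset[of i e] set_drop_subset[of i e] by auto
  ultimately show ?thesis unfolding Obj_chain_power[symmetric] by (simp add: chain_power_def poset_category_def)
qed

lemma insert_mono: "x \<unlhd> y \<Longrightarrow> take i x @ a # drop i x \<unlhd> take i y @ a # drop i y"
  by (intro list_all2_appendI list_all2_takeI) (simp_all add: list_all2_dropI)

lemma grid_Cons [simp]: "a # e \<in> grid k (Suc m) \<longleftrightarrow> a < k \<and> e \<in> grid k m"
  unfolding Obj_chain_power[symmetric] by (auto simp: chain_power_def poset_category_def)

lemma grid_SucE:
  assumes "x \<in> grid k (Suc m)"
  obtains a e where "x = a # e" "a < k" "e \<in> grid k m"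
proof (cases x)
  case Nil
  then show ?thesis using assms by (simp add: box_def)
next
  case (Cons a e)
  then show ?thesis using assms that by simp
qed

section \<open>Pullbacks of multiple arrows, computed at each vertex\<close>

context semi_abelian_category
begin

definition nat_trans :: "nat \<Rightarrow> ('a, 'b) diagram \<Rightarrow> ('a, 'b) diagram \<Rightarrow> (nat list \<Rightarrow> 'b) \<Rightarrow> bool" where
  "nat_trans m F G \<eta> \<longleftrightarrow> (\<forall>x\<in>grid 2 m. \<eta> x \<in> Arr C \<and> Dom C (\<eta> x) = obm F x \<and> Cod C (\<eta> x) = obm G x) \<and>
     (\<forall>x\<in>grid 2 m. \<forall>y\<in>grid 2 m. x \<unlhd> y \<longrightarrow> \<eta> x \<cdot> arm F (x, y) = arm G (x, y) \<cdot> \<eta> y)"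

lemma nat_transD:
  assumes "nat_trans m F G \<eta>" "x \<in> grid 2 m"
  shows "\<eta> x \<in> Arr C" "Dom C (\<eta> x) = obm F x" "Cod C (\<eta> x) = obm G x"
    and "\<lbrakk>y \<in> grid 2 m; x \<unlhd> y\<rbrakk> \<Longrightarrow> \<eta> x \<cdot> arm F (x, y) = arm G (x, y) \<cdot> \<eta> y"
  using assms by (simp_all add: nat_trans_def)

lemma Obj_Arrow_iff:
  "D \<in> Obj (Arrow_category m C) \<longleftrightarrow> diagram_on (grid 2 m) D \<and> obm D \<in> extensional (grid 2 m) \<and> arm D \<in> extensional (Arr (chain_power 2 m))"
  by (simp add: Arrow_category_def functor_category_def Let_def is_functor_chain_power_iff Obj_chain_power)

lemma natural_transformation_iff:
  "natural_transformation (opposite (chain_power 2 m)) C F G \<eta> \<longleftrightarrow>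
     diagram_on (grid 2 m) F \<and> diagram_on (grid 2 m) G \<and> nat_trans m F G \<eta>"
proof -
  have arr: "(\<forall>a\<in>Arr (chain_power 2 m). P (fst a) (snd a)) \<longleftrightarrow> (\<forall>x\<in>grid 2 m. \<forall>y\<in>grid 2 m. x \<unlhd> y \<longrightarrow> P x y)" for P
    by (metis chain_power_simps(1) fst_conv snd_conv surj_pair)
  have nat: "(\<forall>a\<in>Arr (chain_power 2 m). \<eta> (fst a) \<cdot> arm F a = arm G a \<cdot> \<eta> (snd a)) \<longleftrightarrow>
      (\<forall>x\<in>grid 2 m. \<forall>y\<in>grid 2 m. x \<unlhd> y \<longrightarrow> \<eta> x \<cdot> arm F (x, y) = arm G (x, y) \<cdot> \<eta> y)"
    using arr[of "\<lambda>x y. \<eta> x \<cdot> arm F (x, y) = arm G (x, y) \<cdot> \<eta> y"] by simp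
  show ?thesis
    unfolding natural_transformation_def is_functor_chain_power_iff nat_trans_def
    by (simp add: Obj_chain_power nat in_hom_iff)
qed

lemma Arr_Arrow_iff:
  "(F, G, \<eta>) \<in> Arr (Arrow_category m C) \<longleftrightarrow> F \<in> Obj (Arrow_category m C) \<and> G \<in> Obj (Arrow_category m C) \<and>
     nat_trans m F G \<eta> \<and> \<eta> \<in> extensional (grid 2 m)"
  by (auto simp: Arrow_category_def functor_category_def Let_def is_functor_chain_power_iff Obj_chain_power natural_transformation_iff)

lemma Arrow_simps [simp]:
  "Dom (Arrow_category m C) (F, G, \<eta>) = F" "Cod (Arrow_category m C) (F, G, \<eta>) = G"
  "Cmp (Arrow_category m C) (G', H, \<theta>) (F, G, \<eta>) = (F, H, \<lambda>j\<in>grid 2 m. \<theta> j \<cdot> \<eta> j)"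
  by (simp_all add: Arrow_category_def functor_category_def Let_def Obj_chain_power)

lemma hom_Arrow_iff:
  "h \<in> hom (Arrow_category m C) F G \<longleftrightarrow> (\<exists>\<eta>. h = (F, G, \<eta>) \<and> F \<in> Obj (Arrow_category m C) \<and> G \<in> Obj (Arrow_category m C) \<and>
     nat_trans m F G \<eta> \<and> \<eta> \<in> extensional (grid 2 m))"
  by (cases h) (auto simp: hom_def Arr_Arrow_iff)

lemma restrict_cong_iff: "(\<lambda>j\<in>S. f j) = (\<lambda>j\<in>S. g j) \<longleftrightarrow> (\<forall>j\<in>S. f j = g j)"
  by (metis restrict_apply' restrict_ext)

lemma restrict_eq_iff: "\<eta> \<in> extensional S \<Longrightarrow> (\<lambda>j\<in>S. f j) = \<eta> \<longleftrightarrow> (\<forall>j\<in>S. f j = \<eta> j)"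
  by (metis extensionalityI restrict_apply' restrict_extensional)

text \<open>Pullbacks are chosen vertex by vertex; the arrows between them are the induced ones, and
  these compose as they should because the two projections are jointly monic.\<close>

lemma pointwise_pullback_exists:
  assumes f: "(F, H, \<phi>) \<in> Arr (Arrow_category m C)" and g: "(G, H, \<psi>) \<in> Arr (Arrow_category m C)"
  obtains P \<pi> \<rho> where "(P, F, \<pi>) \<in> Arr (Arrow_category m C)" "(P, G, \<rho>) \<in> Arr (Arrow_category m C)"
    "\<And>x. x \<in> grid 2 m \<Longrightarrow> is_pullback C (\<phi> x) (\<psi> x) (\<pi> x) (\<rho> x)"
proof -
  let ?S = "grid 2 m"
  have dF: "diagram_on ?S F" and dG: "diagram_on ?S G" and n\<phi>: "nat_trans m F H \<phi>" and n\<psi>: "nat_trans m G H \<psi>"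
    and dH: "diagram_on ?S H"
    using f g by (simp_all add: Arr_Arrow_iff Obj_Arrow_iff)
  have "\<exists>\<pi> \<rho>. is_pullback C (\<phi> x) (\<psi> x) \<pi> \<rho>" if "x \<in> ?S" for x
    by (rule has_pullbacks) (simp_all add: nat_transD[OF n\<phi> that] nat_transD[OF n\<psi> that])
  then obtain \<pi>0 \<rho>0 where pb0: "\<And>x. x \<in> ?S \<Longrightarrow> is_pullback C (\<phi> x) (\<psi> x) (\<pi>0 x) (\<rho>0 x)" by metis
  define \<pi> where "\<pi> = restrict \<pi>0 ?S"
  define \<rho> where "\<rho> = restrict \<rho>0 ?S"
  have pb: "is_pullback C (\<phi> x) (\<psi> x) (\<pi> x) (\<rho> x)" if "x \<in> ?S" for x using pb0[OF that] that by (simp add: \<pi>_def \<rho>_def)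
  have t: "\<pi> x \<in> Arr C" "Cod C (\<pi> x) = obm F x" "\<rho> x \<in> Arr C" "Dom C (\<rho> x) = Dom C (\<pi> x)" "Cod C (\<rho> x) = obm G x" if "x \<in> ?S" for x
    using pullbackD[OF pb[OF that]] nat_transD[OF n\<phi> that] nat_transD[OF n\<psi> that] by simp_all
  have ex: "\<exists>u. u \<in> Arr C \<and> Dom C u = Dom C (\<pi> y) \<and> Cod C u = Dom C (\<pi> x) \<and>
      \<pi> x \<cdot> u = arm F (x, y) \<cdot> \<pi> y \<and> \<rho> x \<cdot> u = arm G (x, y) \<cdot> \<rho> y" if xy: "x \<in> ?S" "y \<in> ?S" "x \<unlhd> y" for x y
  proof -
    note [simp] = t[OF xy(1)] t[OF xy(2)] diagramD(3-5)[OF dF xy] diagramD(3-5)[OF dG xy] diagramD(3-5)[OF dH xy]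
      nat_transD(1-3)[OF n\<phi> xy(1)] nat_transD(1-3)[OF n\<phi> xy(2)] nat_transD(1-3)[OF n\<psi> xy(1)] nat_transD(1-3)[OF n\<psi> xy(2)]
    have "\<phi> x \<cdot> (arm F (x, y) \<cdot> \<pi> y) = arm H (x, y) \<cdot> (\<phi> y \<cdot> \<pi> y)" by (simp add: Cmp_eq_left[OF nat_transD(4)[OF n\<phi> xy]])
    also have "\<dots> = arm H (x, y) \<cdot> (\<psi> y \<cdot> \<rho> y)" using pullbackD(9)[OF pb[OF xy(2)]] by simp
    also have "\<dots> = \<psi> x \<cdot> (arm G (x, y) \<cdot> \<rho> y)" by (simp add: Cmp_eq_left[OF nat_transD(4)[OF n\<psi> xy]])
    finally obtain u where "u \<in> Arr C" "Dom C u = Dom C (arm F (x, y) \<cdot> \<pi> y)" "Cod C u = Dom C (\<pi> x)"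
      "\<pi> x \<cdot> u = arm F (x, y) \<cdot> \<pi> y" "\<rho> x \<cdot> u = arm G (x, y) \<cdot> \<rho> y"
      by (rule pullback_lift[OF pb[OF xy(1)]]) simp_all
    then show ?thesis by (intro exI[of _ u]) simp
  qed
  define \<omega> where "\<omega> = (\<lambda>(x, y). SOME u. u \<in> Arr C \<and> Dom C u = Dom C (\<pi> y) \<and> Cod C u = Dom C (\<pi> x) \<and>
      \<pi> x \<cdot> u = arm F (x, y) \<cdot> \<pi> y \<and> \<rho> x \<cdot> u = arm G (x, y) \<cdot> \<rho> y)"
  have \<omega>: "\<omega> (x, y) \<in> Arr C" "Dom C (\<omega> (x, y)) = Dom C (\<pi> y)" "Cod C (\<omega> (x, y)) = Dom C (\<pi> x)"
      "\<pi> x \<cdot> \<omega> (x, y) = arm F (x, y) \<cdot> \<pi> y" "\<rho> x \<cdot> \<omega> (x, y) = arm G (x, y) \<cdot> \<rho> y" if xy: "x \<in> ?S" "y \<in> ?S" "x \<unlhd> y" for x y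
    using someI_ex[OF ex[OF xy]] by (simp_all add: \<omega>_def)
  define P where "P = \<lparr>obm = (\<lambda>x\<in>?S. Dom C (\<pi> x)), arm = restrict \<omega> (Arr (chain_power 2 m))\<rparr>"
  have Pa: "arm P (x, y) = \<omega> (x, y)" if "x \<in> ?S" "y \<in> ?S" "x \<unlhd> y" for x y using that by (simp add: P_def)
  have Po: "obm P x = Dom C (\<pi> x)" if "x \<in> ?S" for x using that by (simp add: P_def)
  have dP: "diagram_on ?S P" unfolding diagram_on_def
  proof (intro conjI ballI impI)
    fix x assume x: "x \<in> ?S"
    note [simp] = t[OF x] \<omega>(1-3)[OF x x list_le_refl] Pa[OF x x list_le_refl] Po[OF x]
    show "obm P x \<in> Obj C" by simp
    show "arm P (x, x) = Id C (obm P x)"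
      unfolding Pa[OF x x list_le_refl] by (rule pullback_eq[OF pb[OF x]])
        (simp_all add: \<omega>(4,5)[OF x x list_le_refl] diagramD(2)[OF dF x] diagramD(2)[OF dG x] diagramD(1)[OF dF x] diagramD(1)[OF dG x])
    fix y assume y: "y \<in> ?S"
    show "arm P (x, y) \<in> Arr C" "Dom C (arm P (x, y)) = obm P y" "Cod C (arm P (x, y)) = obm P x" if "x \<unlhd> y"
      using \<omega>[OF x y that] Pa[OF x y that] Po[OF y] by simp_all
    fix z assume z: "z \<in> ?S" and "x \<unlhd> y \<and> y \<unlhd> z"
    then have xy: "x \<unlhd> y" and yz: "y \<unlhd> z" and xz: "x \<unlhd> z" using list_le_trans[of x y z] by simp_all
    note [simp] = t[OF y] t[OF z] \<omega>(1-3)[OF x y xy] \<omega>(1-3)[OF y z yz] \<omega>(1-3)[OF x z xz]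
      diagramD(3-5)[OF dF x y xy] diagramD(3-5)[OF dF y z yz] diagramD(3-5)[OF dG x y xy] diagramD(3-5)[OF dG y z yz]
    have "\<omega> (x, y) \<cdot> \<omega> (y, z) = \<omega> (x, z)"
    proof (rule pullback_eq[OF pb[OF x]])
      show "\<pi> x \<cdot> (\<omega> (x, y) \<cdot> \<omega> (y, z)) = \<pi> x \<cdot> \<omega> (x, z)"
        by (simp add: Cmp_eq_left[OF \<omega>(4)[OF x y xy]] \<omega>(4)[OF y z yz] \<omega>(4)[OF x z xz] diagram_Cmp[OF dF x y z xy yz])
      show "\<rho> x \<cdot> (\<omega> (x, y) \<cdot> \<omega> (y, z)) = \<rho> x \<cdot> \<omega> (x, z)"
        by (simp add: Cmp_eq_left[OF \<omega>(5)[OF x y xy]] \<omega>(5)[OF y z yz] \<omega>(5)[OF x z xz] diagram_Cmp[OF dG x y z xy yz])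
    qed simp_all
    then show "arm P (x, y) \<cdot> arm P (y, z) = arm P (x, z)" using Pa[OF x y xy] Pa[OF y z yz] Pa[OF x z xz] by simp
  qed
  have PO: "P \<in> Obj (Arrow_category m C)" using dP by (simp add: Obj_Arrow_iff P_def)
  have "nat_trans m P F \<pi>" "nat_trans m P G \<rho>" unfolding nat_trans_def using t Po Pa \<omega>(4,5) by simp_all
  then have "(P, F, \<pi>) \<in> Arr (Arrow_category m C)" "(P, G, \<rho>) \<in> Arr (Arrow_category m C)"
    using PO f g by (simp_all add: Arr_Arrow_iff \<pi>_def \<rho>_def)
  then show ?thesis using pb by (rule that)
qed

text \<open>The induced arrows at the vertices form a natural transformation because naturality can
  be checked after both projections.\<close>

lemma pointwise_is_pullback:
  assumes f: "(F, H, \<phi>) \<in> Arr (Arrow_category m C)" and g: "(G, H, \<psi>) \<in> Arr (Arrow_category m C)"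
    and p: "(P, F, \<pi>) \<in> Arr (Arrow_category m C)" and q: "(P, G, \<rho>) \<in> Arr (Arrow_category m C)"
    and pb: "\<And>x. x \<in> grid 2 m \<Longrightarrow> is_pullback C (\<phi> x) (\<psi> x) (\<pi> x) (\<rho> x)"
  shows "is_pullback (Arrow_category m C) (F, H, \<phi>) (G, H, \<psi>) (P, F, \<pi>) (P, G, \<rho>)"
  unfolding is_pullback_def
proof (intro conjI ballI impI)
  let ?S = "grid 2 m"
  have n\<pi>: "nat_trans m P F \<pi>" and n\<rho>: "nat_trans m P G \<rho>" and dF: "diagram_on ?S F" and dG: "diagram_on ?S G" and dP: "diagram_on ?S P"
    using p q by (simp_all add: Arr_Arrow_iff Obj_Arrow_iff)
  show "(F, H, \<phi>) \<cdot>\<^bsub>Arrow_category m C\<^esub> (P, F, \<pi>) = (G, H, \<psi>) \<cdot>\<^bsub>Arrow_category m C\<^esub> (P, G, \<rho>)"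
    using pullbackD(9)[OF pb] by (auto simp: restrict_cong_iff)
  fix T a b assume T: "T \<in> Obj (Arrow_category m C)"
    and a: "a \<in> hom (Arrow_category m C) T (Dom (Arrow_category m C) (F, H, \<phi>))"
    and b: "b \<in> hom (Arrow_category m C) T (Dom (Arrow_category m C) (G, H, \<psi>))"
    and eq: "(F, H, \<phi>) \<cdot>\<^bsub>Arrow_category m C\<^esub> a = (G, H, \<psi>) \<cdot>\<^bsub>Arrow_category m C\<^esub> b"
  obtain \<alpha> where \<alpha>: "a = (T, F, \<alpha>)" "nat_trans m T F \<alpha>" "\<alpha> \<in> extensional ?S" using a by (auto simp: hom_Arrow_iff)
  obtain \<beta> where \<beta>: "b = (T, G, \<beta>)" "nat_trans m T G \<beta>" "\<beta> \<in> extensional ?S" using b by (auto simp: hom_Arrow_iff)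
  have dT: "diagram_on ?S T" using T by (simp add: Obj_Arrow_iff)
  have e: "\<phi> x \<cdot> \<alpha> x = \<psi> x \<cdot> \<beta> x" if "x \<in> ?S" for x using eq that by (simp add: \<alpha> \<beta> restrict_cong_iff)
  have "\<exists>u. u \<in> Arr C \<and> Dom C u = obm T x \<and> Cod C u = obm P x \<and> \<pi> x \<cdot> u = \<alpha> x \<and> \<rho> x \<cdot> u = \<beta> x" if x: "x \<in> ?S" for x
  proof -
    obtain u where "u \<in> Arr C" "Dom C u = Dom C (\<alpha> x)" "Cod C u = Dom C (\<pi> x)" "\<pi> x \<cdot> u = \<alpha> x" "\<rho> x \<cdot> u = \<beta> x"
      using e[OF x] by (rule pullback_lift[OF pb[OF x]])
        (use nat_transD[OF \<alpha>(2) x] nat_transD[OF \<beta>(2) x] nat_transD[OF n\<pi> x] nat_transD[OF n\<rho> x] pullbackD[OF pb[OF x]] in simp_all)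
    then show ?thesis using nat_transD[OF \<alpha>(2) x] nat_transD[OF n\<pi> x] by (intro exI[of _ u]) simp
  qed
  then obtain \<upsilon>0 where \<upsilon>0: "\<And>x. x \<in> ?S \<Longrightarrow> \<upsilon>0 x \<in> Arr C \<and> Dom C (\<upsilon>0 x) = obm T x \<and> Cod C (\<upsilon>0 x) = obm P x \<and> \<pi> x \<cdot> \<upsilon>0 x = \<alpha> x \<and> \<rho> x \<cdot> \<upsilon>0 x = \<beta> x"
    by metis
  define \<upsilon> where "\<upsilon> = restrict \<upsilon>0 ?S"
  have \<upsilon>: "\<upsilon> x \<in> Arr C" "Dom C (\<upsilon> x) = obm T x" "Cod C (\<upsilon> x) = obm P x" "\<pi> x \<cdot> \<upsilon> x = \<alpha> x" "\<rho> x \<cdot> \<upsilon> x = \<beta> x" if "x \<in> ?S" for x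
    using \<upsilon>0[OF that] that by (simp_all add: \<upsilon>_def)
  have \<upsilon>e: "\<upsilon> \<in> extensional ?S" by (simp add: \<upsilon>_def)
  have n\<upsilon>: "nat_trans m T P \<upsilon>" unfolding nat_trans_def
  proof (intro conjI ballI impI)
    fix x y assume x: "x \<in> ?S" and y: "y \<in> ?S" and xy: "x \<unlhd> y"
    note [simp] = \<upsilon>(1-3)[OF x] \<upsilon>(1-3)[OF y] nat_transD(1-3)[OF n\<pi> x] nat_transD(1-3)[OF n\<pi> y] nat_transD(1-3)[OF n\<rho> x] nat_transD(1-3)[OF n\<rho> y]
      diagramD(3-5)[OF dT x y xy] diagramD(3-5)[OF dP x y xy] diagramD(3-5)[OF dF x y xy] diagramD(3-5)[OF dG x y xy]
    show "\<upsilon> x \<cdot> arm T (x, y) = arm P (x, y) \<cdot> \<upsilon> y"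
    proof (rule pullback_eq[OF pb[OF x]])
      show "\<pi> x \<cdot> (\<upsilon> x \<cdot> arm T (x, y)) = \<pi> x \<cdot> (arm P (x, y) \<cdot> \<upsilon> y)"
        by (simp add: Cmp_eq_left[OF \<upsilon>(4)[OF x]] nat_transD(4)[OF \<alpha>(2) x y xy] Cmp_eq_left[OF nat_transD(4)[OF n\<pi> x y xy]] \<upsilon>(4)[OF y])
      show "\<rho> x \<cdot> (\<upsilon> x \<cdot> arm T (x, y)) = \<rho> x \<cdot> (arm P (x, y) \<cdot> \<upsilon> y)"
        by (simp add: Cmp_eq_left[OF \<upsilon>(5)[OF x]] nat_transD(4)[OF \<beta>(2) x y xy] Cmp_eq_left[OF nat_transD(4)[OF n\<rho> x y xy]] \<upsilon>(5)[OF y])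
    qed simp_all
  qed (simp_all add: \<upsilon>)
  have PO: "P \<in> Obj (Arrow_category m C)" using p by (simp add: Arr_Arrow_iff)
  show "\<exists>!u. u \<in> hom (Arrow_category m C) T (Dom (Arrow_category m C) (P, F, \<pi>)) \<and>
      (P, F, \<pi>) \<cdot>\<^bsub>Arrow_category m C\<^esub> u = a \<and> (P, G, \<rho>) \<cdot>\<^bsub>Arrow_category m C\<^esub> u = b"
  proof (rule ex1I[of _ "(T, P, \<upsilon>)"])
    show "(T, P, \<upsilon>) \<in> hom (Arrow_category m C) T (Dom (Arrow_category m C) (P, F, \<pi>)) \<and>
      (P, F, \<pi>) \<cdot>\<^bsub>Arrow_category m C\<^esub> (T, P, \<upsilon>) = a \<and> (P, G, \<rho>) \<cdot>\<^bsub>Arrow_category m C\<^esub> (T, P, \<upsilon>) = b"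
      using T PO n\<upsilon> by (simp add: hom_Arrow_iff \<upsilon>e \<alpha>(1) \<beta>(1) restrict_eq_iff[OF \<alpha>(3)] restrict_eq_iff[OF \<beta>(3)] \<upsilon>(4,5))
    fix w assume w: "w \<in> hom (Arrow_category m C) T (Dom (Arrow_category m C) (P, F, \<pi>)) \<and>
      (P, F, \<pi>) \<cdot>\<^bsub>Arrow_category m C\<^esub> w = a \<and> (P, G, \<rho>) \<cdot>\<^bsub>Arrow_category m C\<^esub> w = b"
    then obtain \<zeta> where \<zeta>: "w = (T, P, \<zeta>)" "nat_trans m T P \<zeta>" "\<zeta> \<in> extensional ?S" by (auto simp: hom_Arrow_iff)
    have z: "\<pi> x \<cdot> \<zeta> x = \<alpha> x" "\<rho> x \<cdot> \<zeta> x = \<beta> x" if "x \<in> ?S" for x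
      using w that by (simp_all add: \<zeta>(1) \<alpha>(1) \<beta>(1) restrict_eq_iff[OF \<alpha>(3)] restrict_eq_iff[OF \<beta>(3)])
    have "\<zeta> = \<upsilon>"
    proof (rule extensionalityI[OF \<zeta>(3)])
      show "\<upsilon> \<in> extensional ?S" by (simp add: \<upsilon>_def)
      fix x assume x: "x \<in> ?S"
      show "\<zeta> x = \<upsilon> x" by (rule pullback_eq[OF pb[OF x]])
        (simp_all add: z[OF x] \<upsilon>[OF x] nat_transD[OF \<zeta>(2) x] nat_transD[OF n\<pi> x])
    qed
    then show "w = (T, P, \<upsilon>)" by (simp add: \<zeta>(1))
  qed
qed (use f g p q in \<open>auto simp: hom_Arrow_iff Arr_Arrow_iff\<close>)

text \<open>A pullback of multiple arrows, such as the unspecified one in the definition of cubic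
  extensions, is compared with a pointwise one; the comparison arrows \<open>\<upsilon>\<close> and
  \<open>\<nu>\<close> carry the universal property at each vertex over.\<close>

lemma pullback_pointwise:
  assumes pb: "is_pullback (Arrow_category m C) (F, H, \<phi>) (G, H, \<psi>) (P, F, \<pi>) (P, G, \<rho>)" and x: "x \<in> grid 2 m"
  shows "is_pullback C (\<phi> x) (\<psi> x) (\<pi> x) (\<rho> x)"
proof -
  let ?S = "grid 2 m" and ?A = "Arrow_category m C"
  have f: "(F, H, \<phi>) \<in> Arr ?A" and g: "(G, H, \<psi>) \<in> Arr ?A"
    and p: "(P, F, \<pi>) \<in> Arr ?A" and q: "(P, G, \<rho>) \<in> Arr ?A"
    using pb by (auto simp: is_pullback_def hom_def)
  have n\<pi>: "nat_trans m P F \<pi>" "\<pi> \<in> extensional ?S" and n\<rho>: "nat_trans m P G \<rho>" "\<rho> \<in> extensional ?S"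
    and n\<phi>: "nat_trans m F H \<phi>" and n\<psi>: "nat_trans m G H \<psi>" and PO: "P \<in> Obj ?A" and dP: "diagram_on ?S P"
    using p q f g by (simp_all add: Arr_Arrow_iff Obj_Arrow_iff)
  have sq: "\<phi> x \<cdot> \<pi> x = \<psi> x \<cdot> \<rho> x" if "x \<in> ?S" for x using pb that by (simp add: is_pullback_def restrict_cong_iff)
  obtain Q \<sigma> \<tau> where s: "(Q, F, \<sigma>) \<in> Arr ?A" and t: "(Q, G, \<tau>) \<in> Arr ?A"
    and pbQ: "\<And>x. x \<in> ?S \<Longrightarrow> is_pullback C (\<phi> x) (\<psi> x) (\<sigma> x) (\<tau> x)" by (rule pointwise_pullback_exists[OF f g]) blast
  have pbQ': "is_pullback ?A (F, H, \<phi>) (G, H, \<psi>) (Q, F, \<sigma>) (Q, G, \<tau>)" by (rule pointwise_is_pullback[OF f g s t pbQ])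
  have n\<sigma>: "nat_trans m Q F \<sigma>" "\<sigma> \<in> extensional ?S" and n\<tau>: "nat_trans m Q G \<tau>" "\<tau> \<in> extensional ?S" and QO: "Q \<in> Obj ?A"
    using s t by (simp_all add: Arr_Arrow_iff)
  have un: "\<exists>!u. u \<in> hom ?A T P \<and> (P, F, \<pi>) \<cdot>\<^bsub>?A\<^esub> u = (T, F, \<alpha>) \<and> (P, G, \<rho>) \<cdot>\<^bsub>?A\<^esub> u = (T, G, \<beta>)"
    if "(T, F, \<alpha>) \<in> Arr ?A" "(T, G, \<beta>) \<in> Arr ?A" "\<And>x. x \<in> ?S \<Longrightarrow> \<phi> x \<cdot> \<alpha> x = \<psi> x \<cdot> \<beta> x" for T \<alpha> \<beta>
  proof -
    have "T \<in> Obj ?A" "(T, F, \<alpha>) \<in> hom ?A T F" "(T, G, \<beta>) \<in> hom ?A T G" using that by (auto simp: hom_Arrow_iff Arr_Arrow_iff)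
    moreover have "(F, H, \<phi>) \<cdot>\<^bsub>?A\<^esub> (T, F, \<alpha>) = (G, H, \<psi>) \<cdot>\<^bsub>?A\<^esub> (T, G, \<beta>)" using that(3) by (simp add: restrict_cong_iff)
    ultimately show ?thesis using pb unfolding is_pullback_def by simp
  qed
  have "\<exists>!u. u \<in> hom ?A Q P \<and> (P, F, \<pi>) \<cdot>\<^bsub>?A\<^esub> u = (Q, F, \<sigma>) \<and> (P, G, \<rho>) \<cdot>\<^bsub>?A\<^esub> u = (Q, G, \<tau>)"
    by (rule un[OF s t]) (use pullbackD(9)[OF pbQ] in simp)
  then obtain u where u: "u \<in> hom ?A Q P" "(P, F, \<pi>) \<cdot>\<^bsub>?A\<^esub> u = (Q, F, \<sigma>)" "(P, G, \<rho>) \<cdot>\<^bsub>?A\<^esub> u = (Q, G, \<tau>)" by blast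
  obtain \<upsilon> where \<upsilon>: "u = (Q, P, \<upsilon>)" "nat_trans m Q P \<upsilon>" "\<upsilon> \<in> extensional ?S" using u(1) by (auto simp: hom_Arrow_iff)
  have \<upsilon>e: "\<pi> x \<cdot> \<upsilon> x = \<sigma> x" "\<rho> x \<cdot> \<upsilon> x = \<tau> x" if "x \<in> ?S" for x
    using u(2,3) that by (simp_all add: \<upsilon>(1) restrict_eq_iff[OF n\<sigma>(2)] restrict_eq_iff[OF n\<tau>(2)])
  have "P \<in> Obj ?A" "(P, F, \<pi>) \<in> hom ?A P F" "(P, G, \<rho>) \<in> hom ?A P G" using p q by (auto simp: hom_Arrow_iff Arr_Arrow_iff)
  moreover have "(F, H, \<phi>) \<cdot>\<^bsub>?A\<^esub> (P, F, \<pi>) = (G, H, \<psi>) \<cdot>\<^bsub>?A\<^esub> (P, G, \<rho>)" using sq by (simp add: restrict_cong_iff)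
  ultimately have "\<exists>!v. v \<in> hom ?A P Q \<and> (Q, F, \<sigma>) \<cdot>\<^bsub>?A\<^esub> v = (P, F, \<pi>) \<and> (Q, G, \<tau>) \<cdot>\<^bsub>?A\<^esub> v = (P, G, \<rho>)"
    using pbQ' unfolding is_pullback_def by simp
  then obtain v where v: "v \<in> hom ?A P Q" "(Q, F, \<sigma>) \<cdot>\<^bsub>?A\<^esub> v = (P, F, \<pi>)" "(Q, G, \<tau>) \<cdot>\<^bsub>?A\<^esub> v = (P, G, \<rho>)" by blast
  obtain \<nu> where \<nu>: "v = (P, Q, \<nu>)" "nat_trans m P Q \<nu>" "\<nu> \<in> extensional ?S" using v(1) by (auto simp: hom_Arrow_iff)
  have \<nu>e: "\<sigma> x \<cdot> \<nu> x = \<pi> x" "\<tau> x \<cdot> \<nu> x = \<rho> x" if "x \<in> ?S" for x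
    using v(2,3) that by (simp_all add: \<nu>(1) restrict_eq_iff[OF n\<pi>(2)] restrict_eq_iff[OF n\<rho>(2)])
  have ty: "\<pi> x \<in> Arr C" "Dom C (\<pi> x) = obm P x" "Cod C (\<pi> x) = obm F x" "\<rho> x \<in> Arr C" "Dom C (\<rho> x) = obm P x" "Cod C (\<rho> x) = obm G x"
     "\<sigma> x \<in> Arr C" "Dom C (\<sigma> x) = obm Q x" "Cod C (\<sigma> x) = obm F x" "\<tau> x \<in> Arr C" "Dom C (\<tau> x) = obm Q x" "Cod C (\<tau> x) = obm G x"
     "\<upsilon> x \<in> Arr C" "Dom C (\<upsilon> x) = obm Q x" "Cod C (\<upsilon> x) = obm P x" "\<nu> x \<in> Arr C" "Dom C (\<nu> x) = obm P x" "Cod C (\<nu> x) = obm Q x"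
    if "x \<in> ?S" for x
    using nat_transD[OF n\<pi>(1) that] nat_transD[OF n\<rho>(1) that] nat_transD[OF n\<sigma>(1) that] nat_transD[OF n\<tau>(1) that]
      nat_transD[OF \<upsilon>(2) that] nat_transD[OF \<nu>(2) that] by simp_all
  note dom = diagramD[OF dP]
  have Pid: "obm P j \<in> Obj C" if "j \<in> ?S" for j using dom(1)[OF that] .
  have idn: "(P, P, \<lambda>j\<in>?S. Id C (obm P j)) \<in> hom ?A P P"
    unfolding hom_Arrow_iff using PO by (simp add: nat_trans_def Pid dom)
  have uvn: "(P, P, \<lambda>j\<in>?S. \<upsilon> j \<cdot> \<nu> j) \<in> hom ?A P P"
  proof -
    have dQ: "diagram_on ?S Q" using QO by (simp add: Obj_Arrow_iff)
    have "(\<upsilon> i \<cdot> \<nu> i) \<cdot> arm P (i, j) = arm P (i, j) \<cdot> (\<upsilon> j \<cdot> \<nu> j)" if i: "i \<in> ?S" and j: "j \<in> ?S" and ij: "i \<unlhd> j" for i j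
    proof -
      note [simp] = ty[OF i] ty[OF j] diagramD(3-5)[OF dP i j ij] diagramD(3-5)[OF dQ i j ij]
      show ?thesis by (simp add: nat_transD(4)[OF \<nu>(2) i j ij] Cmp_eq_left[OF nat_transD(4)[OF \<upsilon>(2) i j ij]])
    qed
    then show ?thesis unfolding hom_Arrow_iff using PO by (simp add: nat_trans_def ty)
  qed
  \<comment> \<open>Both endomorphisms of \<open>P\<close> are compatible with the two projections,
    so they agree.\<close>
  have "(P, P, \<lambda>j\<in>?S. \<upsilon> j \<cdot> \<nu> j) = (P, P, \<lambda>j\<in>?S. Id C (obm P j))"
  proof -
    have "\<exists>!w. w \<in> hom ?A P P \<and> (P, F, \<pi>) \<cdot>\<^bsub>?A\<^esub> w = (P, F, \<pi>) \<and> (P, G, \<rho>) \<cdot>\<^bsub>?A\<^esub> w = (P, G, \<rho>)"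
      by (rule un[OF p q sq])
    moreover have "(P, F, \<pi>) \<cdot>\<^bsub>?A\<^esub> (P, P, \<lambda>j\<in>?S. Id C (obm P j)) = (P, F, \<pi>)" "(P, G, \<rho>) \<cdot>\<^bsub>?A\<^esub> (P, P, \<lambda>j\<in>?S. Id C (obm P j)) = (P, G, \<rho>)"
      by (simp_all add: restrict_eq_iff[OF n\<pi>(2)] restrict_eq_iff[OF n\<rho>(2)] ty)
    moreover have "(P, F, \<pi>) \<cdot>\<^bsub>?A\<^esub> (P, P, \<lambda>j\<in>?S. \<upsilon> j \<cdot> \<nu> j) = (P, F, \<pi>)" "(P, G, \<rho>) \<cdot>\<^bsub>?A\<^esub> (P, P, \<lambda>j\<in>?S. \<upsilon> j \<cdot> \<nu> j) = (P, G, \<rho>)"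
      by (simp_all add: restrict_eq_iff[OF n\<pi>(2)] restrict_eq_iff[OF n\<rho>(2)] ty Cmp_eq_left[OF \<upsilon>e(1)] Cmp_eq_left[OF \<upsilon>e(2)] \<nu>e)
    ultimately show ?thesis using idn uvn by blast
  qed
  then have uv: "\<upsilon> j \<cdot> \<nu> j = Id C (obm P j)" if "j \<in> ?S" for j using that by (simp add: restrict_cong_iff)
  note [simp] = ty[OF x] nat_transD(1-3)[OF n\<phi> x] nat_transD(1-3)[OF n\<psi> x]
  show ?thesis unfolding is_pullback_iff
  proof (intro conjI allI impI)
    fix a b assume ab: "a \<in> Arr C \<and> b \<in> Arr C \<and> Dom C b = Dom C a \<and> Cod C a = Dom C (\<phi> x) \<and> Cod C b = Dom C (\<psi> x) \<and> \<phi> x \<cdot> a = \<psi> x \<cdot> b"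
    then have [simp]: "a \<in> Arr C" "b \<in> Arr C" "Dom C b = Dom C a" "Cod C a = obm F x" "Cod C b = obm G x" and eq: "\<phi> x \<cdot> a = \<psi> x \<cdot> b"
      by simp_all
    obtain w where [simp]: "w \<in> Arr C" "Dom C w = Dom C a" "Cod C w = Dom C (\<sigma> x)" and w: "\<sigma> x \<cdot> w = a" "\<tau> x \<cdot> w = b"
      by (rule pullback_lift[OF pbQ[OF x] eq]) simp_all
    show "\<exists>!u. u \<in> Arr C \<and> Dom C u = Dom C a \<and> Cod C u = Dom C (\<pi> x) \<and> \<pi> x \<cdot> u = a \<and> \<rho> x \<cdot> u = b"
    proof (rule ex1I[of _ "\<upsilon> x \<cdot> w"])
      show "\<upsilon> x \<cdot> w \<in> Arr C \<and> Dom C (\<upsilon> x \<cdot> w) = Dom C a \<and> Cod C (\<upsilon> x \<cdot> w) = Dom C (\<pi> x) \<and> \<pi> x \<cdot> (\<upsilon> x \<cdot> w) = a \<and> \<rho> x \<cdot> (\<upsilon> x \<cdot> w) = b"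
        by (simp add: Cmp_eq_left[OF \<upsilon>e(1)[OF x]] Cmp_eq_left[OF \<upsilon>e(2)[OF x]] w)
      fix k assume k: "k \<in> Arr C \<and> Dom C k = Dom C a \<and> Cod C k = Dom C (\<pi> x) \<and> \<pi> x \<cdot> k = a \<and> \<rho> x \<cdot> k = b"
      then have [simp]: "k \<in> Arr C" "Dom C k = Dom C a" "Cod C k = obm P x" and ke: "\<pi> x \<cdot> k = a" "\<rho> x \<cdot> k = b" by simp_all
      have "\<nu> x \<cdot> k = w" by (rule pullback_eq[OF pbQ[OF x]])
        (simp_all add: Cmp_eq_left[OF \<nu>e(1)[OF x]] Cmp_eq_left[OF \<nu>e(2)[OF x]] ke w)
      then have "\<upsilon> x \<cdot> (\<nu> x \<cdot> k) = \<upsilon> x \<cdot> w" by simp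
      then show "k = \<upsilon> x \<cdot> w" by (simp add: Cmp_eq_left[OF uv[OF x]] Pid[OF x])
    qed
  qed (simp_all add: sq[OF x])
qed

section \<open>Faces and edges\<close>

lemma Arrow_Obj_eqI:
  assumes D: "D \<in> Obj (Arrow_category m C)" "D' \<in> Obj (Arrow_category m C)"
    and o: "\<And>x. x \<in> grid 2 m \<Longrightarrow> obm D x = obm D' x"
    and a: "\<And>x y. \<lbrakk>x \<in> grid 2 m; y \<in> grid 2 m; x \<unlhd> y\<rbrakk> \<Longrightarrow> arm D (x, y) = arm D' (x, y)"
  shows "D = D'"
proof -
  have "obm D = obm D'" by (rule extensionalityI[of _ "grid 2 m"]) (use D o in \<open>simp_all add: Obj_Arrow_iff\<close>)
  moreover have "arm D = arm D'"
  proof (rule extensionalityI[of _ "Arr (chain_power 2 m)"])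
    fix p assume "p \<in> Arr (chain_power 2 m)"
    then show "arm D p = arm D' p" using a by (cases p) simp
  qed (use D in \<open>simp_all add: Obj_Arrow_iff\<close>)
  ultimately show ?thesis by simp
qed

lemma face_simps:
  assumes "x \<in> grid 2 m"
  shows "obm (face m i k A) x = obm A (take i x @ k # drop i x)"
    and "y \<in> grid 2 m \<Longrightarrow> x \<unlhd> y \<Longrightarrow> arm (face m i k A) (x, y) = arm A (take i x @ k # drop i x, take i y @ k # drop i y)"
  using assms by (simp_all add: face_def restrict_along_def Obj_chain_power)

lemma face_Obj:
  assumes A: "diagram_on (grid 2 (Suc m)) A" and k: "k < 2"
  shows "face m i k A \<in> Obj (Arrow_category m C)"
proof -
  note im = insert_grid[OF _ k] and le = insert_mono
  have "diagram_on (grid 2 m) (face m i k A)" unfolding diagram_on_def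
  proof (intro conjI ballI impI)
    fix x y z assume xyz: "x \<in> grid 2 m" "y \<in> grid 2 m" "z \<in> grid 2 m" "x \<unlhd> y \<and> y \<unlhd> z"
    then have "x \<unlhd> z" using list_le_trans by blast
    with xyz show "arm (face m i k A) (x, y) \<cdot> arm (face m i k A) (y, z) = arm (face m i k A) (x, z)"
      using diagramD(6)[OF A im im im le le, of x y z] by (simp add: face_simps)
  qed (simp_all add: face_simps diagramD[OF A] im le list_le_refl)
  then show ?thesis by (simp add: Obj_Arrow_iff face_def restrict_along_def Obj_chain_power)
qed

lemma edge_Arr:
  assumes A: "diagram_on (grid 2 (Suc m)) A"
  shows "edge m A \<in> Arr (Arrow_category m C)"
proof -
  have "nat_trans m (face m 0 1 A) (face m 0 0 A) (\<lambda>e\<in>grid 2 m. arm A (0 # e, 1 # e))"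
    unfolding nat_trans_def
  proof (intro conjI ballI impI)
    fix x y assume "x \<in> grid 2 m" "y \<in> grid 2 m" "x \<unlhd> y"
    then show "(\<lambda>e\<in>grid 2 m. arm A (0 # e, 1 # e)) x \<cdot> arm (face m 0 1 A) (x, y) = arm (face m 0 0 A) (x, y) \<cdot> (\<lambda>e\<in>grid 2 m. arm A (0 # e, 1 # e)) y"
      using diagramD(6)[OF A, of "0 # x" "1 # x" "1 # y"] diagramD(6)[OF A, of "0 # x" "0 # y" "1 # y"]
      by (simp add: face_simps list_le_refl)
  qed (simp_all add: face_simps diagramD[OF A] list_le_refl)
  then show ?thesis using face_Obj[OF A] by (simp add: edge_def Arr_Arrow_iff Obj_chain_power)
qed

text \<open>An arrow of \<open>m\<close>-fold arrows is an \<open>(m+1)\<close>-fold arrow: first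
  coordinate 1 indexes the source, 0 the target, and an arrow that crosses from 1 to 0 is an arrow
  of the source followed by \<open>\<eta>\<close>.\<close>

lemma edge_surj:
  assumes "(F, G, \<eta>) \<in> Arr (Arrow_category m C)"
  obtains B where "B \<in> Obj (Arrow_category (Suc m) C)" "edge m B = (F, G, \<eta>)"
proof -
  have FO: "F \<in> Obj (Arrow_category m C)" and GO: "G \<in> Obj (Arrow_category m C)" and n: "nat_trans m F G \<eta>" and \<eta>e: "\<eta> \<in> extensional (grid 2 m)"
    using assms by (simp_all add: Arr_Arrow_iff)
  have F: "diagram_on (grid 2 m) F" and G: "diagram_on (grid 2 m) G" using FO GO by (simp_all add: Obj_Arrow_iff)
  define B where "B = \<lparr>obm = (\<lambda>x\<in>grid 2 (Suc m). if hd x = 1 then obm F (tl x) else obm G (tl x)),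
    arm = (\<lambda>(x, y)\<in>Arr (chain_power 2 (Suc m)). if hd x = 1 then arm F (tl x, tl y)
      else if hd y = 1 then \<eta> (tl x) \<cdot> arm F (tl x, tl y) else arm G (tl x, tl y))\<rparr>"
  have Bo: "obm B (a # e) = (if a = 1 then obm F e else obm G e)" if "a < 2" "e \<in> grid 2 m" for a e
    using that by (simp add: B_def)
  have Ba: "arm B (a # x, b # y) = (if a = 1 then arm F (x, y) else if b = 1 then \<eta> x \<cdot> arm F (x, y) else arm G (x, y))"
    if "b < 2" "a \<le> b" "x \<in> grid 2 m" "y \<in> grid 2 m" "x \<unlhd> y" for a b x y
    using that by (simp add: B_def)
  have "diagram_on (grid 2 (Suc m)) B" unfolding diagram_on_def
  proof (intro conjI ballI impI)
    fix x assume "x \<in> grid 2 (Suc m)"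
    then obtain a x' where x: "x = a # x'" "a < 2" "x' \<in> grid 2 m" by (rule grid_SucE)
    show "obm B x \<in> Obj C" "arm B (x, x) = Id C (obm B x)"
      using x diagramD(1,2)[OF F x(3)] diagramD(1,2)[OF G x(3)] by (simp_all add: Bo Ba list_le_refl)
    fix y assume "y \<in> grid 2 (Suc m)"
    then obtain b y' where y: "y = b # y'" "b < 2" "y' \<in> grid 2 m" by (rule grid_SucE)
    {
      assume "x \<unlhd> y"
      then have ab: "a \<le> b" "x' \<unlhd> y'" using x y by simp_all
      then have "a = 0 \<and> b = 0 \<or> a = 0 \<and> b = 1 \<or> a = 1 \<and> b = 1" using y(2) by linarith
      then show "arm B (x, y) \<in> Arr C" "Dom C (arm B (x, y)) = obm B y" "Cod C (arm B (x, y)) = obm B x"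
        using x y ab diagramD(3-5)[OF F x(3) y(3) ab(2)] diagramD(3-5)[OF G x(3) y(3) ab(2)] nat_transD(1-3)[OF n x(3)]
        by (auto simp: Bo Ba)
    }
    fix z assume "z \<in> grid 2 (Suc m)" and xyz: "x \<unlhd> y \<and> y \<unlhd> z"
    then obtain c z' where z: "z = c # z'" "c < 2" "z' \<in> grid 2 m" by (rule_tac grid_SucE)
    have le: "a \<le> b" "b \<le> c" "x' \<unlhd> y'" "y' \<unlhd> z'" "x' \<unlhd> z'" using x y z xyz list_le_trans[of x' y' z'] by simp_all
    \<comment> \<open>The first coordinates increase, so only the place where they pass from 0 to 1
      matters; the case \<open>0, 0, 1\<close> is naturality of \<open>\<eta>\<close>.\<close>
    then consider "a = 1" "b = 1" "c = 1" | "a = 0" "b = 1" "c = 1" | "a = 0" "b = 0" "c = 1" | "a = 0" "b = 0" "c = 0" using z(2) by linarith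
    then show "arm B (x, y) \<cdot> arm B (y, z) = arm B (x, z)"
    proof cases
      case 1
      then show ?thesis using x y z le diagramD(6)[OF F x(3) y(3) z(3) le(3,4)] by (simp add: Ba)
    next
      case 2
      then show ?thesis using x y z le diagramD(6)[OF F x(3) y(3) z(3) le(3,4)] nat_transD(1-3)[OF n x(3)]
          diagramD(3-5)[OF F x(3) y(3) le(3)] diagramD(3-5)[OF F y(3) z(3) le(4)] by (simp add: Ba)
    next
      case 3
      have "arm G (x', y') \<cdot> (\<eta> y' \<cdot> arm F (y', z')) = \<eta> x' \<cdot> (arm F (x', y') \<cdot> arm F (y', z'))"
        using nat_transD(1-3)[OF n x(3)] nat_transD(1-3)[OF n y(3)] diagramD(3-5)[OF G x(3) y(3) le(3)]
          diagramD(3-5)[OF F x(3) y(3) le(3)] diagramD(3-5)[OF F y(3) z(3) le(4)]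
        by (simp add: Cmp_eq_left[OF nat_transD(4)[OF n x(3) y(3) le(3), symmetric]])
      then show ?thesis using 3 x y z le diagramD(6)[OF F x(3) y(3) z(3) le(3,4)] by (simp add: Ba)
    next
      case 4
      then show ?thesis using x y z le diagramD(6)[OF G x(3) y(3) z(3) le(3,4)] by (simp add: Ba)
    qed
  qed
  then have BO: "B \<in> Obj (Arrow_category (Suc m) C)" by (simp add: Obj_Arrow_iff B_def)
  have dB: "diagram_on (grid 2 (Suc m)) B" using BO by (simp add: Obj_Arrow_iff)
  have "face m 0 1 B = F" by (rule Arrow_Obj_eqI[OF face_Obj[OF dB] FO]) (simp_all add: face_simps Bo Ba)
  moreover have "face m 0 0 B = G" by (rule Arrow_Obj_eqI[OF face_Obj[OF dB] GO]) (simp_all add: face_simps Bo Ba)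
  moreover have "(\<lambda>e\<in>grid 2 m. arm B (0 # e, 1 # e)) = \<eta>"
    unfolding restrict_eq_iff[OF \<eta>e] using diagramD(2)[OF F] nat_transD[OF n] by (simp add: Ba list_le_refl)
  ultimately have "edge m B = (F, G, \<eta>)" by (simp add: edge_def Obj_chain_power)
  then show ?thesis using BO that by blast
qed

end
section \<open>Cubic extensions and local lifting\<close>

text \<open>The constant 1 is kept from being rewritten to \<open>Suc 0\<close>, so the recursive
  rules for lists do not reach index 1 by themselves.\<close>

lemma list_one_simps [simp]:
  "take 1 (a # e) = [a]" "drop 1 (a # e) = e" "(a # b # e) ! 1 = b" "(a # b # e)[1 := c] = a # c # e"
  "case_nat z f 1 = f 0"
  by (simp_all add: One_nat_def)

text \<open>The generalized elements of the intersection of the kernels of the edges that leave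
  \<open>e\<close> in the directions \<open>S\<close>. When \<open>e\<close> is 1 on
  \<open>S\<close> and all lines are kernels, this intersection is the object at which these
  coordinates are raised to 2.\<close>

definition (in category) killed :: "('o, 'm) diagram \<Rightarrow> nat set \<Rightarrow> nat list \<Rightarrow> 'm \<Rightarrow> bool" where
  "killed A S e y \<longleftrightarrow> y \<in> Arr C \<and> Cod C y = obm A e \<and> (\<forall>j\<in>S. zero_arrow C (arm A (e[j := 0], e) \<cdot> y))"

text \<open>Expresses that the edge in direction \<open>d\<close> is a regular epimorphism between
  the subobjects of killed elements, without naming these subobjects.\<close>

definition (in category) lifts :: "('o, 'm) diagram \<Rightarrow> nat list \<Rightarrow> nat \<Rightarrow> nat set \<Rightarrow> bool" where
  "lifts A e d S \<longleftrightarrow> (\<forall>y. killed A S e y \<longrightarrow> (\<exists>c x. regular_epi C c \<and> Cod C c = Dom C y \<and> Dom C x = Dom C c \<and>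
     killed A S (e[d := 1]) x \<and> arm A (e, e[d := 1]) \<cdot> x = y \<cdot> c))"

text \<open>The edge in direction \<open>d\<close> ends at \<open>e\<close>, those in the directions
  \<open>S\<close> start there; hence \<open>d\<close> is not in \<open>S\<close>.\<close>

definition admissible :: "nat \<Rightarrow> nat list \<Rightarrow> nat \<Rightarrow> nat set \<Rightarrow> bool" where
  "admissible n e d S \<longleftrightarrow> e \<in> grid 2 n \<and> d < n \<and> S \<subseteq> {..<n} \<and> e ! d = 0 \<and> (\<forall>j\<in>S. e ! j = 1)"

definition (in category) lifting :: "nat \<Rightarrow> ('o, 'm) diagram \<Rightarrow> bool" where
  "lifting n A \<longleftrightarrow> (\<forall>e d S. admissible n e d S \<longrightarrow> lifts A e d S)"

lemma update_0_le: "e[j := 0] \<unlhd> (e :: nat list)"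
  using list_le_update_self[of 0 "e ! j" e j] by simp

lemma update_1_ge: "e ! d = 0 \<Longrightarrow> (e :: nat list) \<unlhd> e[d := 1]"
proof -
  assume "e ! d = 0"
  then have "e[d := e ! d] \<unlhd> e[d := 1]" by (intro list_le_update_self) simp
  then show ?thesis by (simp only: list_update_id)
qed

lemma base_update_1: "base (x[i := 1]) = (base x)[i := 1]"
  by (simp add: base_def map_update)

context category
begin

lemma killed_insert: "killed A (insert j S) e y \<longleftrightarrow> killed A S e y \<and> zero_arrow C (arm A (e[j := 0], e) \<cdot> y)"
  by (auto simp: killed_def)

lemma killed_cong:
  assumes ag: "diagrams_agree (grid 2 n) A A'" and e: "e \<in> grid 2 n"
  shows "killed A S e y \<longleftrightarrow> killed A' S e y"
proof -
  have "arm A (e[j := 0], e) = arm A' (e[j := 0], e)" for j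
    using ag box_update_same[OF e, of j 0] e update_0_le by (simp add: diagrams_agree_def)
  moreover have "obm A e = obm A' e" using ag e by (simp add: diagrams_agree_def)
  ultimately show ?thesis by (simp add: killed_def)
qed

lemma lifting_cong:
  assumes ag: "diagrams_agree (grid 2 n) A A'"
  shows "lifting n A \<longleftrightarrow> lifting n A'"
proof -
  have "lifts A e d S \<longleftrightarrow> lifts A' e d S" if ad: "admissible n e d S" for e d S
  proof -
    have e: "e \<in> grid 2 n" "e ! d = 0" using ad by (simp_all add: admissible_def)
    then have e1: "e[d := 1] \<in> grid 2 n" "e \<unlhd> e[d := 1]" using box_update_same[of e "\<lambda>_. 2" n d 1] update_1_ge by simp_all
    then have "arm A (e, e[d := 1]) = arm A' (e, e[d := 1])" using ag e by (simp add: diagrams_agree_def)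
    then show ?thesis unfolding lifts_def killed_cong[OF ag e(1)] killed_cong[OF ag e1(1)] by simp
  qed
  then show ?thesis by (simp add: lifting_def)
qed

end

section \<open>Exactness of lines as local lifting\<close>

context semi_abelian_category
begin

text \<open>The object at \<open>x\<close> is the subobject of the cube vertex \<open>base x\<close>
  that consists of the elements killed in the directions where \<open>x\<close> has a 2, and a
  kernel line is exact iff its second arrow is a regular epimorphism. Lifting of killed elements at
  \<open>base x\<close> says just this for the line through \<open>x\<close>.\<close>

theorem coker_lines_iff_lifting:
  assumes E: "diagram_on (grid 3 n) E" and k: "ker_lines C n E"
  shows "coker_lines C n E \<longleftrightarrow> lifting n E"
proof
  have sub: "z \<preceq> arm E (base x, x) \<longleftrightarrow> killed E {j. j < n \<and> x ! j = 2} (base x) z"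
    if "x \<in> grid 3 n" "z \<in> Arr C" "Cod C z = obm E (base x)" for x z
    using ker_lines_subobject[OF E k that(1)] that(2,3) by (auto simp: killed_def)
  have mono: "monic (arm E (base x, x))" if "x \<in> grid 3 n" for x using ker_lines_subobject[OF E k that] by simp
  {
    assume co: "coker_lines C n E"
    show "lifting n E" unfolding lifting_def lifts_def
    proof (intro allI impI)
      fix e d S y assume ad: "admissible n e d S" and y: "killed E S e y"
      have e: "e \<in> grid 2 n" "d < n" "S \<subseteq> {..<n}" "e ! d = 0" "\<And>j. j \<in> S \<Longrightarrow> e ! j = 1" "length e = n"
        using ad by (simp_all add: admissible_def box_def)
      have e2: "e ! j = 0 \<or> e ! j = 1" if "j < n" for j
      proof -
        have "e ! j < 2" using e(1) that by (simp add: box_def)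
        then show ?thesis by linarith
      qed
      have dS: "d \<notin> S" using e(4,5) by force
      \<comment> \<open>\<open>x\<close> raises the coordinates in \<open>S\<close> to 2, so that
        the killed elements at \<open>e\<close> are the elements of the object at
        \<open>x\<close>.\<close>
      define x where "x = map (\<lambda>j. if j \<in> S then 2 else e ! j) [0..<n]"
      have "e ! j < 3" if "j < n" for j using e2[OF that] by auto
      then have x: "x \<in> grid 3 n" "length x = n" by (auto simp: x_def box_def)
      have bx: "base x = e" using e e2 by (intro nth_equalityI) (auto simp: base_def x_def, force)
      have x0: "x[d := 0] = x" using e dS by (intro nth_equalityI) (auto simp: x_def nth_list_update)
      have b1: "base (x[d := 1]) = e[d := 1]" by (simp add: base_update_1 bx)
      have x1: "x[d := 1] \<in> grid 3 n" by (rule grid_update[OF x(1)]) simp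
      have "x ! j = 2 \<longleftrightarrow> j \<in> S" if "j < n" for j using e2[OF that] that by (auto simp: x_def)
      then have S: "{j. j < n \<and> x ! j = 2} = S" using e(3) by auto
      have "x[d := 1] ! j = 2 \<longleftrightarrow> x ! j = 2" if "j < n" for j
      proof (cases "j = d")
        case True
        have "d \<notin> {j. j < n \<and> x ! j = 2}" using dS S by simp
        then show ?thesis using True that x(2) by simp
      qed simp
      then have S1: "{j. j < n \<and> x[d := 1] ! j = 2} = S" using S by auto
      have xle: "x \<unlhd> x[d := 1]" using list_le_update_self[of 0 1 x d] x0 by simp
      have ble: "base x \<unlhd> x" "base (x[d := 1]) \<unlhd> x[d := 1]" "base x \<unlhd> base (x[d := 1])" "base x \<in> grid 3 n" "base (x[d := 1]) \<in> grid 3 n"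
        using base_props(2,3)[OF x(1)] base_props(2,3)[OF x1] base_mono[OF xle] by simp_all
      define m where "m = arm E (base x, x)"
      define m' where "m' = arm E (base (x[d := 1]), x[d := 1])"
      define f where "f = arm E (x, x[d := 1])"
      define g where "g = arm E (base x, base (x[d := 1]))"
      note [simp] = diagramD(3-5)[OF E ble(4) x(1) ble(1), folded m_def] diagramD(3-5)[OF E ble(5) x1 ble(2), folded m'_def]
        diagramD(3-5)[OF E x(1) x1 xle, folded f_def] diagramD(3-5)[OF E ble(4,5) ble(3), folded g_def]
      have sq: "m \<cdot> f = g \<cdot> m'" unfolding m_def f_def g_def m'_def
        using diagramD(6)[OF E ble(4) x(1) x1 ble(1) xle] diagramD(6)[OF E ble(4,5) x1 ble(3,2)] by simp
      have ya[simp]: "y \<in> Arr C" "Cod C y = obm E (base x)" using y by (simp_all add: killed_def bx)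
      have "y \<preceq> m" unfolding m_def using y sub[OF x(1) ya] unfolding S bx by simp
      then obtain w where [simp]: "w \<in> Arr C" "Dom C w = Dom C y" "Cod C w = Dom C m" and w: "m \<cdot> w = y" by (rule le_arrowE)
      have "is_cokernel C (arm E (x[d := 0], x[d := 1])) (arm E (x[d := 1], x[d := 2]))"
        using co x(1) e(2) unfolding coker_lines_def by blast
      then have fe: "regular_epi C f" unfolding x0 f_def by (rule cokernel_regular_epi)
      obtain c v where c: "regular_epi C c" and [simp]: "Cod C c = Dom C w" "v \<in> Arr C" "Dom C v = Dom C c" "Cod C v = Dom C f"
        and v: "f \<cdot> v = w \<cdot> c" by (rule regular_epi_lift[OF fe, of w]) simp_all
      note [simp] = regular_epi_Arr[OF c]
      have "m' \<cdot> v \<preceq> m'" by (rule le_arrowI[of _ v]) simp_all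
      then have "killed E S (e[d := 1]) (m' \<cdot> v)" using sub[OF x1, of "m' \<cdot> v"] unfolding S1 b1[symmetric] m'_def[symmetric] by simp
      moreover have "g \<cdot> (m' \<cdot> v) = y \<cdot> c" by (simp add: Cmp_eq_left[OF sq[symmetric]] v Cmp_eq_left[OF w])
      ultimately show "\<exists>c x. regular_epi C c \<and> Cod C c = Dom C y \<and> Dom C x = Dom C c \<and> killed E S (e[d := 1]) x \<and> arm E (e, e[d := 1]) \<cdot> x = y \<cdot> c"
        using c by (intro exI[of _ c] exI[of _ "m' \<cdot> v"]) (simp add: g_def bx b1)
    qed
  next
    assume l: "lifting n E"
    show "coker_lines C n E" unfolding coker_lines_def
    proof (intro ballI allI impI)
      fix x i assume x: "x \<in> grid 3 n" and i: "i < n"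
      define x0 where "x0 = x[i := 0]"
      define x1 where "x1 = x[i := 1]"
      have lx: "length x = n" using x by (rule box_length)
      have xx: "x0 \<in> grid 3 n" "x1 \<in> grid 3 n" "x0 \<unlhd> x1" "x1 = x0[i := 1]"
        using grid_update[OF x] by (simp_all add: x0_def x1_def list_le_update_self)
      define S where "S = {j. j < n \<and> x0 ! j = 2}"
      have S1: "{j. j < n \<and> x1 ! j = 2} = S" using i lx by (auto simp: S_def x0_def x1_def nth_list_update)
      have b1: "base x1 = (base x0)[i := 1]" by (simp add: xx(4) base_update_1)
      have ad: "admissible n (base x0) i S"
        using base_props(1)[OF xx(1)] i lx by (auto simp: admissible_def S_def x0_def base_def)
      have ble: "base x0 \<unlhd> x0" "base x1 \<unlhd> x1" "base x0 \<unlhd> base x1" "base x0 \<in> grid 3 n" "base x1 \<in> grid 3 n"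
        using base_props(2,3)[OF xx(1)] base_props(2,3)[OF xx(2)] base_mono[OF xx(3)] by simp_all
      define m where "m = arm E (base x0, x0)"
      define m' where "m' = arm E (base x1, x1)"
      define f where "f = arm E (x0, x1)"
      define g where "g = arm E (base x0, base x1)"
      note [simp] = diagramD(3-5)[OF E ble(4) xx(1) ble(1), folded m_def] diagramD(3-5)[OF E ble(5) xx(2) ble(2), folded m'_def]
        diagramD(3-5)[OF E xx(1-3), folded f_def] diagramD(3-5)[OF E ble(4,5) ble(3), folded g_def]
      have sq: "m \<cdot> f = g \<cdot> m'" unfolding m_def f_def g_def m'_def
        using diagramD(6)[OF E ble(4) xx(1) xx(2) ble(1) xx(3)] diagramD(6)[OF E ble(4,5) xx(2) ble(3,2)] by simp
      \<comment> \<open>\<open>m\<close> itself is the universal killed element; a local lift of it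
        exhibits \<open>f\<close> as a regular epimorphism.\<close>
      have "killed E S (base x0) m" using sub[OF xx(1), folded m_def, of m] le_arrow_refl[of m] by (simp add: S_def)
      then obtain c z where c: "regular_epi C c" and [simp]: "Cod C c = Dom C m" "Dom C z = Dom C c"
        and z: "killed E S (base x1) z" "g \<cdot> z = m \<cdot> c"
        using l ad unfolding lifting_def lifts_def b1 g_def by blast
      note [simp] = regular_epi_Arr[OF c]
      have za[simp]: "z \<in> Arr C" "Cod C z = obm E (base x1)" using z(1) by (simp_all add: killed_def)
      have "z \<preceq> m'" using z(1) sub[OF xx(2) za] unfolding S1 m'_def by simp
      then obtain w where [simp]: "w \<in> Arr C" "Dom C w = Dom C z" "Cod C w = Dom C m'" and w: "m' \<cdot> w = z" by (rule le_arrowE)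
      have "m \<cdot> (f \<cdot> w) = m \<cdot> c" by (simp add: Cmp_eq_left[OF sq] w z(2))
      then have "f \<cdot> w = c" by (rule monicD[OF mono[OF xx(1), folded m_def]]) simp_all
      then have "regular_epi C f" by (rule local_lift_regular_epi[OF c]) simp_all
      moreover have "is_kernel C (arm E (x[i := 1], x[i := 2])) f" using k x i unfolding ker_lines_def f_def x0_def x1_def by blast
      ultimately show "is_cokernel C (arm E (x[i := 0], x[i := 1])) (arm E (x[i := 1], x[i := 2]))"
        unfolding f_def x0_def x1_def by (rule regular_epi_is_cokernel)
    qed
  }
qed

lemma pullback_zero_iff:
  assumes pb: "is_pullback C f g p q" and [simp]: "x \<in> Arr C" "Cod C x = Dom C p"
  shows "zero_arrow C x \<longleftrightarrow> zero_arrow C (p \<cdot> x) \<and> zero_arrow C (q \<cdot> x)"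
proof
  have [simp]: "p \<in> Arr C" "q \<in> Arr C" "Dom C q = Dom C p" using pullbackD[OF pb] by simp_all
  show "zero_arrow C x \<Longrightarrow> zero_arrow C (p \<cdot> x) \<and> zero_arrow C (q \<cdot> x)" by simp
  assume z: "zero_arrow C (p \<cdot> x) \<and> zero_arrow C (q \<cdot> x)"
  obtain w where w: "zero_arrow C w" and [simp]: "Dom C w = Dom C x" "Cod C w = Dom C p"
    by (rule zero_arrow_exists[of "Dom C x" "Dom C p"]) simp_all
  note [simp] = zero_arrow_Arr[OF w]
  have 1: "p \<cdot> x = p \<cdot> w" by (rule zero_arrow_unique) (use z w in simp_all)
  have 2: "q \<cdot> x = q \<cdot> w" by (rule zero_arrow_unique) (use z w in simp_all)
  have "x = w" by (rule pullback_eq[OF pb 1 2]) simp_all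
  with w show "zero_arrow C x" by simp
qed

text \<open>The killed elements are those of a finite intersection of kernels. A representing
  monomorphism is needed to form images and pullbacks of them.\<close>

lemma killed_subobject:
  assumes dA: "diagram_on (grid 2 n) A" and e: "e \<in> grid 2 n" and S: "S \<subseteq> {..<n}"
  obtains \<kappa> where "monic \<kappa>" "Cod C \<kappa> = obm A e" "\<And>x. \<lbrakk>x \<in> Arr C; Cod C x = obm A e\<rbrakk> \<Longrightarrow> x \<preceq> \<kappa> \<longleftrightarrow> killed A S e x"
proof -
  have e0: "e[j := 0] \<in> grid 2 n" for j by (rule box_update_same[OF e]) simp
  note h = diagramD(3-5)[OF dA e0 e update_0_le]
  define H where "H = (\<lambda>j. chosen_kernel C (arm A (e[j := 0], e))) ` S"
  have ck: "is_kernel C (chosen_kernel C (arm A (e[j := 0], e))) (arm A (e[j := 0], e))" for j by (rule chosen_kernel[OF h(1)])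
  have nH: "normal_mono C a \<and> Cod C a = obm A e" if "a \<in> H" for a
    using that ck kernelD(3)[OF ck] h(2) by (auto simp: H_def normal_mono_def)
  have "finite H" using finite_subset[OF S] by (simp add: H_def)
  from normal_intersection_exists[OF diagramD(1)[OF dA e] this nH] obtain \<kappa> where
    \<kappa>: "normal_mono C \<kappa>" "Cod C \<kappa> = obm A e" "\<And>x. \<lbrakk>x \<in> Arr C; Cod C x = obm A e\<rbrakk> \<Longrightarrow> x \<preceq> \<kappa> \<longleftrightarrow> (\<forall>a\<in>H. x \<preceq> a)" by blast
  have "x \<preceq> \<kappa> \<longleftrightarrow> killed A S e x" if "x \<in> Arr C" "Cod C x = obm A e" for x
    using \<kappa>(3)[OF that] kernel_le_iff[OF ck] that h(2) by (simp add: H_def killed_def)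
  then show ?thesis using \<kappa>(1,2) normal_mono_monic that by blast
qed

text \<open>The increasing map that misses \<open>i\<close>: coordinate \<open>j\<close> of a face
  in direction \<open>i\<close> is coordinate \<open>skip i j\<close> of the cube.\<close>

definition skip :: "nat \<Rightarrow> nat \<Rightarrow> nat" where "skip i j = (if j < i then j else Suc j)"

lemma insert_update:
  assumes "i \<le> length e" "j < length e"
  shows "(take i e @ k # drop i e)[skip i j := a] = take i (e[j := a]) @ k # drop i (e[j := a])"
    and "(take i e @ k # drop i e) ! skip i j = e ! j"
  using assms by (auto simp: skip_def list_update_append nth_append min_def take_update_swap drop_update_swap Suc_diff_le list_update_beyond)

lemma lifts_face:
  assumes dA: "diagram_on (grid 2 (Suc m)) A" and i: "i \<le> m" and k: "k < 2" and ad: "admissible m e d S"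
  shows "lifts (face m i k A) e d S \<longleftrightarrow> lifts A (take i e @ k # drop i e) (skip i d) (skip i ` S)"
proof -
  have e: "e \<in> grid 2 m" "d < m" "S \<subseteq> {..<m}" "e ! d = 0" "length e = m" using ad by (simp_all add: admissible_def box_def)
  have kl: "killed (face m i k A) S e' y \<longleftrightarrow> killed A (skip i ` S) (take i e' @ k # drop i e') y" if e': "e' \<in> grid 2 m" for e' y
  proof -
    have "arm (face m i k A) (e'[j := 0], e') = arm A ((take i e' @ k # drop i e')[skip i j := 0], take i e' @ k # drop i e')" if "j \<in> S" for j
      using face_simps(2)[OF box_update_same[OF e', of j 0] e' update_0_le, of i k A] insert_update(1)[of i e' j k 0] that e i box_length[OF e'] by auto
    then show ?thesis by (simp add: killed_def face_simps(1)[OF e'])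
  qed
  have e1: "e[d := 1] \<in> grid 2 m" by (rule box_update_same[OF e(1)]) simp
  have "arm (face m i k A) (e, e[d := 1]) = arm A (take i e @ k # drop i e, (take i e @ k # drop i e)[skip i d := 1])"
    using face_simps(2)[OF e(1) e1 update_1_ge[OF e(4)], of i k A] insert_update(1)[of i e d k 1] e i by simp
  then show ?thesis unfolding lifts_def kl[OF e(1)] kl[OF e1] using insert_update(1)[of i e d k 1] e i by simp
qed

lemma lifting_face:
  assumes dA: "diagram_on (grid 2 (Suc m)) A" and i: "i \<le> m" and k: "k < 2" and l: "lifting (Suc m) A"
  shows "lifting m (face m i k A)"
  unfolding lifting_def
proof (intro allI impI)
  fix e d S assume ad: "admissible m e d S"
  then have e: "e \<in> grid 2 m" "d < m" "S \<subseteq> {..<m}" "e ! d = 0" "\<And>j. j \<in> S \<Longrightarrow> e ! j = 1" "length e = m" by (simp_all add: admissible_def box_def)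
  have "admissible (Suc m) (take i e @ k # drop i e) (skip i d) (skip i ` S)"
  proof -
    have "skip i j < Suc m" if "j < m" for j using that by (simp add: skip_def)
    then show ?thesis
      unfolding admissible_def using insert_grid[OF e(1) k] e i by (auto simp: insert_update(2) subset_iff)
  qed
  then show "lifts (face m i k A) e d S" using l by (simp add: lifts_face[OF dA i k ad] lifting_def)
qed

text \<open>If direction \<open>i\<close> is neither lifted along nor killed in, the whole lifting
  problem takes place in the face on which the \<open>i\<close>-th coordinate is
  \<open>x ! i\<close>.\<close>

lemma lifts_from_face:
  assumes dA: "diagram_on (grid 2 (Suc m)) A" and i: "i \<le> m" and l: "\<And>k. k < 2 \<Longrightarrow> lifting m (face m i k A)"
    and ad: "admissible (Suc m) x d S" and di: "d \<noteq> i" "i \<notin> S"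
  shows "lifts A x d S"
proof -
  have x: "x \<in> grid 2 (Suc m)" "d < Suc m" "S \<subseteq> {..<Suc m}" "x ! d = 0" "\<And>j. j \<in> S \<Longrightarrow> x ! j = 1" "length x = Suc m"
    using ad by (simp_all add: admissible_def box_def)
  define e where "e = take i x @ drop (Suc i) x"
  have le: "length e = m" using x(6) i by (simp add: e_def)
  have k: "x ! i < 2" using x(1) i by (simp add: box_def)
  have xe: "take i e @ x ! i # drop i e = x" using x(6) i by (simp add: e_def id_take_nth_drop[symmetric])
  have e: "e \<in> grid 2 m"
  proof -
    have "e ! j < 2" if "j < m" for j
    proof -
      have "e ! j = x ! skip i j" using insert_update(2)[of i e j "x ! i"] xe le i that by simp
      moreover have "skip i j < Suc m" using that by (simp add: skip_def)
      ultimately show ?thesis using x(1) by (simp add: box_def)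
    qed
    then show ?thesis using le by (simp add: box_def)
  qed
  define unskip where "unskip = (\<lambda>j. if j < i then j else j - 1 :: nat)"
  have unskip: "skip i (unskip j) = j" if "j \<noteq> i" for j using that by (auto simp: skip_def unskip_def)
  have unskipm: "unskip j < m" if "j < Suc m" "j \<noteq> i" for j using that i by (auto simp: unskip_def)
  have ex: "e ! unskip j = x ! j" if "j < Suc m" "j \<noteq> i" for j
    using insert_update(2)[of i e "unskip j" "x ! i"] xe le i unskipm[OF that] unskip[OF that(2)] by simp
  have ni: "j \<noteq> i" if "j \<in> S" for j using that di(2) by blast
  have ad': "admissible m e (unskip d) (unskip ` S)"
    unfolding admissible_def using e unskipm x di(1) ni by (auto simp: ex subset_iff)
  have "skip i ` unskip ` S = S" using unskip ni by (force simp: image_image)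
  then show ?thesis using lifts_face[OF dA i k ad'] l[OF k] ad' unskip[OF di(1)] by (simp add: xe lifting_def)
qed

text \<open>\<open>B\<close> is the comparison from the initial corner of \<open>A\<close> to a
  pullback: its face at 1 is the corner \<open>1, 1\<close> of \<open>A\<close>, its face at 0 is
  the pullback, with projections \<open>\<pi>\<close> and \<open>\<rho>\<close>. The data are given
  vertex by vertex, in the base category.\<close>

context
  fixes m :: nat and A B :: "('a, 'b) diagram" and \<pi> \<rho> :: "nat list \<Rightarrow> 'b"
  assumes dA: "diagram_on (grid 2 (Suc (Suc m))) A" and dB: "diagram_on (grid 2 (Suc m)) B"
    and B1: "\<And>e. e \<in> grid 2 m \<Longrightarrow> obm B (1 # e) = obm A (1 # 1 # e)"
      "\<And>e e'. \<lbrakk>e \<in> grid 2 m; e' \<in> grid 2 m; e \<unlhd> e'\<rbrakk> \<Longrightarrow> arm B (1 # e, 1 # e') = arm A (1 # 1 # e, 1 # 1 # e')"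
    and pb: "\<And>e. e \<in> grid 2 m \<Longrightarrow> is_pullback C (arm A (0 # 0 # e, 0 # 1 # e)) (arm A (0 # 0 # e, 1 # 0 # e)) (\<pi> e) (\<rho> e)"
    and \<pi>d: "\<And>e. e \<in> grid 2 m \<Longrightarrow> Dom C (\<pi> e) = obm B (0 # e)"
    and nat: "\<And>e e'. \<lbrakk>e \<in> grid 2 m; e' \<in> grid 2 m; e \<unlhd> e'\<rbrakk> \<Longrightarrow> \<pi> e \<cdot> arm B (0 # e, 0 # e') = arm A (0 # 1 # e, 0 # 1 # e') \<cdot> \<pi> e'"
      "\<And>e e'. \<lbrakk>e \<in> grid 2 m; e' \<in> grid 2 m; e \<unlhd> e'\<rbrakk> \<Longrightarrow> \<rho> e \<cdot> arm B (0 # e, 0 # e') = arm A (1 # 0 # e, 1 # 0 # e') \<cdot> \<rho> e'"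
    and \<theta>: "\<And>e. e \<in> grid 2 m \<Longrightarrow> \<pi> e \<cdot> arm B (0 # e, 1 # e) = arm A (0 # 1 # e, 1 # 1 # e)"
      "\<And>e. e \<in> grid 2 m \<Longrightarrow> \<rho> e \<cdot> arm B (0 # e, 1 # e) = arm A (1 # 0 # e, 1 # 1 # e)"
begin

section \<open>Killed elements and lifting in the comparison cube\<close>

private lemma gA [simp]: "e \<in> grid 2 m \<Longrightarrow> a < 2 \<Longrightarrow> b < 2 \<Longrightarrow> a # b # e \<in> grid 2 (Suc (Suc m))"
  and gB [simp]: "e \<in> grid 2 m \<Longrightarrow> a < 2 \<Longrightarrow> a # e \<in> grid 2 (Suc m)"
  by simp_all

private lemma tA [simp]:
  assumes "e \<in> grid 2 m" "e' \<in> grid 2 m" "e \<unlhd> e'" "a \<le> a'" "b \<le> b'" "a' < 2" "b' < 2"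
  shows "arm A (a # b # e, a' # b' # e') \<in> Arr C" "Dom C (arm A (a # b # e, a' # b' # e')) = obm A (a' # b' # e')"
    "Cod C (arm A (a # b # e, a' # b' # e')) = obm A (a # b # e)"
  using diagramD(3-5)[OF dA, of "a # b # e" "a' # b' # e'"] assms by simp_all

private lemma tB [simp]:
  assumes "e \<in> grid 2 m" "e' \<in> grid 2 m" "e \<unlhd> e'" "a \<le> a'" "a' < 2"
  shows "arm B (a # e, a' # e') \<in> Arr C" "Dom C (arm B (a # e, a' # e')) = obm B (a' # e')"
    "Cod C (arm B (a # e, a' # e')) = obm B (a # e)"
  using diagramD(3-5)[OF dB, of "a # e" "a' # e'"] assms by simp_all

private lemma tP [simp]:
  assumes e: "e \<in> grid 2 m"
  shows "\<pi> e \<in> Arr C" "Dom C (\<pi> e) = obm B (0 # e)" "Cod C (\<pi> e) = obm A (0 # 1 # e)"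
    "\<rho> e \<in> Arr C" "Dom C (\<rho> e) = obm B (0 # e)" "Cod C (\<rho> e) = obm A (1 # 0 # e)"
  using pullbackD[OF pb[OF e]] \<pi>d[OF e] e by (simp_all add: list_le_refl)

private lemma grid0 [simp]: "e \<in> grid 2 m \<Longrightarrow> e[j := 0] \<in> grid 2 m"
  and grid1 [simp]: "e \<in> grid 2 m \<Longrightarrow> e[j := 1] \<in> grid 2 m"
  and le0 [simp]: "e[j := 0] \<unlhd> e"
  and lerefl [simp]: "e \<unlhd> e"
  by (auto intro: box_update_same update_0_le list_le_refl)

private lemma cA:
  assumes "e \<in> grid 2 m" "e' \<in> grid 2 m" "e'' \<in> grid 2 m" "e \<unlhd> e'" "e' \<unlhd> e''" "a \<le> a'" "b \<le> b'" "a' \<le> a''" "b' \<le> b''" "a'' < 2" "b'' < 2"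
  shows "arm A (a # b # e, a' # b' # e') \<cdot> arm A (a' # b' # e', a'' # b'' # e'') = arm A (a # b # e, a'' # b'' # e'')"
  using assms by (intro diagramD(6)[OF dA]) simp_all

private abbreviation (input) shift2 where "shift2 S \<equiv> Suc ` Suc ` (S :: nat set)"

private lemma killed_B1:
  assumes e: "e \<in> grid 2 m"
  shows "killed B (Suc ` S) (1 # e) y \<longleftrightarrow> killed A (shift2 S) (1 # 1 # e) y"
  using e by (simp add: killed_def B1)

text \<open>An element of the initial corner vanishes in the pullback iff both its projections
  vanish, so direction 0 of \<open>B\<close> stands for directions 0 and 1 of \<open>A\<close>
  together.\<close>

private lemma killed_B10:
  assumes e: "e \<in> grid 2 m"
  shows "killed B (insert 0 (Suc ` S)) (1 # e) y \<longleftrightarrow> killed A (insert 0 (insert 1 (shift2 S))) (1 # 1 # e) y"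
proof (cases "y \<in> Arr C \<and> Cod C y = obm A (1 # 1 # e)")
  case True
  have "zero_arrow C (arm B (0 # e, 1 # e) \<cdot> y) \<longleftrightarrow>
      zero_arrow C (arm A (0 # 1 # e, 1 # 1 # e) \<cdot> y) \<and> zero_arrow C (arm A (1 # 0 # e, 1 # 1 # e) \<cdot> y)"
    using pullback_zero_iff[OF pb[OF e], of "arm B (0 # e, 1 # e) \<cdot> y"] True e
    by (simp add: Cmp_eq_left[OF \<theta>(1)[OF e]] Cmp_eq_left[OF \<theta>(2)[OF e]] B1)
  then show ?thesis using killed_B1[OF e, of S y] by (auto simp: killed_insert)
qed (use e in \<open>auto simp: killed_def B1\<close>)

text \<open>An element of the pullback is a pair, and so is its image at the neighbouring vertex in
  direction \<open>j\<close>; such a pair vanishes iff both entries do.\<close>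

private lemma killed_B0:
  assumes e: "e \<in> grid 2 m" and [simp]: "w \<in> Arr C" "Cod C w = obm B (0 # e)"
  shows "killed B (Suc ` S) (0 # e) w \<longleftrightarrow> killed A (shift2 S) (0 # 1 # e) (\<pi> e \<cdot> w) \<and> killed A (shift2 S) (1 # 0 # e) (\<rho> e \<cdot> w)"
proof -
  have "zero_arrow C (arm B (0 # e[j := 0], 0 # e) \<cdot> w) \<longleftrightarrow>
      zero_arrow C (arm A (0 # 1 # e[j := 0], 0 # 1 # e) \<cdot> (\<pi> e \<cdot> w)) \<and> zero_arrow C (arm A (1 # 0 # e[j := 0], 1 # 0 # e) \<cdot> (\<rho> e \<cdot> w))" for j
    using pullback_zero_iff[OF pb[OF grid0[OF e]], of "arm B (0 # e[j := 0], 0 # e) \<cdot> w"] e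
    by (simp add: Cmp_eq_left[OF nat(1)[OF grid0[OF e] e le0]] Cmp_eq_left[OF nat(2)[OF grid0[OF e] e le0]])
  then show ?thesis using e by (auto simp: killed_def)
qed

private lemma lifts_B1:
  assumes e: "e \<in> grid 2 m" "e ! d = 0"
  shows "lifts B (1 # e) (Suc d) (Suc ` S) \<longleftrightarrow> lifts A (1 # 1 # e) (Suc (Suc d)) (shift2 S)"
  using e killed_B1[OF e(1)] killed_B1[OF grid1[OF e(1)]] B1(2)[OF e(1) grid1[OF e(1)] update_1_ge[OF e(2)]]
  by (simp add: lifts_def)

private lemma lifts_B10:
  assumes e: "e \<in> grid 2 m" "e ! d = 0"
  shows "lifts B (1 # e) (Suc d) (insert 0 (Suc ` S)) \<longleftrightarrow> lifts A (1 # 1 # e) (Suc (Suc d)) (insert 0 (insert 1 (shift2 S)))"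
  using e killed_B10[OF e(1)] killed_B10[OF grid1[OF e(1)]] B1(2)[OF e(1) grid1[OF e(1)] update_1_ge[OF e(2)]]
  by (simp add: lifts_def)

text \<open>An element \<open>y\<close> that is killed in direction 1 forms together with zero an
  element of the pullback. A lift of this pair to the initial corner maps to \<open>y\<close> and is
  killed in direction 1; the other component is treated symmetrically.\<close>

private lemma lifts_A_from_B:
  assumes e: "e \<in> grid 2 m" and l: "lifts B (0 # e) 0 (Suc ` S)"
  shows "lifts A (0 # 1 # e) 0 (insert 1 (shift2 S))" "lifts A (1 # 0 # e) 1 (insert 0 (shift2 S))"
proof -
  have main: "\<exists>c x. regular_epi C c \<and> Cod C c = Dom C y \<and> Dom C x = Dom C c \<and> killed A (shift2 S) (1 # 1 # e) x \<and>
      arm A (0 # 1 # e, 1 # 1 # e) \<cdot> x = y \<cdot> c \<and> arm A (1 # 0 # e, 1 # 1 # e) \<cdot> x = z \<cdot> c"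
    if y: "killed A (shift2 S) (0 # 1 # e) y" and z: "killed A (shift2 S) (1 # 0 # e) z" and d: "Dom C z = Dom C y"
      and yz: "arm A (0 # 0 # e, 0 # 1 # e) \<cdot> y = arm A (0 # 0 # e, 1 # 0 # e) \<cdot> z" for y z
  proof -
    have [simp]: "y \<in> Arr C" "Cod C y = obm A (0 # 1 # e)" "z \<in> Arr C" "Cod C z = obm A (1 # 0 # e)"
      using y z by (simp_all add: killed_def)
    obtain w where [simp]: "w \<in> Arr C" "Dom C w = Dom C y" "Cod C w = Dom C (\<pi> e)" and w: "\<pi> e \<cdot> w = y" "\<rho> e \<cdot> w = z"
      using yz by (rule pullback_lift[OF pb[OF e]]) (simp_all add: d e)
    have "killed B (Suc ` S) (0 # e) w" using y z e by (subst killed_B0[OF e]) (simp_all add: w)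
    then obtain c x where c: "regular_epi C c" "Cod C c = Dom C w" "Dom C x = Dom C c" "killed B (Suc ` S) (1 # e) x"
      "arm B (0 # e, 1 # e) \<cdot> x = w \<cdot> c" using l unfolding lifts_def by auto
    have x: "killed A (shift2 S) (1 # 1 # e) x" using c(4) by (simp only: killed_B1[OF e])
    then have [simp]: "x \<in> Arr C" "Cod C x = obm A (1 # 1 # e)" by (simp_all add: killed_def)
    note [simp] = regular_epi_Arr[OF c(1)] c(2,3)
    have "\<pi> e \<cdot> (arm B (0 # e, 1 # e) \<cdot> x) = y \<cdot> c" "\<rho> e \<cdot> (arm B (0 # e, 1 # e) \<cdot> x) = z \<cdot> c"
      using e by (simp_all add: c(5) Cmp_eq_left[OF w(1)] Cmp_eq_left[OF w(2)])
    then have "arm A (0 # 1 # e, 1 # 1 # e) \<cdot> x = y \<cdot> c" "arm A (1 # 0 # e, 1 # 1 # e) \<cdot> x = z \<cdot> c"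
      using e by (simp_all add: Cmp_eq_left[OF \<theta>(1)[OF e]] Cmp_eq_left[OF \<theta>(2)[OF e]] B1)
    with x c show ?thesis by (intro exI[of _ c] exI[of _ x]) simp
  qed
  have zk: "killed A (shift2 S) (a # b # e) z" if "zero_arrow C z" "Cod C z = obm A (a # b # e)" "a < 2" "b < 2" for a b z
    using that e by (simp add: killed_def zero_arrow_Cmp_left)
  show "lifts A (0 # 1 # e) 0 (insert 1 (shift2 S))" unfolding lifts_def
  proof (intro allI impI)
    fix y assume "killed A (insert 1 (shift2 S)) (0 # 1 # e) y"
    then have y: "killed A (shift2 S) (0 # 1 # e) y" "zero_arrow C (arm A (0 # 0 # e, 0 # 1 # e) \<cdot> y)" by (simp_all add: killed_insert)
    then have [simp]: "y \<in> Arr C" "Cod C y = obm A (0 # 1 # e)" by (simp_all add: killed_def)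
    have "obm A (1 # 0 # e) \<in> Obj C" using diagramD(1)[OF dA, of "1 # 0 # e"] e by simp
    then obtain z where z: "zero_arrow C z" "Dom C z = Dom C y" "Cod C z = obm A (1 # 0 # e)"
      by (rule_tac zero_arrow_exists[of "Dom C y" "obm A (1 # 0 # e)"]) simp_all
    have "arm A (0 # 0 # e, 0 # 1 # e) \<cdot> y = arm A (0 # 0 # e, 1 # 0 # e) \<cdot> z"
      by (rule zero_arrow_unique[OF y(2)]) (use z e in \<open>simp_all add: zero_arrow_Cmp_left\<close>)
    from main[OF y(1) zk[OF z(1,3)] z(2) this] obtain c x where c: "regular_epi C c" "Cod C c = Dom C y" "Dom C x = Dom C c"
      "killed A (shift2 S) (1 # 1 # e) x" "arm A (0 # 1 # e, 1 # 1 # e) \<cdot> x = y \<cdot> c" "arm A (1 # 0 # e, 1 # 1 # e) \<cdot> x = z \<cdot> c" by auto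
    have "zero_arrow C (z \<cdot> c)" by (rule zero_arrow_Cmp_right[OF z(1)]) (simp_all add: c z)
    then have "killed A (insert 1 (shift2 S)) (1 # 1 # e) x" using c by (simp add: killed_insert)
    then show "\<exists>c x. regular_epi C c \<and> Cod C c = Dom C y \<and> Dom C x = Dom C c \<and> killed A (insert 1 (shift2 S)) ((0 # 1 # e)[0 := 1]) x \<and>
        arm A (0 # 1 # e, (0 # 1 # e)[0 := 1]) \<cdot> x = y \<cdot> c" using c by (intro exI[of _ c] exI[of _ x]) simp
  qed
  show "lifts A (1 # 0 # e) 1 (insert 0 (shift2 S))" unfolding lifts_def
  proof (intro allI impI)
    fix z assume "killed A (insert 0 (shift2 S)) (1 # 0 # e) z"
    then have z: "killed A (shift2 S) (1 # 0 # e) z" "zero_arrow C (arm A (0 # 0 # e, 1 # 0 # e) \<cdot> z)" by (simp_all add: killed_insert)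
    then have [simp]: "z \<in> Arr C" "Cod C z = obm A (1 # 0 # e)" by (simp_all add: killed_def)
    have "obm A (0 # 1 # e) \<in> Obj C" using diagramD(1)[OF dA, of "0 # 1 # e"] e by simp
    then obtain y where y: "zero_arrow C y" "Dom C y = Dom C z" "Cod C y = obm A (0 # 1 # e)"
      by (rule_tac zero_arrow_exists[of "Dom C z" "obm A (0 # 1 # e)"]) simp_all
    have "arm A (0 # 0 # e, 0 # 1 # e) \<cdot> y = arm A (0 # 0 # e, 1 # 0 # e) \<cdot> z"
      by (rule zero_arrow_unique[OF _ z(2)]) (use y e in \<open>simp_all add: zero_arrow_Cmp_left\<close>)
    from main[OF zk[OF y(1,3)] z(1) y(2)[symmetric] this] obtain c x where c: "regular_epi C c" "Cod C c = Dom C y" "Dom C x = Dom C c"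
      "killed A (shift2 S) (1 # 1 # e) x" "arm A (0 # 1 # e, 1 # 1 # e) \<cdot> x = y \<cdot> c" "arm A (1 # 0 # e, 1 # 1 # e) \<cdot> x = z \<cdot> c" by auto
    have "zero_arrow C (y \<cdot> c)" by (rule zero_arrow_Cmp_right[OF y(1)]) (simp_all add: c)
    then have "killed A (insert 0 (shift2 S)) (1 # 1 # e) x" using c by (simp add: killed_insert)
    then show "\<exists>c x. regular_epi C c \<and> Cod C c = Dom C z \<and> Dom C x = Dom C c \<and> killed A (insert 0 (shift2 S)) ((1 # 0 # e)[1 := 1]) x \<and>
        arm A (1 # 0 # e, (1 # 0 # e)[1 := 1]) \<cdot> x = z \<cdot> c" using c y(2) by (intro exI[of _ c] exI[of _ x]) simp
  qed
qed

text \<open>On the subobjects of killed elements, the comparison to the pullback \<open>P\<close> has an image that contains the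
  kernel of the projection \<open>P \<rightarrow> V\<close> and maps onto \<open>V\<close>; by protomodularity it is all of \<open>P\<close>.\<close>
private lemma lifts_B_comparison:
  assumes e: "e \<in> grid 2 m" and S: "S \<subseteq> {..<m}"
    and l1: "lifts A (0 # 1 # e) 0 (insert 1 (shift2 S))" and l2: "lifts A (1 # 0 # e) 1 (shift2 S)"
  shows "lifts B (0 # e) 0 (Suc ` S)"
proof -
  have S2: "shift2 S \<subseteq> {..<Suc (Suc m)}" using S by auto
  \<comment> \<open>The arrows in the first two directions preserve killed elements, so they
    restrict to the subobjects introduced below.\<close>
  have kc: "killed A (shift2 S) (a # b # e) (arm A (a # b # e, a' # b' # e) \<cdot> x)"
    if "killed A (shift2 S) (a' # b' # e) x" "a \<le> a'" "b \<le> b'" "a' < 2" "b' < 2" for a b a' b' x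
  proof -
    have [simp]: "x \<in> Arr C" "Cod C x = obm A (a' # b' # e)" using that by (simp_all add: killed_def)
    have "zero_arrow C (arm A (a # b # e[j := 0], a # b # e) \<cdot> (arm A (a # b # e, a' # b' # e) \<cdot> x))" if j: "j \<in> S" for j
    proof -
      have "zero_arrow C (arm A (a' # b' # e[j := 0], a' # b' # e) \<cdot> x)" using \<open>killed A (shift2 S) (a' # b' # e) x\<close> j by (simp add: killed_def)
      then have "zero_arrow C (arm A (a # b # e[j := 0], a' # b' # e[j := 0]) \<cdot> (arm A (a' # b' # e[j := 0], a' # b' # e) \<cdot> x))"
        by (rule zero_arrow_Cmp_left) (use that e \<open>a \<le> a'\<close> \<open>b \<le> b'\<close> \<open>a' < 2\<close> \<open>b' < 2\<close> in simp_all)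
      moreover have "arm A (a # b # e[j := 0], a' # b' # e[j := 0]) \<cdot> (arm A (a' # b' # e[j := 0], a' # b' # e) \<cdot> x) =
          arm A (a # b # e[j := 0], a # b # e) \<cdot> (arm A (a # b # e, a' # b' # e) \<cdot> x)"
        using e \<open>a \<le> a'\<close> \<open>b \<le> b'\<close> \<open>a' < 2\<close> \<open>b' < 2\<close> by (simp add: Cmp_eq_left[OF cA])
      ultimately show ?thesis by simp
    qed
    then show ?thesis using that e by (simp add: killed_def)
  qed
  obtain \<kappa>X where \<kappa>X: "monic \<kappa>X" "Cod C \<kappa>X = obm A (1 # 1 # e)" "\<And>x. \<lbrakk>x \<in> Arr C; Cod C x = obm A (1 # 1 # e)\<rbrakk> \<Longrightarrow> x \<preceq> \<kappa>X \<longleftrightarrow> killed A (shift2 S) (1 # 1 # e) x"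
    by (rule killed_subobject[OF dA _ S2, of "1 # 1 # e"]) (use e in auto)
  obtain \<kappa>U where \<kappa>U: "monic \<kappa>U" "Cod C \<kappa>U = obm A (0 # 1 # e)" "\<And>x. \<lbrakk>x \<in> Arr C; Cod C x = obm A (0 # 1 # e)\<rbrakk> \<Longrightarrow> x \<preceq> \<kappa>U \<longleftrightarrow> killed A (shift2 S) (0 # 1 # e) x"
    by (rule killed_subobject[OF dA _ S2, of "0 # 1 # e"]) (use e in auto)
  obtain \<kappa>V where \<kappa>V: "monic \<kappa>V" "Cod C \<kappa>V = obm A (1 # 0 # e)" "\<And>x. \<lbrakk>x \<in> Arr C; Cod C x = obm A (1 # 0 # e)\<rbrakk> \<Longrightarrow> x \<preceq> \<kappa>V \<longleftrightarrow> killed A (shift2 S) (1 # 0 # e) x"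
    by (rule killed_subobject[OF dA _ S2, of "1 # 0 # e"]) (use e in auto)
  note [simp] = monic_Arr[OF \<kappa>X(1)] monic_Arr[OF \<kappa>U(1)] monic_Arr[OF \<kappa>V(1)] \<kappa>X(2) \<kappa>U(2) \<kappa>V(2)
  have kX: "killed A (shift2 S) (1 # 1 # e) \<kappa>X" and kU: "killed A (shift2 S) (0 # 1 # e) \<kappa>U" and kV: "killed A (shift2 S) (1 # 0 # e) \<kappa>V"
    using \<kappa>X(3)[of \<kappa>X] \<kappa>U(3)[of \<kappa>U] \<kappa>V(3)[of \<kappa>V] le_arrow_refl by simp_all
  define u where "u = arm A (0 # 1 # e, 1 # 1 # e)"
  define v where "v = arm A (1 # 0 # e, 1 # 1 # e)"
  define f where "f = arm A (0 # 0 # e, 0 # 1 # e)"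
  define g where "g = arm A (0 # 0 # e, 1 # 0 # e)"
  have ty[simp]: "u \<in> Arr C" "Dom C u = obm A (1 # 1 # e)" "Cod C u = obm A (0 # 1 # e)" "v \<in> Arr C" "Dom C v = obm A (1 # 1 # e)" "Cod C v = obm A (1 # 0 # e)"
    "f \<in> Arr C" "Dom C f = obm A (0 # 1 # e)" "Cod C f = obm A (0 # 0 # e)" "g \<in> Arr C" "Dom C g = obm A (1 # 0 # e)" "Cod C g = obm A (0 # 0 # e)"
    using e by (simp_all add: u_def v_def f_def g_def)
  have fu: "f \<cdot> u = g \<cdot> v" unfolding f_def u_def g_def v_def using e by (simp add: cA)
  have "u \<cdot> \<kappa>X \<preceq> \<kappa>U" unfolding u_def by (subst \<kappa>U(3)) (use e kc[OF kX] in simp_all)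
  then obtain u' where [simp]: "u' \<in> Arr C" "Dom C u' = Dom C \<kappa>X" "Cod C u' = Dom C \<kappa>U" and u': "\<kappa>U \<cdot> u' = u \<cdot> \<kappa>X" by (auto elim!: le_arrowE)
  have "v \<cdot> \<kappa>X \<preceq> \<kappa>V" unfolding v_def by (subst \<kappa>V(3)) (use e kc[OF kX] in simp_all)
  then obtain v' where [simp]: "v' \<in> Arr C" "Dom C v' = Dom C \<kappa>X" "Cod C v' = Dom C \<kappa>V" and v': "\<kappa>V \<cdot> v' = v \<cdot> \<kappa>X" by (auto elim!: le_arrowE)
  \<comment> \<open>Elements of this pullback are compatible pairs of killed elements, that is, by
    \<open>killed_B0\<close>, the killed elements of the pullback in \<open>B\<close>.\<close>
  obtain a b where pb': "is_pullback C (f \<cdot> \<kappa>U) (g \<cdot> \<kappa>V) a b" using has_pullbacks[of "f \<cdot> \<kappa>U" "g \<cdot> \<kappa>V"] by auto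
  have [simp]: "a \<in> Arr C" "b \<in> Arr C" "Dom C b = Dom C a" "Cod C a = Dom C \<kappa>U" "Cod C b = Dom C \<kappa>V" using pullbackD[OF pb'] by simp_all
  have "(f \<cdot> \<kappa>U) \<cdot> u' = (g \<cdot> \<kappa>V) \<cdot> v'" by (simp add: u' v' Cmp_eq_left[OF fu])
  then obtain \<phi> where [simp]: "\<phi> \<in> Arr C" "Dom C \<phi> = Dom C \<kappa>X" "Cod C \<phi> = Dom C a" and \<phi>: "a \<cdot> \<phi> = u'" "b \<cdot> \<phi> = v'"
    by (rule pullback_lift[OF pb']) simp_all
  obtain \<epsilon> n where \<epsilon>: "regular_epi C \<epsilon>" and n: "monic n" and [simp]: "Dom C \<epsilon> = Dom C \<kappa>X" "Dom C n = Cod C \<epsilon>" "Cod C n = Dom C a" and n\<epsilon>: "n \<cdot> \<epsilon> = \<phi>"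
    by (rule image_factorization[of \<phi>]) simp_all
  note [simp] = regular_epi_Arr[OF \<epsilon>] monic_Arr[OF n]
  \<comment> \<open>The lifting hypothesis \<open>l2\<close>, applied to the universal killed
    element \<open>\<kappa>V\<close>.\<close>
  have v'e: "regular_epi C v'"
  proof -
    obtain c x where c: "regular_epi C c" "Cod C c = Dom C \<kappa>V" "Dom C x = Dom C c" "killed A (shift2 S) (1 # 1 # e) x" "v \<cdot> x = \<kappa>V \<cdot> c"
      using l2 kV unfolding lifts_def v_def by auto
    have [simp]: "x \<in> Arr C" "Cod C x = obm A (1 # 1 # e)" using c(4) by (simp_all add: killed_def)
    have "x \<preceq> \<kappa>X" using c(4) \<kappa>X(3)[of x] by simp
    then obtain w where [simp]: "w \<in> Arr C" "Dom C w = Dom C x" "Cod C w = Dom C \<kappa>X" and w: "\<kappa>X \<cdot> w = x" by (rule le_arrowE)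
    have "\<kappa>V \<cdot> (v' \<cdot> w) = \<kappa>V \<cdot> c" by (simp add: Cmp_eq_left[OF v'] w c)
    then have "v' \<cdot> w = c" by (rule monicD[OF \<kappa>V(1)]) (simp_all add: c)
    then show ?thesis by (rule local_lift_regular_epi[OF c(1)]) simp_all
  qed
  have "Id C (Dom C a) \<preceq> n"
  proof (rule regular_extension_le[of b \<phi>])
    show "regular_epi C (b \<cdot> \<phi>)" using v'e \<phi> by simp
    show "Id C (Dom C a) \<cdot> \<phi> \<preceq> n" using n\<epsilon> by (intro le_arrowI[of _ \<epsilon>]) simp_all
    fix x assume [simp]: "x \<in> Arr C" "Cod C x = Dom C b" and bx: "zero_arrow C (b \<cdot> x)"
    \<comment> \<open>An element of the kernel of \<open>b\<close> is a pair with second entry zero.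
      Its first entry is killed in direction 1, so \<open>l1\<close> lifts it locally to an element
      whose second projection vanishes.\<close>
    have ak: "killed A (shift2 S) (0 # 1 # e) (\<kappa>U \<cdot> (a \<cdot> x))"
      by (subst \<kappa>U(3)[symmetric]) (auto intro: le_arrowI)
    have "zero_arrow C ((g \<cdot> \<kappa>V) \<cdot> (b \<cdot> x))" by (rule zero_arrow_Cmp_left[OF bx]) simp_all
    then have "zero_arrow C (f \<cdot> (\<kappa>U \<cdot> (a \<cdot> x)))" using pullback_comm[OF pb', of x] by simp
    then have "killed A (insert 1 (shift2 S)) (0 # 1 # e) (\<kappa>U \<cdot> (a \<cdot> x))" using ak by (simp add: killed_insert f_def)
    then obtain c z where c: "regular_epi C c" "Cod C c = Dom C (\<kappa>U \<cdot> (a \<cdot> x))" "Dom C z = Dom C c"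
        "killed A (insert 1 (shift2 S)) (1 # 1 # e) z" "u \<cdot> z = (\<kappa>U \<cdot> (a \<cdot> x)) \<cdot> c"
      using l1 unfolding lifts_def u_def by (auto simp del: assoc)
    note [simp] = regular_epi_Arr[OF c(1)]
    have cx[simp]: "Cod C c = Dom C x" using c(2) by simp
    have zz: "killed A (shift2 S) (1 # 1 # e) z" "zero_arrow C (v \<cdot> z)" using c(4) by (simp_all add: killed_insert v_def)
    have [simp]: "z \<in> Arr C" "Cod C z = obm A (1 # 1 # e)" "Dom C z = Dom C c" using zz(1) c(3) by (simp_all add: killed_def)
    have "z \<preceq> \<kappa>X" using zz(1) \<kappa>X(3)[of z] by simp
    then obtain w where [simp]: "w \<in> Arr C" "Dom C w = Dom C z" "Cod C w = Dom C \<kappa>X" and w: "\<kappa>X \<cdot> w = z" by (rule le_arrowE)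
    have "\<phi> \<cdot> w = x \<cdot> c"
    proof (rule pullback_eq[OF pb'])
      have "\<kappa>U \<cdot> (u' \<cdot> w) = \<kappa>U \<cdot> (a \<cdot> (x \<cdot> c))" using c(5) by (simp add: Cmp_eq_left[OF u'] w)
      then have "u' \<cdot> w = a \<cdot> (x \<cdot> c)" by (rule monicD[OF \<kappa>U(1)]) simp_all
      then show "a \<cdot> (\<phi> \<cdot> w) = a \<cdot> (x \<cdot> c)" by (simp add: Cmp_eq_left[OF \<phi>(1)])
      have "zero_arrow C (\<kappa>V \<cdot> (v' \<cdot> w))" using zz(2) by (simp add: Cmp_eq_left[OF v'] w)
      then have 1: "zero_arrow C (v' \<cdot> w)" by (rule monic_zero_arrow[OF \<kappa>V(1)]) simp_all
      have "zero_arrow C ((b \<cdot> x) \<cdot> c)" by (rule zero_arrow_Cmp_right[OF bx]) simp_all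
      then have 2: "zero_arrow C (b \<cdot> (x \<cdot> c))" by simp
      have "v' \<cdot> w = b \<cdot> (x \<cdot> c)" by (rule zero_arrow_unique[OF 1 2]) simp_all
      then show "b \<cdot> (\<phi> \<cdot> w) = b \<cdot> (x \<cdot> c)" by (simp add: Cmp_eq_left[OF \<phi>(2)])
    qed simp_all
    then have "n \<cdot> (\<epsilon> \<cdot> w) = x \<cdot> c" by (simp add: Cmp_eq_left[OF n\<epsilon>])
    then have "x \<cdot> c \<preceq> n" by (rule le_arrowI) simp_all
    then have "x \<preceq> n" by (rule le_arrow_local[OF n c(1)]) simp_all
    then show "Id C (Dom C a) \<cdot> x \<preceq> n" by simp
  qed (simp_all add: n)
  then obtain j where [simp]: "j \<in> Arr C" "Dom C j = Dom C a" "Cod C j = Cod C \<epsilon>" and j: "n \<cdot> j = Id C (Dom C a)" by (auto elim!: le_arrowE)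
  show ?thesis unfolding lifts_def
  proof (intro allI impI)
    fix w assume w: "killed B (Suc ` S) (0 # e) w"
    then have [simp]: "w \<in> Arr C" "Cod C w = obm B (0 # e)" by (simp_all add: killed_def)
    have wk: "killed A (shift2 S) (0 # 1 # e) (\<pi> e \<cdot> w)" "killed A (shift2 S) (1 # 0 # e) (\<rho> e \<cdot> w)"
      using w killed_B0[OF e, of w S] by simp_all
    have "\<pi> e \<cdot> w \<preceq> \<kappa>U" "\<rho> e \<cdot> w \<preceq> \<kappa>V" using wk \<kappa>U(3)[of "\<pi> e \<cdot> w"] \<kappa>V(3)[of "\<rho> e \<cdot> w"] e by simp_all
    then obtain s r where [simp]: "s \<in> Arr C" "Dom C s = Dom C w" "Cod C s = Dom C \<kappa>U" and s: "\<kappa>U \<cdot> s = \<pi> e \<cdot> w"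
      and [simp]: "r \<in> Arr C" "Dom C r = Dom C w" "Cod C r = Dom C \<kappa>V" and r: "\<kappa>V \<cdot> r = \<rho> e \<cdot> w"
      using e by (auto elim!: le_arrowE)
    have "(f \<cdot> \<kappa>U) \<cdot> s = (g \<cdot> \<kappa>V) \<cdot> r" using pullback_comm[OF pb[OF e], of w] e by (simp add: s r f_def g_def)
    then obtain t where [simp]: "t \<in> Arr C" "Dom C t = Dom C w" "Cod C t = Dom C a" and t: "a \<cdot> t = s" "b \<cdot> t = r"
      by (rule pullback_lift[OF pb']) simp_all
    obtain c x where c: "regular_epi C c" and [simp]: "Cod C c = Dom C w" "x \<in> Arr C" "Dom C x = Dom C c" "Cod C x = Dom C \<kappa>X" and x: "\<epsilon> \<cdot> x = (j \<cdot> t) \<cdot> c"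
      by (rule regular_epi_lift[OF \<epsilon>, of "j \<cdot> t"]) simp_all
    note [simp] = regular_epi_Arr[OF c]
    have \<phi>x: "\<phi> \<cdot> x = t \<cdot> c"
    proof -
      have "\<phi> \<cdot> x = n \<cdot> (\<epsilon> \<cdot> x)" by (simp add: Cmp_eq_left[OF n\<epsilon>])
      also have "\<dots> = t \<cdot> c" by (simp add: x Cmp_eq_left[OF j])
      finally show ?thesis .
    qed
    have xk: "killed B (Suc ` S) (1 # e) (\<kappa>X \<cdot> x)" unfolding killed_B1[OF e]
      by (subst \<kappa>X(3)[symmetric]) (auto intro: le_arrowI)
    have "arm B (0 # e, 1 # e) \<cdot> (\<kappa>X \<cdot> x) = w \<cdot> c"
    proof (rule pullback_eq[OF pb[OF e]])
      have "\<pi> e \<cdot> (arm B (0 # e, 1 # e) \<cdot> (\<kappa>X \<cdot> x)) = u \<cdot> (\<kappa>X \<cdot> x)" using e by (simp add: Cmp_eq_left[OF \<theta>(1)[OF e]] B1 u_def)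
      also have "\<dots> = \<kappa>U \<cdot> (a \<cdot> (\<phi> \<cdot> x))" by (simp add: Cmp_eq_left[OF u'[symmetric]] Cmp_eq_left[OF \<phi>(1)])
      also have "\<dots> = \<pi> e \<cdot> (w \<cdot> c)" using e by (simp add: \<phi>x Cmp_eq_left[OF t(1)] Cmp_eq_left[OF s])
      finally show "\<pi> e \<cdot> (arm B (0 # e, 1 # e) \<cdot> (\<kappa>X \<cdot> x)) = \<pi> e \<cdot> (w \<cdot> c)" .
      have "\<rho> e \<cdot> (arm B (0 # e, 1 # e) \<cdot> (\<kappa>X \<cdot> x)) = v \<cdot> (\<kappa>X \<cdot> x)" using e by (simp add: Cmp_eq_left[OF \<theta>(2)[OF e]] B1 v_def)
      also have "\<dots> = \<kappa>V \<cdot> (b \<cdot> (\<phi> \<cdot> x))" by (simp add: Cmp_eq_left[OF v'[symmetric]] Cmp_eq_left[OF \<phi>(2)])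
      also have "\<dots> = \<rho> e \<cdot> (w \<cdot> c)" using e by (simp add: \<phi>x Cmp_eq_left[OF t(2)] Cmp_eq_left[OF r])
      finally show "\<rho> e \<cdot> (arm B (0 # e, 1 # e) \<cdot> (\<kappa>X \<cdot> x)) = \<rho> e \<cdot> (w \<cdot> c)" .
    qed (use e in \<open>simp_all add: B1\<close>)
    then show "\<exists>c x. regular_epi C c \<and> Cod C c = Dom C w \<and> Dom C x = Dom C c \<and> killed B (Suc ` S) ((0 # e)[0 := 1]) x \<and>
        arm B (0 # e, (0 # e)[0 := 1]) \<cdot> x = w \<cdot> c"
      using c xk by (intro exI[of _ c] exI[of _ "\<kappa>X \<cdot> x"]) simp
  qed
qed

text \<open>Lift the element to the initial corner along direction 0 of \<open>B\<close>, lift the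
  result there along direction \<open>d\<close>, and map it down to the pullback again.\<close>

private lemma lifts_B0:
  assumes e: "e \<in> grid 2 m" "e ! d = 0" and l: "lifts B (0 # e) 0 (Suc ` S)" and l': "lifts A (1 # 1 # e) (Suc (Suc d)) (shift2 S)"
  shows "lifts B (0 # e) (Suc d) (Suc ` S)"
  unfolding lifts_def
proof (intro allI impI)
  fix w assume w: "killed B (Suc ` S) (0 # e) w"
  then have [simp]: "w \<in> Arr C" "Cod C w = obm B (0 # e)" by (simp_all add: killed_def)
  note e1 = grid1[OF e(1), of d] and le1 = update_1_ge[OF e(2)]
  obtain c x where c: "regular_epi C c" "Cod C c = Dom C w" "Dom C x = Dom C c" "killed B (Suc ` S) (1 # e) x" "arm B (0 # e, 1 # e) \<cdot> x = w \<cdot> c"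
    using l w unfolding lifts_def by auto
  then have "killed A (shift2 S) (1 # 1 # e) x" by (simp only: killed_B1[OF e(1)])
  then obtain c' x' where c': "regular_epi C c'" "Cod C c' = Dom C x" "Dom C x' = Dom C c'" "killed A (shift2 S) (1 # 1 # e[d := 1]) x'"
      "arm A (1 # 1 # e, 1 # 1 # e[d := 1]) \<cdot> x' = x \<cdot> c'"
    using l' unfolding lifts_def by auto
  have x'k: "killed B (Suc ` S) (1 # e[d := 1]) x'" using c'(4) by (simp only: killed_B1[OF e1])
  have ty[simp]: "x \<in> Arr C" "Cod C x = obm B (1 # e)" "x' \<in> Arr C" "Cod C x' = obm B (1 # e[d := 1])" "c \<in> Arr C" "c' \<in> Arr C"
    using c(1,4) c'(1) x'k by (simp_all add: killed_def)
  have cB: "arm B (a # p, a' # p') \<cdot> (arm B (a' # p', a'' # p'') \<cdot> h) = arm B (a # p, a'' # p'') \<cdot> h"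
    if "p \<in> grid 2 m" "p' \<in> grid 2 m" "p'' \<in> grid 2 m" "p \<unlhd> p'" "p' \<unlhd> p''" "a \<le> a'" "a' \<le> a''" "a'' < 2" "h \<in> Arr C" "Cod C h = obm B (a'' # p'')" for a a' a'' p p' p'' h
    using that by (intro diagram_Cmp[OF dB]) simp_all
  have 1: "arm B (0 # e, 0 # e[d := 1]) \<cdot> (arm B (0 # e[d := 1], 1 # e[d := 1]) \<cdot> x') = w \<cdot> (c \<cdot> c')"
  proof -
    have "arm B (0 # e, 0 # e[d := 1]) \<cdot> (arm B (0 # e[d := 1], 1 # e[d := 1]) \<cdot> x') = arm B (0 # e, 1 # e) \<cdot> (arm B (1 # e, 1 # e[d := 1]) \<cdot> x')"
      using e e1 le1 by (simp add: cB)
    also have "arm B (1 # e, 1 # e[d := 1]) \<cdot> x' = x \<cdot> c'" using c'(5) B1(2)[OF e(1) e1 le1] by simp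
    also have "arm B (0 # e, 1 # e) \<cdot> (x \<cdot> c') = w \<cdot> (c \<cdot> c')" using e c'(2) by (simp add: Cmp_eq_left[OF c(5)] c)
    finally show ?thesis .
  qed
  have 2: "killed B (Suc ` S) (0 # e[d := 1]) (arm B (0 # e[d := 1], 1 # e[d := 1]) \<cdot> x')"
  proof -
    have "zero_arrow C (arm B (0 # e[d := 1, j := 0], 0 # e[d := 1]) \<cdot> (arm B (0 # e[d := 1], 1 # e[d := 1]) \<cdot> x'))" if j: "j \<in> S" for j
    proof -
      have "zero_arrow C (arm B (1 # e[d := 1, j := 0], 1 # e[d := 1]) \<cdot> x')" using x'k j by (simp add: killed_def)
      then have "zero_arrow C (arm B (0 # e[d := 1, j := 0], 1 # e[d := 1, j := 0]) \<cdot> (arm B (1 # e[d := 1, j := 0], 1 # e[d := 1]) \<cdot> x'))"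
        by (rule zero_arrow_Cmp_left) (use e in simp_all)
      then show ?thesis using e by (simp add: cB)
    qed
    then show ?thesis using e by (simp add: killed_def)
  qed
  have "regular_epi C (c \<cdot> c')" by (rule regular_epi_Cmp[OF c'(1) c(1)]) (simp add: c c')
  then show "\<exists>c x. regular_epi C c \<and> Cod C c = Dom C w \<and> Dom C x = Dom C c \<and> killed B (Suc ` S) ((0 # e)[Suc d := 1]) x \<and>
      arm B (0 # e, (0 # e)[Suc d := 1]) \<cdot> x = w \<cdot> c"
    using 1 2 e c c' by (intro exI[of _ "c \<cdot> c'"] exI[of _ "arm B (0 # e[d := 1], 1 # e[d := 1]) \<cdot> x'"]) simp
qed

text \<open>A lifting problem for \<open>A\<close> that involves at most one of the directions 0 and
  1 takes place in a face. If it involves both, it is a problem for \<open>B\<close>: lifting along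
  one and killing in the other is lifting of a pair with a zero entry, and killing in both is
  killing in direction 0 of \<open>B\<close>.\<close>

lemma cube_lifting_iff:
  "lifting (Suc (Suc m)) A \<longleftrightarrow> (\<forall>i\<in>{0, 1}. \<forall>k\<in>{0, 1}. lifting (Suc m) (face (Suc m) i k A)) \<and> lifting (Suc m) B"
proof
  assume l: "lifting (Suc (Suc m)) A"
  have lA: "lifts A x d S" if "admissible (Suc (Suc m)) x d S" for x d S using l that by (simp add: lifting_def)
  have comp: "lifts B (0 # e) 0 (Suc ` S)" if e: "e \<in> grid 2 m" "S \<subseteq> {..<m}" "\<And>j. j \<in> S \<Longrightarrow> e ! j = 1" for e S
    by (rule lifts_B_comparison[OF e(1,2)]; rule lA) (use e in \<open>auto simp: admissible_def\<close>)
  have "lifting (Suc m) B" unfolding lifting_def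
  proof (intro allI impI)
    fix x d S assume ad: "admissible (Suc m) x d S"
    then obtain a e where x: "x = a # e" "a < 2" "e \<in> grid 2 m" unfolding admissible_def by (auto elim: grid_SucE)
    define S' where "S' = {j. Suc j \<in> S}"
    have S': "S' \<subseteq> {..<m}" "\<And>j. j \<in> S' \<Longrightarrow> e ! j = 1" using ad x by (auto simp: S'_def admissible_def)
    have Seq: "S = (if 0 \<in> S then insert 0 (Suc ` S') else Suc ` S')"
      by (auto simp: S'_def image_iff) (metis not0_implies_Suc)+
    have a0: "0 \<in> S \<Longrightarrow> a = 1" using ad x by (auto simp: admissible_def)
    have a01: "a = 0 \<or> a = 1" using x(2) by linarith
    show "lifts B x d S"
    proof (cases d)
      case 0
      then have "a = 0" "0 \<notin> S" using ad x by (auto simp: admissible_def)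
      then show ?thesis using comp[OF x(3) S'] Seq x 0 by simp
    next
      case (Suc d')
      then have d': "d' < m" "e ! d' = 0" using ad x by (simp_all add: admissible_def)
      have l1: "lifts A (1 # 1 # e) (Suc (Suc d')) (shift2 S')" by (rule lA) (use x S' d' in \<open>auto simp: admissible_def\<close>)
      show ?thesis
      proof (cases "0 \<in> S")
        case True
        have "lifts A (1 # 1 # e) (Suc (Suc d')) (insert 0 (insert 1 (shift2 S')))"
          by (rule lA) (use x S' d' in \<open>auto simp: admissible_def\<close>)
        then show ?thesis using True Seq a0 x Suc lifts_B10[OF x(3) d'(2)] by simp
      next
        case False
        then have S: "S = Suc ` S'" using Seq by simp
        from a01 show ?thesis
        proof
          assume "a = 1"
          then show ?thesis using l1 lifts_B1[OF x(3) d'(2)] x Suc S by simp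
        next
          assume "a = 0"
          then show ?thesis using lifts_B0[OF x(3) d'(2) comp[OF x(3) S'] l1] x Suc S by simp
        qed
      qed
    qed
  qed
  moreover have "lifting (Suc m) (face (Suc m) i k A)" if "i \<in> {0, 1}" "k \<in> {0, 1}" for i k
    by (rule lifting_face[OF dA _ _ l]) (use that in auto)
  ultimately show "(\<forall>i\<in>{0, 1}. \<forall>k\<in>{0, 1}. lifting (Suc m) (face (Suc m) i k A)) \<and> lifting (Suc m) B" by blast
next
  assume r: "(\<forall>i\<in>{0, 1}. \<forall>k\<in>{0, 1}. lifting (Suc m) (face (Suc m) i k A)) \<and> lifting (Suc m) B"
  have lB: "lifts B x d S" if "admissible (Suc m) x d S" for x d S using r that by (simp add: lifting_def)
  have k2: "k < 2 \<Longrightarrow> k = 0 \<or> k = 1" for k :: nat by linarith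
  have f0: "lifting (Suc m) (face (Suc m) 0 k A)" "lifting (Suc m) (face (Suc m) 1 k A)" if "k < 2" for k
    using r k2[OF that] by auto
  show "lifting (Suc (Suc m)) A" unfolding lifting_def
  proof (intro allI impI)
    fix x d S assume ad: "admissible (Suc (Suc m)) x d S"
    then have "x \<in> grid 2 (Suc (Suc m))" by (simp add: admissible_def)
    then obtain a x' where x': "x = a # x'" "a < 2" "x' \<in> grid 2 (Suc m)" by (rule grid_SucE)
    obtain b e where x: "x = a # b # e" "a < 2" "b < 2" "e \<in> grid 2 m" using x'(3) by (rule grid_SucE) (use x' in auto)
    define S' where "S' = {j. Suc (Suc j) \<in> S}"
    have S': "S' \<subseteq> {..<m}" "\<And>j. j \<in> S' \<Longrightarrow> e ! j = 1" using ad x by (auto simp: S'_def admissible_def)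
    have Sdec: "j \<in> S \<longleftrightarrow> (j = 0 \<and> 0 \<in> S) \<or> (j = 1 \<and> 1 \<in> S) \<or> j \<in> shift2 S'" for j
    proof -
      have "j = 0 \<or> j = 1 \<or> (\<exists>i. j = Suc (Suc i))" by (metis One_nat_def not0_implies_Suc)
      then show ?thesis by (auto simp: S'_def One_nat_def)
    qed
    have v: "0 \<in> S \<Longrightarrow> a = 1" "1 \<in> S \<Longrightarrow> b = 1" "d \<notin> S" "d = 0 \<Longrightarrow> a = 0" "d = 1 \<Longrightarrow> b = 0"
      using ad x by (auto simp: admissible_def)
    consider "d \<noteq> 0" "0 \<notin> S" | "d \<noteq> 1" "1 \<notin> S" | "d = 0" "1 \<in> S" | "d = 1" "0 \<in> S" | "0 \<in> S" "1 \<in> S"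
      using zero_neq_one[where 'a = nat] by metis
    then show "lifts A x d S"
    proof cases
      case 1
      show ?thesis by (rule lifts_from_face[OF dA _ f0(1) ad 1]) simp_all
    next
      case 2
      show ?thesis by (rule lifts_from_face[OF dA _ f0(2) ad 2]) simp_all
    next
      case 3
      then have "S = insert 1 (shift2 S')" using Sdec v(3) by blast
      moreover have "lifts B (0 # e) 0 (Suc ` S')" by (rule lB) (use x S' in \<open>auto simp: admissible_def\<close>)
      ultimately show ?thesis using lifts_A_from_B(1)[OF x(4)] x v 3 by simp
    next
      case 4
      then have "S = insert 0 (shift2 S')" using Sdec v(3) by blast
      moreover have "lifts B (0 # e) 0 (Suc ` S')" by (rule lB) (use x S' in \<open>auto simp: admissible_def\<close>)
      ultimately show ?thesis using lifts_A_from_B(2)[OF x(4)] x v 4 by simp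
    next
      case 5
      then have S: "S = insert 0 (insert 1 (shift2 S'))" using Sdec by blast
      have "d \<noteq> 0 \<and> d \<noteq> 1" by (intro conjI notI) (use 5 v(3) in simp_all)
      then obtain d' where d: "d = Suc (Suc d')" by (metis One_nat_def not0_implies_Suc)
      then have d': "d' < m" "e ! d' = 0" using ad x by (simp_all add: admissible_def)
      have "lifts B (1 # e) (Suc d') (insert 0 (Suc ` S'))" by (rule lB) (use x S' d' in \<open>auto simp: admissible_def\<close>)
      then show ?thesis using lifts_B10[OF x(4) d'(2)] x v 5 S d by simp
    qed
  qed
qed

end

text \<open>A single edge poses one lifting problem, with nothing to kill; lifting the identity of
  its target locally amounts to being a regular epimorphism.\<close>

lemma lifting_1_iff:
  assumes A: "diagram_on (grid 2 1) A"
  shows "lifting 1 A \<longleftrightarrow> regular_epi C (arm A ([0], [1]))"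
proof -
  have g: "[0] \<in> grid 2 1" "[1] \<in> grid 2 1" "[0] \<unlhd> [1]" by (simp_all add: box_def One_nat_def)
  note [simp] = diagramD(3-5)[OF A g]
  have o: "obm A [0] \<in> Obj C" using diagramD(1)[OF A g(1)] .
  have ad: "admissible 1 e d S \<longleftrightarrow> e = [0] \<and> d = 0 \<and> S = {}" for e d S
  proof
    assume a: "admissible 1 e d S"
    then have d: "d = 0" by (simp add: admissible_def)
    obtain a e' where e: "e = a # e'" "e' \<in> grid 2 0" using a unfolding admissible_def One_nat_def by (auto elim: grid_SucE)
    then have "e = [a]" by (simp add: box_def)
    then have "e = [0]" using a d by (simp add: admissible_def)
    moreover have "j \<notin> S" for j
    proof
      assume "j \<in> S"
      then have "j < 1" "e ! j = 1" using a by (auto simp: admissible_def)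
      then show False using \<open>e = [0]\<close> by simp
    qed
    ultimately show "e = [0] \<and> d = 0 \<and> S = {}" using d by auto
  qed (use g in \<open>auto simp: admissible_def\<close>)
  show ?thesis
  proof
    assume "lifting 1 A"
    then have l: "lifts A [0] 0 {}" by (simp add: lifting_def ad)
    have "killed A {} [0] (Id C (obm A [0]))" using o by (simp add: killed_def)
    then obtain c x where c: "regular_epi C c" "Cod C c = obm A [0]" "killed A {} [1] x" "arm A ([0], [1]) \<cdot> x = Id C (obm A [0]) \<cdot> c"
      using l o unfolding lifts_def by auto
    then have "arm A ([0], [1]) \<cdot> x = c" by simp
    then show "regular_epi C (arm A ([0], [1]))" by (rule local_lift_regular_epi[OF c(1)]) (use c(3) in \<open>simp_all add: killed_def\<close>)
  next
    assume r: "regular_epi C (arm A ([0], [1]))"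
    have "lifts A [0] 0 {}" unfolding lifts_def
    proof (intro allI impI)
      fix y assume "killed A {} [0] y"
      then have y: "y \<in> Arr C" "Cod C y = obm A [0]" by (simp_all add: killed_def)
      obtain c x where "regular_epi C c" "Cod C c = Dom C y" "x \<in> Arr C" "Dom C x = Dom C c" "Cod C x = Dom C (arm A ([0], [1]))" "arm A ([0], [1]) \<cdot> x = y \<cdot> c"
        by (rule regular_epi_lift[OF r, of y]) (use y in simp_all)
      then show "\<exists>c x. regular_epi C c \<and> Cod C c = Dom C y \<and> Dom C x = Dom C c \<and> killed A {} ([0][0 := 1]) x \<and> arm A ([0], [0][0 := 1]) \<cdot> x = y \<cdot> c"
        by (intro exI[of _ c] exI[of _ x]) (simp add: killed_def)
    qed
    then show "lifting 1 A" by (simp add: lifting_def ad)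
  qed
qed

end

section \<open>Comparison cubes and the induction on the dimension\<close>

context semi_abelian_category
begin

context
  fixes m :: nat and A :: "('a, 'b) diagram"
  assumes dA: "diagram_on (grid 2 (Suc (Suc m))) A"
begin

private abbreviation (input) corner where "corner a b \<equiv> face m 0 b (face (Suc m) 0 a A)"

private lemma corner_simps [simp]:
  assumes "a < 2" "b < 2" "x \<in> grid 2 m"
  shows "obm (corner a b) x = obm A (a # b # x)"
    and "y \<in> grid 2 m \<Longrightarrow> x \<unlhd> y \<Longrightarrow> arm (corner a b) (x, y) = arm A (a # b # x, a # b # y)"
  using assms by (simp_all add: face_simps)

private lemma corner_Obj: "a < 2 \<Longrightarrow> b < 2 \<Longrightarrow> corner a b \<in> Obj (Arrow_category m C)"
  using face_Obj[OF dA] by (intro face_Obj) (simp_all add: Obj_Arrow_iff)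

private lemma face_face:
  assumes "a < 2" "b < 2"
  shows "face m 0 a (face (Suc m) 1 b A) = corner a b"
proof (rule Arrow_Obj_eqI)
  have "diagram_on (grid 2 (Suc m)) (face (Suc m) 1 b A)" using face_Obj[OF dA assms(2), of 1] by (simp add: Obj_Arrow_iff)
  then show "face m 0 a (face (Suc m) 1 b A) \<in> Obj (Arrow_category m C)" by (rule face_Obj[OF _ assms(1)])
qed (use assms corner_Obj in \<open>simp_all add: face_simps\<close>)

private lemma edge_0:
  assumes "a < 2"
  shows "edge m (face (Suc m) 0 a A) = (corner a 1, corner a 0, \<lambda>e\<in>grid 2 m. arm A (a # 0 # e, a # 1 # e))"
  using assms by (simp add: edge_def Obj_chain_power restrict_cong_iff face_simps list_le_refl)

private lemma edge_1:
  assumes "b < 2"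
  shows "edge m (face (Suc m) 1 b A) = (corner 1 b, corner 0 b, \<lambda>e\<in>grid 2 m. arm A (0 # b # e, 1 # b # e))"
  using assms by (simp add: edge_def Obj_chain_power restrict_cong_iff face_simps(2) face_face list_le_refl)

private lemma edge_Arrs:
  assumes "a < 2"
  shows "edge m (face (Suc m) 0 a A) \<in> Arr (Arrow_category m C)" "edge m (face (Suc m) 1 a A) \<in> Arr (Arrow_category m C)"
  using face_Obj[OF dA assms] by (auto intro!: edge_Arr simp: Obj_Arrow_iff)

text \<open>The existential clause in the definition of cubic extensions, except for the condition
  that \<open>B\<close> is a cubic extension itself.\<close>

private abbreviation (input) comparison where
  "comparison p q B \<equiv> is_pullback (Arrow_category m C)
       (edge m (face (Suc m) 0 0 A)) (edge m (face (Suc m) 1 0 A)) p q \<and>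
     B \<in> Obj (Arrow_category (Suc m) C) \<and>
     Dom (Arrow_category m C) (edge m B) = Dom (Arrow_category m C) (edge m (face (Suc m) 1 1 A)) \<and>
     Cod (Arrow_category m C) (edge m B) = Dom (Arrow_category m C) p \<and>
     p \<cdot>\<^bsub>Arrow_category m C\<^esub> edge m B = edge m (face (Suc m) 1 1 A) \<and>
     q \<cdot>\<^bsub>Arrow_category m C\<^esub> edge m B = edge m (face (Suc m) 0 1 A)"

text \<open>The pullback is an arbitrary one of multiple arrows. Its projections are unpacked into
  components and the pullback is read vertex by vertex, which gives the data that
  \<open>cube_lifting_iff\<close> asks for.\<close>

lemma comparison_lifting:
  assumes c: "comparison p q B"
  shows "lifting (Suc (Suc m)) A \<longleftrightarrow> (\<forall>i\<in>{0, 1}. \<forall>k\<in>{0, 1}. lifting (Suc m) (face (Suc m) i k A)) \<and> lifting (Suc m) B"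
proof -
  let ?A = "Arrow_category m C"
  have pb: "is_pullback ?A (edge m (face (Suc m) 0 0 A)) (edge m (face (Suc m) 1 0 A)) p q"
    and BO: "B \<in> Obj (Arrow_category (Suc m) C)"
    and Bd: "Dom ?A (edge m B) = Dom ?A (edge m (face (Suc m) 1 1 A))" "Cod ?A (edge m B) = Dom ?A p"
    and Bc: "p \<cdot>\<^bsub>?A\<^esub> edge m B = edge m (face (Suc m) 1 1 A)" "q \<cdot>\<^bsub>?A\<^esub> edge m B = edge m (face (Suc m) 0 1 A)"
    using c by simp_all
  have dB: "diagram_on (grid 2 (Suc m)) B" using BO by (simp add: Obj_Arrow_iff)
  have eB: "edge m B = (face m 0 1 B, face m 0 0 B, \<lambda>e\<in>grid 2 m. arm B (0 # e, 1 # e))" by (simp add: edge_def Obj_chain_power)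
  obtain P \<pi> where p: "p = (P, corner 0 1, \<pi>)" "nat_trans m P (corner 0 1) \<pi>"
    using pb unfolding is_pullback_def by (auto simp: edge_0 hom_Arrow_iff)
  obtain \<rho> where q: "q = (P, corner 1 0, \<rho>)" "nat_trans m P (corner 1 0) \<rho>"
    using pb unfolding is_pullback_def by (auto simp: edge_1 hom_Arrow_iff p(1))
  have f1: "face m 0 1 B = corner 1 1" and f0: "face m 0 0 B = P" using Bd by (simp_all add: eB edge_1 p(1))
  have Po: "obm P e = obm B (0 # e)" "\<And>e'. \<lbrakk>e' \<in> grid 2 m; e \<unlhd> e'\<rbrakk> \<Longrightarrow> arm P (e, e') = arm B (0 # e, 0 # e')" if "e \<in> grid 2 m" for e
    unfolding f0[symmetric] using that by (simp_all add: face_simps)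
  have "\<pi> e \<cdot> arm B (0 # e, 1 # e) = arm A (0 # 1 # e, 1 # 1 # e)" "\<rho> e \<cdot> arm B (0 # e, 1 # e) = arm A (1 # 0 # e, 1 # 1 # e)"
    if "e \<in> grid 2 m" for e
    using Bc that by (simp_all add: eB p(1) q(1) edge_0 edge_1 restrict_cong_iff)
  note \<theta> = this
  show ?thesis
  proof (rule cube_lifting_iff[OF dA dB, of \<pi> \<rho>])
    fix e assume e: "e \<in> grid 2 m"
    show "obm B (1 # e) = obm A (1 # 1 # e)" using arg_cong[OF f1, of "\<lambda>D. obm D e"] e by (simp add: face_simps)
    show "Dom C (\<pi> e) = obm B (0 # e)" using nat_transD(2)[OF p(2) e] Po(1)[OF e] by simp
    show "is_pullback C (arm A (0 # 0 # e, 0 # 1 # e)) (arm A (0 # 0 # e, 1 # 0 # e)) (\<pi> e) (\<rho> e)"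
      using pullback_pointwise[OF pb[unfolded p(1) q(1) edge_0[of 0, simplified] edge_1[of 0, simplified]] e] e by simp
    fix e' assume e': "e' \<in> grid 2 m" "e \<unlhd> e'"
    show "arm B (1 # e, 1 # e') = arm A (1 # 1 # e, 1 # 1 # e')"
      using arg_cong[OF f1, of "\<lambda>D. arm D (e, e')"] e e' by (simp add: face_simps)
    show "\<pi> e \<cdot> arm B (0 # e, 0 # e') = arm A (0 # 1 # e, 0 # 1 # e') \<cdot> \<pi> e'"
      using nat_transD(4)[OF p(2) e e'] Po(2)[OF e e'] e e' by simp
    show "\<rho> e \<cdot> arm B (0 # e, 0 # e') = arm A (1 # 0 # e, 1 # 0 # e') \<cdot> \<rho> e'"
      using nat_transD(4)[OF q(2) e e'] Po(2)[OF e e'] e e' by simp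
  qed (rule \<theta>; assumption)+
qed

text \<open>The commuting square of \<open>A\<close> induces an arrow from its initial corner to a
  pointwise pullback, and every arrow of \<open>m\<close>-fold arrows is the edge of an
  \<open>(m+1)\<close>-fold arrow.\<close>

lemma comparison_exists: "\<exists>p q B. comparison p q B"
proof -
  let ?A = "Arrow_category m C"
  let ?f = "edge m (face (Suc m) 0 0 A)" and ?g = "edge m (face (Suc m) 1 0 A)"
  have f: "?f = (corner 0 1, corner 0 0, \<lambda>e\<in>grid 2 m. arm A (0 # 0 # e, 0 # 1 # e))"
    and g: "?g = (corner 1 0, corner 0 0, \<lambda>e\<in>grid 2 m. arm A (0 # 0 # e, 1 # 0 # e))"
    and a: "edge m (face (Suc m) 1 1 A) = (corner 1 1, corner 0 1, \<lambda>e\<in>grid 2 m. arm A (0 # 1 # e, 1 # 1 # e))"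
    and b: "edge m (face (Suc m) 0 1 A) = (corner 1 1, corner 1 0, \<lambda>e\<in>grid 2 m. arm A (1 # 0 # e, 1 # 1 # e))"
    by (simp_all add: edge_0 edge_1)
  have ar: "?f \<in> Arr ?A" "?g \<in> Arr ?A" "edge m (face (Suc m) 1 1 A) \<in> Arr ?A" "edge m (face (Suc m) 0 1 A) \<in> Arr ?A"
    by (simp_all add: edge_Arrs)
  obtain P \<pi> \<rho> where P: "(P, corner 0 1, \<pi>) \<in> Arr ?A" "(P, corner 1 0, \<rho>) \<in> Arr ?A"
    and pw: "\<And>x. x \<in> grid 2 m \<Longrightarrow> is_pullback C ((\<lambda>e\<in>grid 2 m. arm A (0 # 0 # e, 0 # 1 # e)) x) ((\<lambda>e\<in>grid 2 m. arm A (0 # 0 # e, 1 # 0 # e)) x) (\<pi> x) (\<rho> x)"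
    by (rule pointwise_pullback_exists[OF ar(1)[unfolded f] ar(2)[unfolded g]]) blast
  have pb: "is_pullback ?A ?f ?g (P, corner 0 1, \<pi>) (P, corner 1 0, \<rho>)"
    unfolding f g by (rule pointwise_is_pullback[OF ar(1)[unfolded f] ar(2)[unfolded g] P pw])
  have sq: "?f \<cdot>\<^bsub>?A\<^esub> edge m (face (Suc m) 1 1 A) = ?g \<cdot>\<^bsub>?A\<^esub> edge m (face (Suc m) 0 1 A)"
  proof -
    have "arm A (0 # 0 # e, 0 # 1 # e) \<cdot> arm A (0 # 1 # e, 1 # 1 # e) = arm A (0 # 0 # e, 1 # 0 # e) \<cdot> arm A (1 # 0 # e, 1 # 1 # e)"
      if "e \<in> grid 2 m" for e
      using diagramD(6)[OF dA, of "0 # 0 # e" "0 # 1 # e" "1 # 1 # e"] diagramD(6)[OF dA, of "0 # 0 # e" "1 # 0 # e" "1 # 1 # e"] that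
      by (simp add: list_le_refl)
    then show ?thesis by (simp add: f g a b restrict_cong_iff)
  qed
  have "corner 1 1 \<in> Obj ?A" by (rule corner_Obj) simp_all
  moreover have "edge m (face (Suc m) 1 1 A) \<in> hom ?A (corner 1 1) (Dom ?A ?f)" "edge m (face (Suc m) 0 1 A) \<in> hom ?A (corner 1 1) (Dom ?A ?g)"
    using ar(3,4) by (simp_all add: hom_def f g a b)
  ultimately obtain u where u: "u \<in> hom ?A (corner 1 1) P" "(P, corner 0 1, \<pi>) \<cdot>\<^bsub>?A\<^esub> u = edge m (face (Suc m) 1 1 A)"
      "(P, corner 1 0, \<rho>) \<cdot>\<^bsub>?A\<^esub> u = edge m (face (Suc m) 0 1 A)"
    using pb sq unfolding is_pullback_def Arrow_simps(1) by blast
  obtain \<upsilon> where \<upsilon>: "u = (corner 1 1, P, \<upsilon>)" using u(1) by (auto simp: hom_Arrow_iff)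
  have "(corner 1 1, P, \<upsilon>) \<in> Arr ?A" using u(1) by (simp add: hom_def \<upsilon>)
  then obtain B where "B \<in> Obj (Arrow_category (Suc m) C)" "edge m B = (corner 1 1, P, \<upsilon>)" by (rule edge_surj)
  then have "comparison (P, corner 0 1, \<pi>) (P, corner 1 0, \<rho>) B" using pb u by (simp add: \<upsilon> a)
  then show ?thesis by blast
qed

end

text \<open>A comparison cube exists, and for any such cube lifting for \<open>A\<close> is
  equivalent to lifting for the four faces and for that cube. The existential quantifier in the
  definition is therefore harmless, and the induction on the dimension applies to faces and
  comparison alike.\<close>

theorem cubic_extension_iff_lifting:
  "A \<in> Obj (Arrow_category (Suc m) C) \<Longrightarrow> cubic_extension C (Suc m) A \<longleftrightarrow> lifting (Suc m) A"
proof (induction m arbitrary: A)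
  case 0
  then have "A \<in> Obj (Arrow_category 1 C)" "diagram_on (grid 2 1) A" by (simp_all add: Obj_Arrow_iff One_nat_def)
  then show ?case using lifting_1_iff[of A] by (simp add: One_nat_def)
next
  case (Suc m)
  have dA: "diagram_on (grid 2 (Suc (Suc m))) A" using Suc.prems by (simp add: Obj_Arrow_iff)
  have faces: "cubic_extension C (Suc m) (face (Suc m) i k A) \<longleftrightarrow> lifting (Suc m) (face (Suc m) i k A)" if "k \<in> {0, 1}" for i k
    by (rule Suc.IH[OF face_Obj[OF dA]]) (use that in auto)
  show ?case
  proof
    assume cu: "cubic_extension C (Suc (Suc m)) A"
    then have cf: "\<forall>i\<in>{0, 1}. \<forall>k\<in>{0, 1}. lifting (Suc m) (face (Suc m) i k A)" using faces by simp
    obtain p q B where B: "is_pullback (Arrow_category m C) (edge m (face (Suc m) 0 0 A)) (edge m (face (Suc m) 1 0 A)) p q \<and>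
        B \<in> Obj (Arrow_category (Suc m) C) \<and>
        Dom (Arrow_category m C) (edge m B) = Dom (Arrow_category m C) (edge m (face (Suc m) 1 1 A)) \<and>
        Cod (Arrow_category m C) (edge m B) = Dom (Arrow_category m C) p \<and>
        p \<cdot>\<^bsub>Arrow_category m C\<^esub> edge m B = edge m (face (Suc m) 1 1 A) \<and>
        q \<cdot>\<^bsub>Arrow_category m C\<^esub> edge m B = edge m (face (Suc m) 0 1 A)" "cubic_extension C (Suc m) B"
      using cu unfolding cubic_extension.simps by blast
    have "lifting (Suc m) B" using Suc.IH[of B] B by simp
    then show "lifting (Suc (Suc m)) A" using comparison_lifting[OF dA B(1)] cf by simp
  next
    assume l: "lifting (Suc (Suc m)) A"
    obtain p q B where B: "is_pullback (Arrow_category m C) (edge m (face (Suc m) 0 0 A)) (edge m (face (Suc m) 1 0 A)) p q \<and>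
        B \<in> Obj (Arrow_category (Suc m) C) \<and>
        Dom (Arrow_category m C) (edge m B) = Dom (Arrow_category m C) (edge m (face (Suc m) 1 1 A)) \<and>
        Cod (Arrow_category m C) (edge m B) = Dom (Arrow_category m C) p \<and>
        p \<cdot>\<^bsub>Arrow_category m C\<^esub> edge m B = edge m (face (Suc m) 1 1 A) \<and>
        q \<cdot>\<^bsub>Arrow_category m C\<^esub> edge m B = edge m (face (Suc m) 0 1 A)"
      using comparison_exists[OF dA] by blast
    then have "(\<forall>i\<in>{0, 1}. \<forall>k\<in>{0, 1}. lifting (Suc m) (face (Suc m) i k A)) \<and> lifting (Suc m) B"
      using comparison_lifting[OF dA B] l by blast
    then have "\<forall>i\<in>{0, 1}. \<forall>k\<in>{0, 1}. cubic_extension C (Suc m) (face (Suc m) i k A)" "cubic_extension C (Suc m) B"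
      using faces Suc.IH[of B] B by blast+
    then show "cubic_extension C (Suc (Suc m)) A" unfolding cubic_extension.simps using Suc.prems B by blast
  qed
qed

end

theorem theorem4p5:
  fixes \<X> :: "('o, 'm) category"
    and n :: nat
    and E :: "('o, 'm) diagram"
  assumes "semi_abelian_category \<X>"
    and "n \<ge> 1"
    and "is_sequence \<X> n E"
  shows "(is_3n_diagram \<X> n E \<longleftrightarrow>
            isomorphic_fixing \<X> n {0, 1} E (KerSeq \<X> n (epi_part n E)) \<and>
            cubic_extension \<X> n (epi_part n E))
       \<and> (is_3n_diagram \<X> n E \<longleftrightarrow>
            isomorphic_fixing \<X> n {1, 2} E (CokerSeq \<X> n (mono_part n E)) \<and>
            (\<exists>X K. distributive_tuple \<X> n X K \<and> induced_by \<X> n (mono_part n E) X K))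
       \<and> (is_3n_diagram \<X> n E \<longleftrightarrow>
            isomorphic_fixing \<X> n {0, 1} E (KerSeq \<X> n (epi_part n E)) \<and>
            isomorphic_fixing \<X> n {1, 2} E (CokerSeq \<X> n (mono_part n E)))"
proof -
  interpret semi_abelian_category \<X> by (rule assms(1))
  have dE: "diagram_on (grid 3 n) E" using assms(3) by (simp add: is_sequence_def is_functor_chain_power_iff)
  have ag: "diagrams_agree (grid 2 n) E (epi_part n E)"
    by (auto simp: diagrams_agree_def epi_part_def restrict_along_def Obj_chain_power)
  have "diagram_on (grid 2 n) (epi_part n E)"
    by (rule diagram_on_cong[OF ag diagram_on_subset[OF dE grid_2_3]])
  then have "epi_part n E \<in> Obj (Arrow_category n \<X>)"
    by (simp add: Obj_Arrow_iff epi_part_def restrict_along_def Obj_chain_power)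
  \<comment> \<open>Here \<open>n \<ge> 1\<close> matters: in dimension 0 being a cubic extension is
    false by convention.\<close>
  moreover obtain m where "n = Suc m" using assms(2) by (cases n) (simp_all add: One_nat_def)
  ultimately have cubic: "cubic_extension \<X> n (epi_part n E) \<longleftrightarrow> lifting n E"
    using cubic_extension_iff_lifting lifting_cong[OF ag] by simp
  \<comment> \<open>Every condition is now one on \<open>E\<close> itself: the first and the fourth
    are kernel lines together with cokernel lines, the second has lifting in place of cokernel
    lines, and the third has distributivity in place of kernel lines.\<close>
  note iffs = is_3n_diagram_iff[OF assms(3)] KerSeq_iff[OF assms(3)] CokerSeq_iff[OF assms(3)]
  show ?thesis
    unfolding iffs cubic
    using coker_lines_iff_lifting[OF dE] exact_lines_distributive[OF dE] distributive_exact_lines[OF dE] by blast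
qed

end
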